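(* Let $u$ be a minimizer of $\mathcal J_{A,\varphi}$ over $H^1_g(\Omega)$, with $A\in M_{\lambda,\Lambda}(\Omega)$ and with $g$ and $u$ nonnegative. Let $x_0\in\partial\{u>0\}$ be a free boundary point, and for some $p>1$ and $\sigma\in[0,d)$, assume that there exist $c_0,r_0>0$ such that $$|\{\varphi(x)>t\}\cap B_r(x_0)|\ge\min\left(c_0r^\sigma t^{-p},|B_r(x_0)|\right)\quad\text{for all } t>0,\ r\in(0,r_0).$$ Then, for any $x\in\Omega$ with $u(x)>0$ such that $r:=|x-x_0|=\mathrm{dist}(x,\partial\{u>0\})\le r_0/2$, the estimate $$u(x)\ge C|x-x_0|^{1-(d-\sigma)/(2p)}$$ holds, with $C>0$ depending only on $d$, $p$, $\lambda$, $\Lambda$, and $c_0$.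
   Context: $\Omega\subset\mathbb R^d$, $d\ge2$, is a bounded domain with Lipschitz boundary; $0<\lambda\le\Lambda$. $M_{\lambda,\Lambda}(\Omega)$ is the set of (measurable) symmetric matrix-valued functions $A:\Omega\to\mathbb R^{d\times d}$ with $\lambda|e|^2\le A_{ij}(x)e_ie_j\le\Lambda|e|^2$ for all $x\in\Omega$, $e\in\mathbb R^d$. For $\varphi:\Omega\to\mathbb R$, $$\mathcal J_{A,\varphi}(u):=\int_\Omega\left(\nabla u\cdot(A(x)\nabla u)+\varphi(x)1_{\{u>0\}}\right)dx,$$ and, for $g\in H^{1/2}(\partial\Omega)$, $H^1_g(\Omega)=\{w\in H^1(\Omega): w=g \text{ on }\partial\Omega\text{ in the trace sense}\}$. $|E|$ denotes Lebesgue measure of $E$. *)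

theory Defs
  imports "HOL-Analysis.Analysis"
begin

lemma ennreal_add_SUP:
  fixes c :: ennreal
  assumes "I \<noteq> {}"
  shows "c + (SUP i\<in>I. f i) = (SUP i\<in>I. c + f i)"
  using ennreal_SUP_add_left[OF assms, of f c] by (simp add: add.commute)

definition hausdorff_gauge :: "nat \<Rightarrow> real \<Rightarrow> 'a::metric_space set \<Rightarrow> ennreal" where
  "hausdorff_gauge s \<delta> U =
     (if U = {} then 0
      else if bounded U \<and> diameter U \<le> \<delta>
        then ennreal (unit_ball_vol (real s) * (diameter U / 2) ^ s)
      else \<infinity>)"

definition hausdorff_pre :: "nat \<Rightarrow> real \<Rightarrow> 'a::metric_space set \<Rightarrow> ennreal" where
  "hausdorff_pre s \<delta> E =
     (INF U \<in> {U :: nat \<Rightarrow> 'a set. E \<subseteq> (\<Union>i. U i)}. \<Sum>i. hausdorff_gauge s \<delta> (U i))"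

definition hausdorff_outer :: "nat \<Rightarrow> 'a::metric_space set \<Rightarrow> ennreal" where
  "hausdorff_outer s E = (SUP \<delta> \<in> {0<..}. hausdorff_pre s \<delta> E)"

text \<open>The restriction of the outer measure to its Caratheodory-measurable sets; it is a measure
  on these (\<open>measure_space_hausdorff\<close>), and they include the Borel sets
  (\<open>borel_subset_sets_hausdorff\<close>).\<close>

definition hausdorff_measure :: "nat \<Rightarrow> 'a::metric_space measure" where
  "hausdorff_measure s =
     measure_of UNIV (lambda_system UNIV UNIV (hausdorff_outer s)) (hausdorff_outer s)"

lemma hausdorff_gauge_empty [simp]: "hausdorff_gauge s \<delta> {} = 0"
  by (simp add: hausdorff_gauge_def)

lemma hausdorff_pre_le:
  "E \<subseteq> (\<Union>i. U i) \<Longrightarrow> hausdorff_pre s \<delta> E \<le> (\<Sum>i. hausdorff_gauge s \<delta> (U i))"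
  unfolding hausdorff_pre_def by (rule INF_lower) simp

lemma hausdorff_pre_empty [simp]: "hausdorff_pre s \<delta> {} = 0"
  using hausdorff_pre_le[of "{}" "\<lambda>_. {}" s \<delta>] by simp

lemma hausdorff_pre_mono: "E \<subseteq> F \<Longrightarrow> hausdorff_pre s \<delta> E \<le> hausdorff_pre s \<delta> F"
  unfolding hausdorff_pre_def by (rule INF_superset_mono) auto

lemma hausdorff_pre_antimono:
  assumes "\<delta>' \<le> \<delta>"
  shows "hausdorff_pre s \<delta> E \<le> hausdorff_pre s \<delta>' E"
proof -
  have "hausdorff_gauge s \<delta> U \<le> hausdorff_gauge s \<delta>' U" for U :: "'a set"
    using assms by (auto simp: hausdorff_gauge_def)
  then show ?thesis
    unfolding hausdorff_pre_def by (intro INF_mono') (auto intro!: suminf_le)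
qed

lemma hausdorff_pre_countably_subadditive:
  fixes A :: "nat \<Rightarrow> 'a::metric_space set"
  shows "hausdorff_pre s \<delta> (\<Union>i. A i) \<le> (\<Sum>i. hausdorff_pre s \<delta> (A i))"
proof (rule ennreal_le_epsilon)
  fix e :: real assume "0 < e" and fin: "(\<Sum>n. hausdorff_pre s \<delta> (A n)) < top"
  then have *: "hausdorff_pre s \<delta> (A n) < hausdorff_pre s \<delta> (A n) + e * (1/2)^Suc n" for n
    by (auto simp add: less_top dest!: ennreal_suminf_lessD)
  have "\<exists>U. A n \<subseteq> (\<Union>i. U i) \<and>
      (\<Sum>i. hausdorff_gauge s \<delta> (U i)) \<le> hausdorff_pre s \<delta> (A n) + e * (1/2)^Suc n" for n
    using *[of n] unfolding hausdorff_pre_def[of s \<delta> "A n"]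
    by (subst (asm) INF_less_iff) (auto intro: less_imp_le)
  then obtain B where B: "\<And>n. A n \<subseteq> (\<Union>i. B n i)"
    and Ble: "\<And>n. (\<Sum>i. hausdorff_gauge s \<delta> (B n i)) \<le> hausdorff_pre s \<delta> (A n) + e * (1/2)^Suc n"
    by metis
  define C where "C = case_prod B o prod_decode"
  have A_C: "(\<Union>i. A i) \<subseteq> (\<Union>i. C i)"
    using B by (auto simp add: C_def subset_eq) (metis prod.case prod_encode_inverse)
  have "hausdorff_pre s \<delta> (\<Union>i. A i) \<le> (\<Sum>i. hausdorff_gauge s \<delta> (C i))"
    by (rule hausdorff_pre_le[OF A_C])
  also have "\<dots> = (\<Sum>n. \<Sum>i. hausdorff_gauge s \<delta> (B n i))"
    unfolding C_def comp_def
    using suminf_ennreal_2dimen[of "\<lambda>n. \<Sum>i. hausdorff_gauge s \<delta> (B n i)"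
        "\<lambda>x. hausdorff_gauge s \<delta> (case_prod B x)"] by simp
  also have "\<dots> \<le> (\<Sum>n. hausdorff_pre s \<delta> (A n) + e * (1/2) ^ Suc n)"
    by (intro suminf_le allI Ble) auto
  also have "\<dots> = (\<Sum>n. hausdorff_pre s \<delta> (A n)) + (\<Sum>n. ennreal e * ennreal ((1/2) ^ Suc n))"
    using \<open>0 < e\<close> by (subst suminf_add[symmetric])
      (auto simp del: ennreal_suminf_cmult simp add: ennreal_mult[symmetric])
  also have "\<dots> = (\<Sum>n. hausdorff_pre s \<delta> (A n)) + e"
    unfolding ennreal_suminf_cmult
    by (subst suminf_ennreal_eq[OF zero_le_power power_half_series]) auto
  finally show "hausdorff_pre s \<delta> (\<Union>i. A i) \<le> (\<Sum>n. hausdorff_pre s \<delta> (A n)) + e" .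
qed

lemma hausdorff_outer_empty [simp]: "hausdorff_outer s {} = 0"
  by (simp add: hausdorff_outer_def)

lemma hausdorff_outer_mono: "E \<subseteq> F \<Longrightarrow> hausdorff_outer s E \<le> hausdorff_outer s F"
  unfolding hausdorff_outer_def by (intro SUP_mono') (rule hausdorff_pre_mono)

lemma hausdorff_pre_le_outer: "0 < \<delta> \<Longrightarrow> hausdorff_pre s \<delta> E \<le> hausdorff_outer s E"
  unfolding hausdorff_outer_def by (rule SUP_upper) simp

lemma hausdorff_outer_countably_subadditive:
  "hausdorff_outer s (\<Union>i. A i) \<le> (\<Sum>i. hausdorff_outer s (A i))"
proof -
  have "hausdorff_pre s \<delta> (\<Union>i. A i) \<le> (\<Sum>i. hausdorff_outer s (A i))" if "0 < \<delta>" for \<delta>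
    using hausdorff_pre_countably_subadditive[of s \<delta> A]
    by (rule order_trans) (intro suminf_le hausdorff_pre_le_outer that, auto)
  then show ?thesis
    unfolding hausdorff_outer_def[of s "\<Union>i. A i"] by (auto intro!: SUP_least)
qed

lemma hausdorff_outer_Un:
  "hausdorff_outer s (E \<union> F) \<le> hausdorff_outer s E + hausdorff_outer s F"
proof -
  have "(\<Union>i. binaryset E F i) = E \<union> F" by (rule UN_binaryset_eq)
  moreover have "(\<Sum>i. hausdorff_outer s (binaryset E F i)) = hausdorff_outer s E + hausdorff_outer s F"
    by (intro suminf_binaryset_eq) simp
  ultimately show ?thesis
    using hausdorff_outer_countably_subadditive[of s "binaryset E F"] by simp
qed

lemma outer_measure_space_hausdorff: "outer_measure_space UNIV (hausdorff_outer s)"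
  unfolding outer_measure_space_def positive_def increasing_def countably_subadditive_def
  by (auto intro: hausdorff_outer_mono hausdorff_outer_countably_subadditive)

lemma measure_space_hausdorff:
  "measure_space UNIV (lambda_system UNIV UNIV (hausdorff_outer s)) (hausdorff_outer s)"
proof -
  interpret sigma_algebra UNIV UNIV
    using sigma_algebra_Pow[of UNIV] by simp
  show ?thesis by (rule caratheodory_lemma[OF outer_measure_space_hausdorff])
qed

lemma sets_hausdorff_measure:
  "sets (hausdorff_measure s :: 'a::metric_space measure) =
     lambda_system UNIV UNIV (hausdorff_outer s)"
proof -
  have "sigma_algebra UNIV (lambda_system UNIV UNIV (hausdorff_outer s) :: 'a set set)"
    using measure_space_hausdorff[where 'a='a and s=s] by (simp add: measure_space_def)
  then show ?thesis
    unfolding hausdorff_measure_def by (simp add: sigma_algebra.sigma_sets_eq)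
qed

lemma emeasure_hausdorff_measure:
  assumes "E \<in> sets (hausdorff_measure s)"
  shows "emeasure (hausdorff_measure s) E = hausdorff_outer s E"
proof (rule emeasure_measure_of[OF hausdorff_measure_def])
  show "positive (sets (hausdorff_measure s)) (hausdorff_outer s)"
    "countably_additive (sets (hausdorff_measure s)) (hausdorff_outer s)"
    using measure_space_hausdorff[of s] by (auto simp: sets_hausdorff_measure measure_space_def)
qed (use assms in auto)

lemma hausdorff_outer_separated:
  fixes E F :: "'a::metric_space set"
  assumes e: "0 < e" and sep: "\<And>x y. x \<in> E \<Longrightarrow> y \<in> F \<Longrightarrow> e \<le> dist x y"
  shows "hausdorff_outer s E + hausdorff_outer s F \<le> hausdorff_outer s (E \<union> F)"
proof -
  have small: "hausdorff_pre s \<delta> E + hausdorff_pre s \<delta> F \<le> hausdorff_pre s \<delta> (E \<union> F)"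
    if d: "0 < \<delta>" "\<delta> < e" for \<delta>
    unfolding hausdorff_pre_def[of s \<delta> "E \<union> F"]
  proof (rule INF_greatest)
    fix U :: "nat \<Rightarrow> 'a set" assume "U \<in> {U. E \<union> F \<subseteq> (\<Union>i. U i)}"
    then have U: "E \<union> F \<subseteq> (\<Union>i. U i)" by simp
    define V where "V i = (if U i \<inter> E = {} then {} else U i)" for i
    define W where "W i = (if U i \<inter> F = {} then {} else U i)" for i
    have le: "hausdorff_gauge s \<delta> (V i) + hausdorff_gauge s \<delta> (W i) \<le> hausdorff_gauge s \<delta> (U i)" for i
    proof (cases "U i \<inter> E = {} \<or> U i \<inter> F = {}")
      case True
      then show ?thesis by (auto simp: V_def W_def)
    next
      case False
      then obtain x y where xy: "x \<in> U i" "x \<in> E" "y \<in> U i" "y \<in> F" by auto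
      have "\<not> (bounded (U i) \<and> diameter (U i) \<le> \<delta>)"
        using diameter_bounded_bound[of "U i" x y] sep[of x y] xy d by force
      then have "hausdorff_gauge s \<delta> (U i) = \<infinity>"
        using xy by (auto simp: hausdorff_gauge_def)
      then show ?thesis by simp
    qed
    have "E \<subseteq> (\<Union>i. V i)"
    proof
      fix x assume "x \<in> E"
      moreover from this U obtain i where "x \<in> U i" by auto
      ultimately have "x \<in> V i" by (auto simp: V_def)
      then show "x \<in> (\<Union>i. V i)" by auto
    qed
    moreover have "F \<subseteq> (\<Union>i. W i)"
    proof
      fix x assume "x \<in> F"
      moreover from this U obtain i where "x \<in> U i" by auto
      ultimately have "x \<in> W i" by (auto simp: W_def)
      then show "x \<in> (\<Union>i. W i)" by auto
    qed
    ultimately have "hausdorff_pre s \<delta> E + hausdorff_pre s \<delta> F \<le>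
        (\<Sum>i. hausdorff_gauge s \<delta> (V i)) + (\<Sum>i. hausdorff_gauge s \<delta> (W i))"
      by (intro add_mono hausdorff_pre_le)
    also have "\<dots> = (\<Sum>i. hausdorff_gauge s \<delta> (V i) + hausdorff_gauge s \<delta> (W i))"
      by (intro suminf_add) auto
    also have "\<dots> \<le> (\<Sum>i. hausdorff_gauge s \<delta> (U i))"
      by (intro suminf_le le) auto
    finally show "hausdorff_pre s \<delta> E + hausdorff_pre s \<delta> F \<le> (\<Sum>i. hausdorff_gauge s \<delta> (U i))" .
  qed
  have "hausdorff_pre s \<delta> E + hausdorff_pre s \<delta>' F \<le> hausdorff_outer s (E \<union> F)"
    if "0 < \<delta>" "0 < \<delta>'" for \<delta> \<delta>'
  proof -
    define \<eta> where "\<eta> = min (min \<delta> \<delta>') (e/2)"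
    have \<eta>: "0 < \<eta>" "\<eta> < e" "\<eta> \<le> \<delta>" "\<eta> \<le> \<delta>'" using that e by (auto simp: \<eta>_def)
    have "hausdorff_pre s \<delta> E + hausdorff_pre s \<delta>' F \<le> hausdorff_pre s \<eta> E + hausdorff_pre s \<eta> F"
      by (intro add_mono hausdorff_pre_antimono \<eta>)
    also have "\<dots> \<le> hausdorff_pre s \<eta> (E \<union> F)" by (intro small \<eta>)
    also have "\<dots> \<le> hausdorff_outer s (E \<union> F)" by (intro hausdorff_pre_le_outer \<eta>)
    finally show ?thesis .
  qed
  then have "(SUP \<delta>\<in>{0<..}. hausdorff_pre s \<delta> E + hausdorff_pre s \<delta>' F) \<le> hausdorff_outer s (E \<union> F)"
    if "0 < \<delta>'" for \<delta>'
    using that by (intro SUP_least) auto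
  then have "hausdorff_outer s E + hausdorff_pre s \<delta>' F \<le> hausdorff_outer s (E \<union> F)"
    if "0 < \<delta>'" for \<delta>'
    using that unfolding hausdorff_outer_def[of s E] by (subst ennreal_SUP_add_left[symmetric]) auto
  then have "(SUP \<delta>'\<in>{0<..}. hausdorff_outer s E + hausdorff_pre s \<delta>' F) \<le> hausdorff_outer s (E \<union> F)"
    by (intro SUP_least) auto
  then show ?thesis
    by (simp add: hausdorff_outer_def[of s F] ennreal_add_SUP)
qed

lemma closed_in_sets_hausdorff:
  fixes C :: "'a::metric_space set"
  assumes C: "closed C"
  shows "C \<in> sets (hausdorff_measure s)"
proof -
  let ?H = "hausdorff_outer s :: 'a set \<Rightarrow> ennreal"
  have key: "?H (C \<inter> X) + ?H (X - C) \<le> ?H X" for X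
  proof (cases "C = {} \<or> ?H X = \<infinity>")
    case True
    then show ?thesis by auto
  next
    case False
    then have ne: "C \<noteq> {}" and fin: "?H X < \<infinity>" by (auto simp: less_top)
    define a where "a n = 1 / (real n + 1)" for n :: nat
    define D where "D n = {x \<in> X - C. a n \<le> infdist x C}" for n
    define R where "R n = D (Suc n) - D n" for n
    define S where "S = (\<Sum>k. ?H (R (Suc k)))"
    have a_pos: "0 < a n" for n by (simp add: a_def)
    have a_less: "a (Suc n) < a n" for n by (simp add: a_def field_simps)
    have infd: "infdist x C \<le> infdist y C + dist x y" for x y
      by (rule infdist_triangle)
    have D_Suc: "D n \<subseteq> D (Suc n)" for n using a_less[of n] by (auto simp: D_def)
    have D_le: "?H (D n) \<le> ?H X" for n by (rule hausdorff_outer_mono) (auto simp: D_def)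
    have step: "?H (R (Suc n)) + ?H (D n) \<le> ?H (D (Suc (Suc n)))" for n
    proof -
      have "?H (R (Suc n)) + ?H (D n) \<le> ?H (R (Suc n) \<union> D n)"
      proof (rule hausdorff_outer_separated[of "a n - a (Suc n)"])
        show "0 < a n - a (Suc n)" using a_less[of n] by simp
        fix x y assume "x \<in> R (Suc n)" "y \<in> D n"
        then have "infdist x C < a (Suc n)" "a n \<le> infdist y C" by (auto simp: R_def D_def)
        with infd[of y x] show "a n - a (Suc n) \<le> dist x y" by (simp add: dist_commute)
      qed
      also have "\<dots> \<le> ?H (D (Suc (Suc n)))"
        using D_Suc[of n] D_Suc[of "Suc n"] by (intro hausdorff_outer_mono) (auto simp: R_def)
      finally show ?thesis .
    qed
    have sumR: "(\<Sum>k<n. ?H (R (Suc k))) \<le> ?H (D n) + ?H (D (Suc n))" for n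
    proof (induction n)
      case (Suc n)
      have "(\<Sum>k<Suc n. ?H (R (Suc k))) \<le> ?H (D n) + ?H (D (Suc n)) + ?H (R (Suc n))"
        using Suc by (simp add: add_right_mono)
      also have "\<dots> = ?H (D (Suc n)) + (?H (R (Suc n)) + ?H (D n))" by (simp add: ac_simps)
      also have "\<dots> \<le> ?H (D (Suc n)) + ?H (D (Suc (Suc n)))" by (intro add_left_mono step)
      finally show ?case .
    qed simp
    have "S \<le> ?H X + ?H X"
      unfolding S_def suminf_eq_SUP
      by (intro SUP_least order_trans[OF sumR] add_mono D_le)
    also have "\<dots> < \<infinity>" using fin by simp
    finally have S_fin: "S < \<infinity>" .
    have cover: "X - C \<subseteq> D (Suc n) \<union> (\<Union>k. R (Suc (k + n)))" for n
    proof
      fix x assume x: "x \<in> X - C"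
      then have "0 < infdist x C" using infdist_pos_not_in_closed[OF C ne] by auto
      then obtain m where "inverse (real (Suc m)) < infdist x C" using reals_Archimedean by blast
      then have "x \<in> D m" using x by (auto simp: D_def a_def inverse_eq_divide add.commute)
      then have ex: "\<exists>m. x \<in> D m" ..
      define l where "l = (LEAST m. x \<in> D m)"
      have l: "x \<in> D l" and lmin: "\<And>m. m < l \<Longrightarrow> x \<notin> D m"
        using LeastI_ex[OF ex] not_less_Least by (auto simp: l_def)
      show "x \<in> D (Suc n) \<union> (\<Union>k. R (Suc (k + n)))"
      proof (cases "l \<le> Suc n")
        case True
        have "D l \<subseteq> D (Suc n)" using lift_Suc_mono_le[of D, OF D_Suc True] .
        with l show ?thesis by auto
      next
        case False
        define k where "k = l - Suc (Suc n)"
        have "l = Suc (Suc (k + n))" using False by (simp add: k_def)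
        then have "x \<in> R (Suc (k + n))" using l lmin by (auto simp: R_def)
        then show ?thesis by auto
      qed
    qed
    have bound: "?H (C \<inter> X) + ?H (X - C) + (\<Sum>k<n. ?H (R (Suc k))) \<le> ?H X + S" for n
    proof -
      have "?H (X - C) \<le> ?H (D (Suc n)) + ?H (\<Union>k. R (Suc (k + n)))"
        by (rule order_trans[OF hausdorff_outer_mono[OF cover] hausdorff_outer_Un])
      also have "\<dots> \<le> ?H (D (Suc n)) + (\<Sum>k. ?H (R (Suc (k + n))))"
        by (intro add_left_mono hausdorff_outer_countably_subadditive)
      finally have 1: "?H (X - C) \<le> ?H (D (Suc n)) + (\<Sum>k. ?H (R (Suc (k + n))))" .
      have 2: "(\<Sum>k. ?H (R (Suc (k + n)))) + (\<Sum>k<n. ?H (R (Suc k))) = S"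
        unfolding S_def by (rule suminf_offset[symmetric]) simp
      have 3: "?H (C \<inter> X) + ?H (D (Suc n)) \<le> ?H X"
      proof -
        have "?H (C \<inter> X) + ?H (D (Suc n)) \<le> ?H (C \<inter> X \<union> D (Suc n))"
        proof (rule hausdorff_outer_separated[OF a_pos[of "Suc n"]])
          fix x y assume "x \<in> C \<inter> X" "y \<in> D (Suc n)"
          then show "a (Suc n) \<le> dist x y"
            using infdist_le[of x C y] by (auto simp: D_def dist_commute)
        qed
        also have "\<dots> \<le> ?H X" by (rule hausdorff_outer_mono) (auto simp: D_def)
        finally show ?thesis .
      qed
      have "?H (C \<inter> X) + ?H (X - C) + (\<Sum>k<n. ?H (R (Suc k)))
          \<le> ?H (C \<inter> X) + (?H (D (Suc n)) + (\<Sum>k. ?H (R (Suc (k + n))))) + (\<Sum>k<n. ?H (R (Suc k)))"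
        by (intro add_mono order_refl 1)
      also have "\<dots> = ?H (C \<inter> X) + ?H (D (Suc n)) + S"
        unfolding 2[symmetric] by (simp add: ac_simps)
      also have "\<dots> \<le> ?H X + S" by (intro add_right_mono 3)
      finally show ?thesis .
    qed
    have "?H (C \<inter> X) + ?H (X - C) + S = (SUP n. ?H (C \<inter> X) + ?H (X - C) + (\<Sum>k<n. ?H (R (Suc k))))"
      unfolding S_def suminf_eq_SUP by (rule ennreal_add_SUP) simp
    also have "\<dots> \<le> ?H X + S" by (intro SUP_least bound)
    finally have "S + (?H (C \<inter> X) + ?H (X - C)) \<le> S + ?H X" by (simp add: add.commute)
    then show ?thesis using S_fin by (auto simp: ennreal_add_left_cancel_le)
  qed
  have "?H (C \<inter> X) + ?H ((UNIV - C) \<inter> X) = ?H X" for X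
  proof (rule antisym)
    have *: "(UNIV - C) \<inter> X = X - C" by auto
    show "?H (C \<inter> X) + ?H ((UNIV - C) \<inter> X) \<le> ?H X" unfolding * by (rule key)
    have "?H (C \<inter> X \<union> (X - C)) \<le> ?H (C \<inter> X) + ?H (X - C)" by (rule hausdorff_outer_Un)
    moreover have "C \<inter> X \<union> (X - C) = X" by auto
    ultimately show "?H X \<le> ?H (C \<inter> X) + ?H ((UNIV - C) \<inter> X)" unfolding * by simp
  qed
  then show ?thesis by (simp add: sets_hausdorff_measure lambda_system_def)
qed

lemma space_hausdorff_measure [simp]: "space (hausdorff_measure s) = UNIV"
  by (simp add: hausdorff_measure_def space_measure_of_conv)

lemma borel_subset_sets_hausdorff: "sets borel \<subseteq> sets (hausdorff_measure s)"
proof -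
  have "sigma_sets (space (hausdorff_measure s)) {C :: 'a set. closed C} \<subseteq> sets (hausdorff_measure s)"
    by (rule sets.sigma_sets_subset) (auto intro: closed_in_sets_hausdorff)
  then show ?thesis by (simp add: borel_eq_closed)
qed

definition surface_measure :: "(real^'n) set \<Rightarrow> (real^'n) measure" where
  "surface_measure \<Omega> = restrict_space (hausdorff_measure (CARD('n) - 1)) (frontier \<Omega>)"

text \<open>Near each boundary point, \<open>\<Omega>\<close> is the part above the graph of a Lipschitz function over the
  hyperplane orthogonal to some unit vector \<open>e\<close>.\<close>

definition lipschitz_boundary :: "(real^'n) set \<Rightarrow> bool" where
  "lipschitz_boundary \<Omega> \<longleftrightarrow>
     (\<forall>z\<in>frontier \<Omega>. \<exists>e \<rho> L \<gamma>. norm e = 1 \<and> 0 < \<rho> \<and> L-lipschitz_on {y. y \<bullet> e = 0} \<gamma> \<and>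
        \<Omega> \<inter> ball z \<rho> = {y \<in> ball z \<rho>. \<gamma> (y - (y \<bullet> e) *\<^sub>R e) < y \<bullet> e})"

definition bounded_lipschitz_domain :: "(real^'n) set \<Rightarrow> bool" where
  "bounded_lipschitz_domain \<Omega> \<longleftrightarrow>
     open \<Omega> \<and> connected \<Omega> \<and> \<Omega> \<noteq> {} \<and> bounded \<Omega> \<and> lipschitz_boundary \<Omega>"

definition partial_deriv :: "'n \<Rightarrow> (real^'n \<Rightarrow> real) \<Rightarrow> real^'n \<Rightarrow> real" where
  "partial_deriv i f x = frechet_derivative f (at x) (axis i 1)"

primrec C_k :: "nat \<Rightarrow> (real^'n \<Rightarrow> real) \<Rightarrow> bool" where
  "C_k 0 f \<longleftrightarrow> continuous_on UNIV f"
| "C_k (Suc k) f \<longleftrightarrow> (\<forall>x. f differentiable at x) \<and> (\<forall>i. C_k k (partial_deriv i f))"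

definition smooth :: "(real^'n \<Rightarrow> real) \<Rightarrow> bool" where
  "smooth f \<longleftrightarrow> (\<forall>k. C_k k f)"

definition test_function :: "(real^'n) set \<Rightarrow> (real^'n \<Rightarrow> real) \<Rightarrow> bool" where
  "test_function \<Omega> \<eta> \<longleftrightarrow>
     smooth \<eta> \<and> compact (closure {x. \<eta> x \<noteq> 0}) \<and> closure {x. \<eta> x \<noteq> 0} \<subseteq> \<Omega>"

definition square_integrable :: "'a measure \<Rightarrow> ('a \<Rightarrow> 'b::euclidean_space) \<Rightarrow> bool" where
  "square_integrable M f \<longleftrightarrow> f \<in> borel_measurable M \<and> integrable M (\<lambda>x. (norm (f x))\<^sup>2)"

text \<open>The square-integrable weak gradient of \<open>w\<close> on \<open>\<Omega>\<close>.\<close>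

definition has_weak_gradient ::
    "(real^'n) set \<Rightarrow> (real^'n \<Rightarrow> real) \<Rightarrow> (real^'n \<Rightarrow> real^'n) \<Rightarrow> bool" where
  "has_weak_gradient \<Omega> w G \<longleftrightarrow> square_integrable (lebesgue_on \<Omega>) G \<and>
     (\<forall>\<eta> i. test_function \<Omega> \<eta> \<longrightarrow>
        (\<integral>x. w x * partial_deriv i \<eta> x \<partial>lebesgue_on \<Omega>) = - (\<integral>x. G x $ i * \<eta> x \<partial>lebesgue_on \<Omega>))"

definition H1 :: "(real^'n) set \<Rightarrow> (real^'n \<Rightarrow> real) set" where
  "H1 \<Omega> = {w. square_integrable (lebesgue_on \<Omega>) w \<and> (\<exists>G. has_weak_gradient \<Omega> w G)}"

text \<open>For \<open>w \<in> H1 \<Omega>\<close> with \<open>\<Omega>\<close> open, this is determined up to a null set.\<close>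

definition weak_gradient :: "(real^'n) set \<Rightarrow> (real^'n \<Rightarrow> real) \<Rightarrow> real^'n \<Rightarrow> real^'n" where
  "weak_gradient \<Omega> w = (SOME G. has_weak_gradient \<Omega> w G)"

definition H1_norm :: "(real^'n) set \<Rightarrow> (real^'n \<Rightarrow> real) \<Rightarrow> real" where
  "H1_norm \<Omega> w =
     sqrt ((\<integral>x. (w x)\<^sup>2 \<partial>lebesgue_on \<Omega>) + (\<integral>x. (norm (weak_gradient \<Omega> w x))\<^sup>2 \<partial>lebesgue_on \<Omega>))"

text \<open>The graph of the trace operator \<open>H\<^sup>1(\<Omega>) \<rightarrow> L\<^sup>2(\<partial>\<Omega>)\<close>: the continuous extension of the restriction
  map from functions smooth up to the boundary, which are dense in \<open>H\<^sup>1(\<Omega>)\<close> for a bounded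
  Lipschitz domain.\<close>

definition has_trace :: "(real^'n) set \<Rightarrow> (real^'n \<Rightarrow> real) \<Rightarrow> (real^'n \<Rightarrow> real) \<Rightarrow> bool" where
  "has_trace \<Omega> w g \<longleftrightarrow>
     w \<in> H1 \<Omega> \<and> square_integrable (surface_measure \<Omega>) g \<and>
     (\<exists>v :: nat \<Rightarrow> real^'n \<Rightarrow> real. (\<forall>k. smooth (v k)) \<and>
        (\<lambda>k. H1_norm \<Omega> (\<lambda>x. v k x - w x)) \<longlonglongrightarrow> 0 \<and>
        (\<lambda>k. \<integral>\<^sup>+x. ennreal ((v k x - g x)\<^sup>2) \<partial>surface_measure \<Omega>) \<longlonglongrightarrow> 0)"

text \<open>\<open>H\<^sup>1\<^sup>/\<^sup>2(\<partial>\<Omega>)\<close> through the Gagliardo seminorm; the exponent is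
  \<open>d = (d - 1) + 2 \<cdot> (1/2)\<close>, since \<open>\<partial>\<Omega>\<close> has dimension \<open>d - 1\<close>.\<close>

definition H_half_boundary :: "(real^'n) set \<Rightarrow> (real^'n \<Rightarrow> real) set" where
  "H_half_boundary \<Omega> = {g. square_integrable (surface_measure \<Omega>) g \<and>
     (\<integral>\<^sup>+x. (\<integral>\<^sup>+y. ennreal ((g x - g y)\<^sup>2 / norm (x - y) ^ CARD('n)) \<partial>surface_measure \<Omega>)
        \<partial>surface_measure \<Omega>) < \<infinity>}"

definition H1_trace :: "(real^'n) set \<Rightarrow> (real^'n \<Rightarrow> real) \<Rightarrow> (real^'n \<Rightarrow> real) set" where
  "H1_trace \<Omega> g = {w \<in> H1 \<Omega>. has_trace \<Omega> w g}"

definition elliptic_matrices :: "real \<Rightarrow> real \<Rightarrow> (real^'n) set \<Rightarrow> (real^'n \<Rightarrow> real^'n^'n) set" where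
  "elliptic_matrices lam Lam \<Omega> = {A. A \<in> borel_measurable (lebesgue_on \<Omega>) \<and>
     (\<forall>x\<in>\<Omega>. transpose (A x) = A x \<and>
        (\<forall>e. lam * (norm e)\<^sup>2 \<le> e \<bullet> (A x *v e) \<and> e \<bullet> (A x *v e) \<le> Lam * (norm e)\<^sup>2))}"

definition positivity_set :: "(real^'n) set \<Rightarrow> (real^'n \<Rightarrow> real) \<Rightarrow> (real^'n) set" where
  "positivity_set \<Omega> w = {x \<in> \<Omega>. 0 < w x}"

definition J_integrand ::
    "(real^'n) set \<Rightarrow> (real^'n \<Rightarrow> real^'n^'n) \<Rightarrow> (real^'n \<Rightarrow> real) \<Rightarrow> (real^'n \<Rightarrow> real) \<Rightarrow> real^'n \<Rightarrow> real" where
  "J_integrand \<Omega> A \<phi> w x =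
     weak_gradient \<Omega> w x \<bullet> (A x *v weak_gradient \<Omega> w x) + \<phi> x * indicator (positivity_set \<Omega> w) x"

text \<open>The value \<open>\<infinity>\<close> is the integral itself whenever the negative part of \<open>\<phi>\<close> is integrable and the
  integrand is not, since the gradient term is integrable on \<open>H\<^sup>1(\<Omega>)\<close>.\<close>

definition J_functional ::
    "(real^'n) set \<Rightarrow> (real^'n \<Rightarrow> real^'n^'n) \<Rightarrow> (real^'n \<Rightarrow> real) \<Rightarrow> (real^'n \<Rightarrow> real) \<Rightarrow> ereal" where
  "J_functional \<Omega> A \<phi> w =
     (if integrable (lebesgue_on \<Omega>) (J_integrand \<Omega> A \<phi> w)
      then ereal (\<integral>x. J_integrand \<Omega> A \<phi> w x \<partial>lebesgue_on \<Omega>) else \<infinity>)"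

definition J_minimizer ::
    "(real^'n) set \<Rightarrow> (real^'n \<Rightarrow> real^'n^'n) \<Rightarrow> (real^'n \<Rightarrow> real) \<Rightarrow> (real^'n \<Rightarrow> real) \<Rightarrow> (real^'n \<Rightarrow> real) \<Rightarrow> bool" where
  "J_minimizer \<Omega> A \<phi> g u \<longleftrightarrow>
     u \<in> H1_trace \<Omega> g \<and> J_functional \<Omega> A \<phi> u < \<infinity> \<and>
     (\<forall>w\<in>H1_trace \<Omega> g. J_functional \<Omega> A \<phi> u \<le> J_functional \<Omega> A \<phi> w)"

text \<open>Elements of \<open>H\<^sup>1(\<Omega>)\<close> are classes of functions modulo null sets, whereas the free boundary and
  point values refer to a representative. This fixes it: at every point where the averages over
  shrinking balls converge, the function equals their limit. Every class has such a
  representative, and a function continuous on \<open>\<Omega>\<close> is one.\<close>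

definition precise_representative :: "(real^'n) set \<Rightarrow> (real^'n \<Rightarrow> real) \<Rightarrow> bool" where
  "precise_representative \<Omega> w \<longleftrightarrow>
     (\<forall>y\<in>\<Omega>. \<forall>l. ((\<lambda>\<rho>. (\<integral>z. w z \<partial>lebesgue_on (ball y \<rho>)) / measure lebesgue (ball y \<rho>)) \<longlongrightarrow> l)
        (at_right 0) \<longrightarrow> w y = l)"

end

theory Submission
  imports Defs "HOL-Computational_Algebra.Polynomial"
begin

text \<open>The density hypothesis forces \<open>\<phi> \<ge> m\<close> almost everywhere in \<open>B\<^sub>2\<^sub>r(x\<^sub>0)\<close>, where \<open>m\<close> is a constant times
  \<open>r\<close> to the power \<open>- (d - \<sigma>) / p\<close>, and \<open>B\<^sub>r(x)\<close> is contained in \<open>{u > 0}\<close>; so it suffices to show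
  \<open>u(x) \<ge> C r \<surd>m\<close>. On \<open>B\<^sub>r(x)\<close> the minimizer solves \<open>div (A \<nabla>u) = 0\<close>. Comparing \<open>u\<close> with \<open>(u - k \<eta>)\<^sup>+\<close>, with a
  cut-off function \<open>\<eta>\<close>, bounds the measure of \<open>{u \<le> k}\<close> in the half ball by a constant times
  \<open>k\<^sup>2 / (m r\<^sup>2)\<close> times the volume of the ball. For \<open>k = \<epsilon> r \<surd>m\<close> this fraction is so small that De Giorgi's
  iteration, applied to \<open>- u\<close>, gives \<open>u \<ge> k / 2\<close> almost everywhere near \<open>x\<close>; no Harnack inequality is
  needed. Since \<open>u(x)\<close> refers to the precise representative, the averages of \<open>u\<close> over shrinking balls
  must converge at \<open>x\<close>, which is De Giorgi's oscillation decay.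

  Sobolev's inequality is replaced by the inequality of Faber-Krahn type obtained by averaging
  \<open>\<integral>\<bar>f(x + h) - f(x)\<bar>\<^sup>2 \<le> \<bar>h\<bar>\<^sup>2 \<integral>\<bar>\<nabla>f\<bar>\<^sup>2\<close> over a ball of vectors \<open>h\<close> of twice the volume of the support of \<open>f\<close>.\<close>

section \<open>Smooth functions\<close>

text \<open>The indicator makes the functional nondifferentiable in \<open>u\<close>. Inside
  \<open>{u > 0}\<close> this does no harm: a perturbation \<open>h\<close> supported there can only
  shrink the positivity set, and only where \<open>\<phi> \<ge> m\<close>. Minimality thus becomes a
  single inequality, linear plus quadratic in \<open>h\<close>, whose left-hand side is nonnegative.
  Replacing \<open>h\<close> by \<open>t h\<close> gives the Euler-Lagrange equation; a large
  \<open>h\<close> gives the measure bound. The level is dictated by scaling: bringing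
  \<open>u\<close> down from height \<open>k\<close> to zero costs energy of order
  \<open>k^2 / r^2\<close> per unit volume and saves \<open>m\<close> per unit volume, and the two
  balance at \<open>k\<close> of order \<open>r \<surd>m\<close>. The constant \<open>m\<close> is
  the value of \<open>t\<close> for which \<open>c0 s^\<sigma> t^(-p)\<close> equals the volume of
  the ball of radius \<open>s = 2 r\<close>, and \<open>r \<surd>m\<close> then has the exponent of
  the theorem. The measure bound holds only almost everywhere, while the claim concerns one point.
  Hence every intermediate result is an almost everywhere statement about Borel functions on the
  whole space, with constants fixed before the functions, and the point \<open>x\<close> enters only
  through the essential limit of \<open>u\<close> there.\<close>

definition grad :: "(real^'n::finite \<Rightarrow> real) \<Rightarrow> real^'n \<Rightarrow> real^'n" where
  "grad f x = (\<chi> i. partial_deriv i f x)"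

lemma grad_nth [simp]: "grad f x $ i = partial_deriv i f x"
  by (simp add: grad_def)

lemma partial_deriv_eq:
  assumes "(f has_derivative D) (at x)"
  shows "partial_deriv i f x = D (axis i 1)"
  using frechet_derivative_at[OF assms] by (simp add: partial_deriv_def)

lemma has_derivative_grad:
  fixes f :: "real^'n::finite \<Rightarrow> real"
  assumes "f differentiable at x"
  shows "(f has_derivative (\<lambda>h. grad f x \<bullet> h)) (at x)"
proof -
  have D: "(f has_derivative frechet_derivative f (at x)) (at x)"
    using assms frechet_derivative_works by blast
  then interpret linear "frechet_derivative f (at x)" by (rule has_derivative_linear)
  have "frechet_derivative f (at x) h = grad f x \<bullet> h" for h
  proof -
    have "frechet_derivative f (at x) h = frechet_derivative f (at x) (\<Sum>i\<in>UNIV. h $ i *\<^sub>R axis i 1)"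
      by (simp add: basis_expansion scalar_mult_eq_scaleR[symmetric])
    also have "\<dots> = (\<Sum>i\<in>UNIV. h $ i * partial_deriv i f x)"
      by (simp add: sum scaleR partial_deriv_def)
    finally show ?thesis by (simp add: inner_vec_def mult.commute)
  qed
  with D show ?thesis by (metis (no_types, lifting) ext)
qed

section \<open>Closure properties of the classes \<open>C_k\<close>\<close>

lemma C_k_Suc_imp: "C_k (Suc k) f \<Longrightarrow> C_k k f"
proof (induction k arbitrary: f)
  case 0
  then show ?case
    by (auto intro!: continuous_at_imp_continuous_on differentiable_imp_continuous_within)
qed auto

lemma C_k_const: "C_k k (\<lambda>x. c)"
proof (induction k arbitrary: c)
  case (Suc k)
  have "partial_deriv i (\<lambda>x::real^'a. c) = (\<lambda>x. 0)" for i
    by (rule ext, subst partial_deriv_eq) (auto intro!: derivative_eq_intros)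
  with Suc show ?case by simp
qed simp

lemma C_k_nth: "C_k k (\<lambda>x::real^'n::finite. x $ j)"
proof (cases k)
  case 0
  then show ?thesis by (simp add: continuous_on_component continuous_on_id)
next
  case (Suc l)
  have D: "((\<lambda>x::real^'n. x $ j) has_derivative (\<lambda>h. h $ j)) (at x)" for x
    by (intro bounded_linear_imp_has_derivative bounded_linear_vec_nth)
  have "partial_deriv i (\<lambda>x::real^'n. x $ j) = (\<lambda>x. axis i 1 $ j)" for i
    by (rule ext) (rule partial_deriv_eq[OF D])
  with D Suc show ?thesis by (auto simp: C_k_const differentiable_def)
qed

lemma C_k_add: "C_k k f \<Longrightarrow> C_k k g \<Longrightarrow> C_k k (\<lambda>x. f x + g x)"
proof (induction k arbitrary: f g)
  case 0
  then show ?case by (simp add: continuous_on_add)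
next
  case (Suc k)
  have D: "((\<lambda>x. f x + g x) has_derivative (\<lambda>h. grad f x \<bullet> h + grad g x \<bullet> h)) (at x)" for x
    using Suc.prems by (auto intro!: has_derivative_add has_derivative_grad)
  have "partial_deriv i (\<lambda>x. f x + g x) = (\<lambda>x. partial_deriv i f x + partial_deriv i g x)" for i
    by (rule ext, subst partial_deriv_eq[OF D]) (simp add: inner_axis)
  with D Suc show ?case by (auto simp: differentiable_def)
qed

lemma C_k_mult: "C_k k f \<Longrightarrow> C_k k g \<Longrightarrow> C_k k (\<lambda>x. f x * g x)"
proof (induction k arbitrary: f g)
  case 0
  then show ?case by (simp add: continuous_on_mult)
next
  case (Suc k)
  have D: "((\<lambda>x. f x * g x) has_derivative (\<lambda>h. f x * (grad g x \<bullet> h) + (grad f x \<bullet> h) * g x)) (at x)" for x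
    using Suc.prems by (auto intro!: has_derivative_mult has_derivative_grad)
  have "partial_deriv i (\<lambda>x. f x * g x) = (\<lambda>x. f x * partial_deriv i g x + partial_deriv i f x * g x)" for i
    by (rule ext, subst partial_deriv_eq[OF D]) (simp add: inner_axis)
  moreover have "C_k k f" "C_k k g" using Suc.prems C_k_Suc_imp by auto
  ultimately show ?case using D Suc by (auto simp: differentiable_def intro!: C_k_add)
qed

lemma C_k_affine: "C_k k f \<Longrightarrow> C_k k (\<lambda>x. f (a *\<^sub>R x + b))"
proof (induction k arbitrary: f)
  case 0
  then show ?case by (auto intro!: continuous_on_compose2[of UNIV f] continuous_intros)
next
  case (Suc k)
  have D: "((\<lambda>x. f (a *\<^sub>R x + b)) has_derivative (\<lambda>h. grad f (a *\<^sub>R x + b) \<bullet> (a *\<^sub>R h))) (at x)" for x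
  proof (rule has_derivative_compose[of "\<lambda>x. a *\<^sub>R x + b"])
    show "((\<lambda>x. a *\<^sub>R x + b) has_derivative (\<lambda>h. a *\<^sub>R h)) (at x)"
      by (auto intro!: derivative_eq_intros)
    show "(f has_derivative (\<bullet>) (grad f (a *\<^sub>R x + b))) (at (a *\<^sub>R x + b))"
      using Suc.prems by (intro has_derivative_grad) auto
  qed
  have "partial_deriv i (\<lambda>x. f (a *\<^sub>R x + b)) = (\<lambda>x. a * partial_deriv i f (a *\<^sub>R x + b))" for i
    by (rule ext, subst partial_deriv_eq[OF D]) (simp add: inner_axis)
  with D Suc show ?case by (auto simp: differentiable_def intro!: C_k_mult C_k_const)
qed

text \<open>The outer function has to come with all its derivatives: the chain rule replaces
  \<open>\<phi> n\<close> by \<open>\<phi> (Suc n)\<close>, so the induction on \<open>k\<close>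
  runs for all \<open>n\<close> at once.\<close>

lemma C_k_compose:
  assumes "\<And>n t. (\<phi> n has_real_derivative \<phi> (Suc n) t) (at t)" and "smooth q"
  shows "C_k k (\<lambda>x. \<phi> n (q x))"
proof (induction k arbitrary: n)
  case 0
  have "continuous_on UNIV (\<phi> n)"
    using assms(1) DERIV_continuous by (force intro!: continuous_at_imp_continuous_on)
  moreover have "continuous_on UNIV q" using assms(2) by (metis smooth_def C_k.simps(1))
  ultimately show ?case using continuous_on_compose2 by fastforce
next
  case (Suc k)
  have q: "C_k (Suc k) q" using assms(2) by (auto simp: smooth_def simp del: C_k.simps)
  have D: "((\<lambda>x. \<phi> n (q x)) has_derivative (\<lambda>h. \<phi> (Suc n) (q x) * (grad q x \<bullet> h))) (at x)" for x
  proof (rule has_derivative_compose[of q "(\<bullet>) (grad q x)" x UNIV "\<phi> n" "(*) (\<phi> (Suc n) (q x))"])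
    show "(q has_derivative (\<bullet>) (grad q x)) (at x)"
      using q by (intro has_derivative_grad) auto
    show "(\<phi> n has_derivative (*) (\<phi> (Suc n) (q x))) (at (q x))"
      using assms(1)[of n "q x"] by (simp add: has_field_derivative_def)
  qed
  have "partial_deriv i (\<lambda>x. \<phi> n (q x)) = (\<lambda>x. \<phi> (Suc n) (q x) * partial_deriv i q x)" for i
    by (rule ext, subst partial_deriv_eq[OF D]) (simp add: inner_axis)
  with D Suc q show ?case by (auto simp: differentiable_def intro!: C_k_mult)
qed

lemma smooth_const: "smooth (\<lambda>x. c)"
  and smooth_nth: "smooth (\<lambda>x::real^'n::finite. x $ j)"
  and smooth_add: "smooth f \<Longrightarrow> smooth g \<Longrightarrow> smooth (\<lambda>x. f x + g x)"
  and smooth_mult: "smooth f \<Longrightarrow> smooth g \<Longrightarrow> smooth (\<lambda>x. f x * g x)"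
  and smooth_affine: "smooth f \<Longrightarrow> smooth (\<lambda>x. f (a *\<^sub>R x + b))"
  by (auto simp: smooth_def C_k_const C_k_nth intro!: C_k_add C_k_mult C_k_affine)

lemma smooth_diff: "smooth f \<Longrightarrow> smooth g \<Longrightarrow> smooth (\<lambda>x. f x - g x)"
  using smooth_add[of f "\<lambda>x. (-1) * g x"] smooth_mult[OF smooth_const, of g "-1"] by simp

lemma smooth_sum: "(\<And>i. i \<in> I \<Longrightarrow> smooth (f i)) \<Longrightarrow> smooth (\<lambda>x. \<Sum>i\<in>I. f i x)"
  by (induction I rule: infinite_finite_induct) (auto intro: smooth_const smooth_add)

lemma smooth_power2_norm: "smooth (\<lambda>x::real^'n::finite. (norm x)\<^sup>2)"
  unfolding power2_norm_eq_inner inner_vec_def by (auto intro!: smooth_sum smooth_mult smooth_nth)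

lemma smooth_differentiable: "smooth f \<Longrightarrow> f differentiable at x"
  using C_k.simps(2)[of 0 f] by (simp add: smooth_def del: C_k.simps)

lemma smooth_has_derivative: "smooth f \<Longrightarrow> (f has_derivative (\<lambda>h. grad f x \<bullet> h)) (at x)"
  by (intro has_derivative_grad smooth_differentiable)

lemma smooth_partial_deriv: "smooth f \<Longrightarrow> smooth (partial_deriv i f)"
  unfolding smooth_def using C_k.simps(2) by blast

lemma smooth_continuous: "smooth f \<Longrightarrow> continuous_on UNIV f"
  unfolding smooth_def using C_k.simps(1) by blast

lemma smooth_continuous_grad: "smooth f \<Longrightarrow> continuous_on UNIV (grad f)"
  unfolding grad_def
  by (intro continuous_on_vec_lambda smooth_continuous smooth_partial_deriv)

lemma grad_eq: "(\<And>h. D h = v \<bullet> h) \<Longrightarrow> (f has_derivative D) (at x) \<Longrightarrow> grad f x = v"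
  by (simp add: vec_eq_iff partial_deriv_eq inner_axis)

lemma grad_mult: "smooth f \<Longrightarrow> smooth g \<Longrightarrow> grad (\<lambda>x. f x * g x) x = f x *\<^sub>R grad g x + g x *\<^sub>R grad f x"
  by (rule grad_eq[OF _ has_derivative_mult[OF smooth_has_derivative smooth_has_derivative]])
     (auto simp: inner_left_distrib)

lemma eq_0_outside_support: "x \<notin> closure {x. f x \<noteq> 0} \<Longrightarrow> f x = 0"
  using subsetD[OF closure_subset, of x "{x. f x \<noteq> 0}"] by auto

lemma grad_eq_0_outside:
  assumes "x \<notin> closure {x. f x \<noteq> 0}"
  shows "grad f x = 0"
proof -
  have "open (- closure {x. f x \<noteq> 0})" by auto
  then have "\<forall>\<^sub>F y in nhds x. y \<in> - closure {x. f x \<noteq> 0}"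
    using assms by (intro eventually_nhds_in_open) auto
  then have *: "\<forall>\<^sub>F y in at x within UNIV. (\<lambda>y. 0) y = f y"
    unfolding eventually_at_filter
    by eventually_elim (use eq_0_outside_support in force)
  have fx: "0 = f x" using eq_0_outside_support[OF assms] by (rule sym)
  have "((\<lambda>y. 0) has_derivative (\<lambda>h. 0)) (at x)" by simp
  from has_derivative_transform_eventually[OF this * fx] show ?thesis
    by (intro grad_eq[of "\<lambda>h. 0"]) auto
qed

text \<open>The derivatives of \<open>exp (-1/t)\<close>, extended by \<open>0\<close> to \<open>t \<le> 0\<close>, are of the form
  \<open>P (1/t) exp (-1/t)\<close> with polynomials \<open>P\<close>.\<close>

definition flat_exp :: "real poly \<Rightarrow> real \<Rightarrow> real" where
  "flat_exp P t = (if 0 < t then poly P (1/t) * exp (- (1/t)) else 0)"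

lemma poly_times_exp_tendsto_0: "((\<lambda>s. poly P s * exp (- s)) \<longlongrightarrow> 0) at_top" for P :: "real poly"
proof -
  have "((\<lambda>s. coeff P i * (s ^ i / exp s)) \<longlongrightarrow> coeff P i * 0) at_top" for i
    by (intro tendsto_mult tendsto_const tendsto_power_div_exp_0)
  then have "((\<lambda>s. \<Sum>i\<le>degree P. coeff P i * (s ^ i / exp s)) \<longlongrightarrow> (\<Sum>i\<le>degree P. coeff P i * 0)) at_top"
    by (intro tendsto_sum)
  moreover have "(\<lambda>s. \<Sum>i\<le>degree P. coeff P i * (s ^ i / exp s)) = (\<lambda>s. poly P s * exp (- s))"
    by (auto simp: poly_altdef sum_distrib_right exp_minus divide_simps)
  ultimately show ?thesis by simp
qed

text \<open>With \<open>s = 1/t\<close>, differentiating \<open>P(s) exp(-s)\<close> in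
  \<open>t\<close> gives \<open>s^2 (P - P')(s) exp(-s)\<close>, and \<open>[:0,0,1:]\<close> is the
  factor \<open>s^2\<close>. So the functions \<open>flat_exp P\<close> are closed under
  differentiation, as \<open>C_k_compose\<close> requires. At \<open>t = 0\<close> the exponential
  decay beats every polynomial in \<open>1/t\<close>.\<close>

lemma flat_exp_deriv:
  "(flat_exp P has_real_derivative flat_exp ([:0,0,1:] * (P - pderiv P)) t) (at t)"
proof (cases t "0::real" rule: linorder_cases)
  case greater
  have "((\<lambda>t. poly P (1/t) * exp (- (1/t))) has_real_derivative
      flat_exp ([:0,0,1:] * (P - pderiv P)) t) (at t)"
    using greater
    by (auto intro!: derivative_eq_intros simp: flat_exp_def field_simps power2_eq_square)
  moreover have "\<forall>\<^sub>F s in nhds t. flat_exp P s = poly P (1/s) * exp (- (1/s))"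
    using greater eventually_nhds_in_open[of "{0<..}" t]
    by (auto simp: flat_exp_def elim!: eventually_mono)
  ultimately show ?thesis by (simp add: DERIV_cong_ev)
next
  case less
  have "\<forall>\<^sub>F s in nhds t. flat_exp P s = 0"
    using less eventually_nhds_in_open[of "{..<0}" t]
    by (auto simp: flat_exp_def elim!: eventually_mono)
  then show ?thesis using less by (simp add: DERIV_cong_ev flat_exp_def)
next
  case equal
  have "((\<lambda>h. flat_exp P h / h) \<longlongrightarrow> 0) (at_right 0)"
  proof (rule Lim_transform_eventually)
    have "filterlim (\<lambda>h::real. 1 / h) at_top (at_right 0)"
      using filterlim_inverse_at_top_right by (simp add: inverse_eq_divide)
    \<comment> \<open>\<open>pCons 0 P\<close> is the polynomial \<open>s P(s)\<close>: dividing by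
      \<open>h\<close> is multiplying by \<open>s = 1/h\<close>.\<close>
    from filterlim_compose[OF poly_times_exp_tendsto_0[of "pCons 0 P"] this]
    show "((\<lambda>h. poly (pCons 0 P) (1/h) * exp (- (1/h))) \<longlongrightarrow> 0) (at_right 0)" .
    show "\<forall>\<^sub>F h in at_right 0. poly (pCons 0 P) (1/h) * exp (- (1/h)) = flat_exp P h / h"
      by (auto simp: eventually_at_filter flat_exp_def field_simps)
  qed
  moreover have "((\<lambda>h. flat_exp P h / h) \<longlongrightarrow> 0) (at_left 0)"
    by (rule Lim_transform_eventually[of "\<lambda>_. 0"]) (auto simp: eventually_at_filter flat_exp_def)
  ultimately have "((\<lambda>h. flat_exp P h / h) \<longlongrightarrow> 0) (at 0)"
    using filterlim_split_at by blast
  then show ?thesis using equal by (simp add: DERIV_def flat_exp_def)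
qed

lemma smooth_flat_exp: "smooth q \<Longrightarrow> smooth (\<lambda>x. flat_exp 1 (q x))"
proof -
  define Q where "Q n = ((\<lambda>P. [:0,0,1:] * (P - pderiv P)) ^^ n) (1 :: real poly)" for n
  assume "smooth q"
  then have "C_k k (\<lambda>x. flat_exp (Q 0) (q x))" for k
    by (intro C_k_compose[of "\<lambda>n. flat_exp (Q n)"]) (simp_all add: Q_def flat_exp_deriv del: mult_pCons_left)
  then show ?thesis by (simp add: smooth_def Q_def)
qed

text \<open>The bump is \<open>exp (-1/(1 - |x|^2))\<close>, extended by zero; the squared norm
  keeps it smooth at the origin.\<close>

lemma bump_exists:
  obtains \<rho> :: "real^'n::finite \<Rightarrow> real"
  where "smooth \<rho>" "\<And>x. 0 \<le> \<rho> x" "\<And>x. norm x < 1 \<Longrightarrow> 0 < \<rho> x" "\<And>x. 1 \<le> norm x \<Longrightarrow> \<rho> x = 0"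
proof
  define \<rho> where "\<rho> x = flat_exp 1 (1 - (norm x)\<^sup>2)" for x :: "real^'n"
  show "smooth \<rho>" unfolding \<rho>_def
    by (intro smooth_flat_exp smooth_diff smooth_const smooth_power2_norm)
  show "0 \<le> \<rho> x" for x by (simp add: \<rho>_def flat_exp_def)
  show "0 < \<rho> x" if "norm x < 1" for x
    using that power_strict_mono[of "norm x" 1 2] by (simp add: \<rho>_def flat_exp_def)
  show "\<rho> x = 0" if "1 \<le> norm x" for x
    using one_le_power[OF that, of 2] by (simp add: \<rho>_def flat_exp_def)
qed

section \<open>Test functions and their bounds\<close>

lemma test_functionI:
  assumes "smooth f" "compact K" "K \<subseteq> \<Omega>" "\<And>x. x \<notin> K \<Longrightarrow> f x = 0"
  shows "test_function \<Omega> f"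
proof -
  have "closure {x. f x \<noteq> 0} \<subseteq> K"
    using assms by (intro closure_minimal compact_imp_closed) auto
  then show ?thesis using assms compact_Int_closed[of K "closure {x. f x \<noteq> 0}"]
    by (auto simp: test_function_def Int_absorb1)
qed

lemma test_function_smooth: "test_function \<Omega> f \<Longrightarrow> smooth f"
  by (simp add: test_function_def)

lemma test_function_mono: "test_function \<Omega> f \<Longrightarrow> \<Omega> \<subseteq> \<Omega>' \<Longrightarrow> test_function \<Omega>' f"
  by (auto simp: test_function_def)

lemma test_function_outside: "test_function \<Omega> f \<Longrightarrow> x \<notin> \<Omega> \<Longrightarrow> f x = 0"
  using eq_0_outside_support[of x f] by (auto simp: test_function_def)

lemma test_function_grad_outside: "test_function \<Omega> f \<Longrightarrow> x \<notin> \<Omega> \<Longrightarrow> grad f x = 0"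
  by (auto simp: test_function_def intro!: grad_eq_0_outside)

lemma test_function_partial:
  assumes "test_function \<Omega> f" shows "test_function \<Omega> (partial_deriv i f)"
proof (rule test_functionI[of _ "closure {x. f x \<noteq> 0}"])
  show "partial_deriv i f x = 0" if "x \<notin> closure {x. f x \<noteq> 0}" for x
    using grad_eq_0_outside[OF that] by (metis grad_nth zero_index)
qed (use assms in \<open>auto simp: test_function_def intro: smooth_partial_deriv\<close>)

lemma test_function_mult:
  assumes "test_function \<Omega> f" "smooth g"
  shows "test_function \<Omega> (\<lambda>x. f x * g x)"
proof (rule test_functionI[of _ "closure {x. f x \<noteq> 0}"])
  show "f x * g x = 0" if "x \<notin> closure {x. f x \<noteq> 0}" for x
    using eq_0_outside_support[OF that] by (metis mult_zero_left)
qed (use assms in \<open>auto simp: test_function_def intro!: smooth_mult\<close>)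

lemma compact_support_bounded:
  fixes f :: "real^'n::finite \<Rightarrow> 'b::real_normed_vector"
  assumes "continuous_on UNIV f" "compact K" "\<And>x. x \<notin> K \<Longrightarrow> f x = 0"
  obtains C where "0 < C" "\<And>x. norm (f x) \<le> C"
proof -
  have "bounded (f ` K)"
    using assms continuous_on_subset by (blast intro: compact_imp_bounded compact_continuous_image)
  then obtain C where "\<And>x. x \<in> K \<Longrightarrow> norm (f x) \<le> C" by (auto simp: bounded_iff)
  then have "norm (f x) \<le> max C 1" for x by (cases "x \<in> K") (fastforce simp: assms(3))+
  then show thesis by (intro that[of "max C 1"]) auto
qed

lemma test_function_bounded:
  assumes "test_function \<Omega> f" obtains C where "0 < C" "\<And>x. \<bar>f x\<bar> \<le> C" "\<And>x. norm (grad f x) \<le> C"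
proof -
  let ?K = "closure {x. f x \<noteq> 0}"
  have K: "compact ?K" using assms by (simp add: test_function_def)
  have "\<And>x. x \<notin> ?K \<Longrightarrow> f x = 0" by (rule eq_0_outside_support)
  then obtain C1 where "0 < C1" "\<And>x. norm (f x) \<le> C1"
    using compact_support_bounded[OF smooth_continuous K] test_function_smooth[OF assms] by blast
  moreover obtain C2 where "0 < C2" "\<And>x. norm (grad f x) \<le> C2"
    using compact_support_bounded[OF smooth_continuous_grad K] assms grad_eq_0_outside test_function_smooth
    by metis
  ultimately show thesis by (intro that[of "C1 + C2"]) (auto simp: add_increasing add_increasing2)
qed

lemma test_function_measurable [measurable]:
  assumes "test_function \<Omega> f"
  shows "f \<in> borel_measurable borel" "grad f \<in> borel_measurable borel" "partial_deriv i f \<in> borel_measurable borel"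
  using assms by (auto intro!: borel_measurable_continuous_onI smooth_continuous smooth_continuous_grad
    smooth_partial_deriv simp: test_function_def)

section \<open>Square integrable functions\<close>

lemma null_sequence_comparison:
  "(\<And>n::nat. norm (f n) \<le> g n) \<Longrightarrow> g \<longlonglongrightarrow> 0 \<Longrightarrow> f \<longlonglongrightarrow> 0"
  by (rule Lim_null_comparison[of f g]) auto

lemma square_integrable_measurable: "square_integrable M f \<Longrightarrow> f \<in> borel_measurable M"
  by (simp add: square_integrable_def)

lemma square_integrable_integrable: "square_integrable M f \<Longrightarrow> integrable M (\<lambda>x. (norm (f x))\<^sup>2)"
  by (simp add: square_integrable_def)

lemma square_integrable_bound:
  assumes "square_integrable M f" "g \<in> borel_measurable M" "AE x in M. norm (g x) \<le> C * norm (f x)"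
  shows "square_integrable M g"
proof -
  have "integrable M (\<lambda>x. C\<^sup>2 * (norm (f x))\<^sup>2)"
    using assms by (simp add: square_integrable_def)
  then have "integrable M (\<lambda>x. (norm (g x))\<^sup>2)"
  proof (rule Bochner_Integration.integrable_bound)
    show "AE x in M. norm ((norm (g x))\<^sup>2) \<le> norm (C\<^sup>2 * (norm (f x))\<^sup>2)"
      using assms(3) by eventually_elim (auto simp: power_mult_distrib[symmetric] intro!: power_mono)
  qed (use assms in measurable)
  then show ?thesis using assms by (simp add: square_integrable_def)
qed

lemma power2_norm_add_le: "(norm (a + b))\<^sup>2 \<le> 2 * (norm a)\<^sup>2 + 2 * (norm b)\<^sup>2"
  for a b :: "'a::real_normed_vector"
proof -
  have "(norm (a + b))\<^sup>2 \<le> (norm a + norm b)\<^sup>2"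
    by (intro power_mono norm_triangle_ineq) auto
  also have "\<dots> \<le> 2 * (norm a)\<^sup>2 + 2 * (norm b)\<^sup>2"
    using zero_le_power2[of "norm a - norm b"] by (simp add: power2_eq_square algebra_simps)
  finally show ?thesis .
qed

lemma square_integrable_add:
  assumes "square_integrable M f" "square_integrable M g"
  shows "square_integrable M (\<lambda>x. f x + g x)"
proof -
  have [measurable]: "f \<in> borel_measurable M" "g \<in> borel_measurable M"
    using assms by (auto simp: square_integrable_def)
  have "integrable M (\<lambda>x. 2 * (norm (f x))\<^sup>2 + 2 * (norm (g x))\<^sup>2)"
    using assms by (simp add: square_integrable_def)
  then have "integrable M (\<lambda>x. (norm (f x + g x))\<^sup>2)"
    by (rule Bochner_Integration.integrable_bound)
       (use assms power2_norm_add_le in \<open>auto simp: square_integrable_def\<close>)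
  then show ?thesis using assms by (simp add: square_integrable_def)
qed

lemma square_integrable_mult_bounded:
  fixes f :: "_ \<Rightarrow> 'b::euclidean_space" and m :: "_ \<Rightarrow> real"
  assumes "square_integrable M f" "m \<in> borel_measurable M" "\<And>x. \<bar>m x\<bar> \<le> C"
  shows "square_integrable M (\<lambda>x. m x *\<^sub>R f x)"
  by (rule square_integrable_bound[OF assms(1), of _ C])
     (use assms in \<open>auto simp: square_integrable_def mult_right_mono\<close>)

lemma square_integrable_scaleR: "square_integrable M f \<Longrightarrow> square_integrable M (\<lambda>x. c *\<^sub>R f x)"
  by (rule square_integrable_mult_bounded[of _ _ "\<lambda>_. c" "\<bar>c\<bar>"]) auto

lemma square_integrable_cmult: "square_integrable M f \<Longrightarrow> square_integrable M (\<lambda>x. c * f x)" for c :: real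
  using square_integrable_scaleR[of M f c] by simp

lemma square_integrable_diff:
  assumes "square_integrable M f" "square_integrable M g"
  shows "square_integrable M (\<lambda>x. f x - g x)"
  using square_integrable_add[OF assms(1) square_integrable_scaleR[OF assms(2), of "-1"]] by simp

lemma square_integrable_zero [simp]: "square_integrable M (\<lambda>x. 0)"
  by (simp add: square_integrable_def)

lemma square_integrable_nth:
  fixes f :: "_ \<Rightarrow> real^'n::finite"
  shows "square_integrable M f \<Longrightarrow> square_integrable M (\<lambda>x. f x $ i)"
  by (rule square_integrable_bound[of _ f _ 1])
     (auto simp: square_integrable_def component_le_norm_cart intro!: measurable_compose[of f M borel])

lemma square_integrable_vec:
  fixes f :: "_ \<Rightarrow> real^'n::finite"
  assumes "\<And>i. square_integrable M (\<lambda>x. f x $ i)"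
  shows "square_integrable M f"
proof -
  have eq: "f = (\<lambda>x. \<Sum>i\<in>UNIV. f x $ i *\<^sub>R axis i 1)"
    by (simp add: basis_expansion scalar_mult_eq_scaleR[symmetric])
  have [measurable]: "(\<lambda>x. f x $ i) \<in> borel_measurable M" for i
    using assms by (simp add: square_integrable_def)
  have "square_integrable M (\<lambda>x. f x $ i *\<^sub>R (axis i 1 :: real^'n))" for i
    by (rule square_integrable_bound[OF assms[of i], of _ 1])
       (use assms in \<open>auto simp: square_integrable_def norm_axis_1\<close>)
  then have "square_integrable M (\<lambda>x. \<Sum>i\<in>I. f x $ i *\<^sub>R (axis i 1 :: real^'n))" for I
    by (induction I rule: infinite_finite_induct) (auto intro: square_integrable_add)
  then have "square_integrable M (\<lambda>x. \<Sum>i\<in>UNIV. f x $ i *\<^sub>R (axis i 1 :: real^'n))" .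
  then show ?thesis by (subst eq)
qed

lemma integrable_norm_mult:
  assumes "square_integrable M f" "square_integrable M g"
  shows "integrable M (\<lambda>x. norm (f x) * norm (g x))"
proof -
  have "integrable M (\<lambda>x. (norm (f x))\<^sup>2 + (norm (g x))\<^sup>2)"
    using assms by (simp add: square_integrable_def)
  then show ?thesis
  proof (rule Bochner_Integration.integrable_bound)
    have "norm (f x) * norm (g x) \<le> (norm (f x))\<^sup>2 + (norm (g x))\<^sup>2" for x
      using zero_le_power2[of "norm (f x) - norm (g x)"] zero_le_power2[of "norm (f x)"] zero_le_power2[of "norm (g x)"]
      by (simp only: power2_diff)
    then show "AE x in M. norm (norm (f x) * norm (g x)) \<le> norm ((norm (f x))\<^sup>2 + (norm (g x))\<^sup>2)"
      by auto
  qed (use assms in \<open>auto simp: square_integrable_def\<close>)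
qed

lemma integrable_inner:
  fixes f g :: "_ \<Rightarrow> 'b::euclidean_space"
  assumes "square_integrable M f" "square_integrable M g"
  shows "integrable M (\<lambda>x. f x \<bullet> g x)"
  by (rule Bochner_Integration.integrable_bound[OF integrable_norm_mult[OF assms]])
     (use assms Cauchy_Schwarz_ineq2 in \<open>auto simp: square_integrable_def\<close>)

lemma integrable_mult:
  fixes f g :: "_ \<Rightarrow> real"
  assumes "square_integrable M f" "square_integrable M g"
  shows "integrable M (\<lambda>x. f x * g x)"
  using integrable_inner[OF assms] by simp

text \<open>The integral of \<open>(t |f| - |g|)^2\<close> is a quadratic polynomial in
  \<open>t\<close> that is never negative; evaluating it at its minimum \<open>t = b / a\<close>
  gives the claim.\<close>

lemma Cauchy_Schwarz_integral:
  assumes "square_integrable M f" "square_integrable M g"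
  shows "(\<integral>x. norm (f x) * norm (g x) \<partial>M)\<^sup>2 \<le> (\<integral>x. (norm (f x))\<^sup>2 \<partial>M) * (\<integral>x. (norm (g x))\<^sup>2 \<partial>M)"
    (is "?b\<^sup>2 \<le> ?a * ?c")
proof -
  have q: "0 \<le> ?a * t\<^sup>2 - 2 * ?b * t + ?c" for t
  proof -
    have "0 \<le> (\<integral>x. (t * norm (f x) - norm (g x))\<^sup>2 \<partial>M)" by simp
    also have "(\<lambda>x. (t * norm (f x) - norm (g x))\<^sup>2) =
        (\<lambda>x. t\<^sup>2 * (norm (f x))\<^sup>2 - 2 * t * (norm (f x) * norm (g x)) + (norm (g x))\<^sup>2)"
      by (simp add: power2_eq_square algebra_simps)
    also have "(\<integral>x. t\<^sup>2 * (norm (f x))\<^sup>2 - 2 * t * (norm (f x) * norm (g x)) + (norm (g x))\<^sup>2 \<partial>M) =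
        t\<^sup>2 * ?a - 2 * t * ?b + ?c"
      using assms integrable_norm_mult[OF assms] by (simp add: square_integrable_def)
    finally show ?thesis by (simp add: mult_ac)
  qed
  have a: "0 \<le> ?a" "0 \<le> ?c" by simp_all
  show ?thesis
  proof (cases "?a = 0")
    case True
    have "?b = 0"
    proof (rule ccontr)
      assume "?b \<noteq> 0"
      \<comment> \<open>For \<open>a = 0\<close> the polynomial is affine, and this \<open>t\<close>
        makes it \<open>-1\<close>.\<close>
      with q[of "(?c + 1) / (2 * ?b)"] True show False by simp
    qed
    with True show ?thesis by simp
  next
    case False
    with a have "0 < ?a" by linarith
    with q[of "?b / ?a"] show ?thesis
      by (simp add: power2_eq_square field_simps)
  qed
qed

lemma L2_convergence_inner:
  fixes f :: "_ \<Rightarrow> 'b::euclidean_space"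
  assumes fk: "\<And>k::nat. square_integrable M (fk k)" and f: "square_integrable M f" and g: "square_integrable M g"
    and lim: "(\<lambda>k. \<integral>x. (norm (fk k x - f x))\<^sup>2 \<partial>M) \<longlonglongrightarrow> 0"
  shows "(\<lambda>k. \<integral>x. fk k x \<bullet> g x \<partial>M) \<longlonglongrightarrow> (\<integral>x. f x \<bullet> g x \<partial>M)"
proof -
  let ?e = "\<lambda>k. sqrt ((\<integral>x. (norm (fk k x - f x))\<^sup>2 \<partial>M) * (\<integral>x. (norm (g x))\<^sup>2 \<partial>M))"
  have "norm ((\<integral>x. fk k x \<bullet> g x \<partial>M) - (\<integral>x. f x \<bullet> g x \<partial>M)) \<le> ?e k" for k
  proof -
    have d: "square_integrable M (\<lambda>x. fk k x - f x)" by (intro square_integrable_diff fk f)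
    have "norm ((\<integral>x. fk k x \<bullet> g x \<partial>M) - (\<integral>x. f x \<bullet> g x \<partial>M)) = norm (\<integral>x. (fk k x - f x) \<bullet> g x \<partial>M)"
      by (simp add: inner_diff_left integrable_inner[OF fk g] integrable_inner[OF f g])
    also have "\<dots> \<le> (\<integral>x. norm (fk k x - f x) * norm (g x) \<partial>M)"
      by (rule order_trans[OF integral_norm_bound]) 
         (intro integral_mono integrable_norm integrable_inner integrable_norm_mult d g, simp add: Cauchy_Schwarz_ineq2)
    also have "\<dots> \<le> ?e k"
      by (rule real_le_rsqrt[OF Cauchy_Schwarz_integral[OF d g]])
    finally show ?thesis .
  qed
  moreover have "?e \<longlonglongrightarrow> 0"
    using tendsto_real_sqrt[OF tendsto_mult_right[OF lim, of "\<integral>x. (norm (g x))\<^sup>2 \<partial>M"]] by simp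
  ultimately have "(\<lambda>k. (\<integral>x. fk k x \<bullet> g x \<partial>M) - (\<integral>x. f x \<bullet> g x \<partial>M)) \<longlonglongrightarrow> 0"
    by (rule null_sequence_comparison)
  then show ?thesis by (rule LIM_zero_cancel)
qed

lemma square_integrable_compact_support:
  fixes f :: "real^'n::finite \<Rightarrow> 'b::euclidean_space"
  assumes "f \<in> borel_measurable borel" "compact K" "\<And>x. x \<notin> K \<Longrightarrow> f x = 0" "\<And>x. norm (f x) \<le> C"
  shows "square_integrable lborel f"
proof -
  have "integrable lborel (\<lambda>x. C\<^sup>2 * indicator K x :: real)"
    using emeasure_bounded_finite[OF compact_imp_bounded[OF assms(2)]] compact_imp_closed[OF assms(2)]
    by (intro integrable_mult_right integrable_real_indicator) auto
  then have "integrable lborel (\<lambda>x. (norm (f x))\<^sup>2)"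
    by (rule Bochner_Integration.integrable_bound)
       (use assms in \<open>auto simp: indicator_def intro!: AE_I2 power_mono\<close>)
  then show ?thesis using assms by (simp add: square_integrable_def)
qed

lemma test_function_square_integrable:
  fixes f :: "real^'n::finite \<Rightarrow> real"
  assumes "test_function \<Omega> f"
  shows "square_integrable lborel f" "square_integrable lborel (grad f)"
    "square_integrable lborel (partial_deriv i f)"
proof -
  obtain C where C: "0 < C" "\<And>x. \<bar>f x\<bar> \<le> C" "\<And>x. norm (grad f x) \<le> C"
    using test_function_bounded[OF assms] by metis
  have K: "compact (closure {x. f x \<noteq> 0})" using assms by (simp add: test_function_def)
  show f: "square_integrable lborel f"
    by (rule square_integrable_compact_support[OF _ K, of _ C])
       (use assms C in \<open>auto intro: eq_0_outside_support test_function_measurable\<close>)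
  show g: "square_integrable lborel (grad f)"
    by (rule square_integrable_compact_support[OF _ K, of _ C])
       (use assms C in \<open>auto intro: grad_eq_0_outside test_function_measurable\<close>)
  then show "square_integrable lborel (partial_deriv i f)"
    using square_integrable_nth[OF g, of i] by simp
qed

subsection \<open>Affine changes of variables\<close>

text \<open>The two cases \<open>c = 1\<close> and \<open>c = -1\<close> are translation and
  reflection.\<close>

lemma lborel_distr_affine:
  fixes t :: "real^'n::finite"
  assumes "\<bar>c\<bar> = 1"
  shows "distr lborel borel (\<lambda>x. t + c *\<^sub>R x) = lborel"
proof -
  have "c \<noteq> 0" using assms by auto
  from lborel_affine[OF this, of t] show ?thesis using assms by (simp add: density_1)
qed

lemma
  fixes t :: "real^'n::finite" and f :: "_ \<Rightarrow> 'b::euclidean_space"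
  assumes [measurable]: "f \<in> borel_measurable borel"
  shows integral_translate: "(\<integral>x. f (x + t) \<partial>lborel) = (\<integral>x. f x \<partial>lborel)"
    and integral_reflect: "(\<integral>x. f (t - x) \<partial>lborel) = (\<integral>x. f x \<partial>lborel)"
    and integrable_translate: "integrable lborel (\<lambda>x. f (x + t)) = integrable lborel f"
    and integrable_reflect: "integrable lborel (\<lambda>x. f (t - x)) = integrable lborel f"
proof -
  have d1: "distr lborel borel (\<lambda>x. x + t) = lborel" using lborel_distr_affine[of 1 t] by (simp add: add.commute)
  have d2: "distr lborel borel (\<lambda>x. t - x) = lborel" using lborel_distr_affine[of "-1" t] by simp
  show "(\<integral>x. f (x + t) \<partial>lborel) = (\<integral>x. f x \<partial>lborel)"
    by (subst (2) d1[symmetric], subst integral_distr) auto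
  show "(\<integral>x. f (t - x) \<partial>lborel) = (\<integral>x. f x \<partial>lborel)"
    by (subst (2) d2[symmetric], subst integral_distr) auto
  show "integrable lborel (\<lambda>x. f (x + t)) = integrable lborel f"
    by (subst (2) d1[symmetric], subst integrable_distr_eq) auto
  show "integrable lborel (\<lambda>x. f (t - x)) = integrable lborel f"
    by (subst (2) d2[symmetric], subst integrable_distr_eq) auto
qed

lemma nn_integral_translate:
  fixes t :: "real^'n::finite"
  assumes [measurable]: "f \<in> borel_measurable borel"
  shows "(\<integral>\<^sup>+x. f (x + t) \<partial>lborel) = (\<integral>\<^sup>+x. f x \<partial>lborel)"
proof -
  have d1: "distr lborel borel (\<lambda>x. x + t) = lborel" using lborel_distr_affine[of 1 t] by (simp add: add.commute)
  show ?thesis by (subst (2) d1[symmetric], subst nn_integral_distr) auto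
qed

lemma integral_scale:
  fixes f :: "real^'n::finite \<Rightarrow> real"
  assumes [measurable]: "f \<in> borel_measurable borel" and "0 < c"
  shows "(\<integral>x. f (c *\<^sub>R x) \<partial>lborel) = (\<integral>x. f x \<partial>lborel) / c ^ CARD('n)"
proof -
  have "(\<integral>x. f x \<partial>lborel) = (\<integral>x. f x \<partial>density (distr lborel borel (\<lambda>x. 0 + c *\<^sub>R x)) (\<lambda>_. \<bar>c\<bar> ^ DIM(real^'n)))"
    using lborel_affine[of c "0::real^'n"] assms by simp
  also have "\<dots> = (\<integral>x. c ^ CARD('n) * f (c *\<^sub>R x) \<partial>lborel)"
    using assms by (subst integral_density) (auto simp: integral_distr)
  finally show ?thesis using assms by simp
qed

lemma square_integrable_translate:
  fixes f :: "real^'n::finite \<Rightarrow> 'b::euclidean_space"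
  assumes "square_integrable lborel f"
  shows "square_integrable lborel (\<lambda>x. f (x + h))"
  using assms integrable_translate[of "\<lambda>x. (norm (f x))\<^sup>2" h] by (auto simp: square_integrable_def)

subsection \<open>Continuity of translations\<close>

text \<open>Functions whose translations are continuous in \<open>L^1\<close> form a closed set. An
  approximant \<open>g\<close> enters twice, shifted and unshifted, and translation invariance makes
  the two errors equal; each of the three terms is kept below \<open>r / 4\<close>.\<close>

lemma L1_translation_closure:
  fixes f :: "real^'n::finite \<Rightarrow> real"
  assumes f: "integrable lborel f"
    and approx: "\<And>e. 0 < e \<Longrightarrow> \<exists>g. integrable lborel g \<and> (\<integral>x. \<bar>f x - g x\<bar> \<partial>lborel) \<le> e \<and>
      (\<lambda>n. \<integral>x. \<bar>g (x + h n) - g x\<bar> \<partial>lborel) \<longlonglongrightarrow> 0"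
  shows "(\<lambda>n::nat. \<integral>x. \<bar>f (x + h n) - f x\<bar> \<partial>lborel) \<longlonglongrightarrow> 0"
proof (rule LIMSEQ_I)
  fix r :: real assume "0 < r"
  then obtain g where g: "integrable lborel g" "(\<integral>x. \<bar>f x - g x\<bar> \<partial>lborel) \<le> r / 4"
    and lim: "(\<lambda>n. \<integral>x. \<bar>g (x + h n) - g x\<bar> \<partial>lborel) \<longlonglongrightarrow> 0"
    using approx[of "r / 4"] by auto
  have [measurable]: "f \<in> borel_measurable borel" "g \<in> borel_measurable borel"
    using f g by (auto dest: borel_measurable_integrable)
  have ft: "integrable lborel (\<lambda>x. f (x + h n))" and gt: "integrable lborel (\<lambda>x. g (x + h n))" for n
    using f g by (simp_all add: integrable_translate)
  obtain N where N: "\<And>n. N \<le> n \<Longrightarrow> (\<integral>x. \<bar>g (x + h n) - g x\<bar> \<partial>lborel) < r / 4"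
    using LIMSEQ_D[OF lim, of "r / 4"] \<open>0 < r\<close> by auto
  have "norm ((\<integral>x. \<bar>f (x + h n) - f x\<bar> \<partial>lborel) - 0) < r" if "N \<le> n" for n
  proof -
    have "(\<integral>x. \<bar>f (x + h n) - f x\<bar> \<partial>lborel) \<le>
        (\<integral>x. \<bar>f (x + h n) - g (x + h n)\<bar> + \<bar>g (x + h n) - g x\<bar> + \<bar>f x - g x\<bar> \<partial>lborel)"
      using f g ft gt by (intro integral_mono) auto
    also have "\<dots> = (\<integral>x. \<bar>f (x + h n) - g (x + h n)\<bar> \<partial>lborel) + (\<integral>x. \<bar>g (x + h n) - g x\<bar> \<partial>lborel)
        + (\<integral>x. \<bar>f x - g x\<bar> \<partial>lborel)"
      using f g ft gt by simp
    also have "(\<integral>x. \<bar>f (x + h n) - g (x + h n)\<bar> \<partial>lborel) = (\<integral>x. \<bar>f x - g x\<bar> \<partial>lborel)"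
      using integral_translate[of "\<lambda>x. \<bar>f x - g x\<bar>" "h n"] by simp
    finally show ?thesis using N[OF that] g \<open>0 < r\<close> by simp
  qed
  then show "\<exists>no. \<forall>n\<ge>no. norm ((\<integral>x. \<bar>f (x + h n) - f x\<bar> \<partial>lborel) - 0) < r" by blast
qed

text \<open>A point of an open set stays in it under small shifts, so the one-sided difference
  \<open>(1_U(x) - 1_U(x + h))^+\<close> tends to zero pointwise and is dominated by
  \<open>1_U\<close>. The two indicators have the same integral, hence the full \<open>L^1\<close>
  distance is twice the one-sided one.\<close>

lemma L1_translation_open:
  fixes U :: "(real^'n::finite) set"
  assumes U: "open U" "emeasure lborel U < \<infinity>" and h: "h \<longlonglongrightarrow> 0"
  shows "(\<lambda>n::nat. \<integral>x. \<bar>indicator U (x + h n) - indicator U x :: real\<bar> \<partial>lborel) \<longlonglongrightarrow> 0"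
proof -
  let ?i = "indicator U :: real^'n \<Rightarrow> real"
  have [measurable]: "U \<in> sets borel" using U by simp
  have iU: "integrable lborel ?i" using U by simp
  have it: "integrable lborel (\<lambda>x. ?i (x + h n))" for n
    using iU by (simp add: integrable_translate del: integrable_indicator_iff)
  have "(\<lambda>n. \<integral>x. max 0 (?i x - ?i (x + h n)) \<partial>lborel) \<longlonglongrightarrow> (\<integral>x. 0 \<partial>(lborel :: (real^'n) measure))"
  proof (rule integral_dominated_convergence[OF _ _ iU])
    show "AE x in lborel. (\<lambda>n. max 0 (?i x - ?i (x + h n))) \<longlonglongrightarrow> 0"
    proof (rule AE_I2, rule tendsto_eventually)
      fix x
      have "(\<lambda>n. x + h n) \<longlonglongrightarrow> x" using tendsto_add[OF tendsto_const h, of x] by simp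
      then have "x \<in> U \<Longrightarrow> \<forall>\<^sub>F n in sequentially. x + h n \<in> U" using U topological_tendstoD by blast
      then show "\<forall>\<^sub>F n in sequentially. max 0 (?i x - ?i (x + h n)) = 0"
        by (cases "x \<in> U") (auto elim!: eventually_mono simp: indicator_def)
    qed
  qed (auto simp: indicator_def)
  then have "(\<lambda>n. 2 * (\<integral>x. max 0 (?i x - ?i (x + h n)) \<partial>lborel)) \<longlonglongrightarrow> 0"
    using tendsto_mult_right_zero by auto
  moreover have "(\<integral>x. \<bar>?i (x + h n) - ?i x\<bar> \<partial>lborel) = 2 * (\<integral>x. max 0 (?i x - ?i (x + h n)) \<partial>lborel)" for n
  proof -
    have m: "integrable lborel (\<lambda>x. max 0 (?i x - ?i (x + h n)))"
      using iU it by (intro integrable_max Bochner_Integration.integrable_diff) auto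
    have "(\<integral>x. \<bar>?i (x + h n) - ?i x\<bar> \<partial>lborel) =
        (\<integral>x. 2 * max 0 (?i x - ?i (x + h n)) - (?i x - ?i (x + h n)) \<partial>lborel)"
      by (intro Bochner_Integration.integral_cong) (auto simp: indicator_def)
    also have "\<dots> = 2 * (\<integral>x. max 0 (?i x - ?i (x + h n)) \<partial>lborel) - ((\<integral>x. ?i x \<partial>lborel) - (\<integral>x. ?i (x + h n) \<partial>lborel))"
      using m it[of n] iU by (simp del: integrable_indicator_iff integral_indicator)
    also have "(\<integral>x. ?i (x + h n) \<partial>lborel) = (\<integral>x. ?i x \<partial>lborel)" by (rule integral_translate) simp
    finally show ?thesis by simp
  qed
  ultimately show ?thesis by simp
qed

lemma L1_translation_continuous:
  fixes f :: "real^'n::finite \<Rightarrow> real"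
  assumes "integrable lborel f" and h: "h \<longlonglongrightarrow> 0"
  shows "(\<lambda>n::nat. \<integral>x. \<bar>f (x + h n) - f x\<bar> \<partial>lborel) \<longlonglongrightarrow> 0"
  using assms(1)
proof (induction f rule: integrable_induct)
  case (base A c)
  then have [measurable]: "A \<in> sets borel" by simp
  have iA: "integrable lborel (indicator A :: real^'n \<Rightarrow> real)" using base by simp
  have "(\<lambda>n. \<integral>x. \<bar>indicator A (x + h n) - indicator A x :: real\<bar> \<partial>lborel) \<longlonglongrightarrow> 0"
  proof (rule L1_translation_closure[OF iA])
    fix e :: real assume e: "0 < e"
    \<comment> \<open>Outer regularity replaces \<open>A\<close> by an open set up to measure
      \<open>e\<close>, and open sets are covered by \<open>L1_translation_open\<close>.\<close>
    have "A \<in> sets lebesgue" using base by simp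
    from sets_lebesgue_outer_open[OF this e] obtain U where U: "open U" "A \<subseteq> U" "U - A \<in> lmeasurable"
      "emeasure lebesgue (U - A) < ennreal e" .
    have m: "U - A \<in> sets borel" using U base by auto
    have fin: "emeasure lborel (U - A) < \<infinity>"
      using U(3) m by (auto simp: fmeasurable_def)
    have "U = A \<union> (U - A)" using U by auto
    then have "emeasure lborel U \<le> emeasure lborel A + emeasure lborel (U - A)"
      using emeasure_subadditive[of A lborel "U - A"] m by auto
    also have "\<dots> < \<infinity>" using fin base by simp
    finally have finU: "emeasure lborel U < \<infinity>" .
    have "(\<integral>x. \<bar>indicator A x - indicator U x :: real\<bar> \<partial>lborel) = (\<integral>x. indicator (U - A) x \<partial>lborel)"
      using U by (intro Bochner_Integration.integral_cong) (auto simp: indicator_def)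
    also have "\<dots> = measure lborel (U - A)" by simp
    also have "\<dots> \<le> e"
      using U(4) m e by (auto simp: measure_def intro!: enn2real_leI)
    finally show "\<exists>g. integrable lborel g \<and> (\<integral>x. \<bar>indicator A x - g x\<bar> \<partial>lborel) \<le> e \<and>
      (\<lambda>n. \<integral>x. \<bar>g (x + h n) - g x\<bar> \<partial>lborel) \<longlonglongrightarrow> 0"
      using L1_translation_open[OF U(1) finU h] finU U by (intro exI[of _ "indicator U"]) auto
  qed
  then have "(\<lambda>n. \<bar>c\<bar> * (\<integral>x. \<bar>indicator A (x + h n) - indicator A x :: real\<bar> \<partial>lborel)) \<longlonglongrightarrow> 0"
    using tendsto_mult_right_zero by blast
  moreover have "\<bar>indicator A x *\<^sub>R c - indicator A y *\<^sub>R c\<bar> = \<bar>c\<bar> * \<bar>indicator A x - indicator A y :: real\<bar>" for x y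
    by (simp add: left_diff_distrib[symmetric] abs_mult)
  ultimately show ?case by simp
next
  case (add f g)
  have [measurable]: "f \<in> borel_measurable borel" "g \<in> borel_measurable borel"
    using add by (auto dest: borel_measurable_integrable)
  have i: "integrable lborel (\<lambda>x. f (x + h n))" "integrable lborel (\<lambda>x. g (x + h n))" for n
    using add by (simp_all add: integrable_translate)
  have "(\<lambda>n. (\<integral>x. \<bar>f (x + h n) - f x\<bar> \<partial>lborel) + (\<integral>x. \<bar>g (x + h n) - g x\<bar> \<partial>lborel)) \<longlonglongrightarrow> 0"
    using tendsto_add[OF add(3,4)] by simp
  moreover have "norm ((\<integral>x. \<bar>f (x + h n) + g (x + h n) - (f x + g x)\<bar> \<partial>lborel)) \<le>
      (\<integral>x. \<bar>f (x + h n) - f x\<bar> \<partial>lborel) + (\<integral>x. \<bar>g (x + h n) - g x\<bar> \<partial>lborel)" for n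
  proof -
    have "(\<integral>x. \<bar>f (x + h n) + g (x + h n) - (f x + g x)\<bar> \<partial>lborel) \<le>
        (\<integral>x. \<bar>f (x + h n) - f x\<bar> + \<bar>g (x + h n) - g x\<bar> \<partial>lborel)"
      using add i[of n] by (intro integral_mono) auto
    also have "\<dots> = (\<integral>x. \<bar>f (x + h n) - f x\<bar> \<partial>lborel) + (\<integral>x. \<bar>g (x + h n) - g x\<bar> \<partial>lborel)"
      using add i[of n] by (intro Bochner_Integration.integral_add integrable_abs Bochner_Integration.integrable_diff)
    finally show ?thesis by simp
  qed
  ultimately show ?case by (rule null_sequence_comparison[rotated])
next
  case (lim f s)
  show ?case
  proof (rule L1_translation_closure[OF lim(4)])
    fix e :: real assume e: "0 < e"
    have [measurable]: "f \<in> borel_measurable borel" "s i \<in> borel_measurable borel" for i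
      using lim by (auto dest: borel_measurable_integrable)
    have "(\<lambda>i. \<integral>x. \<bar>f x - s i x\<bar> \<partial>lborel) \<longlonglongrightarrow> (\<integral>x. 0 \<partial>(lborel :: (real^'n) measure))"
    \<comment> \<open>The approximating simple functions satisfy
      \<open>|s i x| \<le> 2 |f x|\<close>, whence the factor \<open>3\<close>.\<close>
    proof (rule integral_dominated_convergence[where w="\<lambda>x. 3 * \<bar>f x\<bar>"])
      show "integrable lborel (\<lambda>x. 3 * \<bar>f x\<bar>)" using lim by simp
      show "AE x in lborel. (\<lambda>i. \<bar>f x - s i x\<bar>) \<longlonglongrightarrow> 0"
      proof (rule AE_I2)
        fix x have "(\<lambda>i. s i x) \<longlonglongrightarrow> f x" using lim by simp
        from tendsto_rabs_zero[OF LIM_zero[OF this]] show "(\<lambda>i. \<bar>f x - s i x\<bar>) \<longlonglongrightarrow> 0"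
          by (simp add: abs_minus_commute)
      qed
      show "AE x in lborel. norm \<bar>f x - s i x\<bar> \<le> 3 * \<bar>f x\<bar>" for i
      proof (rule AE_I2)
        fix x have "\<bar>s i x\<bar> \<le> 2 * \<bar>f x\<bar>" using lim(3)[of x i] by simp
        then show "norm \<bar>f x - s i x\<bar> \<le> 3 * \<bar>f x\<bar>" by simp
      qed
    qed simp_all
    then obtain i where "\<bar>\<integral>x. \<bar>f x - s i x\<bar> \<partial>lborel\<bar> < e"
      using LIMSEQ_D[of _ 0 e] e by fastforce
    with lim show "\<exists>g. integrable lborel g \<and> (\<integral>x. \<bar>f x - g x\<bar> \<partial>lborel) \<le> e \<and>
      (\<lambda>n. \<integral>x. \<bar>g (x + h n) - g x\<bar> \<partial>lborel) \<longlonglongrightarrow> 0"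
      by (intro exI[of _ "s i"]) auto
  qed
qed

text \<open>For nonnegative numbers \<open>(a - b)\<^sup>2 \<le> \<bar>a\<^sup>2 - b\<^sup>2\<bar>\<close>, which reduces the \<open>L\<^sup>2\<close> case to \<open>L\<^sup>1\<close>.\<close>

lemma L2_translation_continuous:
  fixes f :: "real^'n::finite \<Rightarrow> real"
  assumes f: "square_integrable lborel f" and h: "h \<longlonglongrightarrow> 0"
  shows "(\<lambda>n::nat. \<integral>x. (f (x + h n) - f x)\<^sup>2 \<partial>lborel) \<longlonglongrightarrow> 0"
proof -
  have pos: "(\<lambda>n. \<integral>x. (g (x + h n) - g x)\<^sup>2 \<partial>lborel) \<longlonglongrightarrow> 0"
    if g: "square_integrable lborel g" "\<And>x. 0 \<le> g x" for g :: "real^'n \<Rightarrow> real"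
  proof -
    have ig: "integrable lborel (\<lambda>x. (g x)\<^sup>2)" using square_integrable_integrable[OF g(1)] by simp
    have [measurable]: "g \<in> borel_measurable borel" using g by (simp add: square_integrable_def)
    have it: "integrable lborel (\<lambda>x. (g (x + h n))\<^sup>2)" for n
      using ig integrable_translate[of "\<lambda>x. (g x)\<^sup>2" "h n"] by simp
    have "(a - b)\<^sup>2 \<le> \<bar>a\<^sup>2 - b\<^sup>2\<bar>" if "0 \<le> a" "0 \<le> b" for a b :: real
    proof -
      have "(a - b)\<^sup>2 = \<bar>a - b\<bar> * \<bar>a - b\<bar>" by (simp add: power2_eq_square)
      also have "\<dots> \<le> \<bar>a - b\<bar> * \<bar>a + b\<bar>" using that by (intro mult_left_mono) auto
      also have "\<dots> = \<bar>a\<^sup>2 - b\<^sup>2\<bar>" by (simp add: abs_mult[symmetric] power2_eq_square algebra_simps)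
      finally show ?thesis .
    qed
    then have "(\<integral>x. (g (x + h n) - g x)\<^sup>2 \<partial>lborel) \<le> (\<integral>x. \<bar>(g (x + h n))\<^sup>2 - (g x)\<^sup>2\<bar> \<partial>lborel)" for n
      using ig it[of n] g square_integrable_integrable[OF square_integrable_diff[OF square_integrable_translate[OF g(1), of "h n"] g(1)]]
      by (intro integral_mono) auto
    then show ?thesis
      by (intro tendsto_sandwich[OF _ _ tendsto_const L1_translation_continuous[OF ig h]]) auto
  qed
  define p where "p x = max 0 (f x)" for x
  define m where "m x = max 0 (- f x)" for x
  have fm: "f \<in> borel_measurable borel" using f by (simp add: square_integrable_def)
  have [measurable]: "p \<in> borel_measurable borel" "m \<in> borel_measurable borel"
    unfolding p_def[abs_def] m_def[abs_def] using fm by auto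
  have L: "square_integrable lborel p" "square_integrable lborel m"
    by (auto intro!: square_integrable_bound[OF f, of _ 1]) (auto simp: p_def m_def)
  have "(\<lambda>n. 2 * (\<integral>x. (p (x + h n) - p x)\<^sup>2 \<partial>lborel) + 2 * (\<integral>x. (m (x + h n) - m x)\<^sup>2 \<partial>lborel)) \<longlonglongrightarrow> 2 * 0 + 2 * 0"
    by (intro tendsto_add tendsto_mult tendsto_const pos L) (simp_all add: p_def m_def)
  moreover have "(\<integral>x. (f (x + h n) - f x)\<^sup>2 \<partial>lborel) \<le>
      2 * (\<integral>x. (p (x + h n) - p x)\<^sup>2 \<partial>lborel) + 2 * (\<integral>x. (m (x + h n) - m x)\<^sup>2 \<partial>lborel)" for n
  proof -
    have fp: "f x = p x - m x" for x by (simp add: p_def m_def)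
    have i: "integrable lborel (\<lambda>x. (q (x + h n) - q x)\<^sup>2)" if "square_integrable lborel q" for q :: "real^'n \<Rightarrow> real"
      using square_integrable_integrable[OF square_integrable_diff[OF square_integrable_translate[OF that, of "h n"] that]] by simp
    have "(\<integral>x. (f (x + h n) - f x)\<^sup>2 \<partial>lborel) \<le> (\<integral>x. 2 * (p (x + h n) - p x)\<^sup>2 + 2 * (m (x + h n) - m x)\<^sup>2 \<partial>lborel)"
    proof (intro integral_mono)
      show "(f (x + h n) - f x)\<^sup>2 \<le> 2 * (p (x + h n) - p x)\<^sup>2 + 2 * (m (x + h n) - m x)\<^sup>2" for x
      proof -
        have "f (x + h n) - f x = (p (x + h n) - p x) + (m x - m (x + h n))" by (simp add: fp)
        then show ?thesis
          using power2_norm_add_le[of "p (x + h n) - p x" "m x - m (x + h n)"]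
          by (simp add: power2_commute[of "m x"])
      qed
    qed (use i f L in auto)
    also have "\<dots> = 2 * (\<integral>x. (p (x + h n) - p x)\<^sup>2 \<partial>lborel) + 2 * (\<integral>x. (m (x + h n) - m x)\<^sup>2 \<partial>lborel)"
      using i[OF L(1)] i[OF L(2)] by simp
    finally show ?thesis .
  qed
  ultimately show ?thesis
    by - (rule null_sequence_comparison[where g="\<lambda>n. 2 * (\<integral>x. (p (x + h n) - p x)\<^sup>2 \<partial>lborel) + 2 * (\<integral>x. (m (x + h n) - m x)\<^sup>2 \<partial>lborel)"], auto)
qed

section \<open>Mollification\<close>

definition mol :: "(real^'n::finite \<Rightarrow> real) \<Rightarrow> (real^'n \<Rightarrow> real) \<Rightarrow> real^'n \<Rightarrow> real" where
  "mol \<rho> f x = (\<integral>y. \<rho> (x - y) * f y \<partial>lborel)"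

lemma test_function_reflect:
  assumes "test_function UNIV \<rho>"
  shows "test_function UNIV (\<lambda>y. \<rho> (x - y))"
proof (rule test_functionI[of _ "(\<lambda>z. x - z) ` closure {z. \<rho> z \<noteq> 0}"])
  show "smooth (\<lambda>y. \<rho> (x - y))"
    using smooth_affine[of \<rho> "-1" x] assms by (simp add: test_function_def)
  show "compact ((\<lambda>z. x - z) ` closure {z. \<rho> z \<noteq> 0})"
    using assms by (intro compact_continuous_image) (auto simp: test_function_def intro!: continuous_intros)
  show "\<rho> (x - y) = 0" if "y \<notin> (\<lambda>z. x - z) ` closure {z. \<rho> z \<noteq> 0}" for y
  proof (rule eq_0_outside_support[of "x - y" \<rho>])
    show "x - y \<notin> closure {z. \<rho> z \<noteq> 0}"
      using that by (auto simp: image_iff dest: bspec[of _ _ "x - y"])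
  qed
qed auto

lemma partial_deriv_reflect:
  assumes "smooth \<rho>"
  shows "partial_deriv i (\<lambda>y. \<rho> (x - y)) y = - partial_deriv i \<rho> (x - y)"
proof -
  have "((\<lambda>y. \<rho> (x - y)) has_derivative (\<lambda>h. grad \<rho> (x - y) \<bullet> (- h))) (at y)"
    by (rule has_derivative_compose[of "\<lambda>y. x - y" uminus y UNIV \<rho> "(\<bullet>) (grad \<rho> (x - y))"])
       (auto intro!: derivative_eq_intros smooth_has_derivative assms)
  from partial_deriv_eq[OF this] show ?thesis by (simp add: inner_axis)
qed

lemma mol_integrable:
  assumes "test_function UNIV \<rho>" "square_integrable lborel f"
  shows "integrable lborel (\<lambda>y. \<rho> (x - y) * f y)"
  by (intro integrable_mult test_function_square_integrable[OF test_function_reflect] assms)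

section \<open>Differentiation under the convolution integral\<close>

lemma test_function_radius:
  assumes "test_function UNIV \<rho>"
  obtains R where "0 < R" "\<And>z. R \<le> norm z \<Longrightarrow> \<rho> z = 0" "\<And>z. R \<le> norm z \<Longrightarrow> grad \<rho> z = 0"
proof -
  have "bounded (closure {x. \<rho> x \<noteq> 0})" using assms by (auto simp: test_function_def compact_imp_bounded)
  then obtain R where R: "\<And>x. x \<in> closure {x. \<rho> x \<noteq> 0} \<Longrightarrow> norm x \<le> R" by (auto simp: bounded_iff)
  have *: "z \<notin> closure {x. \<rho> x \<noteq> 0}" if "max 1 (R + 1) \<le> norm z" for z
    using R[of z] that by linarith
  show thesis
  proof
    show "0 < max 1 (R + 1)" by simp
    show "\<rho> z = 0" "grad \<rho> z = 0" if "max 1 (R + 1) \<le> norm z" for z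
      using *[OF that] eq_0_outside_support[of z \<rho>] grad_eq_0_outside[of z \<rho>] by auto
  qed
qed

text \<open>Near the support, uniform continuity of the gradient on a compact ball and the mean
  value inequality bound the remainder. Farther out, with \<open>|h| < 1\<close>, both
  \<open>z\<close> and \<open>z + h\<close> lie where the function vanishes. The indicator on the
  right makes the bound integrable against any locally integrable function.\<close>

lemma test_function_uniform_linearization:
  fixes \<rho> :: "real^'n::finite \<Rightarrow> real"
  assumes \<rho>: "test_function UNIV \<rho>"
  obtains R where "0 < R"
    "\<And>e. 0 < e \<Longrightarrow> \<exists>d>0. \<forall>z h. norm h < d \<longrightarrow>
       \<bar>\<rho> (z + h) - \<rho> z - grad \<rho> z \<bullet> h\<bar> \<le> e * norm h * indicator (cball 0 R) z"
proof -
  obtain R where R: "0 < R" "\<And>z. R \<le> norm z \<Longrightarrow> \<rho> z = 0" "\<And>z. R \<le> norm z \<Longrightarrow> grad \<rho> z = 0"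
    using test_function_radius[OF \<rho>] by metis
  have sm: "smooth \<rho>" using \<rho> by (rule test_function_smooth)
  show thesis
  proof
    show "0 < R + 1" using R by simp
    fix e :: real assume e: "0 < e"
    have "uniformly_continuous_on (cball 0 (R + 2)) (grad \<rho>)"
      using smooth_continuous_grad[OF sm] by (intro compact_uniformly_continuous) (auto intro: continuous_on_subset)
    from this[unfolded uniformly_continuous_on_def, rule_format, OF e]
    obtain d where d: "0 < d" "\<And>x x'. x \<in> cball 0 (R + 2) \<Longrightarrow> x' \<in> cball 0 (R + 2) \<Longrightarrow> dist x' x < d \<Longrightarrow>
        dist (grad \<rho> x') (grad \<rho> x) < e" by metis
    let ?d = "min d 1"
    have "\<bar>\<rho> (z + h) - \<rho> z - grad \<rho> z \<bullet> h\<bar> \<le> e * norm h * indicator (cball 0 (R + 1)) z"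
      if h: "norm h < ?d" for z h
    proof (cases "norm z \<le> R + 1")
      case True
      have "norm (\<rho> (z + h) - \<rho> z - grad \<rho> z \<bullet> (z + h - z)) \<le> norm (z + h - z) * e"
      proof (rule differentiable_bound_linearization[where S="ball z ?d" and f'="\<lambda>y h. grad \<rho> y \<bullet> h"])
        show "z + t *\<^sub>R (z + h - z) \<in> ball z ?d" if "t \<in> {0..1}" for t
        proof -
          have "norm (t *\<^sub>R h) \<le> norm h" using that by (simp add: mult_left_le_one_le)
          then have "norm (t *\<^sub>R h) < ?d" using h by linarith
          then show ?thesis by (simp add: dist_norm)
        qed
        show "(\<rho> has_derivative (\<bullet>) (grad \<rho> y)) (at y within ball z ?d)" for y
          by (rule has_derivative_at_withinI[OF smooth_has_derivative[OF sm]])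
        show "onorm ((\<bullet>) (grad \<rho> y) - (\<bullet>) (grad \<rho> z)) \<le> e" if "y \<in> ball z ?d" for y
        proof (rule onorm_bound)
          have n: "norm y \<le> norm z + norm (y - z)" using norm_triangle_ineq[of z "y - z"] by simp
          have "dist y z < d" "norm (y - z) < 1" using that by (auto simp: dist_commute dist_norm norm_minus_commute)
          then have "norm (grad \<rho> y - grad \<rho> z) < e"
            using d(2)[of z y] True n by (simp add: dist_norm)
          then show "norm (((\<bullet>) (grad \<rho> y) - (\<bullet>) (grad \<rho> z)) v) \<le> e * norm v" for v
            using Cauchy_Schwarz_ineq2[of "grad \<rho> y - grad \<rho> z" v]
            by (simp add: inner_diff_left) (meson dual_order.trans less_imp_le mult_right_mono norm_ge_zero)
        qed (use e in simp)
      qed (use d in auto)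
      then show ?thesis using True by (simp add: mult.commute)
    next
      case False
      have "norm z \<le> norm (z + h) + norm h" using norm_triangle_ineq4[of "z + h" h] by simp
      then have "R \<le> norm (z + h)" "R \<le> norm z" using False h by auto
      then show ?thesis using R False by simp
    qed
    then show "\<exists>d>0. \<forall>z h. norm h < d \<longrightarrow>
       \<bar>\<rho> (z + h) - \<rho> z - grad \<rho> z \<bullet> h\<bar> \<le> e * norm h * indicator (cball 0 (R + 1)) z"
      using d(1) by (intro exI[of _ ?d]) auto
  qed
qed

lemma square_integrable_indicator:
  fixes S :: "(real^'n::finite) set"
  assumes "S \<in> sets borel" "bounded S"
  shows "square_integrable lborel (indicator S :: _ \<Rightarrow> real)"
proof -
  have "integrable lborel (indicator S :: _ \<Rightarrow> real)"
    using assms emeasure_bounded_finite[of S] by simp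
  moreover have "(\<lambda>x. (norm (indicator S x :: real))\<^sup>2) = indicator S"
    by (auto simp: indicator_def)
  ultimately show ?thesis using assms by (simp add: square_integrable_def)
qed

text \<open>The uniform linearization of the kernel is integrated against \<open>f\<close>. Its
  remainder costs at most \<open>e' |h|\<close> times the integral \<open>M\<close> of
  \<open>|f|\<close> over \<open>cball x R\<close>, which is finite since a square integrable
  function is locally integrable.\<close>

lemma mol_has_derivative:
  assumes \<rho>: "test_function UNIV \<rho>" and f: "square_integrable lborel f"
  shows "(mol \<rho> f has_derivative (\<lambda>h. \<Sum>i\<in>UNIV. h $ i * mol (partial_deriv i \<rho>) f x)) (at x)"
proof -
  obtain R where R: "0 < R" "\<And>e. 0 < e \<Longrightarrow> \<exists>d>0. \<forall>z h. norm h < d \<longrightarrow>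
       \<bar>\<rho> (z + h) - \<rho> z - grad \<rho> z \<bullet> h\<bar> \<le> e * norm h * indicator (cball 0 R) z"
    using test_function_uniform_linearization[OF \<rho>] by metis
  have iM: "integrable lborel (\<lambda>y. indicator (cball x R) y * f y)"
    by (intro integrable_mult square_integrable_indicator f) auto
  define M where "M = (\<integral>y. \<bar>indicator (cball x R) y * f y\<bar> \<partial>lborel)"
  have M: "0 \<le> M" unfolding M_def by simp
  have int: "integrable lborel (\<lambda>y. \<rho> (x' - y) * f y)" "integrable lborel (\<lambda>y. partial_deriv i \<rho> (x' - y) * f y)" for x' i
    by (intro mol_integrable \<rho> test_function_partial f)+
  have "\<exists>d>0. \<forall>y. norm (y - x) < d \<longrightarrow>
      norm (mol \<rho> f y - mol \<rho> f x - (\<Sum>i\<in>UNIV. (y - x) $ i * mol (partial_deriv i \<rho>) f x)) \<le> e * norm (y - x)"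
    if e: "0 < e" for e
  proof -
    \<comment> \<open>The summand \<open>1\<close> allows for \<open>M = 0\<close>.\<close>
    define e' where "e' = e / (M + 1)"
    have e': "0 < e'" "e' * M \<le> e" using e M by (auto simp: e'_def field_simps)
    from R(2)[OF e'(1)] obtain d where d: "0 < d" "\<And>z h. norm h < d \<Longrightarrow>
       \<bar>\<rho> (z + h) - \<rho> z - grad \<rho> z \<bullet> h\<bar> \<le> e' * norm h * indicator (cball 0 R) z" by blast
    have "norm (mol \<rho> f (x + h) - mol \<rho> f x - (\<Sum>i\<in>UNIV. h $ i * mol (partial_deriv i \<rho>) f x)) \<le> e * norm h"
      if h: "norm h < d" for h
    proof -
      have sum: "(\<integral>y. (\<Sum>i\<in>UNIV. h $ i * (partial_deriv i \<rho> (x - y) * f y)) \<partial>lborel) =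
          (\<Sum>i\<in>UNIV. h $ i * mol (partial_deriv i \<rho>) f x)"
        by (subst Bochner_Integration.integral_sum) (auto simp: mol_def int)
      have eq: "(\<rho> (x - y + h) - \<rho> (x - y) - grad \<rho> (x - y) \<bullet> h) * f y =
        \<rho> (x + h - y) * f y - \<rho> (x - y) * f y - (\<Sum>i\<in>UNIV. h $ i * (partial_deriv i \<rho> (x - y) * f y))" for y
        by (simp add: inner_vec_def algebra_simps sum_distrib_left)
      have i: "integrable lborel (\<lambda>y. (\<rho> (x - y + h) - \<rho> (x - y) - grad \<rho> (x - y) \<bullet> h) * f y)"
        unfolding eq by (intro Bochner_Integration.integrable_diff Bochner_Integration.integrable_sum
          integrable_mult_right int)
      have "mol \<rho> f (x + h) - mol \<rho> f x - (\<Sum>i\<in>UNIV. h $ i * mol (partial_deriv i \<rho>) f x) =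
        (\<integral>y. (\<rho> (x - y + h) - \<rho> (x - y) - grad \<rho> (x - y) \<bullet> h) * f y \<partial>lborel)"
        unfolding eq by (simp add: int sum mol_def)
      also have "norm \<dots> \<le> (\<integral>y. norm ((\<rho> (x - y + h) - \<rho> (x - y) - grad \<rho> (x - y) \<bullet> h) * f y) \<partial>lborel)"
        by (rule integral_norm_bound)
      also have "\<dots> \<le> (\<integral>y. e' * norm h * \<bar>indicator (cball x R) y * f y\<bar> \<partial>lborel)"
      proof (rule integral_mono)
        fix y
        have "\<bar>(\<rho> (x - y + h) - \<rho> (x - y) - grad \<rho> (x - y) \<bullet> h)\<bar> * \<bar>f y\<bar> \<le>
            (e' * norm h * indicator (cball 0 R) (x - y)) * \<bar>f y\<bar>"
          using d(2)[OF h, of "x - y"] by (intro mult_right_mono) auto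
        moreover have "indicator (cball 0 R) (x - y) = (indicator (cball x R) y :: real)"
          by (simp add: indicator_def dist_norm norm_minus_commute)
        ultimately show "norm ((\<rho> (x - y + h) - \<rho> (x - y) - grad \<rho> (x - y) \<bullet> h) * f y)
          \<le> e' * norm h * \<bar>indicator (cball x R) y * f y\<bar>" by (simp add: abs_mult mult_ac)
      qed (use i iM in \<open>auto intro!: integrable_mult_right integrable_abs\<close>)
      also have "\<dots> = (e' * M) * norm h" using iM by (simp add: M_def)
      also have "\<dots> \<le> e * norm h" using e' by (intro mult_right_mono) auto
      finally show ?thesis .
    qed
    from this[of "y - x" for y] show ?thesis using d(1) by auto
  qed
  moreover have "bounded_linear (\<lambda>h::real^'a. \<Sum>i\<in>UNIV. h $ i * mol (partial_deriv i \<rho>) f x)"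
    by (intro bounded_linear_sum bounded_linear_mult_left[THEN bounded_linear_compose] bounded_linear_vec_nth)
  ultimately show ?thesis by (simp add: has_derivative_at_alt)
qed

lemma partial_deriv_mol:
  assumes "test_function UNIV \<rho>" "square_integrable lborel f"
  shows "partial_deriv i (mol \<rho> f) = mol (partial_deriv i \<rho>) f"
proof
  fix x
  show "partial_deriv i (mol \<rho> f) x = mol (partial_deriv i \<rho>) f x"
    by (subst partial_deriv_eq[OF mol_has_derivative[OF assms]]) (simp add: axis_def if_distrib[of "\<lambda>t. t * _"] cong: if_cong)
qed

text \<open>A derivative of a mollification is the mollification with the differentiated kernel, so
  the induction has to run over all kernels.\<close>

lemma smooth_mol:
  assumes "test_function UNIV \<rho>" "square_integrable lborel f"
  shows "smooth (mol \<rho> f)"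
  unfolding smooth_def
proof
  fix k show "C_k k (mol \<rho> f)"
    using assms(1)
  proof (induction k arbitrary: \<rho>)
    case 0
    then show ?case
      using has_derivative_continuous[OF mol_has_derivative[OF 0 assms(2)]]
      by (simp add: continuous_at_imp_continuous_on)
  next
    case (Suc k)
    then show ?case
      using mol_has_derivative[OF Suc.prems assms(2)] assms(2)
      by (auto simp: partial_deriv_mol differentiable_def test_function_partial)
  qed
qed

section \<open>Supports of mollifications, mollifiers and cut-off functions\<close>

lemma mol_eq_0:
  assumes "\<And>z. \<epsilon> \<le> norm z \<Longrightarrow> \<rho> z = 0" "AE y in lborel. y \<notin> K \<longrightarrow> f y = 0" "\<And>y. y \<in> K \<Longrightarrow> \<epsilon> \<le> dist x y"
  shows "mol \<rho> f x = 0"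
proof -
  have "AE y in lborel. \<rho> (x - y) * f y = 0"
    using assms(2)
  proof eventually_elim
    case (elim y)
    then show ?case using assms(1)[of "x - y"] assms(3)[of y] by (cases "y \<in> K") (auto simp: dist_norm)
  qed
  then show ?thesis unfolding mol_def by (rule integral_eq_zero_AE)
qed

text \<open>A normalized bump, rescaled to radius \<epsilon>. Each first derivative picks up a
  factor \<open>1/\<epsilon>\<close>; the bound on its \<open>L^1\<close> norm later controls the
  gradient of a mollified indicator, which is how cut-off functions arise.\<close>

lemma mollifier_exists:
  "\<exists>(\<phi> :: real \<Rightarrow> real^'n::finite \<Rightarrow> real) C. 0 < C \<and> (\<forall>\<epsilon>>0. test_function UNIV (\<phi> \<epsilon>) \<and> (\<forall>x. 0 \<le> \<phi> \<epsilon> x) \<and>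
    (\<forall>x. \<epsilon> \<le> norm x \<longrightarrow> \<phi> \<epsilon> x = 0) \<and> (\<integral>x. \<phi> \<epsilon> x \<partial>lborel) = 1 \<and>
    (\<forall>i. (\<integral>x. \<bar>partial_deriv i (\<phi> \<epsilon>) x\<bar> \<partial>lborel) \<le> C / \<epsilon>))"
proof -
  obtain \<rho> :: "real^'n \<Rightarrow> real" where \<rho>: "smooth \<rho>" "\<And>x. 0 \<le> \<rho> x" "\<And>x. norm x < 1 \<Longrightarrow> 0 < \<rho> x" "\<And>x. 1 \<le> norm x \<Longrightarrow> \<rho> x = 0"
    using bump_exists by metis
  have t: "test_function UNIV \<rho>"
    by (rule test_functionI[of _ "cball 0 1"]) (use \<rho> in auto)
  have m [measurable]: "\<rho> \<in> borel_measurable borel" "\<And>i. partial_deriv i \<rho> \<in> borel_measurable borel"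
    using t by auto
  have int: "integrable lborel \<eta>" if \<eta>: "test_function UNIV \<eta>" for \<eta> :: "real^'n \<Rightarrow> real"
  proof -
    obtain R where R: "0 < R" "\<And>z. R \<le> norm z \<Longrightarrow> \<eta> z = 0" using test_function_radius[OF \<eta>] by metis
    have "integrable lborel (\<lambda>x. indicator (cball 0 R) x * \<eta> x)"
      by (intro integrable_mult square_integrable_indicator test_function_square_integrable[OF \<eta>]) auto
    also have "(\<lambda>x. indicator (cball 0 R) x * \<eta> x) = \<eta>" using R(2) by (force simp: indicator_def)
    finally show ?thesis .
  qed
  define c where "c = (\<integral>x. \<rho> x \<partial>lborel)"
  have c: "0 < c"
  proof -
    have "c \<noteq> 0"
    proof
      assume "c = 0"
      then have "AE x in lborel. \<rho> x = 0"
        using integral_nonneg_eq_0_iff_AE[OF int[OF t]] \<rho> by (simp add: c_def)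
      then have "AE x in lborel. x \<notin> ball (0::real^'n) 1"
        by eventually_elim (use \<rho>(3) in \<open>force simp: dist_norm\<close>)
      then have "emeasure lborel (ball (0::real^'n) 1) = 0"
        by (subst (asm) AE_iff_measurable[of "ball 0 1"]) auto
      then show False using unit_ball_vol_pos[of "real CARD('n)"] by (simp add: emeasure_ball)
    qed
    moreover have "0 \<le> c" unfolding c_def using \<rho> by simp
    ultimately show ?thesis by simp
  qed
  \<comment> \<open>The summand \<open>0\<close> gives the argument the affine shape of
    \<open>smooth_affine\<close>.\<close>
  define \<phi> where "\<phi> \<epsilon> x = inverse (c * \<epsilon> ^ CARD('n)) * \<rho> (inverse \<epsilon> *\<^sub>R x + 0)" for \<epsilon> x
  define D where "D i = (\<integral>x. \<bar>partial_deriv i \<rho> x\<bar> \<partial>lborel)" for i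
  \<comment> \<open>The sum serves all directions at once, and the summand \<open>1\<close> makes
    \<open>C\<close> positive without a lower bound on the \<open>D i\<close>.\<close>
  define C where "C = (\<Sum>i\<in>UNIV. D i) / c + 1"
  have D: "0 \<le> D i" for i unfolding D_def by simp
  show ?thesis
  proof (intro exI[of _ \<phi>] exI[of _ C] conjI allI impI)
    show "0 < C" using c D by (auto simp: C_def intro!: add_nonneg_pos sum_nonneg divide_nonneg_pos)
    fix \<epsilon> :: real assume e: "0 < \<epsilon>"
    have sm: "smooth (\<lambda>x. \<rho> (inverse \<epsilon> *\<^sub>R x + 0))" by (intro smooth_affine \<rho>)
    have z: "\<phi> \<epsilon> x = 0" if "\<epsilon> \<le> norm x" for x
      using that e \<rho>(4)[of "inverse \<epsilon> *\<^sub>R x"] by (simp add: \<phi>_def field_simps)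
    show "\<And>x. \<epsilon> \<le> norm x \<Longrightarrow> \<phi> \<epsilon> x = 0" by (rule z)
    show "test_function UNIV (\<phi> \<epsilon>)"
    proof (rule test_functionI[of _ "cball 0 \<epsilon>"])
      show "smooth (\<phi> \<epsilon>)" unfolding \<phi>_def[abs_def] by (intro smooth_mult smooth_const sm)
    qed (use z in auto)
    show "0 \<le> \<phi> \<epsilon> x" for x using \<rho> c e by (simp add: \<phi>_def)
    show "(\<integral>x. \<phi> \<epsilon> x \<partial>lborel) = 1"
      using integral_scale[of \<rho> "inverse \<epsilon>"] c e by (simp add: \<phi>_def c_def[symmetric] field_simps)
    show "(\<integral>x. \<bar>partial_deriv i (\<phi> \<epsilon>) x\<bar> \<partial>lborel) \<le> C / \<epsilon>" for i
    proof -
      have p: "partial_deriv i (\<phi> \<epsilon>) x = inverse (c * \<epsilon> ^ CARD('n)) * (inverse \<epsilon> * partial_deriv i \<rho> (inverse \<epsilon> *\<^sub>R x))" for x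
      proof -
        have "((\<lambda>x. \<rho> (inverse \<epsilon> *\<^sub>R x + 0)) has_derivative (\<lambda>h. grad \<rho> (inverse \<epsilon> *\<^sub>R x + 0) \<bullet> (inverse \<epsilon> *\<^sub>R h))) (at x)"
          by (rule has_derivative_compose[of "\<lambda>x. inverse \<epsilon> *\<^sub>R x + 0" "\<lambda>h. inverse \<epsilon> *\<^sub>R h" x UNIV \<rho>
                "(\<bullet>) (grad \<rho> (inverse \<epsilon> *\<^sub>R x + 0))"])
             (auto intro!: derivative_eq_intros smooth_has_derivative[OF \<rho>(1)] simp del: add_0_right)
        from partial_deriv_eq[OF has_derivative_mult_right[OF this, of "inverse (c * \<epsilon> ^ CARD('n))"]]
        show ?thesis unfolding \<phi>_def[abs_def] by (simp add: inner_axis)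
      qed
      have "(\<integral>x. \<bar>partial_deriv i (\<phi> \<epsilon>) x\<bar> \<partial>lborel) =
          (inverse (c * \<epsilon> ^ CARD('n)) * inverse \<epsilon>) * (\<integral>x. \<bar>partial_deriv i \<rho> (inverse \<epsilon> *\<^sub>R x)\<bar> \<partial>lborel)"
        using c e by (simp add: p abs_mult)
      also have "\<dots> = D i / c / \<epsilon>"
        using integral_scale[of "\<lambda>x. \<bar>partial_deriv i \<rho> x\<bar>" "inverse \<epsilon>"] c e
        by (simp add: D_def field_simps)
      also have "\<dots> \<le> C / \<epsilon>"
      proof -
        have "D i \<le> (\<Sum>i\<in>UNIV. D i)" using D by (intro member_le_sum) auto
        from divide_right_mono[OF this, of c] have "D i / c \<le> C" using c by (simp add: C_def)
        then show ?thesis using e by (intro divide_right_mono) auto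
      qed
      finally show ?thesis .
    qed
  qed
qed

text \<open>The indicator of the ball of radius \<open>(s + t) / 2\<close> is mollified at scale
  \<open>\<epsilon> = (t - s) / 4\<close>, so it is still \<open>1\<close> up to radius
  \<open>s\<close> and vanishes well before radius \<open>t\<close>. Every partial derivative is at
  most the \<open>L^1\<close> norm of the kernel's derivative, that is
  \<open>C / \<epsilon> = 4 C / (t - s)\<close>, and summing over the coordinates gives the
  constant.\<close>

lemma cutoff_exists:
  obtains C :: real where "0 < C"
    "\<And>(c::real^'n::finite) s t. s < t \<Longrightarrow> \<exists>\<eta>. test_function (ball c t) \<eta> \<and> (\<forall>x. 0 \<le> \<eta> x \<and> \<eta> x \<le> 1) \<and>
       (\<forall>x. dist c x \<le> s \<longrightarrow> \<eta> x = 1) \<and> (\<forall>x. norm (grad \<eta> x) \<le> C / (t - s))"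
proof -
  obtain \<phi> :: "real \<Rightarrow> real^'n \<Rightarrow> real" and C where C: "0 < C" and
    M: "\<forall>\<epsilon>>0. test_function UNIV (\<phi> \<epsilon>) \<and> (\<forall>x. 0 \<le> \<phi> \<epsilon> x) \<and>
    (\<forall>x. \<epsilon> \<le> norm x \<longrightarrow> \<phi> \<epsilon> x = 0) \<and> (\<integral>x. \<phi> \<epsilon> x \<partial>lborel) = 1 \<and>
    (\<forall>i. (\<integral>x. \<bar>partial_deriv i (\<phi> \<epsilon>) x\<bar> \<partial>lborel) \<le> C / \<epsilon>)"
    using mollifier_exists by blast
  then have \<phi>: "\<And>\<epsilon>. 0 < \<epsilon> \<Longrightarrow> test_function UNIV (\<phi> \<epsilon>)" "\<And>\<epsilon> x. 0 < \<epsilon> \<Longrightarrow> 0 \<le> \<phi> \<epsilon> x"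
    "\<And>\<epsilon> x. 0 < \<epsilon> \<Longrightarrow> \<epsilon> \<le> norm x \<Longrightarrow> \<phi> \<epsilon> x = 0" "\<And>\<epsilon>. 0 < \<epsilon> \<Longrightarrow> (\<integral>x. \<phi> \<epsilon> x \<partial>lborel) = 1"
    "\<And>\<epsilon> i. 0 < \<epsilon> \<Longrightarrow> (\<integral>x. \<bar>partial_deriv i (\<phi> \<epsilon>) x\<bar> \<partial>lborel) \<le> C / \<epsilon>"
    by simp_all
  show thesis
  proof (rule that[of "CARD('n) * 4 * C"])
    show "0 < CARD('n) * 4 * C" using C by simp
    fix c :: "real^'n" and s t :: real assume st: "s < t"
    define \<epsilon> where "\<epsilon> = (t - s) / 4"
    have e: "0 < \<epsilon>" using st by (simp add: \<epsilon>_def)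
    let ?B = "ball c ((s + t) / 2)"
    define \<eta> where "\<eta> = mol (\<phi> \<epsilon>) (indicator ?B)"
    have sq: "square_integrable lborel (indicator ?B :: _ \<Rightarrow> real)"
      by (rule square_integrable_indicator) auto
    have int: "integrable lborel (\<lambda>y. \<phi> \<epsilon> (x - y) * indicator ?B y)" for x
      by (rule mol_integrable[OF \<phi>(1)[OF e] sq])
    have [measurable]: "\<phi> \<epsilon> \<in> borel_measurable borel" "\<And>i. partial_deriv i (\<phi> \<epsilon>) \<in> borel_measurable borel"
      using \<phi>(1)[OF e] by auto
    \<comment> \<open>A nonintegrable function has integral \<open>0\<close> by convention, so the
      value \<open>1\<close> entails integrability.\<close>
    have i1: "integrable lborel (\<phi> \<epsilon>)" using \<phi>(4)[OF e] not_integrable_integral_eq by fastforce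
    have i1': "integrable lborel (\<lambda>y. \<phi> \<epsilon> (x - y))" for x using i1 by (simp add: integrable_reflect)
    have one: "(\<integral>y. \<phi> \<epsilon> (x - y) \<partial>lborel) = 1" for x
      using integral_reflect[of "\<phi> \<epsilon>" x] \<phi>(4)[OF e] by simp
    have "test_function (ball c t) \<eta>"
    proof (rule test_functionI[of _ "cball c ((s + t) / 2 + \<epsilon>)"])
      show "smooth \<eta>" unfolding \<eta>_def by (rule smooth_mol[OF \<phi>(1)[OF e] sq])
      show "cball c ((s + t) / 2 + \<epsilon>) \<subseteq> ball c t" using st by (auto simp: \<epsilon>_def field_simps)
      show "\<eta> x = 0" if "x \<notin> cball c ((s + t) / 2 + \<epsilon>)" for x
        unfolding \<eta>_def
      proof (rule mol_eq_0[where \<epsilon>=\<epsilon> and K="?B"])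
        show "\<epsilon> \<le> dist x y" if "y \<in> ?B" for y
        proof -
          have "dist c y < (s + t) / 2" "(s + t) / 2 + \<epsilon> < dist c x"
            using that \<open>x \<notin> _\<close> by (simp_all add: mem_ball not_le)
          then show ?thesis using dist_triangle[of c x y] by (simp only: dist_commute[of y x])
        qed
      qed (use \<phi>(3)[OF e] in auto)
    qed simp
    moreover have "0 \<le> \<eta> x" for x unfolding \<eta>_def mol_def using \<phi>(2)[OF e] by simp
    moreover have "\<eta> x \<le> 1" for x
    proof -
      have "\<eta> x \<le> (\<integral>y. \<phi> \<epsilon> (x - y) \<partial>lborel)" unfolding \<eta>_def mol_def
        using \<phi>(2)[OF e] by (intro integral_mono int i1') (auto simp: indicator_def)
      then show ?thesis using one by simp
    qed
    moreover have "\<eta> x = 1" if "dist c x \<le> s" for x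
    proof -
      have eq: "\<phi> \<epsilon> (x - y) * indicator ?B y = \<phi> \<epsilon> (x - y)" for y
      proof (cases "y \<in> ?B")
        case False
        then have "\<epsilon> \<le> dist x y" using dist_triangle[of c y x] that st by (simp add: \<epsilon>_def field_simps)
        then show ?thesis using \<phi>(3)[OF e, of "x - y"] by (simp add: dist_norm)
      qed simp
      show ?thesis unfolding \<eta>_def mol_def eq by (rule one)
    qed
    moreover have "norm (grad \<eta> x) \<le> CARD('n) * 4 * C / (t - s)" for x
    proof -
      have "\<bar>partial_deriv i \<eta> x\<bar> \<le> C / \<epsilon>" for i
      proof -
        have i: "integrable lborel (\<lambda>y. partial_deriv i (\<phi> \<epsilon>) (x - y) * indicator ?B y)"
          by (rule mol_integrable[OF test_function_partial[OF \<phi>(1)[OF e]] sq])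
        obtain R where R: "0 < R" "\<And>z. R \<le> norm z \<Longrightarrow> grad (\<phi> \<epsilon>) z = 0"
          using test_function_radius[OF \<phi>(1)[OF e]] by metis
        have "integrable lborel (\<lambda>x. indicator (cball 0 R) x * partial_deriv i (\<phi> \<epsilon>) x)"
          by (intro integrable_mult square_integrable_indicator test_function_square_integrable[OF \<phi>(1)[OF e]]) auto
        also have "(\<lambda>x. indicator (cball 0 R) x * partial_deriv i (\<phi> \<epsilon>) x) = partial_deriv i (\<phi> \<epsilon>)"
        proof
          fix x show "indicator (cball 0 R) x * partial_deriv i (\<phi> \<epsilon>) x = partial_deriv i (\<phi> \<epsilon>) x"
            using R(2)[of x] grad_nth[of "\<phi> \<epsilon>" x i] by (cases "norm x \<le> R") auto
        qed
        finally have i2: "integrable lborel (\<lambda>y. \<bar>partial_deriv i (\<phi> \<epsilon>) (x - y)\<bar>)"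
          using integrable_reflect[of "\<lambda>z. \<bar>partial_deriv i (\<phi> \<epsilon>) z\<bar>" x] by simp
        have "\<bar>partial_deriv i \<eta> x\<bar> = \<bar>\<integral>y. partial_deriv i (\<phi> \<epsilon>) (x - y) * indicator ?B y \<partial>lborel\<bar>"
          unfolding \<eta>_def partial_deriv_mol[OF \<phi>(1)[OF e] sq] mol_def ..
        also have "\<dots> \<le> (\<integral>y. \<bar>partial_deriv i (\<phi> \<epsilon>) (x - y) * indicator ?B y\<bar> \<partial>lborel)"
          by (rule integral_abs_bound)
        also have "\<dots> \<le> (\<integral>y. \<bar>partial_deriv i (\<phi> \<epsilon>) (x - y)\<bar> \<partial>lborel)"
          by (intro integral_mono i2 integrable_abs[OF i]) (auto simp: indicator_def)
        also have "\<dots> \<le> C / \<epsilon>"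
          using integral_reflect[of "\<lambda>z. \<bar>partial_deriv i (\<phi> \<epsilon>) z\<bar>" x] \<phi>(5)[OF e, of i] by simp
        finally show ?thesis .
      qed
      then have "norm (grad \<eta> x) \<le> (\<Sum>i\<in>(UNIV::'n set). C / \<epsilon>)"
        by (intro order_trans[OF norm_le_l1_cart] sum_mono) auto
      then show ?thesis by (simp add: \<epsilon>_def mult_ac)
    qed
    ultimately show "\<exists>\<eta>. test_function (ball c t) \<eta> \<and> (\<forall>x. 0 \<le> \<eta> x \<and> \<eta> x \<le> 1) \<and>
       (\<forall>x. dist c x \<le> s \<longrightarrow> \<eta> x = 1) \<and> (\<forall>x. norm (grad \<eta> x) \<le> CARD('n) * 4 * C / (t - s))" by blast
  qed
qed

text \<open>Turns sequential continuity into a modulus: vectors that violate the bound with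
  \<open>|z n| < 1/(n + 1)\<close> would form a null sequence.\<close>

lemma L2_translation_modulus:
  fixes f :: "real^'n::finite \<Rightarrow> real"
  assumes f: "square_integrable lborel f" and e: "0 < e"
  shows "\<exists>d>0. \<forall>z. norm z < d \<longrightarrow> (\<integral>x. (f (x + z) - f x)\<^sup>2 \<partial>lborel) < e"
proof (rule ccontr)
  assume neg: "\<not> ?thesis"
  have "\<exists>z. norm z < inverse (real (Suc n)) \<and> e \<le> (\<integral>x. (f (x + z) - f x)\<^sup>2 \<partial>lborel)" for n
  proof -
    have "0 < inverse (real (Suc n))" by simp
    with neg have "\<not> (\<forall>z. norm z < inverse (real (Suc n)) \<longrightarrow> (\<integral>x. (f (x + z) - f x)\<^sup>2 \<partial>lborel) < e)"
      by blast
    then show ?thesis by (simp add: not_less)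
  qed
  then have "\<exists>z. \<forall>n. norm (z n) < inverse (real (Suc n)) \<and> e \<le> (\<integral>x. (f (x + z n) - f x)\<^sup>2 \<partial>lborel)"
    by (intro choice) blast
  then obtain z where z: "\<And>n. norm (z n) < inverse (real (Suc n))"
    "\<And>n. e \<le> (\<integral>x. (f (x + z n) - f x)\<^sup>2 \<partial>lborel)" by blast
  have "z \<longlonglongrightarrow> 0"
    by (rule null_sequence_comparison[OF _ LIMSEQ_inverse_real_of_nat]) (use z less_imp_le in blast)
  from L2_translation_continuous[OF f this] have "e \<le> 0"
    by (rule tendsto_lowerbound) (use z in auto)
  with e show False by simp
qed

text \<open>\<open>mol \<phi> f x\<close> is the mean of \<open>f (x + z)\<close> with respect to
  the probability density \<open>\<psi> z = \<phi> (- z)\<close>. Jensen's inequality bounds its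
  squared distance to \<open>f x\<close> by the mean of \<open>(f (x + z) - f x)^2\<close>; after
  exchanging the integrals only shifts with \<open>|z| < \<epsilon>\<close> contribute, each at most
  \<open>e\<close>.\<close>

lemma mol_L2_estimate:
  fixes f :: "real^'n::finite \<Rightarrow> real"
  assumes f: "square_integrable lborel f" and \<phi>: "test_function UNIV \<phi>" "\<And>x. 0 \<le> \<phi> x"
    "\<And>x. \<epsilon> \<le> norm x \<Longrightarrow> \<phi> x = 0" "(\<integral>x. \<phi> x \<partial>lborel) = 1"
    and e: "0 \<le> e" "\<And>z. norm z < \<epsilon> \<Longrightarrow> (\<integral>x. (f (x + z) - f x)\<^sup>2 \<partial>lborel) \<le> e"
  shows "square_integrable lborel (mol \<phi> f)" "(\<integral>x. (mol \<phi> f x - f x)\<^sup>2 \<partial>lborel) \<le> e"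
proof -
  have fm [measurable]: "f \<in> borel_measurable borel" using f by (simp add: square_integrable_def)
  have \<phi>m [measurable]: "\<phi> \<in> borel_measurable borel" using \<phi> by auto
  have mm [measurable]: "mol \<phi> f \<in> borel_measurable borel"
    using smooth_continuous[OF smooth_mol[OF \<phi>(1) f]] by (rule borel_measurable_continuous_onI)
  have i\<phi>: "integrable lborel \<phi>" using \<phi>(4) not_integrable_integral_eq by fastforce
  define \<psi> where "\<psi> z = \<phi> (0 - z)" for z
  have [measurable]: "\<psi> \<in> borel_measurable borel" unfolding \<psi>_def[abs_def] by measurable
  have i\<psi>: "integrable lborel \<psi>" unfolding \<psi>_def[abs_def] integrable_reflect[OF \<phi>m] by (rule i\<phi>)
  have one: "(\<integral>z. \<psi> z \<partial>lborel) = 1" unfolding \<psi>_def integral_reflect[OF \<phi>m] by (rule \<phi>(4))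
  have \<psi>0: "0 \<le> \<psi> z" for z unfolding \<psi>_def by (rule \<phi>(2))
  have t\<psi>: "test_function UNIV \<psi>" unfolding \<psi>_def[abs_def] by (rule test_function_reflect[OF \<phi>(1)])
  obtain C where C: "0 < C" "\<And>x. \<bar>\<psi> x\<bar> \<le> C" using test_function_bounded[OF t\<psi>] by metis
  have pt: "ennreal ((mol \<phi> f x - f x)\<^sup>2) \<le> (\<integral>\<^sup>+z. ennreal (\<psi> z * (f (x + z) - f x)\<^sup>2) \<partial>lborel)" for x
  proof -
    have ft: "square_integrable lborel (\<lambda>z. f (z + x))" by (rule square_integrable_translate[OF f])
    have i1: "integrable lborel (\<lambda>z. \<psi> z * f (z + x))"
      by (intro integrable_mult test_function_square_integrable[OF t\<psi>] ft)
    have i2: "integrable lborel (\<lambda>z. \<psi> z * (f (z + x))\<^sup>2)"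
    proof (rule Bochner_Integration.integrable_bound)
      show "integrable lborel (\<lambda>z. C * (f (z + x))\<^sup>2)"
        using square_integrable_integrable[OF ft] by simp
      show "AE z in lborel. norm (\<psi> z * (f (z + x))\<^sup>2) \<le> norm (C * (f (z + x))\<^sup>2)"
        using C \<psi>0 by (auto simp: abs_mult intro!: mult_right_mono)
    qed simp
    have "mol \<phi> f x = (\<integral>z. \<phi> (x - (z + x)) * f (z + x) \<partial>lborel)"
      unfolding mol_def by (rule integral_translate[symmetric]) measurable
    then have m: "mol \<phi> f x = (\<integral>z. \<psi> z * f (z + x) \<partial>lborel)" by (simp add: \<psi>_def)
    define a where "a = mol \<phi> f x"
    have exp: "\<psi> z * (f (z + x) - b)\<^sup>2 = \<psi> z * (f (z + x))\<^sup>2 - (2 * b) * (\<psi> z * f (z + x)) + b\<^sup>2 * \<psi> z" for z b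
      by (simp add: power2_eq_square algebra_simps)
    have i3: "integrable lborel (\<lambda>z. \<psi> z * (f (z + x) - b)\<^sup>2)" for b
      unfolding exp using i1 i2 i\<psi> by simp
    have val: "(\<integral>z. \<psi> z * (f (z + x) - b)\<^sup>2 \<partial>lborel) = (\<integral>z. \<psi> z * (f (z + x))\<^sup>2 \<partial>lborel) - 2 * b * a + b\<^sup>2" for b
      unfolding exp using i1 i2 i\<psi> one by (simp add: m a_def)
    \<comment> \<open>Jensen's inequality in the form that a variance is nonnegative: the mean of
      \<open>f^2\<close> is at least \<open>a^2\<close>.\<close>
    have "0 \<le> (\<integral>z. \<psi> z * (f (z + x) - a)\<^sup>2 \<partial>lborel)" using \<psi>0 by simp
    then have "(a - f x)\<^sup>2 \<le> (\<integral>z. \<psi> z * (f (z + x) - f x)\<^sup>2 \<partial>lborel)"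
      unfolding val by (simp add: power2_eq_square algebra_simps)
    then have "ennreal ((a - f x)\<^sup>2) \<le> ennreal (\<integral>z. \<psi> z * (f (z + x) - f x)\<^sup>2 \<partial>lborel)"
      by (rule ennreal_leI)
    also have "\<dots> = (\<integral>\<^sup>+z. ennreal (\<psi> z * (f (z + x) - f x)\<^sup>2) \<partial>lborel)"
      by (rule nn_integral_eq_integral[symmetric, OF i3]) (simp add: \<psi>0)
    finally show ?thesis by (simp add: a_def add.commute)
  qed
  have "(\<integral>\<^sup>+x. ennreal ((mol \<phi> f x - f x)\<^sup>2) \<partial>lborel) \<le>
      (\<integral>\<^sup>+x. (\<integral>\<^sup>+z. ennreal (\<psi> z * (f (x + z) - f x)\<^sup>2) \<partial>lborel) \<partial>lborel)"
    by (rule nn_integral_mono) (rule pt)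
  also have "\<dots> = (\<integral>\<^sup>+z. (\<integral>\<^sup>+x. ennreal (\<psi> z * (f (x + z) - f x)\<^sup>2) \<partial>lborel) \<partial>lborel)"
    by (rule lborel_pair.Fubini'[symmetric]) measurable
  also have "\<dots> \<le> (\<integral>\<^sup>+z. ennreal (\<psi> z) * ennreal e \<partial>lborel)"
  proof (rule nn_integral_mono)
    fix z
    show "(\<integral>\<^sup>+x. ennreal (\<psi> z * (f (x + z) - f x)\<^sup>2) \<partial>lborel) \<le> ennreal (\<psi> z) * ennreal e"
    proof (cases "norm z < \<epsilon>")
      case True
      have i: "integrable lborel (\<lambda>x. (f (x + z) - f x)\<^sup>2)"
        using square_integrable_integrable[OF square_integrable_diff[OF square_integrable_translate[OF f] f]] by simp
      have "(\<integral>\<^sup>+x. ennreal (\<psi> z * (f (x + z) - f x)\<^sup>2) \<partial>lborel) = ennreal (\<psi> z) * (\<integral>\<^sup>+x. ennreal ((f (x + z) - f x)\<^sup>2) \<partial>lborel)"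
        using \<psi>0 by (simp add: ennreal_mult nn_integral_cmult)
      also have "(\<integral>\<^sup>+x. ennreal ((f (x + z) - f x)\<^sup>2) \<partial>lborel) = ennreal (\<integral>x. (f (x + z) - f x)\<^sup>2 \<partial>lborel)"
        by (rule nn_integral_eq_integral[OF i]) simp
      also have "\<dots> \<le> ennreal e" using e(2)[OF True] by (rule ennreal_leI)
      finally show ?thesis by (simp add: mult_left_mono)
    next
      case False
      then have "\<psi> z = 0" using \<phi>(3)[of "0 - z"] by (simp add: \<psi>_def)
      then show ?thesis by simp
    qed
  qed
  also have "\<dots> = ennreal e"
  proof -
    have "(\<integral>\<^sup>+z. ennreal (\<psi> z) \<partial>lborel) = 1"
      using nn_integral_eq_integral[OF i\<psi>] \<psi>0 one by simp
    then show ?thesis by (simp add: nn_integral_multc)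
  qed
  finally have le: "(\<integral>\<^sup>+x. ennreal ((mol \<phi> f x - f x)\<^sup>2) \<partial>lborel) \<le> ennreal e" .
  have int: "integrable lborel (\<lambda>x. (mol \<phi> f x - f x)\<^sup>2)"
    by (rule integrableI_nonneg) (use le in \<open>auto intro: le_less_trans\<close>)
  then have "square_integrable lborel (\<lambda>x. mol \<phi> f x - f x)"
    by (simp add: square_integrable_def)
  from square_integrable_add[OF this f] show "square_integrable lborel (mol \<phi> f)" by simp
  show "(\<integral>x. (mol \<phi> f x - f x)\<^sup>2 \<partial>lborel) \<le> e"
    using le nn_integral_eq_integral[OF int] e by simp
qed

lemma mollifier_sequence_exists:
  "\<exists>\<phi> :: nat \<Rightarrow> real^'n::finite \<Rightarrow> real. (\<forall>k. test_function UNIV (\<phi> k)) \<and>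
    (\<forall>k x. inverse (real (Suc k)) \<le> norm x \<longrightarrow> \<phi> k x = 0) \<and>
    (\<forall>f k. square_integrable lborel f \<longrightarrow> square_integrable lborel (mol (\<phi> k) f)) \<and>
    (\<forall>f. square_integrable lborel f \<longrightarrow> (\<lambda>k. \<integral>x. (mol (\<phi> k) f x - f x)\<^sup>2 \<partial>lborel) \<longlonglongrightarrow> 0)"
proof -
  obtain \<phi> :: "real \<Rightarrow> real^'n \<Rightarrow> real" and C where
    M: "\<forall>\<epsilon>>0. test_function UNIV (\<phi> \<epsilon>) \<and> (\<forall>x. 0 \<le> \<phi> \<epsilon> x) \<and>
    (\<forall>x. \<epsilon> \<le> norm x \<longrightarrow> \<phi> \<epsilon> x = 0) \<and> (\<integral>x. \<phi> \<epsilon> x \<partial>lborel) = 1 \<and>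
    (\<forall>i. (\<integral>x. \<bar>partial_deriv i (\<phi> \<epsilon>) x\<bar> \<partial>lborel) \<le> C / \<epsilon>)"
    using mollifier_exists by blast
  define \<psi> where "\<psi> k = \<phi> (inverse (real (Suc k)))" for k
  have p: "0 < inverse (real (Suc k))" for k by simp
  have \<psi>: "test_function UNIV (\<psi> k)" "0 \<le> \<psi> k x" "inverse (real (Suc k)) \<le> norm x \<Longrightarrow> \<psi> k x = 0"
    "(\<integral>x. \<psi> k x \<partial>lborel) = 1" for k x
    using M[rule_format, OF p[of k]] unfolding \<psi>_def by auto
  have sq: "square_integrable lborel (mol (\<psi> k) f)" if f: "square_integrable lborel f" for f k
  proof (rule mol_L2_estimate(1)[OF f \<psi>])
    \<comment> \<open>A crude bound valid for every shift is enough for square integrability; small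
      shifts matter only in the limit below.\<close>
    have i: "integrable lborel (\<lambda>x. 4 * (f x)\<^sup>2)" using square_integrable_integrable[OF f] by simp
    show "0 \<le> (\<integral>x. 4 * (f x)\<^sup>2 \<partial>lborel)" by simp
    show "(\<integral>x. (f (x + z) - f x)\<^sup>2 \<partial>lborel) \<le> (\<integral>x. 4 * (f x)\<^sup>2 \<partial>lborel)" for z
    proof -
      note ft = square_integrable_translate[OF f, of z]
      have [measurable]: "f \<in> borel_measurable borel" using f by (simp add: square_integrable_def)
      have "(\<integral>x. (f (x + z) - f x)\<^sup>2 \<partial>lborel) \<le> (\<integral>x. 2 * (f (x + z))\<^sup>2 + 2 * (f x)\<^sup>2 \<partial>lborel)"
        using square_integrable_integrable[OF square_integrable_diff[OF ft f]] square_integrable_integrable[OF ft]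
          square_integrable_integrable[OF f] power2_norm_add_le[of "f (x + z)" "- f x" for x]
        by (intro integral_mono) auto
      also have "\<dots> = 2 * (\<integral>x. (f (x + z))\<^sup>2 \<partial>lborel) + 2 * (\<integral>x. (f x)\<^sup>2 \<partial>lborel)"
        using square_integrable_integrable[OF ft] square_integrable_integrable[OF f] by simp
      also have "(\<integral>x. (f (x + z))\<^sup>2 \<partial>lborel) = (\<integral>x. (f x)\<^sup>2 \<partial>lborel)"
        by (rule integral_translate[of "\<lambda>x. (f x)\<^sup>2" z]) simp
      finally show ?thesis by simp
    qed
  qed
  have lim: "(\<lambda>k. \<integral>x. (mol (\<psi> k) f x - f x)\<^sup>2 \<partial>lborel) \<longlonglongrightarrow> 0" if f: "square_integrable lborel f" for f
  proof (rule LIMSEQ_I)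
    fix r :: real assume r: "0 < r"
    obtain d where d: "0 < d" "\<And>z. norm z < d \<Longrightarrow> (\<integral>x. (f (x + z) - f x)\<^sup>2 \<partial>lborel) < r / 2"
      using L2_translation_modulus[OF f, of "r / 2"] r by auto
    obtain N where N: "inverse (real (Suc N)) < d" using reals_Archimedean[OF d(1)] by auto
    have "(\<integral>x. (mol (\<psi> k) f x - f x)\<^sup>2 \<partial>lborel) \<le> r / 2" if "N \<le> k" for k
    proof (rule mol_L2_estimate(2)[OF f \<psi>])
      show "(\<integral>x. (f (x + z) - f x)\<^sup>2 \<partial>lborel) \<le> r / 2" if "norm z < inverse (real (Suc k))" for z
      proof -
        have "inverse (real (Suc k)) \<le> inverse (real (Suc N))" using \<open>N \<le> k\<close> by (intro le_imp_inverse_le) auto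
        then show ?thesis using d(2)[of z] that N by linarith
      qed
    qed (use r in simp_all)
    then show "\<exists>no. \<forall>k\<ge>no. norm ((\<integral>x. (mol (\<psi> k) f x - f x)\<^sup>2 \<partial>lborel) - 0) < r"
    proof (intro exI allI impI)
      fix k assume "N \<le> k"
      then have "(\<integral>x. (mol (\<psi> k) f x - f x)\<^sup>2 \<partial>lborel) \<le> r / 2"
        by (rule \<open>\<And>k. N \<le> k \<Longrightarrow> (\<integral>x. (mol (\<psi> k) f x - f x)\<^sup>2 \<partial>lborel) \<le> r / 2\<close>)
      moreover have "0 \<le> (\<integral>x. (mol (\<psi> k) f x - f x)\<^sup>2 \<partial>lborel)" by simp
      ultimately show "norm ((\<integral>x. (mol (\<psi> k) f x - f x)\<^sup>2 \<partial>lborel) - 0) < r"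
        using r unfolding real_norm_def by linarith
    qed
  qed
  show ?thesis using \<psi> sq lim by (intro exI[of _ \<psi>]) blast
qed

section \<open>Functions with square integrable weak gradient on the whole space\<close>

text \<open>A function of \<open>H^1\<close> of the whole space together with a chosen Borel
  gradient. Carrying the gradient along gives pointwise formulas for products and truncations and
  avoids the choice hidden in \<open>weak_gradient\<close>.\<close>

definition H1_pair :: "(real^'n::finite \<Rightarrow> real) \<Rightarrow> (real^'n \<Rightarrow> real^'n) \<Rightarrow> bool" where
  "H1_pair f g \<longleftrightarrow> square_integrable lborel f \<and> square_integrable lborel g \<and>
     (\<forall>\<eta> i. test_function UNIV \<eta> \<longrightarrow>
        (\<integral>x. f x * partial_deriv i \<eta> x \<partial>lborel) = - (\<integral>x. g x $ i * \<eta> x \<partial>lborel))"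

lemma H1_pairD:
  assumes "H1_pair f g"
  shows "square_integrable lborel f" "square_integrable lborel g"
    "f \<in> borel_measurable borel" "g \<in> borel_measurable borel"
    "\<And>\<eta> i. test_function UNIV \<eta> \<Longrightarrow>
        (\<integral>x. f x * partial_deriv i \<eta> x \<partial>lborel) = - (\<integral>x. g x $ i * \<eta> x \<partial>lborel)"
  using assms by (auto simp: H1_pair_def square_integrable_def)

lemma H1_pair_integrable:
  assumes "H1_pair f g" "test_function UNIV \<eta>"
  shows "integrable lborel (\<lambda>x. f x * partial_deriv i \<eta> x)" "integrable lborel (\<lambda>x. g x $ i * \<eta> x)"
    "integrable lborel (\<lambda>x. f x * \<eta> x)"
  using H1_pairD[OF assms(1)] test_function_square_integrable[OF assms(2)]
  by (auto intro!: integrable_mult square_integrable_nth)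

lemma H1_pair_add:
  assumes "H1_pair f g" "H1_pair f' g'"
  shows "H1_pair (\<lambda>x. f x + f' x) (\<lambda>x. g x + g' x)"
  unfolding H1_pair_def
  using H1_pairD(1,2)[OF assms(1)] H1_pairD(1,2)[OF assms(2)]
    H1_pair_integrable[OF assms(1)] H1_pair_integrable[OF assms(2)]
    H1_pairD(5)[OF assms(1)] H1_pairD(5)[OF assms(2)]
  by (auto intro!: square_integrable_add simp: distrib_right)

lemma H1_pair_cmult:
  assumes "H1_pair f g"
  shows "H1_pair (\<lambda>x. c * f x) (\<lambda>x. c *\<^sub>R g x)"
  unfolding H1_pair_def
  using H1_pairD[OF assms] 
  by (auto intro!: square_integrable_cmult square_integrable_scaleR simp: mult.assoc)

lemma H1_pair_diff:
  assumes "H1_pair f g" "H1_pair f' g'"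
  shows "H1_pair (\<lambda>x. f x - f' x) (\<lambda>x. g x - g' x)"
  using H1_pair_add[OF assms(1) H1_pair_cmult[OF assms(2), of "-1"]] by simp

subsection \<open>Integration by parts\<close>

text \<open>Translation invariance makes the integral of every difference quotient of
  \<open>F\<close> vanish. The quotients converge to the derivative and, by the mean value theorem,
  are bounded by its maximum on a fixed bounded set, so the limit may be taken under the
  integral.\<close>

lemma integral_directional_derivative_0:
  fixes F :: "real^'n::finite \<Rightarrow> real"
  assumes D: "\<And>x. (F has_derivative F' x) (at x)" and cont: "continuous_on UNIV (\<lambda>x. F' x v)"
    and K: "compact K" "\<And>x. x \<notin> K \<Longrightarrow> F x = 0" "\<And>x. x \<notin> K \<Longrightarrow> F' x v = 0"
  shows "integrable lborel (\<lambda>x. F' x v)" "(\<integral>x. F' x v \<partial>lborel) = 0"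
proof -
  have contF: "continuous_on UNIV F"
    using has_derivative_continuous[OF D] by (simp add: continuous_at_imp_continuous_on)
  have [measurable]: "F \<in> borel_measurable borel" "(\<lambda>x. F' x v) \<in> borel_measurable borel"
    using contF cont by (auto intro: borel_measurable_continuous_onI)
  obtain C where C: "0 < C" "\<And>x. norm (F' x v) \<le> C"
    using compact_support_bounded[OF cont K(1) K(3)] by metis
  obtain C2 where C2: "0 < C2" "\<And>x. norm (F x) \<le> C2"
    using compact_support_bounded[OF contF K(1) K(2)] by metis
  have fin: "integrable lborel (\<lambda>x. c * indicator S x :: real)" if "bounded S" "closed S" for S :: "(real^'n) set" and c
    using emeasure_bounded_finite[OF that(1)] that by (intro integrable_mult_right integrable_real_indicator) auto
  have iF: "integrable lborel F"
    by (rule Bochner_Integration.integrable_bound[OF fin[OF compact_imp_bounded[OF K(1)] compact_imp_closed[OF K(1)], of C2]])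
       (use C2 K in \<open>auto simp: indicator_def\<close>)
  obtain R where R: "0 < R" "K \<subseteq> cball 0 R" using bounded_subset_ballD[OF compact_imp_bounded[OF K(1)], of 0] ball_subset_cball by blast
  \<comment> \<open>The steps \<open>d n\<close> are at most \<open>1\<close>, so every quotient
    vanishes outside this enlargement of the support.\<close>
  let ?S = "cball (0::real^'n) (R + norm v)"
  define d where "d n = inverse (real (Suc n))" for n
  have d: "0 < d n" "d n \<le> 1" for n by (auto simp: d_def field_simps)
  have quot: "\<exists>z. 0 < z \<and> z < d n \<and> F (x + d n *\<^sub>R v) - F x = d n * F' (x + z *\<^sub>R v) v" for n x
  proof -
    have "((\<lambda>t. F (x + t *\<^sub>R v)) has_real_derivative F' (x + t *\<^sub>R v) v) (at t)" for t
    proof -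
      interpret linear "F' (x + t *\<^sub>R v)" by (rule has_derivative_linear[OF D])
      have "((\<lambda>t. F (x + t *\<^sub>R v)) has_derivative (\<lambda>h. F' (x + t *\<^sub>R v) (h *\<^sub>R v))) (at t)"
        by (rule has_derivative_compose[OF _ D]) (auto intro!: derivative_eq_intros)
      moreover have "(\<lambda>h. F' (x + t *\<^sub>R v) (h *\<^sub>R v)) = (*) (F' (x + t *\<^sub>R v) v)"
        by (rule ext) (simp add: scaleR)
      ultimately show ?thesis by (simp only: has_field_derivative_def)
    qed
    from MVT2[OF d(1) this] show ?thesis by auto
  qed
  have bound: "norm ((F (x + d n *\<^sub>R v) - F x) / d n) \<le> C * indicator ?S x" for n x
  proof -
    obtain z where z: "0 < z" "z < d n" "F (x + d n *\<^sub>R v) - F x = d n * F' (x + z *\<^sub>R v) v"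
      using quot by blast
    have eq: "(F (x + d n *\<^sub>R v) - F x) / d n = F' (x + z *\<^sub>R v) v" using z d[of n] by simp
    show ?thesis
    proof (cases "x \<in> ?S")
      case False
      have "norm (z *\<^sub>R v) \<le> norm v" using z d[of n] by (simp add: mult_left_le_one_le)
      moreover have "norm x \<le> norm (x + z *\<^sub>R v) + norm (z *\<^sub>R v)" using norm_triangle_ineq4[of "x + z *\<^sub>R v" "z *\<^sub>R v"] by simp
      ultimately have "\<not> norm (x + z *\<^sub>R v) \<le> R" using False by simp
      then have "x + z *\<^sub>R v \<notin> K" using R by auto
      then show ?thesis using K(3) C by (simp only: eq) (simp add: indicator_def)
    qed (use C in \<open>simp only: eq, simp\<close>)
  qed
  have lim: "(\<lambda>n. (F (x + d n *\<^sub>R v) - F x) / d n) \<longlonglongrightarrow> F' x v" for x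
  proof -
    have "\<exists>z. \<forall>n. 0 < z n \<and> z n < d n \<and> F (x + d n *\<^sub>R v) - F x = d n * F' (x + z n *\<^sub>R v) v"
      using quot[of _ x] by (intro choice) blast
    then obtain z where z: "\<And>n. 0 < z n" "\<And>n. z n < d n" "\<And>n. F (x + d n *\<^sub>R v) - F x = d n * F' (x + z n *\<^sub>R v) v"
      by blast
    have "z \<longlonglongrightarrow> 0"
    proof (rule null_sequence_comparison)
      show "norm (z n) \<le> inverse (real (Suc n))" for n using z(1,2)[of n] by (simp add: d_def)
    qed (rule LIMSEQ_inverse_real_of_nat)
    then have "(\<lambda>n. x + z n *\<^sub>R v) \<longlonglongrightarrow> x + 0 *\<^sub>R v" by (intro tendsto_intros)
    then have "(\<lambda>n. F' (x + z n *\<^sub>R v) v) \<longlonglongrightarrow> F' (x + 0 *\<^sub>R v) v"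
      using cont continuous_on_tendsto_compose[of UNIV "\<lambda>x. F' x v"] by simp
    moreover have "(F (x + d n *\<^sub>R v) - F x) / d n = F' (x + z n *\<^sub>R v) v" for n
      using z(3)[of n] d[of n] by simp
    ultimately show ?thesis by simp
  qed
  have S: "integrable lborel (\<lambda>x. C * indicator ?S x :: real)" by (rule fin) auto
  have i0: "(\<integral>x. (F (x + d n *\<^sub>R v) - F x) / d n \<partial>lborel) = 0" for n
    using iF integral_translate[of F "d n *\<^sub>R v"] integrable_translate[of F "d n *\<^sub>R v"] by simp
  have "(\<lambda>n. \<integral>x. (F (x + d n *\<^sub>R v) - F x) / d n \<partial>lborel) \<longlonglongrightarrow> (\<integral>x. F' x v \<partial>lborel)"
    by (rule integral_dominated_convergence[OF _ _ S]) (use lim bound in \<open>auto simp del: times_divide_eq_right\<close>)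
  then show "(\<integral>x. F' x v \<partial>lborel) = 0" unfolding i0 using LIMSEQ_unique tendsto_const by blast
  show "integrable lborel (\<lambda>x. F' x v)"
    by (rule Bochner_Integration.integrable_bound[OF fin[OF compact_imp_bounded[OF K(1)] compact_imp_closed[OF K(1)], of C]])
       (use C K in \<open>auto simp: indicator_def\<close>)
qed

text \<open>The product of \<open>\<Phi> (f x)\<close> and \<eta> is differentiable with compact
  support, so its partial derivative has integral zero. Only \<Phi> of class \<open>C^1\<close> is
  asked for, because \<Phi> will be a regularized positive part.\<close>

lemma integral_by_parts_compose:
  fixes f :: "real^'n::finite \<Rightarrow> real"
  assumes f: "smooth f" and \<Phi>: "\<And>t. (\<Phi> has_real_derivative \<Phi>' t) (at t)" "continuous_on UNIV \<Phi>'"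
    and \<eta>: "test_function UNIV \<eta>"
  shows "(\<integral>x. \<Phi> (f x) * partial_deriv i \<eta> x \<partial>lborel) = - (\<integral>x. \<Phi>' (f x) * partial_deriv i f x * \<eta> x \<partial>lborel)"
proof -
  note s\<eta> = test_function_smooth[OF \<eta>]
  obtain K where K: "compact K" and \<eta>0: "\<And>x. x \<notin> K \<Longrightarrow> \<eta> x = 0" "\<And>x. x \<notin> K \<Longrightarrow> partial_deriv i \<eta> x = 0"
  proof
    show "compact (closure {x. \<eta> x \<noteq> 0})" using \<eta> by (simp add: test_function_def)
    show "\<eta> x = 0" "partial_deriv i \<eta> x = 0" if "x \<notin> closure {x. \<eta> x \<noteq> 0}" for x
      using eq_0_outside_support[OF that] grad_eq_0_outside[OF that] grad_nth[of \<eta> x i] by auto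
  qed
  define F' where "F' x h = \<Phi> (f x) * (grad \<eta> x \<bullet> h) + \<Phi>' (f x) * (grad f x \<bullet> h) * \<eta> x" for x h
  have D: "((\<lambda>x. \<Phi> (f x) * \<eta> x) has_derivative F' x) (at x)" for x
    unfolding F'_def
  proof (intro has_derivative_mult smooth_has_derivative[OF s\<eta>])
    show "((\<lambda>x. \<Phi> (f x)) has_derivative (\<lambda>h. \<Phi>' (f x) * (grad f x \<bullet> h))) (at x)"
      by (rule has_derivative_compose[OF smooth_has_derivative[OF f], of \<Phi> "(*) (\<Phi>' (f x))"])
         (use \<Phi>(1) in \<open>simp add: has_field_derivative_def\<close>)
  qed
  have F'e: "F' x (axis i 1) = \<Phi> (f x) * partial_deriv i \<eta> x + \<Phi>' (f x) * partial_deriv i f x * \<eta> x" for x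
    by (simp add: F'_def inner_axis)
  have cont: "continuous_on UNIV f" "continuous_on UNIV \<eta>" "continuous_on UNIV (partial_deriv i f)" "continuous_on UNIV (partial_deriv i \<eta>)"
    by (intro smooth_continuous smooth_partial_deriv f s\<eta>)+
  have "continuous_on UNIV \<Phi>" using DERIV_continuous[OF \<Phi>(1)] by (simp add: continuous_at_imp_continuous_on)
  then have cont2: "continuous_on UNIV (\<lambda>x. \<Phi> (f x))" "continuous_on UNIV (\<lambda>x. \<Phi>' (f x))"
    using continuous_on_compose2[OF _ cont(1)] \<Phi>(2) by auto
  have int: "integrable lborel q" if q: "continuous_on UNIV q" "\<And>x. x \<notin> K \<Longrightarrow> q x = 0" for q :: "real^'n \<Rightarrow> real"
  proof -
    obtain C where "0 < C" "\<And>x. norm (q x) \<le> C" using compact_support_bounded[OF q(1) K q(2)] by metis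
    then have "square_integrable lborel q"
      using q K by (intro square_integrable_compact_support[of _ K C] borel_measurable_continuous_onI) auto
    moreover have "square_integrable lborel (indicator K :: _ \<Rightarrow> real)"
      using K by (intro square_integrable_indicator compact_imp_bounded borel_compact) auto
    ultimately have "integrable lborel (\<lambda>x. q x * indicator K x)" by (rule integrable_mult)
    also have "(\<lambda>x. q x * indicator K x) = q"
    proof
      fix x show "q x * indicator K x = q x" using q(2)[of x] by (cases "x \<in> K") auto
    qed
    finally show ?thesis .
  qed
  have i1: "integrable lborel (\<lambda>x. \<Phi> (f x) * partial_deriv i \<eta> x)"
    using \<eta>0 by (intro int continuous_on_mult cont cont2) auto
  have i2: "integrable lborel (\<lambda>x. \<Phi>' (f x) * partial_deriv i f x * \<eta> x)"
    using \<eta>0 by (intro int continuous_on_mult cont cont2) auto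
  have "(\<integral>x. F' x (axis i 1) \<partial>lborel) = 0"
  proof (rule integral_directional_derivative_0(2)[OF D _ K])
    show "continuous_on UNIV (\<lambda>x. F' x (axis i 1))"
      unfolding F'e by (intro continuous_on_mult continuous_on_add cont cont2)
  qed (use \<eta>0 F'e in auto)
  then show ?thesis unfolding F'e using i1 i2 by simp
qed

lemma integral_by_parts:
  assumes "smooth f" "test_function UNIV \<eta>"
  shows "(\<integral>x. f x * partial_deriv i \<eta> x \<partial>lborel) = - (\<integral>x. partial_deriv i f x * \<eta> x \<partial>lborel)"
  using integral_by_parts_compose[OF assms(1), of "\<lambda>t. t" "\<lambda>_. 1" \<eta> i] assms by (simp add: DERIV_ident)

lemma H1_pair_test_function:
  assumes "test_function \<Omega> \<eta>"
  shows "H1_pair \<eta> (grad \<eta>)"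
  unfolding H1_pair_def
  using test_function_square_integrable[OF assms] integral_by_parts[OF test_function_smooth[OF assms]] by auto

text \<open>Turns a weak gradient on \<Omega> into one on the whole space: for a test function
  \<zeta> of the whole space, \<open>\<eta> x * \<zeta> x\<close> is admissible in \<Omega>, and the
  product rule rearranges the identity.\<close>

lemma H1_pair_localize:
  assumes f: "square_integrable lborel f" and g: "square_integrable lborel g"
    and weak: "\<And>\<eta> i. test_function \<Omega> \<eta> \<Longrightarrow>
      (\<integral>x. f x * partial_deriv i \<eta> x \<partial>lborel) = - (\<integral>x. g x $ i * \<eta> x \<partial>lborel)"
    and \<eta>: "test_function \<Omega> \<eta>"
  shows "H1_pair (\<lambda>x. \<eta> x * f x) (\<lambda>x. \<eta> x *\<^sub>R g x + f x *\<^sub>R grad \<eta> x)"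
  unfolding H1_pair_def
proof (intro conjI allI impI)
  have [measurable]: "f \<in> borel_measurable borel" "g \<in> borel_measurable borel"
    using f g by (auto simp: square_integrable_def)
  note [measurable] = test_function_measurable[OF \<eta>]
  obtain C where C: "0 < C" "\<And>x. \<bar>\<eta> x\<bar> \<le> C" "\<And>x. norm (grad \<eta> x) \<le> C"
    using test_function_bounded[OF \<eta>] by metis
  have "square_integrable lborel (\<lambda>x. \<eta> x *\<^sub>R f x)"
    by (rule square_integrable_mult_bounded[OF f _ C(2)]) simp
  then show "square_integrable lborel (\<lambda>x. \<eta> x * f x)" by simp
  show "square_integrable lborel (\<lambda>x. \<eta> x *\<^sub>R g x + f x *\<^sub>R grad \<eta> x)"
  proof (rule square_integrable_add)
    show "square_integrable lborel (\<lambda>x. \<eta> x *\<^sub>R g x)"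
      by (rule square_integrable_mult_bounded[OF g _ C(2)]) simp
    show "square_integrable lborel (\<lambda>x. f x *\<^sub>R grad \<eta> x)"
      by (rule square_integrable_bound[OF f, of _ C])
         (use mult_right_mono[OF C(3), of "\<bar>f x\<bar>" for x] in \<open>auto simp: mult.commute intro!: AE_I2\<close>)
  qed
  fix \<zeta> :: "real^'a \<Rightarrow> real" and i assume \<zeta>: "test_function UNIV \<zeta>"
  have t1: "test_function \<Omega> (\<lambda>x. \<eta> x * \<zeta> x)" by (rule test_function_mult[OF \<eta> test_function_smooth[OF \<zeta>]])
  have t2: "test_function UNIV (\<lambda>x. \<zeta> x * partial_deriv i \<eta> x)"
    by (rule test_function_mult[OF \<zeta> smooth_partial_deriv[OF test_function_smooth[OF \<eta>]]])
  have pd: "partial_deriv i (\<lambda>x. \<eta> x * \<zeta> x) x = \<zeta> x * partial_deriv i \<eta> x + \<eta> x * partial_deriv i \<zeta> x" for x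
    using grad_mult[OF test_function_smooth[OF \<eta>] test_function_smooth[OF \<zeta>], of x] by (simp add: vec_eq_iff)
  have a: "f x * partial_deriv i (\<lambda>x. \<eta> x * \<zeta> x) x - f x * (\<zeta> x * partial_deriv i \<eta> x) = \<eta> x * f x * partial_deriv i \<zeta> x" for x
    unfolding pd by (simp add: algebra_simps)
  have i1: "integrable lborel (\<lambda>x. f x * partial_deriv i (\<lambda>x. \<eta> x * \<zeta> x) x)"
    by (rule integrable_mult[OF f test_function_square_integrable(3)[OF t1]])
  have i2: "integrable lborel (\<lambda>x. f x * (\<zeta> x * partial_deriv i \<eta> x))"
    by (rule integrable_mult[OF f test_function_square_integrable(1)[OF t2]])
  have i3: "integrable lborel (\<lambda>x. g x $ i * (\<eta> x * \<zeta> x))"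
    by (rule integrable_mult[OF square_integrable_nth[OF g] test_function_square_integrable(1)[OF t1]])
  have "(\<integral>x. \<eta> x * f x * partial_deriv i \<zeta> x \<partial>lborel) =
     (\<integral>x. f x * partial_deriv i (\<lambda>x. \<eta> x * \<zeta> x) x \<partial>lborel) - (\<integral>x. f x * (\<zeta> x * partial_deriv i \<eta> x) \<partial>lborel)"
    using i1 i2 by (simp flip: a)
  also have "\<dots> = - ((\<integral>x. g x $ i * (\<eta> x * \<zeta> x) \<partial>lborel) + (\<integral>x. f x * (\<zeta> x * partial_deriv i \<eta> x) \<partial>lborel))"
    using weak[OF t1, of i] by simp
  also have "\<dots> = - (\<integral>x. (\<eta> x *\<^sub>R g x + f x *\<^sub>R grad \<eta> x) $ i * \<zeta> x \<partial>lborel)"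
    using i2 i3 by (subst Bochner_Integration.integral_add[symmetric]) (auto simp: algebra_simps)
  finally show "(\<integral>x. \<eta> x * f x * partial_deriv i \<zeta> x \<partial>lborel) =
    - (\<integral>x. (\<eta> x *\<^sub>R g x + f x *\<^sub>R grad \<eta> x) $ i * \<zeta> x \<partial>lborel)" .
qed

subsection \<open>Approximation by smooth functions\<close>

text \<open>The value of a mollification at \<open>x\<close> is the pairing of \<open>f\<close> with
  a reflected, shifted kernel, which is a test function. So all mollifications of \<open>f\<close>
  vanish, while they converge to \<open>f\<close> in \<open>L^2\<close>.\<close>

lemma fundamental_lemma:
  fixes f :: "real^'n::finite \<Rightarrow> real"
  assumes f: "square_integrable lborel f" and 0: "\<And>\<eta>. test_function UNIV \<eta> \<Longrightarrow> (\<integral>x. f x * \<eta> x \<partial>lborel) = 0"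
  shows "AE x in lborel. f x = 0"
proof -
  obtain \<phi> :: "nat \<Rightarrow> real^'n \<Rightarrow> real" where \<phi>: "\<forall>k. test_function UNIV (\<phi> k)"
    "\<forall>f. square_integrable lborel f \<longrightarrow> (\<lambda>k. \<integral>x. (mol (\<phi> k) f x - f x)\<^sup>2 \<partial>lborel) \<longlonglongrightarrow> 0"
    using mollifier_sequence_exists by blast
  have "mol (\<phi> k) f x = 0" for k x
    using 0[OF test_function_reflect[of "\<phi> k" x]] \<phi>(1) by (simp add: mol_def mult.commute)
  then have eq: "(mol (\<phi> k) f x - f x)\<^sup>2 = (f x)\<^sup>2" for k x by simp
  have "(\<lambda>k. \<integral>x. (mol (\<phi> k) f x - f x)\<^sup>2 \<partial>lborel) \<longlonglongrightarrow> 0" using \<phi>(2) f by blast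
  then have "(\<integral>x. (f x)\<^sup>2 \<partial>lborel) = 0" unfolding eq using LIMSEQ_unique tendsto_const by blast
  moreover have i: "integrable lborel (\<lambda>x. (f x)\<^sup>2)" using square_integrable_integrable[OF f] by simp
  ultimately have "AE x in lborel. (f x)\<^sup>2 = 0"
    using integral_nonneg_eq_0_iff_AE[OF i] by simp
  then show ?thesis by simp
qed

lemma power2_norm_vec: "(norm (v :: real^'n::finite))\<^sup>2 = (\<Sum>i\<in>UNIV. (v $ i)\<^sup>2)"
  unfolding power2_norm_eq_inner inner_vec_def by (simp add: power2_eq_square)

text \<open>Mollification commutes with the weak gradient, because the shifted kernel is a test
  function. The last clause records that supports grow by at most \<open>1/(k + 1)\<close>; it is
  what keeps traces unchanged later.\<close>

lemma H1_pair_smooth_approximation: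
  fixes f :: "real^'n::finite \<Rightarrow> real"
  assumes fg: "H1_pair f g"
  shows "\<exists>v :: nat \<Rightarrow> real^'n \<Rightarrow> real. (\<forall>k. smooth (v k)) \<and>
    (\<forall>k. square_integrable lborel (v k)) \<and> (\<forall>k. square_integrable lborel (grad (v k))) \<and>
    (\<lambda>k. \<integral>x. (v k x - f x)\<^sup>2 \<partial>lborel) \<longlonglongrightarrow> 0 \<and> (\<lambda>k. \<integral>x. (norm (grad (v k) x - g x))\<^sup>2 \<partial>lborel) \<longlonglongrightarrow> 0 \<and>
    (\<forall>k x K. (AE y in lborel. y \<notin> K \<longrightarrow> f y = 0) \<longrightarrow> (\<forall>y\<in>K. inverse (real (Suc k)) \<le> dist x y) \<longrightarrow> v k x = 0)"
proof -
  obtain \<phi> :: "nat \<Rightarrow> real^'n \<Rightarrow> real" where \<phi>: "\<forall>k. test_function UNIV (\<phi> k)"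
    "\<forall>k x. inverse (real (Suc k)) \<le> norm x \<longrightarrow> \<phi> k x = 0"
    "\<forall>f k. square_integrable lborel f \<longrightarrow> square_integrable lborel (mol (\<phi> k) f)"
    "\<forall>f. square_integrable lborel f \<longrightarrow> (\<lambda>k. \<integral>x. (mol (\<phi> k) f x - f x)\<^sup>2 \<partial>lborel) \<longlonglongrightarrow> 0"
    using mollifier_sequence_exists by blast
  have f: "square_integrable lborel f" and g: "square_integrable lborel (\<lambda>x. g x $ i)" for i
    using H1_pairD[OF fg] by (auto intro: square_integrable_nth)
  have gr: "partial_deriv i (mol (\<phi> k) f) x = mol (\<phi> k) (\<lambda>x. g x $ i) x" for i k x
  proof -
    have \<phi>k: "test_function UNIV (\<phi> k)" using \<phi> by blast
    have "partial_deriv i (mol (\<phi> k) f) x = (\<integral>y. partial_deriv i (\<phi> k) (x - y) * f y \<partial>lborel)"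
      unfolding partial_deriv_mol[OF \<phi>k f] mol_def ..
    also have "\<dots> = - (\<integral>y. f y * partial_deriv i (\<lambda>y. \<phi> k (x - y)) y \<partial>lborel)"
      by (simp add: partial_deriv_reflect test_function_smooth[OF \<phi>k] mult.commute)
    also have "\<dots> = mol (\<phi> k) (\<lambda>x. g x $ i) x"
      using H1_pairD(5)[OF fg test_function_reflect[OF \<phi>k]] by (simp add: mol_def mult.commute)
    finally show ?thesis .
  qed
  have sqg: "square_integrable lborel (grad (mol (\<phi> k) f))" for k
  proof (rule square_integrable_vec)
    show "square_integrable lborel (\<lambda>x. grad (mol (\<phi> k) f) x $ i)" for i
      using \<phi>(3) g[of i] by (simp add: gr)
  qed
  show ?thesis
  proof (intro exI[of _ "\<lambda>k. mol (\<phi> k) f"] conjI allI impI)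
    show "smooth (mol (\<phi> k) f)" "square_integrable lborel (mol (\<phi> k) f)" for k
      using \<phi> f smooth_mol by blast+
    show "square_integrable lborel (grad (mol (\<phi> k) f))" for k by (rule sqg)
    show "(\<lambda>k. \<integral>x. (mol (\<phi> k) f x - f x)\<^sup>2 \<partial>lborel) \<longlonglongrightarrow> 0" using \<phi> f by blast
    have "(\<integral>x. (norm (grad (mol (\<phi> k) f) x - g x))\<^sup>2 \<partial>lborel) =
        (\<Sum>i\<in>UNIV. \<integral>x. (mol (\<phi> k) (\<lambda>x. g x $ i) x - g x $ i)\<^sup>2 \<partial>lborel)" for k
      unfolding power2_norm_vec vector_minus_component grad_nth gr
    proof (rule Bochner_Integration.integral_sum)
      show "integrable lborel (\<lambda>x. (mol (\<phi> k) (\<lambda>x. g x $ i) x - g x $ i)\<^sup>2)" for i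
        using square_integrable_integrable[OF square_integrable_diff[OF _ g[of i]]] \<phi>(3) g[of i] by fastforce
    qed
    moreover have "(\<lambda>k. \<Sum>i\<in>UNIV. \<integral>x. (mol (\<phi> k) (\<lambda>x. g x $ i) x - g x $ i)\<^sup>2 \<partial>lborel) \<longlonglongrightarrow> (\<Sum>i\<in>(UNIV::'n set). 0)"
      using \<phi>(4) g by (intro tendsto_sum) blast
    ultimately show "(\<lambda>k. \<integral>x. (norm (grad (mol (\<phi> k) f) x - g x))\<^sup>2 \<partial>lborel) \<longlonglongrightarrow> 0" by simp
    show "mol (\<phi> k) f x = 0" if "AE y in lborel. y \<notin> K \<longrightarrow> f y = 0" "\<forall>y\<in>K. inverse (real (Suc k)) \<le> dist x y" for k x K
      by (rule mol_eq_0[OF _ that(1)]) (use \<phi>(2) that(2) in auto)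
  qed
qed

subsection \<open>Positive part\<close>

lemma L2_convergence_norm_mult:
  fixes f :: "_ \<Rightarrow> 'b::euclidean_space" and g :: "_ \<Rightarrow> 'c::euclidean_space"
  assumes fk: "\<And>k::nat. square_integrable M (fk k)" and f: "square_integrable M f" and g: "square_integrable M g"
    and lim: "(\<lambda>k. \<integral>x. (norm (fk k x - f x))\<^sup>2 \<partial>M) \<longlonglongrightarrow> 0"
  shows "(\<lambda>k. \<integral>x. norm (fk k x - f x) * norm (g x) \<partial>M) \<longlonglongrightarrow> 0"
proof (rule null_sequence_comparison)
  show "norm (\<integral>x. norm (fk k x - f x) * norm (g x) \<partial>M) \<le>
      sqrt ((\<integral>x. (norm (fk k x - f x))\<^sup>2 \<partial>M) * (\<integral>x. (norm (g x))\<^sup>2 \<partial>M))" for k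
    using real_le_rsqrt[OF Cauchy_Schwarz_integral[OF square_integrable_diff[OF fk f] g]] by simp
  show "(\<lambda>k. sqrt ((\<integral>x. (norm (fk k x - f x))\<^sup>2 \<partial>M) * (\<integral>x. (norm (g x))\<^sup>2 \<partial>M))) \<longlonglongrightarrow> 0"
    using tendsto_real_sqrt[OF tendsto_mult_right[OF lim, of "\<integral>x. (norm (g x))\<^sup>2 \<partial>M"]] by simp
qed

text \<open>For \<open>t > 0\<close> this is \<open>t - t / (1 + c t)\<close>, a \<open>C^1\<close>
  approximation of the positive part from below, with error at most \<open>1/c\<close> and
  derivative \<open>soft_step c\<close>.\<close>

definition soft_pos :: "real \<Rightarrow> real \<Rightarrow> real" where
  "soft_pos c t = c * (max 0 t)\<^sup>2 / (1 + c * max 0 t)"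

definition soft_step :: "real \<Rightarrow> real \<Rightarrow> real" where
  "soft_step c t = 1 - 1 / (1 + c * max 0 t)\<^sup>2"

context
  fixes c :: real
  assumes c: "0 < c"
begin

lemma soft_denom: "1 \<le> 1 + c * max 0 t"
  using c by simp

lemma DERIV_soft_pos: "(soft_pos c has_real_derivative soft_step c t) (at t)"
proof (cases t "0::real" rule: linorder_cases)
  case greater
  have "1 + c * t \<noteq> 0" using greater c by (metis add_pos_pos less_numeral_extra(1) mult_pos_pos less_irrefl)
  then have "((\<lambda>t. c * t\<^sup>2 / (1 + c * t)) has_real_derivative soft_step c t) (at t)"
    using greater
    by (auto intro!: derivative_eq_intros simp: soft_step_def divide_simps power2_eq_square) (simp add: algebra_simps)
  moreover have "\<forall>\<^sub>F s in nhds t. soft_pos c s = c * s\<^sup>2 / (1 + c * s)"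
    using greater eventually_nhds_in_open[of "{0<..}" t]
    by (auto simp: soft_pos_def elim!: eventually_mono)
  ultimately show ?thesis by (simp add: DERIV_cong_ev)
next
  case less
  have "\<forall>\<^sub>F s in nhds t. s \<in> {..<0}" using less by (intro eventually_nhds_in_open) auto
  then have "\<forall>\<^sub>F s in nhds t. soft_pos c s = 0"
    by (rule eventually_mono) (simp add: soft_pos_def)
  then show ?thesis using less by (simp add: DERIV_cong_ev soft_step_def)
next
  case equal
  have "(\<lambda>h. soft_pos c h / h) \<midarrow>0\<rightarrow> 0"
  proof (rule Lim_null_comparison)
    have "\<bar>soft_pos c h / h\<bar> \<le> c * \<bar>h\<bar>" for h
    proof -
      have "\<bar>soft_pos c h\<bar> = c * (max 0 h)\<^sup>2 / (1 + c * max 0 h)" using c by (simp add: soft_pos_def)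
      also have "\<dots> \<le> c * (max 0 h)\<^sup>2 / 1" 
      proof (rule divide_left_mono[OF soft_denom])
        show "0 < (1 + c * max 0 h) * 1" using soft_denom[of h] by (simp only: mult_1_right)
      qed (use c in simp)
      also have "\<dots> \<le> c * h\<^sup>2" using c by (simp add: max_def)
      finally have "\<bar>soft_pos c h\<bar> \<le> c * \<bar>h\<bar> * \<bar>h\<bar>" by (simp add: power2_eq_square mult.assoc)
      then show ?thesis using c by (cases "h = 0") (simp_all add: abs_divide divide_le_eq)
    qed
    then show "\<forall>\<^sub>F h in at 0. norm (soft_pos c h / h) \<le> c * \<bar>h\<bar>" by (intro always_eventually) simp
    show "((\<lambda>h. c * \<bar>h\<bar>) \<longlongrightarrow> 0) (at 0)" by (intro tendsto_eq_intros) auto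
  qed
  then show ?thesis using equal by (simp add: DERIV_def soft_pos_def soft_step_def)
qed

lemma continuous_soft_step: "continuous_on UNIV (soft_step c)"
proof -
  have "1 + c * max 0 t \<noteq> 0" for t using soft_denom[of t] by linarith
  then show ?thesis unfolding soft_step_def[abs_def] by (intro continuous_intros) auto
qed

lemma soft_step_bounds: "0 \<le> soft_step c t" "soft_step c t \<le> 1"
  using one_le_power[OF soft_denom[of t], of 2] by (auto simp: soft_step_def divide_simps)

lemma soft_pos_lipschitz: "\<bar>soft_pos c a - soft_pos c b\<bar> \<le> \<bar>a - b\<bar>"
proof -
  have *: "\<bar>soft_pos c a - soft_pos c b\<bar> \<le> \<bar>a - b\<bar>" if "a < b" for a b
  proof -
    obtain z where "soft_pos c b - soft_pos c a = (b - a) * soft_step c z"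
      using MVT2[of a b "soft_pos c" "soft_step c"] \<open>a < b\<close> DERIV_soft_pos by blast
    then have "\<bar>soft_pos c b - soft_pos c a\<bar> = \<bar>b - a\<bar> * \<bar>soft_step c z\<bar>" by (simp add: abs_mult)
    also have "\<dots> \<le> \<bar>b - a\<bar> * 1" using soft_step_bounds[of z] by (intro mult_left_mono) auto
    finally show ?thesis by (simp add: abs_minus_commute)
  qed
  show ?thesis using *[of a b] *[of b a] by (cases a b rule: linorder_cases) (auto simp: abs_minus_commute)
qed

text \<open>With \<open>X\<close> and \<open>Y\<close> the two denominators, the difference is
  \<open>(X - Y) (X + Y) / (X Y)^2\<close>, and \<open>X + Y \<le> 1 + X Y\<close> as both are at
  least \<open>1\<close>. The bound lets the derivative pass to the limit when its argument
  converges only in \<open>L^2\<close>.\<close>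

lemma soft_step_lipschitz: "\<bar>soft_step c a - soft_step c b\<bar> \<le> 2 * c * \<bar>a - b\<bar>"
proof -
  define X where "X = 1 + c * max 0 a"
  define Y where "Y = 1 + c * max 0 b"
  have XY: "1 \<le> X" "1 \<le> Y" unfolding X_def Y_def by (rule soft_denom)+
  then have p: "1 \<le> X * Y" using mult_mono[of 1 X 1 Y] by simp
  have "soft_step c a - soft_step c b = (X - Y) * ((X + Y) / (X * Y)\<^sup>2)"
    using XY by (simp add: soft_step_def X_def[symmetric] Y_def[symmetric] divide_simps power2_eq_square algebra_simps)
  moreover have "\<bar>(X + Y) / (X * Y)\<^sup>2\<bar> \<le> 2"
  proof -
    have "(X - 1) * (Y - 1) \<ge> 0" using XY by simp
    then have "X + Y \<le> 1 + X * Y" by (simp add: algebra_simps)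
    also have "\<dots> \<le> 2 * (X * Y)\<^sup>2" using p self_le_power[OF p, of 2] one_le_power[OF p, of 2] by simp
    finally show ?thesis using XY p by (simp add: divide_le_eq abs_of_nonneg)
  qed
  ultimately have "\<bar>soft_step c a - soft_step c b\<bar> \<le> \<bar>X - Y\<bar> * 2"
    by (simp only: abs_mult mult_left_mono abs_ge_zero)
  also have "\<bar>X - Y\<bar> = c * \<bar>max 0 a - max 0 b\<bar>"
    using c by (simp add: X_def Y_def abs_mult right_diff_distrib[symmetric])
  also have "\<dots> * 2 \<le> 2 * c * \<bar>a - b\<bar>"
  proof -
    have "\<bar>max 0 a - max 0 b\<bar> \<le> \<bar>a - b\<bar>" by (auto simp: max_def)
    then show ?thesis using c by (simp add: mult_left_mono)
  qed
  finally show ?thesis .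
qed

lemma soft_pos_0 [simp]: "soft_pos c 0 = 0"
  by (simp add: soft_pos_def)

lemma soft_pos_abs_le: "\<bar>soft_pos c t\<bar> \<le> \<bar>t\<bar>"
  using soft_pos_lipschitz[of t 0] by simp

lemma soft_pos_approx: "\<bar>soft_pos c t - max 0 t\<bar> \<le> 1 / c"
proof -
  define X where "X = 1 + c * max 0 t"
  have X: "1 \<le> X" unfolding X_def by (rule soft_denom)
  have "soft_pos c t - max 0 t = - max 0 t / X"
    using X by (simp add: soft_pos_def X_def[symmetric] divide_simps) (simp add: X_def power2_eq_square algebra_simps)
  moreover have "max 0 t / X \<le> 1 / c"
    using X c by (simp add: divide_simps) (simp add: X_def algebra_simps)
  ultimately show ?thesis using X by simp
qed

lemma soft_step_approx: "\<bar>soft_step c t - (if 0 < t then 1 else 0)\<bar> \<le> (if 0 < t then 1 / (c * t) else 0)"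
proof (cases "0 < t")
  case True
  then have ct: "0 < c * t" using c by simp
  have "1 / (1 + c * t)\<^sup>2 \<le> 1 / (c * t)"
  proof (rule divide_left_mono)
    have "c * t \<le> 1 + c * t" by simp
    also have "\<dots> \<le> (1 + c * t)\<^sup>2" using ct by (intro self_le_power) auto
    finally show "c * t \<le> (1 + c * t)\<^sup>2" .
  qed (use ct in auto)
  then show ?thesis using True by (simp add: soft_step_def)
qed (simp add: soft_step_def)

end

text \<open>The chain rule holds for smooth approximations \<open>v k\<close>. On the gradient side
  the error splits into \<open>soft_step\<close> times the gradient error, controlled since
  \<open>soft_step\<close> is at most \<open>1\<close>, and the change of \<open>soft_step\<close>
  times \<open>g\<close>, controlled by its Lipschitz constant and Cauchy-Schwarz.\<close>

lemma H1_pair_soft_pos: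
  fixes f :: "real^'n::finite \<Rightarrow> real"
  assumes fg: "H1_pair f g" and \<eta>: "test_function UNIV \<eta>" and c: "0 < c"
  shows "(\<integral>x. soft_pos c (f x) * partial_deriv i \<eta> x \<partial>lborel) = - (\<integral>x. soft_step c (f x) * g x $ i * \<eta> x \<partial>lborel)"
proof -
  obtain v :: "nat \<Rightarrow> real^'n \<Rightarrow> real" where v: "\<And>k. smooth (v k)"
    "\<And>k. square_integrable lborel (v k)" "\<And>k. square_integrable lborel (grad (v k))"
    "(\<lambda>k. \<integral>x. (v k x - f x)\<^sup>2 \<partial>lborel) \<longlonglongrightarrow> 0" "(\<lambda>k. \<integral>x. (norm (grad (v k) x - g x))\<^sup>2 \<partial>lborel) \<longlonglongrightarrow> 0"
    using H1_pair_smooth_approximation[OF fg] by blast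
  note [measurable] = test_function_measurable[OF \<eta>] H1_pairD(3,4)[OF fg]
    v(2,3)[THEN square_integrable_measurable, simplified]
  have [measurable]: "soft_pos c \<in> borel_measurable borel" "soft_step c \<in> borel_measurable borel"
    unfolding soft_pos_def[abs_def] soft_step_def[abs_def] by measurable
  have [measurable]: "(\<lambda>x. g x $ i) \<in> borel_measurable borel" "(\<lambda>x. partial_deriv i (v k) x) \<in> borel_measurable borel" for k
    using measurable_compose[OF H1_pairD(4)[OF fg], of "\<lambda>z. z $ i" borel]
      smooth_continuous[OF smooth_partial_deriv[OF v(1)]] by (auto intro: borel_measurable_continuous_onI)
  obtain C where C: "0 < C" "\<And>x. \<bar>\<eta> x\<bar> \<le> C" "\<And>x. norm (grad \<eta> x) \<le> C"
    using test_function_bounded[OF \<eta>] by metis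
  note sq\<eta> = test_function_square_integrable[OF \<eta>]
  have gi: "square_integrable lborel (\<lambda>x. g x $ i)" "square_integrable lborel (\<lambda>x. partial_deriv i (v k) x)" for k
    using square_integrable_nth[OF H1_pairD(2)[OF fg]] square_integrable_nth[OF v(3), of k i] by auto
  have sp: "square_integrable lborel (\<lambda>x. soft_pos c (q x))" if "square_integrable lborel q" for q :: "real^'n \<Rightarrow> real"
    by (rule square_integrable_bound[OF that, of _ 1])
       (use soft_pos_abs_le[OF c] square_integrable_measurable[OF that] in auto)
  have ss: "square_integrable lborel (\<lambda>x. soft_step c (q x) * q' x)"
    if "square_integrable lborel q'" "q \<in> borel_measurable borel" for q q' :: "real^'n \<Rightarrow> real"
  proof -
    have "\<bar>soft_step c t\<bar> \<le> 1" for t using soft_step_bounds[OF c, of t] by simp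
    then have "square_integrable lborel (\<lambda>x. soft_step c (q x) *\<^sub>R q' x)"
      using that by (intro square_integrable_mult_bounded[of _ _ _ 1]) auto
    then show ?thesis by simp
  qed
  have iL: "integrable lborel (\<lambda>x. soft_pos c (v k x) * partial_deriv i \<eta> x)"
    "integrable lborel (\<lambda>x. soft_pos c (f x) * partial_deriv i \<eta> x)" for k
    by (intro integrable_mult sp v H1_pairD(1)[OF fg] sq\<eta>)+
  have iR: "integrable lborel (\<lambda>x. soft_step c (v k x) * partial_deriv i (v k) x * \<eta> x)"
    "integrable lborel (\<lambda>x. soft_step c (f x) * g x $ i * \<eta> x)" for k
    by (intro integrable_mult ss gi sq\<eta>; measurable)+
  have vn: "(\<lambda>k. \<integral>x. (norm (v k x - f x))\<^sup>2 \<partial>lborel) \<longlonglongrightarrow> 0" using v(4) by simp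
  have "(\<lambda>k. (\<integral>x. soft_pos c (v k x) * partial_deriv i \<eta> x \<partial>lborel) - (\<integral>x. soft_pos c (f x) * partial_deriv i \<eta> x \<partial>lborel)) \<longlonglongrightarrow> 0"
  proof (rule null_sequence_comparison[OF _ L2_convergence_norm_mult[OF v(2) H1_pairD(1)[OF fg] sq\<eta>(3)[of i] vn]])
    fix k
    have "norm ((\<integral>x. soft_pos c (v k x) * partial_deriv i \<eta> x \<partial>lborel) - (\<integral>x. soft_pos c (f x) * partial_deriv i \<eta> x \<partial>lborel))
      = norm (\<integral>x. (soft_pos c (v k x) * partial_deriv i \<eta> x - soft_pos c (f x) * partial_deriv i \<eta> x) \<partial>lborel)"
      using iL by simp
    also have "\<dots> \<le> (\<integral>x. norm (v k x - f x) * norm (partial_deriv i \<eta> x) \<partial>lborel)"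
    proof (rule order_trans[OF integral_norm_bound], rule integral_mono)
      show "integrable lborel (\<lambda>x. norm (v k x - f x) * norm (partial_deriv i \<eta> x))"
        by (intro integrable_norm_mult square_integrable_diff v H1_pairD(1)[OF fg] sq\<eta>)
      show "norm (soft_pos c (v k x) * partial_deriv i \<eta> x - soft_pos c (f x) * partial_deriv i \<eta> x)
          \<le> norm (v k x - f x) * norm (partial_deriv i \<eta> x)" for x
        using soft_pos_lipschitz[OF c, of "v k x" "f x"]
        by (simp add: left_diff_distrib[symmetric] abs_mult mult_right_mono)
    qed (use iL in auto)
    finally show "norm ((\<integral>x. soft_pos c (v k x) * partial_deriv i \<eta> x \<partial>lborel) - (\<integral>x. soft_pos c (f x) * partial_deriv i \<eta> x \<partial>lborel))
      \<le> (\<integral>x. norm (v k x - f x) * norm (partial_deriv i \<eta> x) \<partial>lborel)" .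
  qed
  then have L: "(\<lambda>k. \<integral>x. soft_pos c (v k x) * partial_deriv i \<eta> x \<partial>lborel) \<longlonglongrightarrow> (\<integral>x. soft_pos c (f x) * partial_deriv i \<eta> x \<partial>lborel)"
    by (rule LIM_zero_cancel)
  have "(\<lambda>k. (\<integral>x. norm (grad (v k) x - g x) * norm (\<eta> x) \<partial>lborel) +
      2 * c * C * (\<integral>x. norm (v k x - f x) * norm (g x $ i) \<partial>lborel)) \<longlonglongrightarrow> 0 + 2 * c * C * 0"
    by (intro tendsto_add tendsto_mult tendsto_const L2_convergence_norm_mult v H1_pairD[OF fg] sq\<eta> gi vn)
  then have lim0: "(\<lambda>k. (\<integral>x. norm (grad (v k) x - g x) * norm (\<eta> x) \<partial>lborel) +
      2 * c * C * (\<integral>x. norm (v k x - f x) * norm (g x $ i) \<partial>lborel)) \<longlonglongrightarrow> 0" by simp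
  have "(\<lambda>k. (\<integral>x. soft_step c (v k x) * partial_deriv i (v k) x * \<eta> x \<partial>lborel) - (\<integral>x. soft_step c (f x) * g x $ i * \<eta> x \<partial>lborel)) \<longlonglongrightarrow> 0"
  proof (rule null_sequence_comparison[OF _ lim0])
    fix k
    have i1: "integrable lborel (\<lambda>x. norm (grad (v k) x - g x) * norm (\<eta> x))"
      by (intro integrable_norm_mult square_integrable_diff v H1_pairD[OF fg] sq\<eta>)
    have i2: "integrable lborel (\<lambda>x. norm (v k x - f x) * norm (g x $ i))"
      by (intro integrable_norm_mult square_integrable_diff v H1_pairD[OF fg] gi)
    have "norm ((\<integral>x. soft_step c (v k x) * partial_deriv i (v k) x * \<eta> x \<partial>lborel) - (\<integral>x. soft_step c (f x) * g x $ i * \<eta> x \<partial>lborel))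
      = norm (\<integral>x. (soft_step c (v k x) * partial_deriv i (v k) x * \<eta> x - soft_step c (f x) * g x $ i * \<eta> x) \<partial>lborel)"
      using iR by simp
    also have "\<dots> \<le> (\<integral>x. norm (grad (v k) x - g x) * norm (\<eta> x) + 2 * c * C * (norm (v k x - f x) * norm (g x $ i)) \<partial>lborel)"
    proof (rule order_trans[OF integral_norm_bound], rule integral_mono)
      fix x
      have e: "soft_step c (v k x) * partial_deriv i (v k) x * \<eta> x - soft_step c (f x) * g x $ i * \<eta> x =
         soft_step c (v k x) * (partial_deriv i (v k) x - g x $ i) * \<eta> x + (soft_step c (v k x) - soft_step c (f x)) * g x $ i * \<eta> x"
        by (simp add: algebra_simps)
      have "\<bar>partial_deriv i (v k) x - g x $ i\<bar> \<le> norm (grad (v k) x - g x)"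
        using component_le_norm_cart[of "grad (v k) x - g x" i] by simp
      moreover have "\<bar>soft_step c (v k x)\<bar> \<le> 1" using soft_step_bounds[OF c, of "v k x"] by simp
      ultimately have "\<bar>soft_step c (v k x)\<bar> * \<bar>partial_deriv i (v k) x - g x $ i\<bar> \<le> 1 * norm (grad (v k) x - g x)"
        by (intro mult_mono) auto
      then have a: "\<bar>soft_step c (v k x) * (partial_deriv i (v k) x - g x $ i) * \<eta> x\<bar> \<le> norm (grad (v k) x - g x) * norm (\<eta> x)"
        by (simp add: abs_mult mult_right_mono)
      have "\<bar>soft_step c (v k x) - soft_step c (f x)\<bar> * \<bar>g x $ i\<bar> * \<bar>\<eta> x\<bar> \<le> (2 * c * \<bar>v k x - f x\<bar>) * \<bar>g x $ i\<bar> * C"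
        using soft_step_lipschitz[OF c, of "v k x" "f x"] C c by (intro mult_mono) auto
      then have b: "\<bar>(soft_step c (v k x) - soft_step c (f x)) * g x $ i * \<eta> x\<bar> \<le> 2 * c * C * (norm (v k x - f x) * norm (g x $ i))"
        by (simp add: abs_mult mult_ac)
      show "norm (soft_step c (v k x) * partial_deriv i (v k) x * \<eta> x - soft_step c (f x) * g x $ i * \<eta> x)
        \<le> norm (grad (v k) x - g x) * norm (\<eta> x) + 2 * c * C * (norm (v k x - f x) * norm (g x $ i))"
        unfolding e real_norm_def[of "_ + _"] using a b by linarith
    qed (use iR i1 i2 in auto)
    also have "\<dots> = (\<integral>x. norm (grad (v k) x - g x) * norm (\<eta> x) \<partial>lborel) + 2 * c * C * (\<integral>x. norm (v k x - f x) * norm (g x $ i) \<partial>lborel)"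
      using i1 i2 by simp
    finally show "norm ((\<integral>x. soft_step c (v k x) * partial_deriv i (v k) x * \<eta> x \<partial>lborel) - (\<integral>x. soft_step c (f x) * g x $ i * \<eta> x \<partial>lborel))
      \<le> (\<integral>x. norm (grad (v k) x - g x) * norm (\<eta> x) \<partial>lborel) + 2 * c * C * (\<integral>x. norm (v k x - f x) * norm (g x $ i) \<partial>lborel)" .
  qed
  then have R: "(\<lambda>k. - (\<integral>x. soft_step c (v k x) * partial_deriv i (v k) x * \<eta> x \<partial>lborel)) \<longlonglongrightarrow> - (\<integral>x. soft_step c (f x) * g x $ i * \<eta> x \<partial>lborel)"
    by (rule tendsto_minus[OF LIM_zero_cancel])
  have "(\<integral>x. soft_pos c (v k x) * partial_deriv i \<eta> x \<partial>lborel) = - (\<integral>x. soft_step c (v k x) * partial_deriv i (v k) x * \<eta> x \<partial>lborel)" for k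
    by (rule integral_by_parts_compose[OF v(1) DERIV_soft_pos[OF c] continuous_soft_step[OF c] \<eta>])
  with L R show ?thesis using LIMSEQ_unique by simp
qed

text \<open>The limit of the regularized chain rule for large \<open>c\<close>. Since
  \<open>soft_step c 0 = 0\<close> for every \<open>c\<close>, the limiting gradient vanishes on
  \<open>{f = 0}\<close>, which fixes the strict inequality in the truncated gradient.\<close>

lemma H1_pair_pos:
  fixes f :: "real^'n::finite \<Rightarrow> real"
  assumes fg: "H1_pair f g"
  shows "H1_pair (\<lambda>x. max 0 (f x)) (\<lambda>x. (if 0 < f x then g x else 0))"
  unfolding H1_pair_def
proof (intro conjI allI impI)
  note [measurable] = H1_pairD(3,4)[OF fg]
  show "square_integrable lborel (\<lambda>x. max 0 (f x))"
    by (rule square_integrable_bound[OF H1_pairD(1)[OF fg], of _ 1]) auto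
  show "square_integrable lborel (\<lambda>x. if 0 < f x then g x else 0)"
    by (rule square_integrable_bound[OF H1_pairD(2)[OF fg], of _ 1]) auto
  fix \<eta> :: "real^'n \<Rightarrow> real" and i assume \<eta>: "test_function UNIV \<eta>"
  note [measurable] = test_function_measurable[OF \<eta>]
  have [measurable]: "(\<lambda>x. g x $ i) \<in> borel_measurable borel"
    using measurable_compose[OF H1_pairD(4)[OF fg], of "\<lambda>z. z $ i" borel] by auto
  define c where "c m = real (Suc m)" for m
  have c: "0 < c m" "1 / c m = inverse (real (Suc m))" for m by (simp_all add: c_def inverse_eq_divide)
  have [measurable]: "soft_pos d \<in> borel_measurable borel" "soft_step d \<in> borel_measurable borel" for d
    unfolding soft_pos_def[abs_def] soft_step_def[abs_def] by measurable
  note int = H1_pair_integrable[OF fg \<eta>]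
  have "(\<lambda>m. \<integral>x. soft_pos (c m) (f x) * partial_deriv i \<eta> x \<partial>lborel) \<longlonglongrightarrow> (\<integral>x. max 0 (f x) * partial_deriv i \<eta> x \<partial>lborel)"
  proof (rule integral_dominated_convergence[where w="\<lambda>x. \<bar>f x * partial_deriv i \<eta> x\<bar>"])
    show "AE x in lborel. (\<lambda>m. soft_pos (c m) (f x) * partial_deriv i \<eta> x) \<longlonglongrightarrow> max 0 (f x) * partial_deriv i \<eta> x"
    proof (intro AE_I2 tendsto_mult tendsto_const LIM_zero_cancel[of _ "max 0 _"])
      show "(\<lambda>m. soft_pos (c m) (f x) - max 0 (f x)) \<longlonglongrightarrow> 0" for x
        by (rule null_sequence_comparison[OF _ LIMSEQ_inverse_real_of_nat])
           (use soft_pos_approx[OF c(1)] c(2) in auto)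
    qed
    show "AE x in lborel. norm (soft_pos (c m) (f x) * partial_deriv i \<eta> x) \<le> \<bar>f x * partial_deriv i \<eta> x\<bar>" for m
      using soft_pos_abs_le[OF c(1)] by (auto simp: abs_mult mult_right_mono)
  qed (use int in \<open>auto intro!: integrable_abs\<close>)
  moreover have "(\<lambda>m. - (\<integral>x. soft_step (c m) (f x) * g x $ i * \<eta> x \<partial>lborel)) \<longlonglongrightarrow> - (\<integral>x. (if 0 < f x then 1 else 0) * g x $ i * \<eta> x \<partial>lborel)"
  proof (rule tendsto_minus, rule integral_dominated_convergence[where w="\<lambda>x. \<bar>g x $ i * \<eta> x\<bar>"])
    have st: "(\<lambda>m. soft_step (c m) t) \<longlonglongrightarrow> (if 0 < t then 1 else 0)" for t
    proof (rule LIM_zero_cancel, rule null_sequence_comparison)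
      show "norm (soft_step (c m) t - (if 0 < t then 1 else 0)) \<le> inverse (real (Suc m)) * (if 0 < t then 1 / t else 0)" for m
      proof -
        have "inverse (real (Suc m)) * (1 / t) = 1 / (c m * t)" by (simp add: c_def inverse_eq_divide)
        then show ?thesis using soft_step_approx[OF c(1)[of m], of t] by (cases "0 < t") auto
      qed
      show "(\<lambda>m. inverse (real (Suc m)) * (if 0 < t then 1 / t else 0)) \<longlonglongrightarrow> 0"
        by (rule tendsto_mult_left_zero[OF LIMSEQ_inverse_real_of_nat])
    qed
    show "AE x in lborel. (\<lambda>m. soft_step (c m) (f x) * g x $ i * \<eta> x) \<longlonglongrightarrow> (if 0 < f x then 1 else 0) * g x $ i * \<eta> x"
      by (intro AE_I2 tendsto_mult st tendsto_const)
    show "AE x in lborel. norm (soft_step (c m) (f x) * g x $ i * \<eta> x) \<le> \<bar>g x $ i * \<eta> x\<bar>" for m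
    proof (rule AE_I2)
      fix x
      have "\<bar>soft_step (c m) (f x)\<bar> \<le> 1" using soft_step_bounds[OF c(1)[of m], of "f x"] by simp
      then show "norm (soft_step (c m) (f x) * g x $ i * \<eta> x) \<le> \<bar>g x $ i * \<eta> x\<bar>"
        by (auto simp: abs_mult mult.assoc intro!: mult_left_le_one_le)
    qed
  qed (use int in \<open>auto intro!: integrable_abs\<close>)
  moreover have "(\<integral>x. soft_pos (c m) (f x) * partial_deriv i \<eta> x \<partial>lborel) = - (\<integral>x. soft_step (c m) (f x) * g x $ i * \<eta> x \<partial>lborel)" for m
    by (rule H1_pair_soft_pos[OF fg \<eta> c(1)])
  ultimately have "(\<integral>x. max 0 (f x) * partial_deriv i \<eta> x \<partial>lborel) = - (\<integral>x. (if 0 < f x then 1 else 0) * g x $ i * \<eta> x \<partial>lborel)"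
    using LIMSEQ_unique by simp
  also have "(\<lambda>x. (if 0 < f x then 1 else 0) * g x $ i * \<eta> x) = (\<lambda>x. (if 0 < f x then g x else 0) $ i * \<eta> x)"
    by auto
  finally show "(\<integral>x. max 0 (f x) * partial_deriv i \<eta> x \<partial>lborel) = - (\<integral>x. (if 0 < f x then g x else 0) $ i * \<eta> x \<partial>lborel)" .
qed

section \<open>Translation inequalities\<close>

text \<open>The fundamental theorem of calculus on the segment from \<open>x\<close> to
  \<open>x + h\<close>; the squared version adds Cauchy-Schwarz against the indicator of the unit
  interval. The nonnegative integral on the right is ready for Tonelli's theorem.\<close>

lemma smooth_increment:
  fixes v :: "real^'n::finite \<Rightarrow> real"
  assumes v: "smooth v"
  shows "ennreal \<bar>v (x + h) - v x\<bar> \<le> (\<integral>\<^sup>+t. ennreal (norm h * norm (grad v (x + t *\<^sub>R h))) * indicator {0..1} t \<partial>lborel)"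
    and "ennreal ((v (x + h) - v x)\<^sup>2) \<le> (\<integral>\<^sup>+t. ennreal ((norm h)\<^sup>2 * (norm (grad v (x + t *\<^sub>R h)))\<^sup>2) * indicator {0..1} t \<partial>lborel)"
proof -
  define \<phi> where "\<phi> t = grad v (x + t *\<^sub>R h) \<bullet> h" for t
  have cont: "continuous_on UNIV \<phi>" unfolding \<phi>_def
    by (intro continuous_on_inner continuous_on_compose2[OF smooth_continuous_grad[OF v]] continuous_intros) auto
  have [measurable]: "\<phi> \<in> borel_measurable borel" using cont by (rule borel_measurable_continuous_onI)
  have D: "((\<lambda>t. v (x + t *\<^sub>R h)) has_real_derivative \<phi> t) (at t)" for t
  proof -
    have "((\<lambda>t. v (x + t *\<^sub>R h)) has_derivative (\<lambda>s. grad v (x + t *\<^sub>R h) \<bullet> (s *\<^sub>R h))) (at t)"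
      by (rule has_derivative_compose[of "\<lambda>t. x + t *\<^sub>R h" "\<lambda>s. s *\<^sub>R h" t UNIV v "(\<bullet>) (grad v (x + t *\<^sub>R h))"])
         (auto intro!: derivative_eq_intros smooth_has_derivative[OF v])
    moreover have "(\<lambda>s. grad v (x + t *\<^sub>R h) \<bullet> (s *\<^sub>R h)) = (*) (\<phi> t)" by (auto simp: \<phi>_def)
    ultimately show ?thesis by (simp only: has_field_derivative_def)
  qed
  have ic: "isCont \<phi> t" for t using cont by (simp add: continuous_on_eq_continuous_at)
  have "has_bochner_integral lborel (\<lambda>t. \<phi> t * indicator {0..1} t) (v (x + 1 *\<^sub>R h) - v (x + 0 *\<^sub>R h))"
    by (rule has_bochner_integral_FTC_Icc_real[OF _ D ic]) simp
  then have int: "integrable lborel (\<lambda>t. \<phi> t * indicator {0..1} t)"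
    and val: "(\<integral>t. \<phi> t * indicator {0..1} t \<partial>lborel) = v (x + h) - v x"
    by (simp_all add: has_bochner_integral_iff)
  have cs: "\<bar>\<phi> t\<bar> \<le> norm h * norm (grad v (x + t *\<^sub>R h))" for t
    unfolding \<phi>_def using Cauchy_Schwarz_ineq2[of "grad v (x + t *\<^sub>R h)" h] by (simp add: mult.commute)
  have "ennreal \<bar>v (x + h) - v x\<bar> \<le> ennreal (\<integral>t. \<bar>\<phi> t * indicator {0..1} t\<bar> \<partial>lborel)"
    unfolding val[symmetric] by (intro ennreal_leI integral_abs_bound)
  also have "\<dots> = (\<integral>\<^sup>+t. ennreal \<bar>\<phi> t * indicator {0..1} t\<bar> \<partial>lborel)"
    using int by (intro nn_integral_eq_integral[symmetric]) auto
  also have "\<dots> \<le> (\<integral>\<^sup>+t. ennreal (norm h * norm (grad v (x + t *\<^sub>R h))) * indicator {0..1} t \<partial>lborel)"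
    using cs by (intro nn_integral_mono) (auto simp: indicator_def intro!: ennreal_leI)
  finally show "ennreal \<bar>v (x + h) - v x\<bar> \<le> (\<integral>\<^sup>+t. ennreal (norm h * norm (grad v (x + t *\<^sub>R h))) * indicator {0..1} t \<partial>lborel)" .
  have "bounded (\<phi> ` {0..1})"
    by (intro compact_imp_bounded compact_continuous_image continuous_on_subset[OF cont]) auto
  then obtain B where "\<forall>y\<in>\<phi> ` {0..1}. norm y \<le> B" unfolding bounded_iff by blast
  then have B: "\<And>t. t \<in> {0..1} \<Longrightarrow> \<bar>\<phi> t\<bar> \<le> B" by auto
  have B0: "0 \<le> B" using B[of 0] by force
  have sqI: "square_integrable lborel (indicator {0..1} :: real \<Rightarrow> real)"
  proof -
    have "(\<lambda>x. (norm (indicator {0..1} x :: real))\<^sup>2) = (indicator {0..1} :: real \<Rightarrow> real)" by (auto simp: indicator_def)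
    then show ?thesis by (simp add: square_integrable_def)
  qed
  have sqF: "square_integrable lborel (\<lambda>t. \<phi> t * indicator {0..1} t)"
    by (rule square_integrable_bound[OF sqI, of _ B]) (use B B0 in \<open>auto simp: indicator_def\<close>)
  have nn: "(\<integral>t. norm (\<phi> t * indicator {0..1} t) * norm (indicator {0..1} t :: real) \<partial>lborel) = (\<integral>t. \<bar>\<phi> t * indicator {0..1} t\<bar> \<partial>lborel)"
    by (intro Bochner_Integration.integral_cong) (auto simp: indicator_def)
  have one: "(\<integral>t. (norm (indicator {0..1::real} t :: real))\<^sup>2 \<partial>lborel) = 1"
  proof -
    have "(\<lambda>t. (norm (indicator {0..1} t :: real))\<^sup>2) = (indicator {0..1} :: real \<Rightarrow> real)" by (auto simp: indicator_def)
    then show ?thesis by simp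
  qed
  have "(v (x + h) - v x)\<^sup>2 = \<bar>\<integral>t. \<phi> t * indicator {0..1} t \<partial>lborel\<bar>\<^sup>2" using val by simp
  also have "\<dots> \<le> (\<integral>t. \<bar>\<phi> t * indicator {0..1} t\<bar> \<partial>lborel)\<^sup>2"
    by (intro power_mono integral_abs_bound) auto
  also have "\<dots> \<le> (\<integral>t. (norm (\<phi> t * indicator {0..1} t))\<^sup>2 \<partial>lborel)"
    using Cauchy_Schwarz_integral[OF sqF sqI] unfolding nn one by simp
  finally have "ennreal ((v (x + h) - v x)\<^sup>2) \<le> ennreal (\<integral>t. (norm (\<phi> t * indicator {0..1} t))\<^sup>2 \<partial>lborel)"
    by (rule ennreal_leI)
  also have "\<dots> = (\<integral>\<^sup>+t. ennreal ((norm (\<phi> t * indicator {0..1} t))\<^sup>2) \<partial>lborel)"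
    by (intro nn_integral_eq_integral[symmetric] square_integrable_integrable[OF sqF]) auto
  also have "\<dots> \<le> (\<integral>\<^sup>+t. ennreal ((norm h)\<^sup>2 * (norm (grad v (x + t *\<^sub>R h)))\<^sup>2) * indicator {0..1} t \<partial>lborel)"
  proof (intro nn_integral_mono)
    fix t
    have "(\<phi> t)\<^sup>2 \<le> (norm h * norm (grad v (x + t *\<^sub>R h)))\<^sup>2"
      using cs[of t] by (metis abs_ge_zero power2_abs power_mono)
    then show "ennreal ((norm (\<phi> t * indicator {0..1} t))\<^sup>2) \<le> ennreal ((norm h)\<^sup>2 * (norm (grad v (x + t *\<^sub>R h)))\<^sup>2) * indicator {0..1} t"
      by (auto simp: indicator_def power_mult_distrib intro!: ennreal_leI)
  qed
  finally show "ennreal ((v (x + h) - v x)\<^sup>2) \<le> (\<integral>\<^sup>+t. ennreal ((norm h)\<^sup>2 * (norm (grad v (x + t *\<^sub>R h)))\<^sup>2) * indicator {0..1} t \<partial>lborel)" .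
qed

text \<open>After exchanging the integrals, each \<open>t\<close> contributes the integral of
  \<open>A\<close> over a translate of \<open>S\<close>, which lies in \<open>S'\<close>; the
  parameters \<open>t\<close> have total length \<open>1\<close>.\<close>

lemma nn_integral_segments_le:
  fixes A :: "real^'n::finite \<Rightarrow> ennreal"
  assumes [measurable]: "A \<in> borel_measurable borel" "S \<in> sets borel" "S' \<in> sets borel"
    and seg: "\<And>x t. x \<in> S \<Longrightarrow> t \<in> {0..1} \<Longrightarrow> x + t *\<^sub>R h \<in> S'"
  shows "(\<integral>\<^sup>+x. indicator S x * (\<integral>\<^sup>+t. A (x + t *\<^sub>R h) * indicator {0..1::real} t \<partial>lborel) \<partial>lborel) \<le>
    (\<integral>\<^sup>+x. indicator S' x * A x \<partial>lborel)" (is "?L \<le> ?R")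
proof -
  have "?L = (\<integral>\<^sup>+x. (\<integral>\<^sup>+t. indicator S x * (A (x + t *\<^sub>R h) * indicator {0..1} t) \<partial>lborel) \<partial>lborel)"
    by (intro nn_integral_cong nn_integral_cmult[symmetric]) measurable
  also have "\<dots> = (\<integral>\<^sup>+t. (\<integral>\<^sup>+x. indicator S x * (A (x + t *\<^sub>R h) * indicator {0..1} t) \<partial>lborel) \<partial>lborel)"
    by (rule lborel_pair.Fubini'[symmetric]) measurable
  also have "\<dots> \<le> (\<integral>\<^sup>+t. indicator {0..1::real} t * ?R \<partial>lborel)"
  proof (rule nn_integral_mono)
    fix t :: real
    show "(\<integral>\<^sup>+x. indicator S x * (A (x + t *\<^sub>R h) * indicator {0..1} t) \<partial>lborel) \<le> indicator {0..1} t * ?R"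
    proof (cases "t \<in> {0..1}")
      case True
      have "(\<integral>\<^sup>+x. indicator S x * (A (x + t *\<^sub>R h) * indicator {0..1} t) \<partial>lborel) \<le>
          (\<integral>\<^sup>+x. indicator S' (x + t *\<^sub>R h) * A (x + t *\<^sub>R h) \<partial>lborel)"
        using True seg[OF _ True] by (intro nn_integral_mono) (auto simp: indicator_def)
      also have "\<dots> = ?R" by (rule nn_integral_translate[of "\<lambda>x. indicator S' x * A x"]) measurable
      finally show ?thesis using True by simp
    qed simp
  qed
  also have "\<dots> = ?R" by (simp add: nn_integral_multc)
  finally show ?thesis .
qed

lemma L2_convergence_norm_square:
  fixes f :: "_ \<Rightarrow> 'b::euclidean_space"
  assumes fk: "\<And>k::nat. square_integrable M (fk k)" and f: "square_integrable M f"
    and lim: "(\<lambda>k. \<integral>x. (norm (fk k x - f x))\<^sup>2 \<partial>M) \<longlonglongrightarrow> 0"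
  shows "(\<lambda>k. \<integral>x. (norm (fk k x))\<^sup>2 \<partial>M) \<longlonglongrightarrow> (\<integral>x. (norm (f x))\<^sup>2 \<partial>M)"
proof -
  have e: "(norm (fk k x))\<^sup>2 = (norm (fk k x - f x))\<^sup>2 + 2 * (fk k x \<bullet> f x) - f x \<bullet> f x" for k x
    by (simp add: power2_norm_eq_inner inner_diff inner_commute)
  have "(\<integral>x. (norm (fk k x))\<^sup>2 \<partial>M) = (\<integral>x. (norm (fk k x - f x))\<^sup>2 \<partial>M) + 2 * (\<integral>x. fk k x \<bullet> f x \<partial>M) - (\<integral>x. f x \<bullet> f x \<partial>M)" for k
    unfolding e using square_integrable_integrable[OF square_integrable_diff[OF fk f]]
      integrable_inner[OF fk f] integrable_inner[OF f f] by simp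
  moreover have "(\<lambda>k. (\<integral>x. (norm (fk k x - f x))\<^sup>2 \<partial>M) + 2 * (\<integral>x. fk k x \<bullet> f x \<partial>M) - (\<integral>x. f x \<bullet> f x \<partial>M)) \<longlonglongrightarrow>
      0 + 2 * (\<integral>x. f x \<bullet> f x \<partial>M) - (\<integral>x. f x \<bullet> f x \<partial>M)"
    by (intro tendsto_intros lim L2_convergence_inner[OF fk f f lim])
  ultimately show ?thesis by (simp add: power2_norm_eq_inner)
qed

lemma L2_convergence_increment:
  fixes f :: "real^'n::finite \<Rightarrow> real"
  assumes v: "\<And>k::nat. square_integrable lborel (v k)" and f: "square_integrable lborel f"
    and lim: "(\<lambda>k. \<integral>x. (v k x - f x)\<^sup>2 \<partial>lborel) \<longlonglongrightarrow> 0"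
  shows "(\<lambda>k. \<integral>x. (norm (v k (x + h) - v k x - (f (x + h) - f x)))\<^sup>2 \<partial>lborel) \<longlonglongrightarrow> 0"
proof (rule null_sequence_comparison)
  show "(\<lambda>k. 4 * (\<integral>x. (v k x - f x)\<^sup>2 \<partial>lborel)) \<longlonglongrightarrow> 0" using tendsto_mult_right_zero[OF lim] by simp
  fix k
  note [measurable] = v[THEN square_integrable_measurable, simplified] square_integrable_measurable[OF f, simplified]
  have q: "square_integrable lborel (\<lambda>x. v k x - f x)" by (intro square_integrable_diff v f)
  have iq: "integrable lborel (\<lambda>x. (v k x - f x)\<^sup>2)" "integrable lborel (\<lambda>x. (v k (x + h) - f (x + h))\<^sup>2)"
    using square_integrable_integrable[OF q] square_integrable_integrable[OF square_integrable_translate[OF q, of h]] by auto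
  have "(\<integral>x. (norm (v k (x + h) - v k x - (f (x + h) - f x)))\<^sup>2 \<partial>lborel) \<le>
     (\<integral>x. 2 * (v k (x + h) - f (x + h))\<^sup>2 + 2 * (v k x - f x)\<^sup>2 \<partial>lborel)"
  proof (rule integral_mono)
    show "integrable lborel (\<lambda>x. (norm (v k (x + h) - v k x - (f (x + h) - f x)))\<^sup>2)"
      by (intro square_integrable_integrable square_integrable_diff[OF square_integrable_diff[OF square_integrable_translate[OF v] v] square_integrable_diff[OF square_integrable_translate[OF f] f]])
    show "(norm (v k (x + h) - v k x - (f (x + h) - f x)))\<^sup>2 \<le> 2 * (v k (x + h) - f (x + h))\<^sup>2 + 2 * (v k x - f x)\<^sup>2" for x
      using power2_norm_add_le[of "v k (x + h) - f (x + h)" "- (v k x - f x)"] by (simp add: algebra_simps power2_commute[of "f x"])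
  qed (use iq in simp)
  also have "\<dots> = 2 * (\<integral>x. (v k (x + h) - f (x + h))\<^sup>2 \<partial>lborel) + 2 * (\<integral>x. (v k x - f x)\<^sup>2 \<partial>lborel)"
    using iq by simp
  also have "(\<integral>x. (v k (x + h) - f (x + h))\<^sup>2 \<partial>lborel) = (\<integral>x. (v k x - f x)\<^sup>2 \<partial>lborel)"
    by (rule integral_translate[of "\<lambda>x. (v k x - f x)\<^sup>2"]) measurable
  finally show "norm (\<integral>x. (norm (v k (x + h) - v k x - (f (x + h) - f x)))\<^sup>2 \<partial>lborel) \<le> 4 * (\<integral>x. (v k x - f x)\<^sup>2 \<partial>lborel)"
    by simp
qed

text \<open>Averaging the gradient along segments proves this for smooth functions; both sides are
  continuous under the \<open>L^2\<close> convergence of the mollifications and of their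
  gradients.\<close>

lemma translation_L2:
  fixes f :: "real^'n::finite \<Rightarrow> real"
  assumes fg: "H1_pair f g"
  shows "(\<integral>x. (f (x + h) - f x)\<^sup>2 \<partial>lborel) \<le> (norm h)\<^sup>2 * (\<integral>x. (norm (g x))\<^sup>2 \<partial>lborel)"
proof -
  obtain v :: "nat \<Rightarrow> real^'n \<Rightarrow> real" where v: "\<And>k. smooth (v k)"
    "\<And>k. square_integrable lborel (v k)" "\<And>k. square_integrable lborel (grad (v k))"
    "(\<lambda>k. \<integral>x. (v k x - f x)\<^sup>2 \<partial>lborel) \<longlonglongrightarrow> 0" "(\<lambda>k. \<integral>x. (norm (grad (v k) x - g x))\<^sup>2 \<partial>lborel) \<longlonglongrightarrow> 0"
    using H1_pair_smooth_approximation[OF fg] by blast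
  note f = H1_pairD(1)[OF fg]
  note [measurable] = v(2,3)[THEN square_integrable_measurable, simplified] H1_pairD(3,4)[OF fg]
  note d = square_integrable_diff[OF square_integrable_translate]
  have step: "(\<integral>x. (v k (x + h) - v k x)\<^sup>2 \<partial>lborel) \<le> (norm h)\<^sup>2 * (\<integral>x. (norm (grad (v k) x))\<^sup>2 \<partial>lborel)" for k
  proof -
    have i1: "integrable lborel (\<lambda>x. (v k (x + h) - v k x)\<^sup>2)"
      using square_integrable_integrable[OF d[OF v(2) v(2), of k h k]] by simp
    have i2: "integrable lborel (\<lambda>x. (norm h)\<^sup>2 * (norm (grad (v k) x))\<^sup>2)"
      using square_integrable_integrable[OF v(3)[of k]] by simp
    have "ennreal (\<integral>x. (v k (x + h) - v k x)\<^sup>2 \<partial>lborel) = (\<integral>\<^sup>+x. indicator UNIV x * ennreal ((v k (x + h) - v k x)\<^sup>2) \<partial>lborel)"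
      using nn_integral_eq_integral[OF i1] by simp
    also have "\<dots> \<le> (\<integral>\<^sup>+x. indicator UNIV x * (\<integral>\<^sup>+t. ennreal ((norm h)\<^sup>2 * (norm (grad (v k) (x + t *\<^sub>R h)))\<^sup>2) * indicator {0..1} t \<partial>lborel) \<partial>lborel)"
      by (intro nn_integral_mono mult_left_mono smooth_increment(2)[OF v(1)]) auto
    also have "\<dots> \<le> (\<integral>\<^sup>+x. indicator UNIV x * ennreal ((norm h)\<^sup>2 * (norm (grad (v k) x))\<^sup>2) \<partial>lborel)"
      by (rule nn_integral_segments_le) auto
    also have "\<dots> = ennreal ((norm h)\<^sup>2 * (\<integral>x. (norm (grad (v k) x))\<^sup>2 \<partial>lborel))"
      using nn_integral_eq_integral[OF i2] by simp
    finally show ?thesis by (simp add: ennreal_le_iff)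
  qed
  have "(\<lambda>k. \<integral>x. (norm (v k (x + h) - v k x))\<^sup>2 \<partial>lborel) \<longlonglongrightarrow> (\<integral>x. (norm (f (x + h) - f x))\<^sup>2 \<partial>lborel)"
    by (rule L2_convergence_norm_square[OF d[OF v(2) v(2)] d[OF f f] L2_convergence_increment[OF v(2) f v(4)]])
  moreover have "(\<lambda>k. (norm h)\<^sup>2 * (\<integral>x. (norm (grad (v k) x))\<^sup>2 \<partial>lborel)) \<longlonglongrightarrow> (norm h)\<^sup>2 * (\<integral>x. (norm (g x))\<^sup>2 \<partial>lborel)"
    by (intro tendsto_mult tendsto_const L2_convergence_norm_square v H1_pairD(2)[OF fg])
  ultimately have "(\<integral>x. (norm (f (x + h) - f x))\<^sup>2 \<partial>lborel) \<le> (norm h)\<^sup>2 * (\<integral>x. (norm (g x))\<^sup>2 \<partial>lborel)"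
    by (rule LIMSEQ_le) (use step in auto)
  then show ?thesis by simp
qed

text \<open>The localized form is needed because the slab argument sees the gradient only on a ball,
  where a truncated function is known explicitly.\<close>

lemma translation_L1_local:
  fixes f :: "real^'n::finite \<Rightarrow> real"
  assumes fg: "H1_pair f g" and S: "S \<in> sets borel" "bounded S" "S' \<in> sets borel" "bounded S'"
    and seg: "\<And>x t. x \<in> S \<Longrightarrow> t \<in> {0..1} \<Longrightarrow> x + t *\<^sub>R h \<in> S'"
  shows "(\<integral>x. indicator S x * \<bar>f (x + h) - f x\<bar> \<partial>lborel) \<le> norm h * (\<integral>x. indicator S' x * norm (g x) \<partial>lborel)"
proof -
  obtain v :: "nat \<Rightarrow> real^'n \<Rightarrow> real" where v: "\<And>k. smooth (v k)"
    "\<And>k. square_integrable lborel (v k)" "\<And>k. square_integrable lborel (grad (v k))"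
    "(\<lambda>k. \<integral>x. (v k x - f x)\<^sup>2 \<partial>lborel) \<longlonglongrightarrow> 0" "(\<lambda>k. \<integral>x. (norm (grad (v k) x - g x))\<^sup>2 \<partial>lborel) \<longlonglongrightarrow> 0"
    using H1_pair_smooth_approximation[OF fg] by blast
  note f = H1_pairD(1)[OF fg] and g = H1_pairD(2)[OF fg]
  note [measurable] = v(2,3)[THEN square_integrable_measurable, simplified] H1_pairD(3,4)[OF fg] S(1,3)
  have iS: "square_integrable lborel (indicator S :: _ \<Rightarrow> real)" "square_integrable lborel (indicator S' :: _ \<Rightarrow> real)"
    using S by (auto intro: square_integrable_indicator)
  have int: "integrable lborel (\<lambda>x. indicator T x * norm (q x))"
    if "square_integrable lborel (indicator T :: _ \<Rightarrow> real)" "square_integrable lborel q" for T and q :: "real^'n \<Rightarrow> 'c::euclidean_space"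
    using integrable_norm_mult[OF that] by simp
  note dt = square_integrable_diff[OF square_integrable_translate]
  have step: "(\<integral>x. indicator S x * \<bar>v k (x + h) - v k x\<bar> \<partial>lborel) \<le> norm h * (\<integral>x. indicator S' x * norm (grad (v k) x) \<partial>lborel)" for k
  proof -
    have i1: "integrable lborel (\<lambda>x. indicator S x * \<bar>v k (x + h) - v k x\<bar>)"
      using int[OF iS(1) dt[OF v(2) v(2), of k h k]] by simp
    have i2: "integrable lborel (\<lambda>x. norm h * (indicator S' x * norm (grad (v k) x)))"
      using int[OF iS(2) v(3)[of k]] by simp
    have "ennreal (\<integral>x. indicator S x * \<bar>v k (x + h) - v k x\<bar> \<partial>lborel) = (\<integral>\<^sup>+x. ennreal (indicator S x * \<bar>v k (x + h) - v k x\<bar>) \<partial>lborel)"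
      using nn_integral_eq_integral[OF i1] by simp
    also have "\<dots> = (\<integral>\<^sup>+x. indicator S x * ennreal \<bar>v k (x + h) - v k x\<bar> \<partial>lborel)"
      by (intro nn_integral_cong) (auto simp: indicator_def)
    also have "\<dots> \<le> (\<integral>\<^sup>+x. indicator S x * (\<integral>\<^sup>+t. ennreal (norm h * norm (grad (v k) (x + t *\<^sub>R h))) * indicator {0..1} t \<partial>lborel) \<partial>lborel)"
      by (intro nn_integral_mono mult_left_mono smooth_increment(1)[OF v(1)]) auto
    also have "\<dots> \<le> (\<integral>\<^sup>+x. indicator S' x * ennreal (norm h * norm (grad (v k) x)) \<partial>lborel)"
      by (rule nn_integral_segments_le) (use seg in auto)
    also have "\<dots> = (\<integral>\<^sup>+x. ennreal (norm h * (indicator S' x * norm (grad (v k) x))) \<partial>lborel)"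
      by (intro nn_integral_cong) (auto simp: indicator_def)
    also have "\<dots> = ennreal (norm h * (\<integral>x. indicator S' x * norm (grad (v k) x) \<partial>lborel))"
      using nn_integral_eq_integral[OF i2] by simp
    finally show ?thesis by (simp add: ennreal_le_iff)
  qed
  have conv: "(\<lambda>k. \<integral>x. indicator T x * norm (q k x) \<partial>lborel) \<longlonglongrightarrow> (\<integral>x. indicator T x * norm (q' x) \<partial>lborel)"
    if T: "square_integrable lborel (indicator T :: _ \<Rightarrow> real)" and q: "\<And>k::nat. square_integrable lborel (q k)" "square_integrable lborel q'"
      "(\<lambda>k. \<integral>x. (norm (q k x - q' x))\<^sup>2 \<partial>lborel) \<longlonglongrightarrow> 0" for T q and q' :: "real^'n \<Rightarrow> 'c::euclidean_space"
  proof (rule LIM_zero_cancel, rule null_sequence_comparison[OF _ L2_convergence_norm_mult[OF q(1,2) T q(3)]])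
    fix k
    have id: "integrable lborel (\<lambda>x. norm (q k x - q' x) * norm (indicator T x :: real))"
      by (intro integrable_norm_mult square_integrable_diff q T)
    have "norm ((\<integral>x. indicator T x * norm (q k x) \<partial>lborel) - (\<integral>x. indicator T x * norm (q' x) \<partial>lborel)) =
        norm (\<integral>x. (indicator T x * norm (q k x) - indicator T x * norm (q' x)) \<partial>lborel)"
      using int[OF T q(1)] int[OF T q(2)] by simp
    also have "\<dots> \<le> (\<integral>x. norm (q k x - q' x) * norm (indicator T x :: real) \<partial>lborel)"
    proof (rule order_trans[OF integral_norm_bound], rule integral_mono)
      show "norm (indicator T x * norm (q k x) - indicator T x * norm (q' x)) \<le> norm (q k x - q' x) * norm (indicator T x :: real)" for x
        using norm_triangle_ineq3[of "q k x" "q' x"] by (auto simp: indicator_def)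
    qed (use int[OF T q(1)] int[OF T q(2)] id in auto)
    finally show "norm ((\<integral>x. indicator T x * norm (q k x) \<partial>lborel) - (\<integral>x. indicator T x * norm (q' x) \<partial>lborel)) \<le>
       (\<integral>x. norm (q k x - q' x) * norm (indicator T x :: real) \<partial>lborel)" .
  qed
  have "(\<lambda>k. \<integral>x. indicator S x * norm (v k (x + h) - v k x) \<partial>lborel) \<longlonglongrightarrow> (\<integral>x. indicator S x * norm (f (x + h) - f x) \<partial>lborel)"
    by (rule conv[OF iS(1) dt[OF v(2) v(2)] dt[OF f f] L2_convergence_increment[OF v(2) f v(4)]])
  moreover have "(\<lambda>k. norm h * (\<integral>x. indicator S' x * norm (grad (v k) x) \<partial>lborel)) \<longlonglongrightarrow> norm h * (\<integral>x. indicator S' x * norm (g x) \<partial>lborel)"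
    by (intro tendsto_mult tendsto_const conv[OF iS(2) v(3) g v(5)])
  ultimately have "(\<integral>x. indicator S x * norm (f (x + h) - f x) \<partial>lborel) \<le> norm h * (\<integral>x. indicator S' x * norm (g x) \<partial>lborel)"
    by (rule LIMSEQ_le) (use step in auto)
  then show ?thesis by simp
qed

text \<open>For fixed \<open>x\<close>, the vectors \<open>h\<close> for which \<open>x + h\<close>
  lies in the support of \<open>f\<close> fill a set of the measure of the support, so at least half
  of the ball moves \<open>x\<close> out of it. There \<open>(f (x + h) - f x)^2\<close> equals
  \<open>(f x)^2\<close>. The double integral is therefore at least \<open>b / 2\<close> times the
  integral of \<open>f^2\<close>, and at most \<open>b R^2\<close> times that of the squared
  gradient.\<close>

lemma Faber_Krahn:
  fixes f :: "real^'n::finite \<Rightarrow> real"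
  assumes fg: "H1_pair f g" and R: "0 < R"
    and small: "2 * emeasure lborel {x. f x \<noteq> 0} \<le> emeasure lborel (ball (0::real^'n) R)"
  shows "(\<integral>x. (f x)\<^sup>2 \<partial>lborel) \<le> 2 * R\<^sup>2 * (\<integral>x. (norm (g x))\<^sup>2 \<partial>lborel)"
proof -
  note [measurable] = H1_pairD(3,4)[OF fg]
  let ?B = "ball (0::real^'n) R"
  have [measurable]: "?B \<in> sets borel" by simp
  define E where "E = {x. f x \<noteq> 0}"
  have [measurable]: "E \<in> sets borel" unfolding E_def by measurable
  define b where "b = measure lborel ?B"
  have eB: "emeasure lborel ?B = ennreal b"
    unfolding b_def by (rule emeasure_eq_ennreal_measure) (use emeasure_bounded_finite[of ?B] in auto)
  have b: "0 < b" unfolding b_def using R unit_ball_vol_pos[of "real CARD('n)"] by (simp add: content_ball)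
  define m where "m = measure lborel E"
  have "emeasure lborel E \<noteq> \<infinity>"
  proof
    assume "emeasure lborel E = \<infinity>"
    with small eB show False by (simp add: E_def ennreal_mult_top top_unique)
  qed
  then have eE: "emeasure lborel E = ennreal m" unfolding m_def by (intro emeasure_eq_ennreal_measure) auto
  have mb: "2 * m \<le> b"
  proof -
    have "ennreal (2 * m) \<le> ennreal b"
      using small unfolding E_def[symmetric] eE eB by (simp add: ennreal_mult m_def)
    then show ?thesis using b by (simp add: ennreal_le_iff)
  qed
  define F where "F = (\<integral>x. (f x)\<^sup>2 \<partial>lborel)"
  define G where "G = (\<integral>x. (norm (g x))\<^sup>2 \<partial>lborel)"
  have iF: "integrable lborel (\<lambda>x. (f x)\<^sup>2)" using square_integrable_integrable[OF H1_pairD(1)[OF fg]] by simp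
  have nF: "(\<integral>\<^sup>+x. ennreal ((f x)\<^sup>2) \<partial>lborel) = ennreal F" unfolding F_def by (rule nn_integral_eq_integral[OF iF]) simp
  have G0: "0 \<le> G" "0 \<le> F" unfolding G_def F_def by simp_all
  let ?I = "\<integral>\<^sup>+x. (\<integral>\<^sup>+h. indicator ?B h * ennreal ((f (x + h) - f x)\<^sup>2) \<partial>lborel) \<partial>lborel"
  have low: "ennreal (b / 2) * ennreal F \<le> ?I"
  proof -
    have "ennreal ((f x)\<^sup>2) * ennreal (b / 2) \<le> (\<integral>\<^sup>+h. indicator ?B h * ennreal ((f (x + h) - f x)\<^sup>2) \<partial>lborel)" for x
    proof -
      have tr: "emeasure lborel {h. h + x \<in> E} = ennreal m"
      proof -
        have m: "{h. h + x \<in> E} \<in> sets lborel" by measurable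
        have "emeasure lborel {h. h + x \<in> E} = (\<integral>\<^sup>+h. indicator {h. h + x \<in> E} h \<partial>lborel)"
          by (rule nn_integral_indicator[OF m, symmetric])
        also have "\<dots> = (\<integral>\<^sup>+h. indicator E (h + x) \<partial>lborel)"
          by (intro nn_integral_cong) (auto simp: indicator_def)
        also have "\<dots> = (\<integral>\<^sup>+h. indicator E h \<partial>lborel)" by (rule nn_integral_translate) measurable
        finally show ?thesis using eE by simp
      qed
      have "emeasure lborel ?B \<le> emeasure lborel (?B - {h. h + x \<in> E}) + emeasure lborel {h. h + x \<in> E}"
        by (rule order_trans[OF emeasure_mono emeasure_subadditive]) auto
      then have "ennreal b - ennreal m \<le> emeasure lborel (?B - {h. h + x \<in> E})"
        unfolding eB tr by (simp add: ennreal_minus_le_iff add.commute)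
      moreover have "ennreal (b / 2) \<le> ennreal b - ennreal m"
        using mb b by (subst ennreal_minus) (auto simp: m_def intro!: ennreal_leI)
      ultimately have half: "ennreal (b / 2) \<le> emeasure lborel (?B - {h. h + x \<in> E})" by (rule order_trans[rotated])
      have "ennreal ((f x)\<^sup>2) * ennreal (b / 2) \<le> ennreal ((f x)\<^sup>2) * emeasure lborel (?B - {h. h + x \<in> E})"
        by (intro mult_left_mono half) simp
      also have "\<dots> = (\<integral>\<^sup>+h. ennreal ((f x)\<^sup>2) * indicator (?B - {h. h + x \<in> E}) h \<partial>lborel)"
        by (subst nn_integral_cmult_indicator) auto
      also have "\<dots> \<le> (\<integral>\<^sup>+h. indicator ?B h * ennreal ((f (x + h) - f x)\<^sup>2) \<partial>lborel)"
        by (intro nn_integral_mono) (auto simp: indicator_def E_def add.commute)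
      finally show ?thesis .
    qed
    then have "(\<integral>\<^sup>+x. ennreal ((f x)\<^sup>2) * ennreal (b / 2) \<partial>lborel) \<le> ?I" by (rule nn_integral_mono)
    moreover have "(\<integral>\<^sup>+x. ennreal ((f x)\<^sup>2) * ennreal (b / 2) \<partial>lborel) = ennreal (b / 2) * ennreal F"
      by (subst nn_integral_multc) (simp_all add: nF mult.commute)
    ultimately show ?thesis by simp
  qed
  have "?I = (\<integral>\<^sup>+h. (\<integral>\<^sup>+x. indicator ?B h * ennreal ((f (x + h) - f x)\<^sup>2) \<partial>lborel) \<partial>lborel)"
    by (rule lborel_pair.Fubini'[symmetric]) measurable
  also have "\<dots> \<le> (\<integral>\<^sup>+h. ennreal (R\<^sup>2 * G) * indicator ?B h \<partial>lborel)"
  proof (rule nn_integral_mono)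
    fix h :: "real^'n"
    show "(\<integral>\<^sup>+x. indicator ?B h * ennreal ((f (x + h) - f x)\<^sup>2) \<partial>lborel) \<le> ennreal (R\<^sup>2 * G) * indicator ?B h"
    proof (cases "h \<in> ?B")
      case True
      have i: "integrable lborel (\<lambda>x. (f (x + h) - f x)\<^sup>2)"
        using square_integrable_integrable[OF square_integrable_diff[OF square_integrable_translate[OF H1_pairD(1)[OF fg]] H1_pairD(1)[OF fg]]] by simp
      have "(\<integral>x. (f (x + h) - f x)\<^sup>2 \<partial>lborel) \<le> (norm h)\<^sup>2 * G" unfolding G_def by (rule translation_L2[OF fg])
      also have "\<dots> \<le> R\<^sup>2 * G" using True G0 by (intro mult_right_mono power_mono) auto
      finally show ?thesis using True nn_integral_eq_integral[OF i] by (simp add: ennreal_leI)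
    qed simp
  qed
  also have "\<dots> = ennreal (R\<^sup>2 * G) * ennreal b" by (subst nn_integral_cmult_indicator) (auto simp: eB)
  finally have "ennreal (b / 2) * ennreal F \<le> ennreal (R\<^sup>2 * G) * ennreal b" using low by (rule order_trans[rotated])
  moreover have "ennreal (b / 2 * F) = ennreal (b / 2) * ennreal F" using G0 b by (intro ennreal_mult) auto
  moreover have "ennreal (R\<^sup>2 * G * b) = ennreal (R\<^sup>2 * G) * ennreal b" using G0 b by (intro ennreal_mult) auto
  ultimately have "ennreal (b / 2 * F) \<le> ennreal (R\<^sup>2 * G * b)" by (simp only:)
  then have "b / 2 * F \<le> R\<^sup>2 * G * b" using G0 b by (simp add: ennreal_le_iff)
  then show ?thesis using b unfolding F_def[symmetric] G_def[symmetric] by (simp add: field_simps)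
qed

text \<open>A substitute for the isoperimetric inequality in De Giorgi's argument. Each pair in
  \<open>Y\<close> times \<open>Z\<close> is written as \<open>x\<close>, \<open>x + h\<close>; the
  increment of \<open>f\<close> along it is at least \<kappa> in size,
  \<open>|h| < 2 \<rho>\<close>, and the segment stays in the ball of radius
  \<open>3 \<rho>\<close>. Integrating the \<open>L^1\<close> translation estimate over all such
  \<open>h\<close> gives the right-hand side.\<close>

lemma slab_inequality:
  fixes f :: "real^'n::finite \<Rightarrow> real"
  assumes fg: "H1_pair f g" and \<rho>: "0 < \<rho>" and \<kappa>: "0 \<le> \<kappa>"
    and Z: "Z \<in> sets borel" "Z \<subseteq> ball c \<rho>" "\<And>x. x \<in> Z \<Longrightarrow> f x = 0"
    and Y: "Y \<in> sets borel" "Y \<subseteq> ball c \<rho>" "\<And>x. x \<in> Y \<Longrightarrow> \<kappa> \<le> f x"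
  shows "\<kappa> * measure lborel Y * measure lborel Z \<le>
    2 * \<rho> * measure lborel (ball (0::real^'n) (2 * \<rho>)) * (\<integral>x. indicator (ball c (3 * \<rho>)) x * norm (g x) \<partial>lborel)"
proof -
  note [measurable] = H1_pairD(3,4)[OF fg] Z(1) Y(1)
  have fin: "emeasure lborel T = ennreal (measure lborel T)" if "T \<subseteq> ball q s" for T and q :: "real^'n" and s
    using that bounded_subset[OF bounded_ball that] emeasure_bounded_finite[of T]
    by (intro emeasure_eq_ennreal_measure) auto
  define G where "G = (\<integral>x. indicator (ball c (3 * \<rho>)) x * norm (g x) \<partial>lborel)"
  have G: "0 \<le> G" unfolding G_def by simp
  let ?B = "ball (0::real^'n) (2 * \<rho>)"
  have [measurable]: "?B \<in> sets borel" "ball c \<rho> \<in> sets borel" by auto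
  let ?J = "\<integral>\<^sup>+x. (\<integral>\<^sup>+h. indicator Y x * indicator Z (h + x) * ennreal \<kappa> \<partial>lborel) \<partial>lborel"
  have "(\<integral>\<^sup>+h. indicator Y x * indicator Z (h + x) * ennreal \<kappa> \<partial>lborel) = indicator Y x * ennreal (measure lborel Z * \<kappa>)" for x
  proof -
    have "(\<integral>\<^sup>+h. indicator Y x * indicator Z (h + x) * ennreal \<kappa> \<partial>lborel) = indicator Y x * ((\<integral>\<^sup>+h. indicator Z (h + x) \<partial>lborel) * ennreal \<kappa>)"
      by (simp add: nn_integral_cmult nn_integral_multc mult.assoc)
    also have "(\<integral>\<^sup>+h. indicator Z (h + x) \<partial>lborel) = (\<integral>\<^sup>+h. indicator Z h \<partial>lborel)"
      by (rule nn_integral_translate) measurable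
    also have "\<dots> = ennreal (measure lborel Z)" using fin[OF Z(2)] by simp
    finally show ?thesis using \<kappa> by (simp add: ennreal_mult)
  qed
  then have "?J = (\<integral>\<^sup>+x. ennreal (measure lborel Z * \<kappa>) * indicator Y x \<partial>lborel)" by (simp add: mult.commute)
  also have "\<dots> = ennreal (measure lborel Z * \<kappa>) * ennreal (measure lborel Y)"
    using fin[OF Y(2)] by (simp add: nn_integral_cmult_indicator)
  finally have J: "?J = ennreal (\<kappa> * measure lborel Y * measure lborel Z)" using \<kappa> by (simp add: ennreal_mult mult_ac)
  have "?J \<le> (\<integral>\<^sup>+x. (\<integral>\<^sup>+h. indicator ?B h * (indicator (ball c \<rho>) x * ennreal \<bar>f (x + h) - f x\<bar>) \<partial>lborel) \<partial>lborel)"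
  proof (intro nn_integral_mono)
    fix x h
    show "indicator Y x * indicator Z (h + x) * ennreal \<kappa> \<le> indicator ?B h * (indicator (ball c \<rho>) x * ennreal \<bar>f (x + h) - f x\<bar>)"
    proof (cases "x \<in> Y \<and> h + x \<in> Z")
      case True
      then have xb: "x \<in> ball c \<rho>" "x + h \<in> ball c \<rho>" using Y Z by (auto simp: add.commute)
      have "norm h = norm ((x + h - c) - (x - c))" by simp
      also have "\<dots> \<le> norm (x + h - c) + norm (x - c)" by (rule norm_triangle_ineq4)
      also have "\<dots> < 2 * \<rho>" using xb by (simp add: dist_norm norm_minus_commute)
      finally have "h \<in> ?B" by simp
      moreover have "\<kappa> \<le> \<bar>f (x + h) - f x\<bar>" using True Z(3)[of "x + h"] Y(3)[of x] by (simp add: add.commute)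
      ultimately show ?thesis using True xb by (auto intro!: ennreal_leI)
    qed auto
  qed
  also have "\<dots> = (\<integral>\<^sup>+h. (\<integral>\<^sup>+x. indicator ?B h * (indicator (ball c \<rho>) x * ennreal \<bar>f (x + h) - f x\<bar>) \<partial>lborel) \<partial>lborel)"
    by (rule lborel_pair.Fubini'[symmetric]) measurable
  also have "\<dots> \<le> (\<integral>\<^sup>+h. ennreal (2 * \<rho> * G) * indicator ?B h \<partial>lborel)"
  proof (rule nn_integral_mono)
    fix h :: "real^'n"
    show "(\<integral>\<^sup>+x. indicator ?B h * (indicator (ball c \<rho>) x * ennreal \<bar>f (x + h) - f x\<bar>) \<partial>lborel) \<le> ennreal (2 * \<rho> * G) * indicator ?B h"
    proof (cases "h \<in> ?B")
      case True
      have i: "integrable lborel (\<lambda>x. indicator (ball c \<rho>) x * \<bar>f (x + h) - f x\<bar>)"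
      proof -
        have "square_integrable lborel (indicator (ball c \<rho>) :: _ \<Rightarrow> real)" by (rule square_integrable_indicator) auto
        from integrable_norm_mult[OF this square_integrable_diff[OF square_integrable_translate[OF H1_pairD(1)[OF fg], of h] H1_pairD(1)[OF fg]]]
        show ?thesis by simp
      qed
      have "(\<integral>x. indicator (ball c \<rho>) x * \<bar>f (x + h) - f x\<bar> \<partial>lborel) \<le> norm h * G"
        unfolding G_def
      proof (rule translation_L1_local[OF fg])
        fix x t assume x: "x \<in> ball c \<rho>" and t: "t \<in> {0..1::real}"
        have "norm (t *\<^sub>R h) \<le> norm h" using t by (simp add: mult_left_le_one_le)
        moreover have "norm (x + t *\<^sub>R h - c) \<le> norm (x - c) + norm (t *\<^sub>R h)"
          using norm_triangle_ineq[of "x - c" "t *\<^sub>R h"] by (simp add: algebra_simps)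
        ultimately show "x + t *\<^sub>R h \<in> ball c (3 * \<rho>)"
          using x True by (simp add: dist_norm norm_minus_commute)
      qed auto
      also have "\<dots> \<le> 2 * \<rho> * G" using True G by (intro mult_right_mono) auto
      finally have le: "(\<integral>x. indicator (ball c \<rho>) x * \<bar>f (x + h) - f x\<bar> \<partial>lborel) \<le> 2 * \<rho> * G" .
      have "(\<integral>\<^sup>+x. indicator (ball c \<rho>) x * ennreal \<bar>f (x + h) - f x\<bar> \<partial>lborel) = (\<integral>\<^sup>+x. ennreal (indicator (ball c \<rho>) x * \<bar>f (x + h) - f x\<bar>) \<partial>lborel)"
        by (intro nn_integral_cong) (auto simp: indicator_def)
      also have "\<dots> = ennreal (\<integral>x. indicator (ball c \<rho>) x * \<bar>f (x + h) - f x\<bar> \<partial>lborel)"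
        by (rule nn_integral_eq_integral[OF i]) simp
      also have "\<dots> \<le> ennreal (2 * \<rho> * G)" using le by (rule ennreal_leI)
      finally show ?thesis using True by simp
    qed simp
  qed
  also have "\<dots> = ennreal (2 * \<rho> * G) * ennreal (measure lborel ?B)"
    using fin[OF order_refl, of "0::real^'n" "2 * \<rho>"] by (simp add: nn_integral_cmult_indicator)
  also have "\<dots> = ennreal (2 * \<rho> * measure lborel ?B * G)" using \<rho> G by (simp add: ennreal_mult[symmetric] mult_ac)
  finally have "ennreal (\<kappa> * measure lborel Y * measure lborel Z) \<le> ennreal (2 * \<rho> * measure lborel ?B * G)"
    unfolding J .
  then show ?thesis using \<rho> G unfolding G_def[symmetric] by (simp add: ennreal_le_iff)
qed

section \<open>De Giorgi classes\<close>

text \<open>The Caccioppoli inequality for the truncations of \<open>w\<close> on balls centred at \<open>c\<close>, phrased for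
  cut-off truncations \<open>f\<close> that extend to the whole space.\<close>

definition degiorgi_class ::
    "real^'n::finite \<Rightarrow> real \<Rightarrow> real \<Rightarrow> (real^'n \<Rightarrow> real) \<Rightarrow> (real^'n \<Rightarrow> real^'n) \<Rightarrow> bool" where
  "degiorgi_class c R K w G \<longleftrightarrow> w \<in> borel_measurable borel \<and> G \<in> borel_measurable borel \<and>
     integrable lborel (\<lambda>x. indicator (ball c R) x * (w x)\<^sup>2) \<and>
     (\<forall>k s t. 0 < s \<longrightarrow> s < t \<longrightarrow> t < R \<longrightarrow> (\<exists>f g. H1_pair f g \<and>
        (\<forall>x\<in>ball c s. f x = max 0 (w x - k) \<and> g x = (if k < w x then G x else 0)) \<and>
        (\<forall>x. x \<notin> ball c t \<or> w x \<le> k \<longrightarrow> f x = 0) \<and>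
        (\<integral>x. (norm (g x))\<^sup>2 \<partial>lborel) \<le> K / (t - s)\<^sup>2 * (\<integral>x. indicator (ball c t) x * (max 0 (w x - k))\<^sup>2 \<partial>lborel)))"

lemma degiorgi_measurable:
  assumes "degiorgi_class c R K w G"
  shows "w \<in> borel_measurable borel" "G \<in> borel_measurable borel"
  using assms by (auto simp: degiorgi_class_def)

lemma degiorgi_integrable:
  assumes dg: "degiorgi_class c R K w G" and "t \<le> R"
  shows "integrable lborel (\<lambda>x. indicator (ball c t) x * (max 0 (w x - k))\<^sup>2)"
proof (rule Bochner_Integration.integrable_bound)
  note [measurable] = degiorgi_measurable[OF dg]
  have [measurable]: "ball c t \<in> sets borel" by simp
  show "(\<lambda>x. indicator (ball c t) x * (max 0 (w x - k))\<^sup>2) \<in> borel_measurable lborel" by measurable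
  have "integrable lborel (\<lambda>x. indicator (ball c R) x :: real)"
    using emeasure_bounded_finite[of "ball c R"] by simp
  then show "integrable lborel (\<lambda>x. 2 * (indicator (ball c R) x * (w x)\<^sup>2) + 2 * k\<^sup>2 * indicator (ball c R) x)"
    using dg by (auto simp: degiorgi_class_def simp del: integrable_indicator_iff)
  have "(max 0 (w x - k))\<^sup>2 \<le> 2 * (w x)\<^sup>2 + 2 * k\<^sup>2" for x
    using power2_norm_add_le[of "w x" "- k"] by (cases "k \<le> w x") auto
  then show "AE x in lborel. norm (indicator (ball c t) x * (max 0 (w x - k))\<^sup>2) \<le>
      norm (2 * (indicator (ball c R) x * (w x)\<^sup>2) + 2 * k\<^sup>2 * indicator (ball c R) x)"
    using \<open>t \<le> R\<close> by (intro AE_I2) (auto simp: indicator_def)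
qed

section \<open>Integrals of squared truncations over balls\<close>

definition excess :: "real^'n::finite \<Rightarrow> (real^'n \<Rightarrow> real) \<Rightarrow> real \<Rightarrow> real \<Rightarrow> real" where
  "excess c w k t = (\<integral>x. indicator (ball c t) x * (max 0 (w x - k))\<^sup>2 \<partial>lborel)"

lemma excess_nonneg: "0 \<le> excess c w k t"
  unfolding excess_def by simp

lemma excess_mono:
  assumes dg: "degiorgi_class c R K w G" and "t \<le> R" "s \<le> t" "l \<le> k"
  shows "excess c w k s \<le> excess c w l t"
  unfolding excess_def
proof (rule integral_mono)
  show "indicator (ball c s) x * (max 0 (w x - k))\<^sup>2 \<le> indicator (ball c t) x * (max 0 (w x - l))\<^sup>2" for x
    using assms by (auto simp: indicator_def intro!: power_mono)
qed (use assms in \<open>auto intro!: degiorgi_integrable[OF dg]\<close>)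

lemma finite_measure_ball_subset:
  fixes c :: "real^'n::finite"
  assumes "T \<subseteq> ball c s"
  shows "emeasure lborel T = ennreal (measure lborel T)"
  using bounded_subset[OF bounded_ball assms] emeasure_bounded_finite[of T]
  by (intro emeasure_eq_ennreal_measure) auto

lemma fmeasurable_ball_subset:
  fixes c :: "real^'n::finite"
  assumes "T \<subseteq> ball c s" "T \<in> sets borel"
  shows "T \<in> fmeasurable lborel"
  using assms finite_measure_ball_subset[OF assms(1)] by (auto simp: fmeasurable_def)

lemma integrable_indicator_ball_subset:
  fixes c :: "real^'n::finite"
  assumes "T \<subseteq> ball c s" "T \<in> sets borel"
  shows "integrable lborel (indicator T :: _ \<Rightarrow> real)"
  using assms finite_measure_ball_subset[OF assms(1)] by (intro integrable_real_indicator) auto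

lemma measure_ball_scale:
  "0 \<le> s \<Longrightarrow> measure lborel (ball (c::real^'n::finite) s) = s ^ CARD('n) * unit_ball_vol (real CARD('n))"
  by (simp add: content_ball mult.commute)

text \<open>Chebyshev's inequality: above level \<open>k\<close> the truncation at \<open>l\<close>
  exceeds \<open>k - l\<close>.\<close>

lemma superlevel_measure_le:
  assumes dg: "degiorgi_class c R K w G" and "t \<le> R" "l < k"
  shows "(k - l)\<^sup>2 * measure lborel {x \<in> ball c t. k < w x} \<le> excess c w l t"
proof -
  note [measurable] = degiorgi_measurable[OF dg]
  let ?E = "{x \<in> ball c t. k < w x}"
  have E: "?E \<in> sets borel" by measurable
  have "integrable lborel (\<lambda>x. (k - l)\<^sup>2 * indicator ?E x :: real)"
    using E by (intro integrable_mult_right integrable_indicator_ball_subset[of _ c t]) auto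
  then have "(\<integral>x. (k - l)\<^sup>2 * indicator ?E x \<partial>lborel) \<le> excess c w l t"
    unfolding excess_def
  proof (rule integral_mono)
    show "(k - l)\<^sup>2 * indicator ?E x \<le> indicator (ball c t) x * (max 0 (w x - l))\<^sup>2" for x
      using assms by (auto simp: indicator_def intro!: power_mono)
  qed (use degiorgi_integrable[OF dg] assms in auto)
  moreover have "(\<integral>x. (k - l)\<^sup>2 * indicator ?E x \<partial>lborel) = (k - l)\<^sup>2 * measure lborel ?E"
    using E by simp
  ultimately show ?thesis by simp
qed

text \<open>One step of the iteration. The extended truncation vanishes off the superlevel set,
  whose measure is small by hypothesis, so the Faber-Krahn inequality bounds its square by the
  energy, and the Caccioppoli inequality bounds the energy by the excess on the larger ball.\<close>

lemma excess_decay: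
  fixes c :: "real^'n::finite"
  assumes dg: "degiorgi_class c R K w G" and st: "0 < s" "s < t" "t < R" and r: "0 < r"
    and small: "2 * measure lborel {x \<in> ball c t. k < w x} \<le> measure lborel (ball (0::real^'n) r)"
  shows "excess c w k s \<le> 2 * r\<^sup>2 * (K / (t - s)\<^sup>2 * excess c w k t)"
proof -
  note [measurable] = degiorgi_measurable[OF dg]
  obtain f g where fg: "H1_pair f g" "\<forall>x\<in>ball c s. f x = max 0 (w x - k) \<and> g x = (if k < w x then G x else 0)"
    "\<forall>x. x \<notin> ball c t \<or> w x \<le> k \<longrightarrow> f x = 0"
    "(\<integral>x. (norm (g x))\<^sup>2 \<partial>lborel) \<le> K / (t - s)\<^sup>2 * excess c w k t"
    using dg st unfolding degiorgi_class_def excess_def by blast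
  note [measurable] = H1_pairD(3)[OF fg(1)]
  let ?E = "{x \<in> ball c t. k < w x}"
  have E: "?E \<in> sets borel" by measurable
  have "emeasure lborel {x. f x \<noteq> 0} \<le> emeasure lborel ?E"
  proof (rule emeasure_mono)
    show "{x. f x \<noteq> 0} \<subseteq> ?E" using fg(3) not_le by blast
  qed (use E in simp)
  then have "2 * emeasure lborel {x. f x \<noteq> 0} \<le> 2 * emeasure lborel ?E" by (rule mult_left_mono) simp
  also have "\<dots> = ennreal (2 * measure lborel ?E)"
    by (subst finite_measure_ball_subset[of ?E c t]) (auto simp: ennreal_mult)
  also have "\<dots> \<le> ennreal (measure lborel (ball (0::real^'n) r))" using small by (rule ennreal_leI)
  also have "\<dots> = emeasure lborel (ball (0::real^'n) r)"
    by (rule finite_measure_ball_subset[OF order_refl, symmetric])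
  finally have "(\<integral>x. (f x)\<^sup>2 \<partial>lborel) \<le> 2 * r\<^sup>2 * (\<integral>x. (norm (g x))\<^sup>2 \<partial>lborel)"
    by (rule Faber_Krahn[OF fg(1) r])
  also have "\<dots> \<le> 2 * r\<^sup>2 * (K / (t - s)\<^sup>2 * excess c w k t)" using fg(4) by (rule mult_left_mono) simp
  finally have *: "(\<integral>x. (f x)\<^sup>2 \<partial>lborel) \<le> 2 * r\<^sup>2 * (K / (t - s)\<^sup>2 * excess c w k t)" .
  have "excess c w k s \<le> (\<integral>x. (f x)\<^sup>2 \<partial>lborel)"
    unfolding excess_def
  proof (rule integral_mono)
    show "integrable lborel (\<lambda>x. indicator (ball c s) x * (max 0 (w x - k))\<^sup>2)"
      using st by (intro degiorgi_integrable[OF dg]) auto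
    show "integrable lborel (\<lambda>x. (f x)\<^sup>2)" using square_integrable_integrable[OF H1_pairD(1)[OF fg(1)]] by simp
    show "indicator (ball c s) x * (max 0 (w x - k))\<^sup>2 \<le> (f x)\<^sup>2" for x
      using fg(2) by (auto simp: indicator_def)
  qed
  with * show ?thesis by linarith
qed

text \<open>De Giorgi's iteration over the levels \<open>k + h (1 - 2\<^sup>-\<^sup>j)\<close> and the radii \<open>\<rho> (1 + 2\<^sup>-\<^sup>j) / 2\<close>. The radius
  \<open>\<rho> \<theta> 2\<^sup>-\<^sup>j\<close> in the Faber-Krahn inequality gives a geometric decay of ratio \<open>q = 32 K \<theta>\<^sup>2\<close>.\<close>

lemma local_maximum_principle:
  fixes K :: real
  assumes K: "0 < K"
  shows "\<exists>\<nu>>0. \<forall>(c::real^'n::finite) R w G \<rho> k h. degiorgi_class c R K w G \<longrightarrow> 0 < \<rho> \<longrightarrow> \<rho> < R \<longrightarrow> 0 < h \<longrightarrow>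
    excess c w k \<rho> \<le> \<nu> * h\<^sup>2 * measure lborel (ball c \<rho>) \<longrightarrow> (AE x in lborel. x \<in> ball c (\<rho> / 2) \<longrightarrow> w x \<le> k + h)"
proof -
  define d where "d = CARD('n)"
  \<comment> \<open>In \<open>q ^ j\<close> the factor \<open>4^(-j)\<close> pays for the shrinking
    level gaps in Chebyshev's inequality, and \<open>2^(-d j)\<close> for the shrinking ball in the
    Faber-Krahn inequality.\<close>
  define q :: real where "q = 1 / (4 * 2 ^ d)"
  define \<theta> where "\<theta> = sqrt (q / (32 * K))"
  \<comment> \<open>Twice the Chebyshev factor \<open>4 \<nu>\<close> then equals
    \<open>\<theta> ^ d\<close>, exactly what the radius \<open>\<rho> \<theta> \<delta> j\<close>
    allows.\<close>
  define \<nu> where "\<nu> = \<theta> ^ d / 8"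
  define \<omega> where "\<omega> = unit_ball_vol (real d)"
  have q: "0 < q" "q < 1"
  proof -
    have "1 \<le> (2::real) ^ d" by simp
    then have "1 < 4 * (2::real) ^ d" by linarith
    then show "0 < q" "q < 1" by (simp_all add: q_def)
  qed
  have \<theta>: "0 < \<theta>" "32 * K * \<theta>\<^sup>2 = q" using q K by (auto simp: \<theta>_def)
  have \<nu>: "0 < \<nu>" using \<theta> by (simp add: \<nu>_def)
  have \<omega>: "0 < \<omega>" unfolding \<omega>_def by (intro unit_ball_vol_pos) simp
  show ?thesis
  proof (intro exI[of _ \<nu>] conjI allI impI \<nu>)
    fix c :: "real^'n" and R w G \<rho> k h
    assume dg: "degiorgi_class c R K w G" and \<rho>: "0 < \<rho>" "\<rho> < R" and h: "0 < h"
      and init: "excess c w k \<rho> \<le> \<nu> * h\<^sup>2 * measure lborel (ball c \<rho>)"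
    note [measurable] = degiorgi_measurable[OF dg]
    define \<delta> :: "nat \<Rightarrow> real" where "\<delta> j = (1/2) ^ j" for j
    define kk where "kk j = k + h * (1 - \<delta> j)" for j
    define rr where "rr j = \<rho> / 2 * (1 + \<delta> j)" for j
    define Y where "Y j = excess c w (kk j) (rr j)" for j
    have \<delta>: "0 < \<delta> j" "\<delta> j \<le> 1" "\<delta> (Suc j) = \<delta> j / 2" for j
      by (auto simp: \<delta>_def power_le_one)
    have rr: "\<rho> / 2 < rr j" "rr j \<le> \<rho>" "rr j - rr (Suc j) = \<rho> * \<delta> j / 4" for j
      using \<rho> \<delta>[of j] by (auto simp: rr_def field_simps)
    have main: "Y j \<le> \<nu> * q ^ j * (h\<^sup>2 * (\<rho> ^ d * \<omega>))" for j
    proof (induction j)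
      case 0
      have "measure lborel (ball c \<rho>) = \<rho> ^ d * \<omega>" using measure_ball_scale[of \<rho> c] \<rho> by (simp add: d_def \<omega>_def)
      then show ?case using init by (simp add: Y_def kk_def rr_def \<delta>_def mult_ac)
    next
      case (Suc j)
      define r where "r = \<rho> * \<theta> * \<delta> j"
      have r: "0 < r" using \<rho> \<theta> \<delta> by (simp add: r_def)
      let ?E = "measure lborel {x \<in> ball c (rr j). kk (Suc j) < w x}"
      have kd: "kk (Suc j) - kk j = h * \<delta> j / 2" using \<delta>(3)[of j] by (simp add: kk_def algebra_simps)
      have klt: "kk j < kk (Suc j)" using kd h \<delta>(1)[of j] by (metis diff_gt_0_iff_gt divide_pos_pos mult_pos_pos zero_less_numeral)
      have "(h * \<delta> j / 2)\<^sup>2 * ?E \<le> Y j"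
        using superlevel_measure_le[OF dg _ klt, of "rr j"] rr[of j] \<rho> unfolding kd Y_def by simp
      also have "\<dots> \<le> \<nu> * q ^ j * (h\<^sup>2 * (\<rho> ^ d * \<omega>))" by (rule Suc.IH)
      finally have "h\<^sup>2 * ((\<delta> j)\<^sup>2 * ?E) \<le> h\<^sup>2 * (4 * \<nu> * q ^ j * (\<rho> ^ d * \<omega>))"
        by (simp add: power2_eq_square field_simps)
      then have e1: "(\<delta> j)\<^sup>2 * ?E \<le> 4 * \<nu> * q ^ j * (\<rho> ^ d * \<omega>)" using h by simp
      have q4: "q ^ j = (\<delta> j)\<^sup>2 * (\<delta> j) ^ d"
      proof -
        have "q = (1/2)\<^sup>2 * (1/2) ^ d" by (simp add: q_def power2_eq_square power_one_over)
        then show ?thesis by (simp add: \<delta>_def power_mult_distrib power_mult[symmetric] mult.commute)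
      qed
      have "(\<delta> j)\<^sup>2 * ?E \<le> (\<delta> j)\<^sup>2 * (4 * \<nu> * (\<delta> j) ^ d * (\<rho> ^ d * \<omega>))" using e1 unfolding q4 by (simp add: mult_ac)
      then have "?E \<le> 4 * \<nu> * (\<delta> j) ^ d * (\<rho> ^ d * \<omega>)" using \<delta>(1)[of j] by simp
      then have "2 * ?E \<le> r ^ d * \<omega>" by (simp add: \<nu>_def r_def power_mult_distrib mult_ac)
      also have "\<dots> = measure lborel (ball (0::real^'n) r)"
        using measure_ball_scale[of r "0::real^'n"] r by (simp add: d_def \<omega>_def)
      finally have small: "2 * ?E \<le> measure lborel (ball (0::real^'n) r)" .
      have "Y (Suc j) \<le> 2 * r\<^sup>2 * (K / (rr j - rr (Suc j))\<^sup>2 * excess c w (kk (Suc j)) (rr j))"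
        unfolding Y_def
      proof (rule excess_decay[OF dg _ _ _ r small])
        show "0 < rr (Suc j)" using rr(1)[of "Suc j"] \<rho> by linarith
        have "0 < \<rho> * \<delta> j / 4" using \<rho> \<delta>(1)[of j] by simp
        then show "rr (Suc j) < rr j" using rr(3)[of j] by linarith
        show "rr j < R" using rr(2)[of j] \<rho> by linarith
      qed
      also have "\<dots> \<le> 2 * r\<^sup>2 * (K / (rr j - rr (Suc j))\<^sup>2 * Y j)"
        unfolding Y_def using rr(2)[of j] \<rho> klt K
        by (intro mult_left_mono excess_mono[OF dg]) auto
      \<comment> \<open>Radius and gap shrink at the same rate, with quotient
        \<open>4 \<theta>\<close>, so \<open>\<delta> j\<close> and \<rho> cancel and the factor is
        the same in every step.\<close>
      also have "2 * r\<^sup>2 * (K / (rr j - rr (Suc j))\<^sup>2 * Y j) = (32 * K * \<theta>\<^sup>2) * Y j"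
        unfolding rr(3) r_def using \<rho> \<delta>(1)[of j] by (simp add: power2_eq_square field_simps)
      also have "\<dots> \<le> q * (\<nu> * q ^ j * (h\<^sup>2 * (\<rho> ^ d * \<omega>)))" unfolding \<theta>(2) using Suc.IH q by (intro mult_left_mono) auto
      finally show ?case by (simp add: mult_ac)
    qed
    have le: "excess c w (k + h) (\<rho> / 2) \<le> \<nu> * q ^ j * (h\<^sup>2 * (\<rho> ^ d * \<omega>))" for j
    proof (rule order_trans[OF _ main])
      show "excess c w (k + h) (\<rho> / 2) \<le> Y j"
        unfolding Y_def
      proof (rule excess_mono[OF dg])
        show "kk j \<le> k + h" using h \<delta>(1)[of j] by (simp add: kk_def)
      qed (use rr[of j] \<rho> in linarith)+
    qed
    \<comment> \<open>The excess at level \<open>k + h\<close> on the half ball lies below every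
      \<open>Y j\<close>, hence it is zero.\<close>
    have "(\<lambda>j. \<nu> * q ^ j * (h\<^sup>2 * (\<rho> ^ d * \<omega>))) \<longlonglongrightarrow> \<nu> * 0 * (h\<^sup>2 * (\<rho> ^ d * \<omega>))"
      using q by (intro tendsto_intros LIMSEQ_realpow_zero) auto
    then have "excess c w (k + h) (\<rho> / 2) \<le> \<nu> * 0 * (h\<^sup>2 * (\<rho> ^ d * \<omega>))"
      by (rule tendsto_lowerbound) (use le in auto)
    then have "excess c w (k + h) (\<rho> / 2) = 0" using excess_nonneg[of c w "k + h" "\<rho> / 2"] by simp
    then have "AE x in lborel. indicator (ball c (\<rho> / 2)) x * (max 0 (w x - (k + h)))\<^sup>2 = 0"
      unfolding excess_def using integral_nonneg_eq_0_iff_AE[OF degiorgi_integrable[OF dg, of "\<rho> / 2" "k + h"]] \<rho> by simp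
    then show "AE x in lborel. x \<in> ball c (\<rho> / 2) \<longrightarrow> w x \<le> k + h"
      by eventually_elim (auto simp: indicator_def max_def split: if_splits)
  qed
qed

section \<open>From half-ball density to decay of oscillation\<close>

lemma square_integral_le_const:
  fixes c :: "real^'n::finite"
  assumes dg: "degiorgi_class c R K w G" and "t \<le> R" and b: "0 \<le> b"
    and bound: "AE x in lborel. x \<in> ball c t \<longrightarrow> w x \<le> k + b"
  shows "excess c w k t \<le> b\<^sup>2 * measure lborel {x \<in> ball c t. k < w x}"
proof -
  note [measurable] = degiorgi_measurable[OF dg]
  let ?E = "{x \<in> ball c t. k < w x}"
  have E: "?E \<in> sets borel" by measurable
  have "excess c w k t \<le> (\<integral>x. b\<^sup>2 * indicator ?E x \<partial>lborel)"
    unfolding excess_def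
  proof (rule integral_mono_AE)
    show "integrable lborel (\<lambda>x. b\<^sup>2 * indicator ?E x :: real)"
      using E by (intro integrable_mult_right integrable_indicator_ball_subset[of _ c t]) auto
    show "AE x in lborel. indicator (ball c t) x * (max 0 (w x - k))\<^sup>2 \<le> b\<^sup>2 * indicator ?E x"
      using bound by eventually_elim (use b in \<open>auto simp: indicator_def not_less max_def intro!: power_mono\<close>)
  qed (rule degiorgi_integrable[OF dg assms(2)])
  also have "\<dots> = b\<^sup>2 * measure lborel ?E" using E by simp
  finally show ?thesis .
qed

text \<open>The slab inequality is applied to the double truncation of \<open>w\<close> between the
  levels \<open>l\<close> and \<open>l + \<kappa>\<close>, whose gradient lives only on the slab
  between them. Cauchy-Schwarz separates the measure of the slab from the energy; the Caccioppoli
  inequality at level \<open>l\<close> and the bound \<open>w \<le> l + 2 \<kappa>\<close> control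
  the energy, and \<kappa> cancels.\<close>

lemma slab_estimate:
  fixes c :: "real^'n::finite"
  assumes dg: "degiorgi_class c R K w G" and K: "0 < K" and \<rho>: "0 < \<rho>" "4 * \<rho> < R" and \<kappa>: "0 < \<kappa>"
    and bound: "AE x in lborel. x \<in> ball c (4 * \<rho>) \<longrightarrow> w x \<le> l + 2 * \<kappa>"
    and half: "measure lborel (ball c \<rho>) \<le> 2 * measure lborel {x \<in> ball c \<rho>. w x \<le> l}"
  shows "(measure lborel {x \<in> ball c \<rho>. l + \<kappa> \<le> w x})\<^sup>2 \<le>
     64 * K * 16 ^ CARD('n) * measure lborel (ball c \<rho>) * measure lborel {x \<in> ball c (3 * \<rho>). l < w x \<and> w x \<le> l + \<kappa>}"
proof -
  note mw = degiorgi_measurable[OF dg]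
  note [measurable] = mw
  define d where "d = CARD('n)"
  let ?Y = "{x \<in> ball c \<rho>. l + \<kappa> \<le> w x}" and ?Z = "{x \<in> ball c \<rho>. w x \<le> l}"
    and ?S = "{x \<in> ball c (3 * \<rho>). l < w x \<and> w x \<le> l + \<kappa>}"
  have sets: "?Y \<in> sets borel" "?Z \<in> sets borel" "?S \<in> sets borel" by measurable
  have "\<exists>f g. H1_pair f g \<and> (\<forall>x\<in>ball c (3 * \<rho>). f x = max 0 (w x - k) \<and> g x = (if k < w x then G x else 0)) \<and>
      (\<integral>x. (norm (g x))\<^sup>2 \<partial>lborel) \<le> K / \<rho>\<^sup>2 * excess c w k (4 * \<rho>)" for k
  proof -
    have "0 < 3 * \<rho>" "3 * \<rho> < 4 * \<rho>" using \<rho> by auto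
    then have "\<exists>f g. H1_pair f g \<and> (\<forall>x\<in>ball c (3 * \<rho>). f x = max 0 (w x - k) \<and> g x = (if k < w x then G x else 0)) \<and>
        (\<forall>x. x \<notin> ball c (4 * \<rho>) \<or> w x \<le> k \<longrightarrow> f x = 0) \<and>
        (\<integral>x. (norm (g x))\<^sup>2 \<partial>lborel) \<le> K / (4 * \<rho> - 3 * \<rho>)\<^sup>2 * excess c w k (4 * \<rho>)"
      using dg \<rho>(2) unfolding degiorgi_class_def excess_def by blast
    moreover have "4 * \<rho> - 3 * \<rho> = \<rho>" by simp
    ultimately show ?thesis by (simp only:) blast
  qed
  note ex = this
  obtain f1 g1 where 1: "H1_pair f1 g1" "\<forall>x\<in>ball c (3 * \<rho>). f1 x = max 0 (w x - l) \<and> g1 x = (if l < w x then G x else 0)"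
      "(\<integral>x. (norm (g1 x))\<^sup>2 \<partial>lborel) \<le> K / \<rho>\<^sup>2 * excess c w l (4 * \<rho>)" using ex[of l] by blast
  obtain f2 g2 where 2: "H1_pair f2 g2"
      "\<forall>x\<in>ball c (3 * \<rho>). f2 x = max 0 (w x - (l + \<kappa>)) \<and> g2 x = (if l + \<kappa> < w x then G x else 0)"
    using ex[of "l + \<kappa>"] by blast
  define B where "B s = measure lborel (ball c s)" for s
  have B: "B (t * \<rho>) = t ^ d * B \<rho>" if "0 \<le> t" for t
    using measure_ball_scale[of "t * \<rho>" c] measure_ball_scale[of \<rho> c] that \<rho> by (simp add: B_def d_def power_mult_distrib)
  have B\<rho>: "0 < B \<rho>" using measure_ball_scale[of \<rho> c] \<rho> unit_ball_vol_pos[of "real CARD('n)"] by (simp add: B_def)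
  have B0: "measure lborel (ball (0::real^'n) s) = B s" for s by (cases "0 \<le> s") (simp_all add: B_def measure_ball_scale ball_empty del: content_ball)
  define y z s where "y = measure lborel ?Y" and "z = measure lborel ?Z" and "s = measure lborel ?S"
  define I where "I = (\<integral>x. indicator (ball c (3 * \<rho>)) x * norm (g1 x - g2 x) \<partial>lborel)"
  \<comment> \<open>On the ball of radius \<open>3 \<rho>\<close> the function
    \<open>f1 - f2\<close> equals \<open>min \<kappa> (max 0 (w - l))\<close>.\<close>
  have slab: "\<kappa> * y * z \<le> 2 * \<rho> * B (2 * \<rho>) * I"
    unfolding y_def z_def I_def B0[symmetric]
  proof (rule slab_inequality[OF H1_pair_diff[OF 1(1) 2(1)]])
    show "f1 x - f2 x = 0" if "x \<in> ?Z" for x using that 1(2) 2(2) \<rho> \<kappa> by auto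
    show "\<kappa> \<le> f1 x - f2 x" if "x \<in> ?Y" for x using that 1(2) 2(2) \<rho> \<kappa> by (auto simp: max_def)
  qed (use sets \<rho> \<kappa> in auto)
  have iS: "square_integrable lborel (indicator ?S :: _ \<Rightarrow> real)"
    using sets by (intro square_integrable_indicator bounded_subset[OF bounded_ball, of _ c "3 * \<rho>"]) auto
  \<comment> \<open>Above \<open>l + \<kappa>\<close> both gradients equal \<open>G\<close> and
    cancel, below \<open>l\<close> both vanish; only the slab remains.\<close>
  have "I \<le> (\<integral>x. norm (indicator ?S x :: real) * norm (g1 x) \<partial>lborel)"
    unfolding I_def
  proof (rule integral_mono)
    show "integrable lborel (\<lambda>x. indicator (ball c (3 * \<rho>)) x * norm (g1 x - g2 x))"
    proof -
      have "square_integrable lborel (indicator (ball c (3 * \<rho>)) :: _ \<Rightarrow> real)" by (rule square_integrable_indicator) auto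
      from integrable_norm_mult[OF this square_integrable_diff[OF H1_pairD(2)[OF 1(1)] H1_pairD(2)[OF 2(1)]]]
      show ?thesis by simp
    qed
    show "integrable lborel (\<lambda>x. norm (indicator ?S x :: real) * norm (g1 x))"
      by (rule integrable_norm_mult[OF iS H1_pairD(2)[OF 1(1)]])
    show "indicator (ball c (3 * \<rho>)) x * norm (g1 x - g2 x) \<le> norm (indicator ?S x :: real) * norm (g1 x)" for x
      using 1(2) 2(2) \<kappa> by (cases "x \<in> ball c (3 * \<rho>)") (auto simp: indicator_def)
  qed
  moreover have I0: "0 \<le> I" unfolding I_def by simp
  ultimately have "I\<^sup>2 \<le> (\<integral>x. norm (indicator ?S x :: real) * norm (g1 x) \<partial>lborel)\<^sup>2" by (intro power_mono)
  also have "\<dots> \<le> (\<integral>x. (norm (indicator ?S x :: real))\<^sup>2 \<partial>lborel) * (\<integral>x. (norm (g1 x))\<^sup>2 \<partial>lborel)"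
    by (rule Cauchy_Schwarz_integral[OF iS H1_pairD(2)[OF 1(1)]])
  also have "(\<integral>x. (norm (indicator ?S x :: real))\<^sup>2 \<partial>lborel) = s"
  proof -
    have e: "(\<lambda>x. (norm (indicator ?S x :: real))\<^sup>2) = indicator ?S" by (auto simp: indicator_def)
    show ?thesis unfolding e s_def using sets by simp
  qed
  also have "s * (\<integral>x. (norm (g1 x))\<^sup>2 \<partial>lborel) \<le> s * (K / \<rho>\<^sup>2 * ((2 * \<kappa>)\<^sup>2 * B (4 * \<rho>)))"
  proof (intro mult_left_mono order_trans[OF 1(3)])
    have "excess c w l (4 * \<rho>) \<le> (2 * \<kappa>)\<^sup>2 * measure lborel {x \<in> ball c (4 * \<rho>). l < w x}"
      using \<rho> \<kappa> bound by (intro square_integral_le_const[OF dg]) auto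
    also have "\<dots> \<le> (2 * \<kappa>)\<^sup>2 * B (4 * \<rho>)"
      unfolding B_def by (intro mult_left_mono measure_mono_fmeasurable fmeasurable_ball_subset[of _ c "4 * \<rho>"]) auto
    finally show "excess c w l (4 * \<rho>) \<le> (2 * \<kappa>)\<^sup>2 * B (4 * \<rho>)" .
  qed (use K in \<open>auto simp: s_def\<close>)
  finally have I2: "I\<^sup>2 \<le> s * (K / \<rho>\<^sup>2 * ((2 * \<kappa>)\<^sup>2 * B (4 * \<rho>)))" .
  have "\<kappa> * y * B \<rho> \<le> \<kappa> * y * (2 * z)"
    using half \<kappa> unfolding B_def y_def z_def by (intro mult_left_mono) auto
  also have "\<kappa> * y * (2 * z) = 2 * (\<kappa> * y * z)" by simp
  also have "\<dots> \<le> 2 * (2 * \<rho> * B (2 * \<rho>) * I)" using slab by (rule mult_left_mono) simp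
  also have "\<dots> = 4 * \<rho> * B (2 * \<rho>) * I" by simp
  also have "\<dots> = 4 * \<rho> * (2 ^ d * B \<rho>) * I" using B[of 2] by simp
  finally have "B \<rho> * (\<kappa> * y) \<le> B \<rho> * (4 * \<rho> * 2 ^ d * I)" by (simp add: mult_ac)
  then have "\<kappa> * y \<le> 4 * \<rho> * 2 ^ d * I" using B\<rho> by simp
  then have "(\<kappa> * y)\<^sup>2 \<le> (4 * \<rho> * 2 ^ d * I)\<^sup>2" using \<kappa> by (intro power_mono) (auto simp: y_def)
  also have "\<dots> = (4 * \<rho> * 2 ^ d)\<^sup>2 * I\<^sup>2" by (simp add: power_mult_distrib)
  also have "\<dots> \<le> (4 * \<rho> * 2 ^ d)\<^sup>2 * (s * (K / \<rho>\<^sup>2 * ((2 * \<kappa>)\<^sup>2 * (4 ^ d * B \<rho>))))"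
    using I2 B[of 4] by (intro mult_left_mono) auto
  also have "\<dots> = \<kappa>\<^sup>2 * (64 * K * 16 ^ d * B \<rho> * s)"
  proof -
    have "(16::real) ^ d = 2 ^ d * 2 ^ d * 4 ^ d" by (simp add: power_mult_distrib[symmetric])
    then show ?thesis using \<rho> by (simp add: power2_eq_square field_simps)
  qed
  finally have "\<kappa>\<^sup>2 * y\<^sup>2 \<le> \<kappa>\<^sup>2 * (64 * K * 16 ^ d * B \<rho> * s)" by (simp add: power_mult_distrib)
  then show ?thesis using \<kappa> unfolding y_def s_def d_def B_def by simp
qed

text \<open>The slabs between consecutive levels \<open>M - a 2\<^sup>-\<^sup>j\<close> are disjoint, so that one of the first \<open>J\<close> of them
  is small; by the slab estimate the superlevel set above it is small as well.\<close>

lemma density_lemma: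
  fixes K :: real
  assumes K: "0 < K"
  shows "\<exists>\<gamma>>0. \<gamma> < 1 \<and> (\<forall>(c::real^'n::finite) R w G \<rho> M a. degiorgi_class c R K w G \<longrightarrow> 0 < \<rho> \<longrightarrow> 4 * \<rho> < R \<longrightarrow> 0 < a \<longrightarrow>
    (AE x in lborel. x \<in> ball c (4 * \<rho>) \<longrightarrow> w x \<le> M) \<longrightarrow>
    measure lborel (ball c \<rho>) \<le> 2 * measure lborel {x \<in> ball c \<rho>. w x \<le> M - a} \<longrightarrow>
    (AE x in lborel. x \<in> ball c (\<rho> / 2) \<longrightarrow> w x \<le> M - \<gamma> * a))"
proof -
  obtain \<nu> where \<nu>: "0 < \<nu>" "\<And>(c::real^'n) R w G \<rho> k h. degiorgi_class c R K w G \<Longrightarrow> 0 < \<rho> \<Longrightarrow> \<rho> < R \<Longrightarrow> 0 < h \<Longrightarrow>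
    excess c w k \<rho> \<le> \<nu> * h\<^sup>2 * measure lborel (ball c \<rho>) \<Longrightarrow> (AE x in lborel. x \<in> ball c (\<rho> / 2) \<longrightarrow> w x \<le> k + h)"
    using local_maximum_principle[OF K, where 'n='n] by blast
  define d where "d = CARD('n)"
  \<comment> \<open>Enough slabs to make the superlevel set above the last one at most
    \<open>\<nu> / 4\<close> of the ball.\<close>
  obtain J where J: "64 * K * 16 ^ d * 3 ^ d / (\<nu> / 4)\<^sup>2 \<le> real J" using real_arch_simple by blast
  have J0: "0 < real J"
    by (rule less_le_trans[OF _ J]) (use K \<nu> in simp)
  have J': "64 * K * 16 ^ d * 3 ^ d \<le> real J * (\<nu> / 4)\<^sup>2" using J \<nu> by (simp add: pos_divide_le_eq)
  define \<delta> :: "nat \<Rightarrow> real" where "\<delta> j = (1/2) ^ j" for j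
  have \<delta>: "0 < \<delta> j" "\<delta> j \<le> 1" "\<delta> (Suc j) = \<delta> j / 2" for j
    by (auto simp: \<delta>_def power_le_one)
  have \<delta>mono: "\<delta> j \<le> \<delta> i" if "i \<le> j" for i j unfolding \<delta>_def using that by (intro power_decreasing) auto
  show ?thesis
  proof (intro exI[of _ "\<delta> (Suc J)"] conjI allI impI)
    show "0 < \<delta> (Suc J)" by (rule \<delta>)
    show "\<delta> (Suc J) < 1" using \<delta>(2)[of J] \<delta>(1)[of J] \<delta>(3)[of J] by linarith
    fix c :: "real^'n" and R w G \<rho> M a
    assume dg: "degiorgi_class c R K w G" and \<rho>: "0 < \<rho>" "4 * \<rho> < R" and a: "0 < a"
      and M: "AE x in lborel. x \<in> ball c (4 * \<rho>) \<longrightarrow> w x \<le> M"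
      and half: "measure lborel (ball c \<rho>) \<le> 2 * measure lborel {x \<in> ball c \<rho>. w x \<le> M - a}"
    note mw = degiorgi_measurable[OF dg]
    note [measurable] = mw
    define k where "k j = M - a * \<delta> j" for j
    have kS: "k (Suc j) = k j + a * \<delta> j / 2" for j using \<delta>(3)[of j] by (simp add: k_def)
    have kmono: "k i \<le> k j" if "i \<le> j" for i j using \<delta>mono[OF that] a by (simp add: k_def)
    define S where "S j = {x \<in> ball c (3 * \<rho>). k j < w x \<and> w x \<le> k (Suc j)}" for j
    have Sm: "S j \<in> sets borel" for j unfolding S_def by measurable
    define y where "y = measure lborel {x \<in> ball c \<rho>. k J < w x}"
    define B where "B = measure lborel (ball c \<rho>)"
    have B: "0 < B" using measure_ball_scale[of \<rho> c] \<rho> unit_ball_vol_pos[of "real CARD('n)"] by (simp add: B_def)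
    \<comment> \<open>The slab estimate is used with \<open>l = k j\<close> and
      \<open>\<kappa> = a * \<delta> j / 2\<close>, for which \<open>l + 2 \<kappa>\<close> is
      exactly \<open>M\<close>. The half-ball hypothesis at level \<open>M - a = k 0\<close> passes
      to the higher levels.\<close>
    have step: "y\<^sup>2 \<le> 64 * K * 16 ^ d * B * measure lborel (S j)" if "j < J" for j
    proof -
      have "y \<le> measure lborel {x \<in> ball c \<rho>. k j + a * \<delta> j / 2 \<le> w x}"
        unfolding y_def kS[symmetric] using kmono[of "Suc j" J] that
        by (intro measure_mono_fmeasurable fmeasurable_ball_subset[of _ c \<rho>]) (auto, measurable)
      then have "y\<^sup>2 \<le> (measure lborel {x \<in> ball c \<rho>. k j + a * \<delta> j / 2 \<le> w x})\<^sup>2"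
        by (intro power_mono) (auto simp: y_def)
      also have "\<dots> \<le> 64 * K * 16 ^ CARD('n) * measure lborel (ball c \<rho>) * measure lborel {x \<in> ball c (3 * \<rho>). k j < w x \<and> w x \<le> k j + a * \<delta> j / 2}"
      proof (rule slab_estimate[OF dg K \<rho>])
        show "0 < a * \<delta> j / 2" using a \<delta>(1)[of j] by simp
        show "AE x in lborel. x \<in> ball c (4 * \<rho>) \<longrightarrow> w x \<le> k j + 2 * (a * \<delta> j / 2)"
          using M by (simp add: k_def)
        have "measure lborel {x \<in> ball c \<rho>. w x \<le> M - a} \<le> measure lborel {x \<in> ball c \<rho>. w x \<le> k j}"
          using kmono[of 0 j] by (intro measure_mono_fmeasurable fmeasurable_ball_subset[of _ c \<rho>]) (auto simp: k_def \<delta>_def, measurable)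
        then show "measure lborel (ball c \<rho>) \<le> 2 * measure lborel {x \<in> ball c \<rho>. w x \<le> k j}" using half by linarith
      qed
      finally show ?thesis unfolding B_def S_def d_def kS .
    qed
    \<comment> \<open>The same \<open>y\<close> bounds every slab from below, while disjointness
      bounds their total measure by that of one ball.\<close>
    have "real J * y\<^sup>2 = (\<Sum>j<J. y\<^sup>2)" by simp
    also have "\<dots> \<le> (\<Sum>j<J. 64 * K * 16 ^ d * B * measure lborel (S j))" by (intro sum_mono step) auto
    also have "\<dots> = 64 * K * 16 ^ d * B * (\<Sum>j<J. measure lborel (S j))" by (simp add: sum_distrib_left)
    also have "(\<Sum>j<J. measure lborel (S j)) = measure lborel (\<Union>j<J. S j)"
    proof (rule measure_UNION'[symmetric])
      show "pairwise (\<lambda>i j. disjnt (S i) (S j)) {..<J}"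
      proof (rule pairwiseI)
        fix i j :: nat assume "i \<noteq> j"
        have "S i \<inter> S j = {}" if "i < j" for i j
        proof -
          have "k (Suc i) \<le> k j" using that by (intro kmono) simp
          then show ?thesis by (auto simp: S_def)
        qed
        from this[of i j] this[of j i] \<open>i \<noteq> j\<close> show "disjnt (S i) (S j)"
          unfolding disjnt_def by (cases i j rule: linorder_cases) auto
      qed
      show "S j \<in> fmeasurable lborel" for j using Sm by (intro fmeasurable_ball_subset[of _ c "3 * \<rho>"]) (auto simp: S_def)
    qed simp
    also have "64 * K * 16 ^ d * B * measure lborel (\<Union>j<J. S j) \<le> 64 * K * 16 ^ d * B * (3 ^ d * B)"
    proof (rule mult_left_mono)
      have "measure lborel (\<Union>j<J. S j) \<le> measure lborel (ball c (3 * \<rho>))"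
        using Sm by (intro measure_mono_fmeasurable fmeasurable_ball_subset[of _ c "3 * \<rho>"]) (auto simp: S_def)
      also have "\<dots> = 3 ^ d * B"
        using measure_ball_scale[of "3 * \<rho>" c] measure_ball_scale[of \<rho> c] \<rho> by (simp add: B_def d_def power_mult_distrib)
      finally show "measure lborel (\<Union>j<J. S j) \<le> 3 ^ d * B" .
    qed (use K B in simp)
    also have "\<dots> = (64 * K * 16 ^ d * 3 ^ d) * B\<^sup>2" by (simp add: power2_eq_square)
    also have "\<dots> \<le> (real J * (\<nu> / 4)\<^sup>2) * B\<^sup>2" using J' by (rule mult_right_mono) simp
    finally have "real J * y\<^sup>2 \<le> real J * (\<nu> / 4 * B)\<^sup>2" by (simp only: power_mult_distrib mult.assoc)
    then have "y\<^sup>2 \<le> (\<nu> / 4 * B)\<^sup>2" using J0 by simp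
    then have y: "y \<le> \<nu> / 4 * B" by (rule power2_le_imp_le) (use \<nu> B in simp)
    \<comment> \<open>Half the distance from \<open>k J\<close> to \<open>M\<close>: the excess is
      then at most \<open>(2 h)^2 y\<close>, which \<open>y \<le> \<nu> B / 4\<close> turns into the
      threshold of the local maximum principle.\<close>
    define h where "h = a * \<delta> J / 2"
    have h: "0 < h" using a \<delta>(1)[of J] by (simp add: h_def)
    have "AE x in lborel. x \<in> ball c (\<rho> / 2) \<longrightarrow> w x \<le> k J + h"
    proof (rule \<nu>(2)[OF dg \<rho>(1) _ h])
      show "\<rho> < R" using \<rho> by linarith
      have "AE x in lborel. x \<in> ball c \<rho> \<longrightarrow> w x \<le> k J + 2 * h"
        using M by eventually_elim (use \<rho> in \<open>auto simp: k_def h_def\<close>)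
      then have "excess c w (k J) \<rho> \<le> (2 * h)\<^sup>2 * y"
        unfolding y_def using h \<rho> by (intro square_integral_le_const[OF dg]) auto
      also have "\<dots> \<le> (2 * h)\<^sup>2 * (\<nu> / 4 * B)" using y by (rule mult_left_mono) simp
      finally show "excess c w (k J) \<rho> \<le> \<nu> * h\<^sup>2 * measure lborel (ball c \<rho>)" by (simp add: B_def mult_ac power_mult_distrib)
    qed
    moreover have "k J + h = M - \<delta> (Suc J) * a" by (simp add: k_def h_def \<delta>(3) field_simps)
    ultimately show "AE x in lborel. x \<in> ball c (\<rho> / 2) \<longrightarrow> w x \<le> M - \<delta> (Suc J) * a" by simp
  qed
qed

text \<open>At the midpoint of the range, either the part of the ball with \<open>w\<close> below or
  the part with \<open>w\<close> above fills at least half of it. The density lemma, applied to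
  \<open>w\<close> or to \<open>- w\<close>, then cuts \<gamma> times half of the oscillation off
  the opposite end, whence \<open>\<theta> = 1 - \<gamma> / 2\<close>.\<close>

lemma oscillation_decay:
  fixes K :: real
  assumes K: "0 < K"
  shows "\<exists>\<theta>>0. \<theta> < 1 \<and> (\<forall>(c::real^'n::finite) R w G \<rho> \<alpha> \<beta>.
    degiorgi_class c R K w G \<longrightarrow> degiorgi_class c R K (\<lambda>x. - w x) (\<lambda>x. - G x) \<longrightarrow> 0 < \<rho> \<longrightarrow> 4 * \<rho> < R \<longrightarrow> \<alpha> \<le> \<beta> \<longrightarrow>
    (AE x in lborel. x \<in> ball c (4 * \<rho>) \<longrightarrow> \<alpha> \<le> w x \<and> w x \<le> \<beta>) \<longrightarrow>
    (\<exists>\<alpha>' \<beta>'. \<alpha> \<le> \<alpha>' \<and> \<alpha>' \<le> \<beta>' \<and> \<beta>' \<le> \<beta> \<and> \<beta>' - \<alpha>' \<le> \<theta> * (\<beta> - \<alpha>) \<and>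
       (AE x in lborel. x \<in> ball c (\<rho> / 2) \<longrightarrow> \<alpha>' \<le> w x \<and> w x \<le> \<beta>')))"
proof -
  obtain \<gamma> where \<gamma>: "0 < \<gamma>" "\<gamma> < 1" "\<And>(c::real^'n) R w G \<rho> M a. degiorgi_class c R K w G \<Longrightarrow> 0 < \<rho> \<Longrightarrow> 4 * \<rho> < R \<Longrightarrow> 0 < a \<Longrightarrow>
    (AE x in lborel. x \<in> ball c (4 * \<rho>) \<longrightarrow> w x \<le> M) \<Longrightarrow>
    measure lborel (ball c \<rho>) \<le> 2 * measure lborel {x \<in> ball c \<rho>. w x \<le> M - a} \<Longrightarrow>
    (AE x in lborel. x \<in> ball c (\<rho> / 2) \<longrightarrow> w x \<le> M - \<gamma> * a)"
    using density_lemma[OF K, where 'n='n] by blast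
  define \<theta> where "\<theta> = 1 - \<gamma> / 2"
  show ?thesis
  proof (rule exI[of _ \<theta>], intro conjI allI impI)
    show "0 < \<theta>" "\<theta> < 1" using \<gamma> by (auto simp: \<theta>_def)
    fix c :: "real^'n" and R w G \<rho> \<alpha> \<beta>
    assume dg: "degiorgi_class c R K w G" "degiorgi_class c R K (\<lambda>x. - w x) (\<lambda>x. - G x)" and \<rho>: "0 < \<rho>" "4 * \<rho> < R"
      and ab: "\<alpha> \<le> \<beta>" and bd: "AE x in lborel. x \<in> ball c (4 * \<rho>) \<longrightarrow> \<alpha> \<le> w x \<and> w x \<le> \<beta>"
    note [measurable] = degiorgi_measurable[OF dg(1)]
    define a where "a = (\<beta> - \<alpha>) / 2"
    have sub: "ball c (\<rho> / 2) \<subseteq> ball c (4 * \<rho>)" using \<rho> by (intro subset_ball) simp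
    show "\<exists>\<alpha>' \<beta>'. \<alpha> \<le> \<alpha>' \<and> \<alpha>' \<le> \<beta>' \<and> \<beta>' \<le> \<beta> \<and> \<beta>' - \<alpha>' \<le> \<theta> * (\<beta> - \<alpha>) \<and>
       (AE x in lborel. x \<in> ball c (\<rho> / 2) \<longrightarrow> \<alpha>' \<le> w x \<and> w x \<le> \<beta>')"
    proof (cases "\<alpha> = \<beta>")
      case True
      have "AE x in lborel. x \<in> ball c (\<rho> / 2) \<longrightarrow> \<alpha> \<le> w x \<and> w x \<le> \<beta>" using bd by eventually_elim (use sub in auto)
      then show ?thesis using True by (intro exI[of _ \<alpha>] exI[of _ \<beta>]) auto
    next
      case False
      with ab have a: "0 < a" by (simp add: a_def)
      have th: "\<beta> - \<gamma> * a - \<alpha> = \<theta> * (\<beta> - \<alpha>)" "\<beta> - (\<alpha> + \<gamma> * a) = \<theta> * (\<beta> - \<alpha>)" by (simp_all add: a_def \<theta>_def field_simps)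
      have ga: "0 < \<gamma> * a" "\<gamma> * a < 2 * a" using \<gamma> a by auto
      let ?L = "{x \<in> ball c \<rho>. w x \<le> \<beta> - a}" and ?U = "{x \<in> ball c \<rho>. - w x \<le> - \<alpha> - a}"
      have sets: "?L \<in> sets borel" "?U \<in> sets borel" by measurable
      have eq: "ball c \<rho> = ?L \<union> ?U" by (auto simp: a_def field_simps)
      have "measure lborel (ball c \<rho>) = measure lborel (?L \<union> ?U)" by (rule arg_cong[OF eq])
      also have "\<dots> \<le> measure lborel ?L + measure lborel ?U" using sets by (intro measure_Un_le) auto
      finally consider "measure lborel (ball c \<rho>) \<le> 2 * measure lborel ?L" | "measure lborel (ball c \<rho>) \<le> 2 * measure lborel ?U"
        by linarith
      then show ?thesis
      proof cases
        case 1
        have "AE x in lborel. x \<in> ball c (4 * \<rho>) \<longrightarrow> w x \<le> \<beta>" using bd by eventually_elim auto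
        from \<gamma>(3)[OF dg(1) \<rho> a this 1] have "AE x in lborel. x \<in> ball c (\<rho> / 2) \<longrightarrow> w x \<le> \<beta> - \<gamma> * a" .
        with bd have "AE x in lborel. x \<in> ball c (\<rho> / 2) \<longrightarrow> \<alpha> \<le> w x \<and> w x \<le> \<beta> - \<gamma> * a"
          by eventually_elim (use sub in auto)
        then show ?thesis using th(1) ga by (intro exI[of _ \<alpha>] exI[of _ "\<beta> - \<gamma> * a"]) (auto simp: a_def)
      next
        case 2
        have "AE x in lborel. x \<in> ball c (4 * \<rho>) \<longrightarrow> - w x \<le> - \<alpha>" using bd by eventually_elim auto
        from \<gamma>(3)[OF dg(2) \<rho> a this 2] have "AE x in lborel. x \<in> ball c (\<rho> / 2) \<longrightarrow> - w x \<le> - \<alpha> - \<gamma> * a" .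
        with bd have "AE x in lborel. x \<in> ball c (\<rho> / 2) \<longrightarrow> \<alpha> + \<gamma> * a \<le> w x \<and> w x \<le> \<beta>"
          by eventually_elim (use sub in auto)
        then show ?thesis using th(2) ga by (intro exI[of _ "\<alpha> + \<gamma> * a"] exI[of _ \<beta>]) (auto simp: a_def)
      qed
    qed
  qed
qed

text \<open>The height \<open>h\<close> is taken so large that the smallness condition holds at
  level zero; \<open>h \<ge> 1\<close> allows replacing \<open>h\<close> by
  \<open>h^2\<close>.\<close>

lemma degiorgi_locally_bounded:
  fixes c :: "real^'n::finite"
  assumes dg: "degiorgi_class c R K w G" and K: "0 < K" and \<rho>: "0 < \<rho>" "\<rho> < R"
  shows "\<exists>M. AE x in lborel. x \<in> ball c (\<rho> / 2) \<longrightarrow> w x \<le> M"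
proof -
  obtain \<nu> where \<nu>: "0 < \<nu>" "\<And>(c::real^'n) R w G \<rho> k h. degiorgi_class c R K w G \<Longrightarrow> 0 < \<rho> \<Longrightarrow> \<rho> < R \<Longrightarrow> 0 < h \<Longrightarrow>
    excess c w k \<rho> \<le> \<nu> * h\<^sup>2 * measure lborel (ball c \<rho>) \<Longrightarrow> (AE x in lborel. x \<in> ball c (\<rho> / 2) \<longrightarrow> w x \<le> k + h)"
    using local_maximum_principle[OF K, where 'n='n] by blast
  define B where "B = \<nu> * measure lborel (ball c \<rho>)"
  have B: "0 < B" using measure_ball_scale[of \<rho> c] \<rho> unit_ball_vol_pos[of "real CARD('n)"] \<nu> by (simp add: B_def)
  define h where "h = 1 + excess c w 0 \<rho> / B"
  have e0: "0 \<le> excess c w 0 \<rho> / B" using excess_nonneg B by (intro divide_nonneg_pos) auto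
  have h: "1 \<le> h" using e0 by (simp add: h_def)
  have "excess c w 0 \<rho> = (excess c w 0 \<rho> / B) * B" using B by simp
  also have "\<dots> \<le> h * B" using B by (intro mult_right_mono) (auto simp: h_def)
  also have "\<dots> \<le> h\<^sup>2 * B" using h B by (intro mult_right_mono) (auto simp: power2_eq_square)
  finally have "excess c w 0 \<rho> \<le> \<nu> * h\<^sup>2 * measure lborel (ball c \<rho>)" by (simp add: B_def mult_ac)
  from \<nu>(2)[OF dg \<rho> _ this] h show ?thesis by auto
qed

text \<open>Nested intervals with lengths bounded by a geometric sequence shrink to one number. The
  Caccioppoli inequalities are available only for balls about \<open>c\<close>, so the conclusion is
  an essential limit at \<open>c\<close>.\<close>

lemma degiorgi_continuous_at_center:
  fixes c :: "real^'n::finite"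
  assumes dg: "degiorgi_class c R K w G" "degiorgi_class c R K (\<lambda>x. - w x) (\<lambda>x. - G x)" and K: "0 < K" and R: "0 < R"
  shows "\<exists>l. \<forall>e>0. \<exists>\<delta>>0. AE x in lborel. x \<in> ball c \<delta> \<longrightarrow> \<bar>w x - l\<bar> \<le> e"
proof -
  obtain \<theta> where \<theta>: "0 < \<theta>" "\<theta> < 1" and osc: "\<And>\<rho> \<alpha> \<beta>. 0 < \<rho> \<Longrightarrow> 4 * \<rho> < R \<Longrightarrow> \<alpha> \<le> \<beta> \<Longrightarrow>
    (AE x in lborel. x \<in> ball c (4 * \<rho>) \<longrightarrow> \<alpha> \<le> w x \<and> w x \<le> \<beta>) \<Longrightarrow>
    (\<exists>\<alpha>' \<beta>'. \<alpha> \<le> \<alpha>' \<and> \<alpha>' \<le> \<beta>' \<and> \<beta>' \<le> \<beta> \<and> \<beta>' - \<alpha>' \<le> \<theta> * (\<beta> - \<alpha>) \<and>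
       (AE x in lborel. x \<in> ball c (\<rho> / 2) \<longrightarrow> \<alpha>' \<le> w x \<and> w x \<le> \<beta>'))"
    using oscillation_decay[OF K, where 'n='n] dg by meson
  \<comment> \<open>One step of oscillation decay passes from radius \<open>4 \<rho>\<close> to
    \<open>\<rho> / 2\<close>, a ratio of \<open>8\<close>; \<open>R / 4\<close> is the radius on
    which the local bounds hold when they are applied with \<open>R / 2\<close>.\<close>
  define t where "t n = R / 4 * (1/8) ^ n" for n :: nat
  have t: "0 < t n" "t n < R" "t (Suc n) = t n / 8" for n
  proof -
    have "(1/8::real) ^ n \<le> 1" by (intro power_le_one) auto
    then have "t n \<le> R / 4 * 1" unfolding t_def using R by (intro mult_left_mono) auto
    then show "t n < R" using R by simp
  qed (use R in \<open>auto simp: t_def\<close>)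
  obtain M1 where M1: "AE x in lborel. x \<in> ball c (t 0) \<longrightarrow> w x \<le> M1"
    using degiorgi_locally_bounded[OF dg(1) K, of "R / 2"] R by (auto simp: t_def)
  obtain M2 where M2: "AE x in lborel. x \<in> ball c (t 0) \<longrightarrow> - w x \<le> M2"
    using degiorgi_locally_bounded[OF dg(2) K, of "R / 2"] R by (auto simp: t_def)
  define P where "P n ab \<longleftrightarrow> fst ab \<le> snd ab \<and> (AE x in lborel. x \<in> ball c (t n) \<longrightarrow> fst ab \<le> w x \<and> w x \<le> snd ab)" for n and ab :: "real \<times> real"
  have "\<exists>f. \<forall>n. P n (f n) \<and> (fst (f n) \<le> fst (f (Suc n)) \<and> snd (f (Suc n)) \<le> snd (f n) \<and>
      snd (f (Suc n)) - fst (f (Suc n)) \<le> \<theta> * (snd (f n) - fst (f n)))"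
  proof (rule dependent_nat_choice)
    \<comment> \<open>The maximum makes the initial endpoints ordered by construction.\<close>
    have "AE x in lborel. x \<in> ball c (t 0) \<longrightarrow> - M2 \<le> w x \<and> w x \<le> max M1 (- M2)"
      using M1 M2 by eventually_elim auto
    then show "\<exists>ab. P 0 ab" unfolding P_def by (intro exI[of _ "(- M2, max M1 (- M2))"]) auto
    fix ab n assume "P n ab"
    then have p: "fst ab \<le> snd ab" "AE x in lborel. x \<in> ball c (4 * (t n / 4)) \<longrightarrow> fst ab \<le> w x \<and> w x \<le> snd ab"
      by (auto simp: P_def)
    have "0 < t n / 4" "4 * (t n / 4) < R" using t by auto
    from osc[OF this p] obtain \<alpha>' \<beta>' where "fst ab \<le> \<alpha>'" "\<alpha>' \<le> \<beta>'" "\<beta>' \<le> snd ab" "\<beta>' - \<alpha>' \<le> \<theta> * (snd ab - fst ab)"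
       "AE x in lborel. x \<in> ball c (t n / 4 / 2) \<longrightarrow> \<alpha>' \<le> w x \<and> w x \<le> \<beta>'" by blast
    then show "\<exists>ab'. P (Suc n) ab' \<and> (fst ab \<le> fst ab' \<and> snd ab' \<le> snd ab \<and> snd ab' - fst ab' \<le> \<theta> * (snd ab - fst ab))"
      unfolding P_def by (intro exI[of _ "(\<alpha>', \<beta>')"]) (auto simp: t(3))
  qed
  then obtain f where f: "\<And>n. P n (f n)" "\<And>n. fst (f n) \<le> fst (f (Suc n))" "\<And>n. snd (f (Suc n)) \<le> snd (f n)"
     "\<And>n. snd (f (Suc n)) - fst (f (Suc n)) \<le> \<theta> * (snd (f n) - fst (f n))" by blast
  define a b where "a n = fst (f n)" and "b n = snd (f n)" for n
  have ab: "a n \<le> b n" "AE x in lborel. x \<in> ball c (t n) \<longrightarrow> a n \<le> w x \<and> w x \<le> b n" for n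
    using f(1)[of n] by (auto simp: P_def a_def b_def)
  have inc: "incseq a" "decseq b" using f(2,3) by (auto simp: a_def b_def intro!: incseq_SucI decseq_SucI)
  have len: "b n - a n \<le> \<theta> ^ n * (b 0 - a 0)" for n
  proof (induction n)
    case (Suc n)
    have "b (Suc n) - a (Suc n) \<le> \<theta> * (b n - a n)" using f(4)[of n] by (simp add: a_def b_def)
    also have "\<dots> \<le> \<theta> * (\<theta> ^ n * (b 0 - a 0))" using Suc \<theta> by (intro mult_left_mono) auto
    finally show ?case by simp
  qed simp
  have bd: "a n \<le> b 0" for n using ab(1)[of n] decseqD[OF inc(2), of 0 n] by simp
  obtain l where l: "a \<longlonglongrightarrow> l" "\<forall>n. a n \<le> l" using incseq_convergent[OF inc(1), of "b 0"] bd by blast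
  have lb: "l \<le> b n" for n
  proof (rule LIMSEQ_le_const2[OF l(1)], intro exI[of _ 0] allI impI)
    fix m
    have "a m \<le> a (max m n)" "b (max m n) \<le> b n" using incseqD[OF inc(1)] decseqD[OF inc(2)] by auto
    then show "a m \<le> b n" using ab(1)[of "max m n"] by linarith
  qed
  have lim0: "(\<lambda>n. \<theta> ^ n * (b 0 - a 0)) \<longlonglongrightarrow> 0"
    using tendsto_mult_left_zero[OF LIMSEQ_realpow_zero[of \<theta>]] \<theta> by auto
  show ?thesis
  proof (rule exI[of _ l], intro allI impI)
    fix e :: real assume e: "0 < e"
    from LIMSEQ_D[OF lim0 e] obtain n where "norm (\<theta> ^ n * (b 0 - a 0) - 0) < e" by blast
    then have ne: "b n - a n \<le> e" using len[of n] by simp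
    have near: "\<bar>v - l\<bar> \<le> e" if "a n \<le> v" "v \<le> b n" for v
      using that ne lb[of n] l(2)[rule_format, of n] unfolding abs_le_iff by linarith
    have "AE x in lborel. x \<in> ball c (t n) \<longrightarrow> \<bar>w x - l\<bar> \<le> e"
      using ab(2)[of n] by eventually_elim (use near in blast)
    then show "\<exists>\<delta>>0. AE x in lborel. x \<in> ball c \<delta> \<longrightarrow> \<bar>w x - l\<bar> \<le> e" using t(1) by blast
  qed
qed

section \<open>Local minimizers\<close>

lemma measurable_quadratic_form [measurable (raw)]:
  fixes A :: "'a \<Rightarrow> real^'n::finite^'n"
  assumes "A \<in> borel_measurable M" "v \<in> borel_measurable M" "w \<in> borel_measurable M"
  shows "(\<lambda>x. v x \<bullet> (A x *v w x)) \<in> borel_measurable M"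
proof -
  have n: "(\<lambda>x. f x $ i) \<in> borel_measurable M" if "f \<in> borel_measurable M" for f :: "'a \<Rightarrow> 'b::euclidean_space^'n" and i
    using measurable_compose[OF that, of "\<lambda>z. z $ i" borel]
    by (simp add: borel_measurable_continuous_onI continuous_on_component continuous_on_id)
  show ?thesis
    unfolding inner_vec_def matrix_vector_mult_def
    by (simp, intro borel_measurable_sum borel_measurable_times n assms n[OF n[OF assms(1)]])
qed

lemma quadratic_form_expand:
  fixes A :: "real^'n::finite^'n"
  assumes "transpose A = A"
  shows "(v + t *\<^sub>R w) \<bullet> (A *v (v + t *\<^sub>R w)) = v \<bullet> (A *v v) + 2 * t * (v \<bullet> (A *v w)) + t\<^sup>2 * (w \<bullet> (A *v w))"
proof -
  have "w \<bullet> (A *v v) = v \<bullet> (A *v w)"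
    by (metis assms dot_lmul_matrix inner_commute transpose_matrix_vector)
  then show ?thesis
    by (simp add: matrix_vector_right_distrib matrix_vector_mult_scaleR inner_left_distrib inner_right_distrib
        power2_eq_square algebra_simps)
qed

text \<open>The type argument fixes the dimension, so that a single cut-off constant can be handed
  through the estimates and the final constant depends on nothing else about the balls. The
  vanishing gradient on the inner ball makes cut-off functions invisible there.\<close>

definition cutoff_bound :: "'n::finite itself \<Rightarrow> real \<Rightarrow> bool" where
  "cutoff_bound _ C \<longleftrightarrow> 0 < C \<and> (\<forall>(c::real^'n) s t. s < t \<longrightarrow> (\<exists>\<eta>. test_function (ball c t) \<eta> \<and>
     (\<forall>x. 0 \<le> \<eta> x \<and> \<eta> x \<le> 1) \<and> (\<forall>x\<in>ball c s. \<eta> x = 1 \<and> grad \<eta> x = 0) \<and> (\<forall>x. norm (grad \<eta> x) \<le> C / (t - s))))"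

lemma cutoff_bound_exists: "\<exists>C. cutoff_bound TYPE('n::finite) C"
proof -
  obtain C where C: "0 < C" "\<And>(c::real^'n) s t. s < t \<Longrightarrow> \<exists>\<eta>. test_function (ball c t) \<eta> \<and> (\<forall>x. 0 \<le> \<eta> x \<and> \<eta> x \<le> 1) \<and>
       (\<forall>x. dist c x \<le> s \<longrightarrow> \<eta> x = 1) \<and> (\<forall>x. norm (grad \<eta> x) \<le> C / (t - s))"
    using cutoff_exists[where 'n='n] by blast
  have "cutoff_bound TYPE('n) C"
    unfolding cutoff_bound_def
  proof (intro conjI allI impI C(1))
    fix c :: "real^'n" and s t :: real assume "s < t"
    from C(2)[OF this] obtain \<eta> where \<eta>: "test_function (ball c t) \<eta>" "\<forall>x. 0 \<le> \<eta> x \<and> \<eta> x \<le> 1"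
      "\<forall>x. dist c x \<le> s \<longrightarrow> \<eta> x = 1" "\<forall>x. norm (grad \<eta> x) \<le> C / (t - s)" by blast
    have "grad \<eta> x = 0" if x: "x \<in> ball c s" for x
    proof (rule grad_eq[of "\<lambda>h. 0"])
      show "(\<eta> has_derivative (\<lambda>h. 0)) (at x)"
        by (rule has_derivative_transform_within_open[of "\<lambda>x. 1" _ _ _ "ball c s"]) (use x \<eta>(3) in auto)
    qed simp
    with \<eta> show "\<exists>\<eta>. test_function (ball c t) \<eta> \<and> (\<forall>x. 0 \<le> \<eta> x \<and> \<eta> x \<le> 1) \<and>
       (\<forall>x\<in>ball c s. \<eta> x = 1 \<and> grad \<eta> x = 0) \<and> (\<forall>x. norm (grad \<eta> x) \<le> C / (t - s))"
      by (intro exI[of _ \<eta>]) auto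
  qed
  then show ?thesis by blast
qed

text \<open>Ellipticity is required at every point of the space, which keeps domains and null sets
  out of the pointwise estimates; the given coefficients are extended accordingly before this is
  applied.\<close>

locale elliptic_field =
  fixes lam Lam :: real and A :: "real^'n::finite \<Rightarrow> real^'n^'n"
  assumes lam: "0 < lam" "lam \<le> Lam"
    and A_measurable [measurable]: "A \<in> borel_measurable borel"
    and A_sym: "\<And>x. transpose (A x) = A x"
    and A_lower: "\<And>x e. lam * (norm e)\<^sup>2 \<le> e \<bullet> (A x *v e)"
    and A_upper: "\<And>x e. e \<bullet> (A x *v e) \<le> Lam * (norm e)\<^sup>2"
begin

lemma A_nonneg: "0 \<le> e \<bullet> (A x *v e)"
  using order_trans[OF _ A_lower, of 0 e x] lam by simp

text \<open>Nonnegativity of the quadratic form at \<open>v + t w\<close> and at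
  \<open>v - t w\<close>.\<close>

lemma A_Young:
  assumes "0 < t"
  shows "2 * \<bar>v \<bullet> (A x *v w)\<bar> \<le> v \<bullet> (A x *v v) / t + t * (w \<bullet> (A x *v w))"
proof -
  have "0 \<le> v \<bullet> (A x *v v) + 2 * s * (v \<bullet> (A x *v w)) + s\<^sup>2 * (w \<bullet> (A x *v w))" for s
    using A_nonneg[of "v + s *\<^sub>R w" x] quadratic_form_expand[OF A_sym[of x], of v s w] by simp
  from this[of t] this[of "- t"]
  have "2 * t * \<bar>v \<bullet> (A x *v w)\<bar> \<le> v \<bullet> (A x *v v) + t\<^sup>2 * (w \<bullet> (A x *v w))"
    by (auto simp: abs_if)
  then have "(2 * t * \<bar>v \<bullet> (A x *v w)\<bar>) / t \<le> (v \<bullet> (A x *v v) + t\<^sup>2 * (w \<bullet> (A x *v w))) / t"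
    using assms by (intro divide_right_mono) auto
  then show ?thesis using assms by (simp add: add_divide_distrib power2_eq_square)
qed

lemma A_integrable:
  assumes v: "square_integrable lborel v" and w: "square_integrable lborel w"
  shows "integrable lborel (\<lambda>x. v x \<bullet> (A x *v w x))"
proof (rule Bochner_Integration.integrable_bound)
  have [measurable]: "v \<in> borel_measurable borel" "w \<in> borel_measurable borel"
    using v w by (auto simp: square_integrable_def)
  show "integrable lborel (\<lambda>x. Lam * (norm (v x))\<^sup>2 + Lam * (norm (w x))\<^sup>2)"
    using v w by (simp add: square_integrable_def)
  show "(\<lambda>x. v x \<bullet> (A x *v w x)) \<in> borel_measurable lborel" by measurable
  show "AE x in lborel. norm (v x \<bullet> (A x *v w x)) \<le> norm (Lam * (norm (v x))\<^sup>2 + Lam * (norm (w x))\<^sup>2)"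
  proof (rule AE_I2)
    fix x
    show "norm (v x \<bullet> (A x *v w x)) \<le> norm (Lam * (norm (v x))\<^sup>2 + Lam * (norm (w x))\<^sup>2)"
      using A_Young[of 1 "v x" x "w x"] A_upper[of "v x" x] A_upper[of "w x" x]
        A_nonneg[of "v x" x] A_nonneg[of "w x" x] by simp
  qed
qed

text \<open>The energy estimate for \<open>\<eta> (w - k)\<^sup>+\<close> comes from testing the equation with \<open>\<eta>\<^sup>2 (w - k)\<^sup>+\<close>.\<close>

lemma solution_degiorgi_class:
  assumes cut: "cutoff_bound TYPE('n) C" and w: "square_integrable lborel w" and G: "square_integrable lborel G"
    and loc: "\<And>\<psi>. test_function (ball c r) \<psi> \<Longrightarrow> H1_pair (\<lambda>x. \<psi> x * w x) (\<lambda>x. \<psi> x *\<^sub>R G x + w x *\<^sub>R grad \<psi> x)"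
    and EL: "\<And>h g \<rho>. H1_pair h g \<Longrightarrow> \<rho> < r \<Longrightarrow> (AE y in lborel. y \<notin> ball c \<rho> \<longrightarrow> h y = 0 \<and> g y = 0) \<Longrightarrow>
      (\<integral>x. G x \<bullet> (A x *v g x) \<partial>lborel) = 0"
  shows "degiorgi_class c r ((8 * Lam + 2 * lam) / lam * C\<^sup>2) w G"
  unfolding degiorgi_class_def
proof (intro conjI allI impI)
  show wm [measurable]: "w \<in> borel_measurable borel" and Gm [measurable]: "G \<in> borel_measurable borel"
    using w G by (auto simp: square_integrable_def)
  have [measurable]: "ball c q \<in> sets borel" for q by simp
  have iw: "integrable lborel (\<lambda>x. (w x)\<^sup>2)" using square_integrable_integrable[OF w] by simp
  show "integrable lborel (\<lambda>x. indicator (ball c r) x * (w x)\<^sup>2)"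
    by (rule Bochner_Integration.integrable_bound[OF iw]) (auto simp: indicator_def)
  fix k s t assume st: "0 < s" "s < t" "t < r"
  obtain \<eta> where \<eta>: "test_function (ball c t) \<eta>" "\<And>x. 0 \<le> \<eta> x" "\<And>x. \<eta> x \<le> 1"
     "\<And>x. x \<in> ball c s \<Longrightarrow> \<eta> x = 1" "\<And>x. x \<in> ball c s \<Longrightarrow> grad \<eta> x = 0" "\<And>x. norm (grad \<eta> x) \<le> C / (t - s)"
    using cut st(2) unfolding cutoff_bound_def by blast
  note sm = test_function_smooth[OF \<eta>(1)]
  note [measurable] = test_function_measurable[OF \<eta>(1)]
  have \<eta>r: "test_function (ball c r) \<eta>" using test_function_mono[OF \<eta>(1)] st by (simp add: subset_ball)
  define \<zeta> where "\<zeta> x = \<eta> x * \<eta> x" for x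
  have \<zeta>r: "test_function (ball c r) \<zeta>" unfolding \<zeta>_def[abs_def] by (rule test_function_mult[OF \<eta>r sm])
  have g\<zeta>: "grad \<zeta> x = (2 * \<eta> x) *\<^sub>R grad \<eta> x" for x
    unfolding \<zeta>_def[abs_def] grad_mult[OF sm sm] by (simp add: scaleR_add_left[symmetric])
  have out: "\<eta> x = 0" "grad \<eta> x = 0" if "x \<notin> ball c t" for x
    using that test_function_outside[OF \<eta>(1)] test_function_grad_outside[OF \<eta>(1)] by auto
  define P where "P x \<longleftrightarrow> 0 < \<eta> x * (w x - k)" for x
  have P\<eta>: "P x \<longleftrightarrow> 0 < \<eta> x \<and> k < w x" for x
    using \<eta>(2)[of x] by (auto simp: P_def zero_less_mult_iff)
  define f where "f x = max 0 (\<eta> x * w x - k * \<eta> x)" for x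
  define g where "g x = (if 0 < \<eta> x * w x - k * \<eta> x then (\<eta> x *\<^sub>R G x + w x *\<^sub>R grad \<eta> x) - k *\<^sub>R grad \<eta> x else 0)" for x
  have fg: "H1_pair f g" unfolding f_def[abs_def] g_def[abs_def]
    by (intro H1_pair_pos H1_pair_diff loc \<eta>r H1_pair_cmult H1_pair_test_function[OF \<eta>r])
  define h where "h x = max 0 (\<zeta> x * w x - k * \<zeta> x)" for x
  define gh where "gh x = (if 0 < \<zeta> x * w x - k * \<zeta> x then (\<zeta> x *\<^sub>R G x + w x *\<^sub>R grad \<zeta> x) - k *\<^sub>R grad \<zeta> x else 0)" for x
  have hg: "H1_pair h gh" unfolding h_def[abs_def] gh_def[abs_def]
    by (intro H1_pair_pos H1_pair_diff loc \<zeta>r H1_pair_cmult H1_pair_test_function[OF \<zeta>r])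
  \<comment> \<open>Both gradients are expressed through the same two fields:
    \<open>g = \<xi> + \<tau>\<close> for the truncation, and
    \<open>gh = \<eta> (\<xi> + 2 \<tau>)\<close> on \<open>P\<close> for the test function. Testing
    the equation therefore controls \<xi> by \<tau>, and \<tau> is bounded by the excess.\<close>
  define \<xi> where "\<xi> x = (if P x then \<eta> x *\<^sub>R G x else 0)" for x
  define \<tau> where "\<tau> x = (if P x then (w x - k) *\<^sub>R grad \<eta> x else 0)" for x
  have Pf: "0 < \<eta> x * w x - k * \<eta> x \<longleftrightarrow> P x" for x by (simp add: P_def algebra_simps)
  have Ph: "0 < \<zeta> x * w x - k * \<zeta> x \<longleftrightarrow> P x" for x
  proof -
    have "\<zeta> x * w x - k * \<zeta> x = \<eta> x * (\<eta> x * (w x - k))" by (simp add: \<zeta>_def algebra_simps)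
    then show ?thesis using \<eta>(2)[of x] by (auto simp: P_def zero_less_mult_iff)
  qed
  have ge: "g x = \<xi> x + \<tau> x" for x
    unfolding g_def Pf \<xi>_def \<tau>_def by (simp add: algebra_simps)
  have ghe: "gh x = (if P x then \<eta> x *\<^sub>R (\<xi> x + 2 *\<^sub>R \<tau> x) else 0)" for x
    unfolding gh_def Ph \<xi>_def \<tau>_def by (simp add: g\<zeta> \<zeta>_def algebra_simps)
  have Q: "G x \<bullet> (A x *v gh x) = \<xi> x \<bullet> (A x *v \<xi> x) + 2 * (\<xi> x \<bullet> (A x *v \<tau> x))" for x
  proof (cases "P x")
    case True
    have "G x \<bullet> (A x *v gh x) = (\<eta> x *\<^sub>R G x) \<bullet> (A x *v (\<xi> x + 2 *\<^sub>R \<tau> x))"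
      using True by (simp add: ghe matrix_vector_mult_scaleR)
    also have "\<eta> x *\<^sub>R G x = \<xi> x" using True by (simp add: \<xi>_def)
    finally show ?thesis by (simp add: matrix_vector_right_distrib matrix_vector_mult_scaleR inner_right_distrib)
  qed (simp add: ghe \<xi>_def \<tau>_def)
  have iQ: "integrable lborel (\<lambda>x. G x \<bullet> (A x *v gh x))" by (rule A_integrable[OF G H1_pairD(2)[OF hg]])
  have Q0: "(\<integral>x. G x \<bullet> (A x *v gh x) \<partial>lborel) = 0"
  proof (rule EL[OF hg st(3)], rule AE_I2, rule impI)
    fix y assume "y \<notin> ball c t"
    then show "h y = 0 \<and> gh y = 0" using out[of y] by (simp add: h_def gh_def \<zeta>_def)
  qed
  define I where "I x = indicator (ball c t) x * (max 0 (w x - k))\<^sup>2" for x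
  have iI: "integrable lborel I"
  proof (rule Bochner_Integration.integrable_bound)
    have "integrable lborel (indicator (ball c t) :: _ \<Rightarrow> real)" by (rule integrable_indicator_ball_subset[OF order_refl]) simp
    then show "integrable lborel (\<lambda>x. 2 * (w x)\<^sup>2 + 2 * k\<^sup>2 * indicator (ball c t) x)" using iw by (simp del: integrable_indicator_iff)
    have "(max 0 (w x - k))\<^sup>2 \<le> 2 * (w x)\<^sup>2 + 2 * k\<^sup>2" for x
      using power2_norm_add_le[of "w x" "- k"] by (cases "k \<le> w x") auto
    then show "AE x in lborel. norm (I x) \<le> norm (2 * (w x)\<^sup>2 + 2 * k\<^sup>2 * indicator (ball c t) x)"
      by (intro AE_I2) (auto simp: I_def indicator_def)
  qed (simp add: I_def[abs_def])
  have \<tau>le: "(norm (\<tau> x))\<^sup>2 \<le> (C / (t - s))\<^sup>2 * I x" for x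
  proof (cases "P x")
    case True
    then have "x \<in> ball c t" "k < w x" using out[of x] by (auto simp: P\<eta>)
    moreover have "(norm (grad \<eta> x))\<^sup>2 \<le> (C / (t - s))\<^sup>2" using \<eta>(6) by (intro power_mono) auto
    ultimately show ?thesis using True by (simp add: \<tau>_def I_def power_mult_distrib mult.commute mult_left_mono del: power_divide)
  qed (simp add: \<tau>_def I_def)
  have pw: "lam * (norm (g x))\<^sup>2 \<le> 4 * (G x \<bullet> (A x *v gh x)) + (8 * Lam + 2 * lam) * ((C / (t - s))\<^sup>2 * I x)" for x
  proof -
    have "(norm (g x))\<^sup>2 \<le> 2 * (norm (\<xi> x))\<^sup>2 + 2 * (norm (\<tau> x))\<^sup>2" unfolding ge by (rule power2_norm_add_le)
    then have "lam * (norm (g x))\<^sup>2 \<le> lam * (2 * (norm (\<xi> x))\<^sup>2 + 2 * (norm (\<tau> x))\<^sup>2)" using lam by (intro mult_left_mono) auto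
    then have 1: "lam * (norm (g x))\<^sup>2 \<le> 2 * (\<xi> x \<bullet> (A x *v \<xi> x)) + 2 * lam * (norm (\<tau> x))\<^sup>2"
      using A_lower[of "\<xi> x" x] by (simp add: algebra_simps)
    \<comment> \<open>Young's inequality with parameter \<open>2\<close> leaves only half of
      \<open>\<xi> \<bullet> A \<xi>\<close> on the other side, where it can be absorbed.\<close>
    have absorb: "a \<le> 2 * (a + 2 * b) + 4 * e" if "2 * \<bar>b\<bar> \<le> a / 2 + 2 * e" for a b e :: real
      using that by (simp add: abs_le_iff)
    have "2 * \<bar>\<xi> x \<bullet> (A x *v \<tau> x)\<bar> \<le> \<xi> x \<bullet> (A x *v \<xi> x) / 2 + 2 * (\<tau> x \<bullet> (A x *v \<tau> x))" by (rule A_Young) simp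
    then have 2: "\<xi> x \<bullet> (A x *v \<xi> x) \<le> 2 * (G x \<bullet> (A x *v gh x)) + 4 * (\<tau> x \<bullet> (A x *v \<tau> x))"
      unfolding Q by (rule absorb)
    have "lam * (norm (g x))\<^sup>2 \<le> 4 * (G x \<bullet> (A x *v gh x)) + (8 * Lam + 2 * lam) * (norm (\<tau> x))\<^sup>2"
      using 1 2 A_upper[of "\<tau> x" x] by (simp add: algebra_simps)
    also have "(8 * Lam + 2 * lam) * (norm (\<tau> x))\<^sup>2 \<le> (8 * Lam + 2 * lam) * ((C / (t - s))\<^sup>2 * I x)"
      using \<tau>le[of x] lam by (intro mult_left_mono) auto
    finally show ?thesis by simp
  qed
  have ig: "integrable lborel (\<lambda>x. (norm (g x))\<^sup>2)" by (rule square_integrable_integrable[OF H1_pairD(2)[OF fg]])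
  have "lam * (\<integral>x. (norm (g x))\<^sup>2 \<partial>lborel) = (\<integral>x. lam * (norm (g x))\<^sup>2 \<partial>lborel)" by simp
  also have "\<dots> \<le> (\<integral>x. 4 * (G x \<bullet> (A x *v gh x)) + (8 * Lam + 2 * lam) * ((C / (t - s))\<^sup>2 * I x) \<partial>lborel)"
    using ig iQ iI pw by (intro integral_mono) auto
  also have "\<dots> = 4 * (\<integral>x. G x \<bullet> (A x *v gh x) \<partial>lborel) + (8 * Lam + 2 * lam) * ((C / (t - s))\<^sup>2 * (\<integral>x. I x \<partial>lborel))"
    using iQ iI by simp
  finally have "lam * (\<integral>x. (norm (g x))\<^sup>2 \<partial>lborel) \<le> (8 * Lam + 2 * lam) * ((C / (t - s))\<^sup>2 * (\<integral>x. I x \<partial>lborel))"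
    unfolding Q0 by simp
  then have "(\<integral>x. (norm (g x))\<^sup>2 \<partial>lborel) \<le> (8 * Lam + 2 * lam) * ((C / (t - s))\<^sup>2 * (\<integral>x. I x \<partial>lborel)) / lam"
    using lam by (simp only: pos_le_divide_eq mult.commute)
  also have "\<dots> = (8 * Lam + 2 * lam) / lam * C\<^sup>2 / (t - s)\<^sup>2 * (\<integral>x. I x \<partial>lborel)"
    by (simp add: power_divide mult_ac)
  finally have "(\<integral>x. (norm (g x))\<^sup>2 \<partial>lborel) \<le> (8 * Lam + 2 * lam) / lam * C\<^sup>2 / (t - s)\<^sup>2 * (\<integral>x. I x \<partial>lborel)" .
  moreover have "f x = max 0 (w x - k) \<and> g x = (if k < w x then G x else 0)" if "x \<in> ball c s" for x
    using \<eta>(4,5)[OF that] by (simp add: f_def g_def)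
  moreover have "f x = 0" if "x \<notin> ball c t \<or> w x \<le> k" for x
  proof (cases "x \<in> ball c t")
    case True
    then have "\<not> P x" using that by (auto simp: P\<eta>)
    then show ?thesis using Pf[of x] by (simp add: f_def)
  qed (use out[of x] in \<open>simp add: f_def\<close>)
  ultimately show "\<exists>f g. H1_pair f g \<and>
     (\<forall>x\<in>ball c s. f x = max 0 (w x - k) \<and> g x = (if k < w x then G x else 0)) \<and>
     (\<forall>x. x \<notin> ball c t \<or> w x \<le> k \<longrightarrow> f x = 0) \<and>
     (\<integral>x. (norm (g x))\<^sup>2 \<partial>lborel) \<le> (8 * Lam + 2 * lam) / lam * C\<^sup>2 / (t - s)\<^sup>2 * (\<integral>x. indicator (ball c t) x * (max 0 (w x - k))\<^sup>2 \<partial>lborel)"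
    using fg unfolding I_def by blast
qed

end

text \<open>What minimality of \<open>u\<close> gives on a ball inside \<open>{u > 0}\<close> on which \<open>\<phi> \<ge> m\<close>: adding a compactly
  supported \<open>h\<close> changes the gradient energy by the right-hand side and saves at least the left-hand side.\<close>

locale local_minimizer = elliptic_field lam Lam A for lam Lam and A :: "real^'n::finite \<Rightarrow> real^'n^'n" +
  fixes c :: "real^'n" and r m :: real and u :: "real^'n \<Rightarrow> real" and G :: "real^'n \<Rightarrow> real^'n"
  assumes r: "0 < r" and m: "0 < m"
    and u_sq: "square_integrable lborel u" and G_sq: "square_integrable lborel G"
    and u_nonneg: "AE y in lborel. y \<in> ball c r \<longrightarrow> 0 \<le> u y"
    and u_loc: "\<And>\<psi>. test_function (ball c r) \<psi> \<Longrightarrow> H1_pair (\<lambda>x. \<psi> x * u x) (\<lambda>x. \<psi> x *\<^sub>R G x + u x *\<^sub>R grad \<psi> x)"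
    and minimal: "\<And>h g \<rho>. H1_pair h g \<Longrightarrow> \<rho> < r \<Longrightarrow> (AE y in lborel. y \<notin> ball c \<rho> \<longrightarrow> h y = 0 \<and> g y = 0) \<Longrightarrow>
      m * measure lborel {y \<in> ball c r. u y + h y \<le> 0} \<le>
        2 * (\<integral>x. G x \<bullet> (A x *v g x) \<partial>lborel) + (\<integral>x. g x \<bullet> (A x *v g x) \<partial>lborel)"
begin

lemma u_measurable [measurable]: "u \<in> borel_measurable borel" and G_measurable [measurable]: "G \<in> borel_measurable borel"
  using u_sq G_sq by (auto simp: square_integrable_def)

text \<open>For the perturbation \<open>t h\<close> the left-hand side of \<open>minimal\<close> is
  nonnegative, so \<open>2 t L + t^2 E \<ge> 0\<close> for all \<open>t\<close> of either sign,
  which forces the linear coefficient \<open>L\<close> to vanish.\<close>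

lemma Euler_Lagrange:
  assumes hg: "H1_pair h g" and \<rho>: "\<rho> < r" and out: "AE y in lborel. y \<notin> ball c \<rho> \<longrightarrow> h y = 0 \<and> g y = 0"
  shows "(\<integral>x. G x \<bullet> (A x *v g x) \<partial>lborel) = 0"
proof (rule ccontr)
  define L where "L = (\<integral>x. G x \<bullet> (A x *v g x) \<partial>lborel)"
  define E where "E = (\<integral>x. g x \<bullet> (A x *v g x) \<partial>lborel)"
  assume "(\<integral>x. G x \<bullet> (A x *v g x) \<partial>lborel) \<noteq> 0"
  then have L: "L \<noteq> 0" by (simp add: L_def)
  have E: "0 \<le> E" unfolding E_def by (intro integral_nonneg_AE AE_I2 A_nonneg)
  have "0 \<le> 2 * (t * L) + t\<^sup>2 * E" for t
  proof -
    have "0 \<le> m * measure lborel {y \<in> ball c r. u y + t * h y \<le> 0}" using m by simp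
    also have "\<dots> \<le> 2 * (\<integral>x. G x \<bullet> (A x *v (t *\<^sub>R g x)) \<partial>lborel) + (\<integral>x. (t *\<^sub>R g x) \<bullet> (A x *v (t *\<^sub>R g x)) \<partial>lborel)"
      by (rule minimal[OF H1_pair_cmult[OF hg] \<rho>]) (use out in \<open>eventually_elim, auto\<close>)
    also have "\<dots> = 2 * (t * L) + t\<^sup>2 * E"
      by (simp add: matrix_vector_mult_scaleR L_def E_def power2_eq_square mult.assoc)
    finally show ?thesis .
  qed
  note nonneg = this
  \<comment> \<open>Near the minimum of the quadratic, with \<open>E + 1\<close> in place of
    \<open>E\<close> to allow for \<open>E = 0\<close>.\<close>
  define t where "t = - L / (E + 1)"
  have t: "t * (E + 1) = - L" using E by (simp add: t_def)
  have "0 \<le> (2 * (t * L) + t\<^sup>2 * E) * (E + 1)\<^sup>2" using nonneg[of t] by simp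
  also have "\<dots> = 2 * (t * (E + 1)) * L * (E + 1) + (t * (E + 1))\<^sup>2 * E"
    by (simp add: power2_eq_square algebra_simps)
  also have "\<dots> = - (L\<^sup>2 * (E + 2))" unfolding t by (simp add: power2_eq_square algebra_simps)
  also have "\<dots> < 0" using L E by simp
  finally show False by simp
qed

text \<open>The equation is linear, so \<open>- u\<close> satisfies it as well, and truncations from
  both sides are controlled.\<close>

lemma degiorgi:
  assumes "cutoff_bound TYPE('n) C"
  shows "degiorgi_class c r ((8 * Lam + 2 * lam) / lam * C\<^sup>2) u G"
    "degiorgi_class c r ((8 * Lam + 2 * lam) / lam * C\<^sup>2) (\<lambda>x. - u x) (\<lambda>x. - G x)"
proof -
  show "degiorgi_class c r ((8 * Lam + 2 * lam) / lam * C\<^sup>2) u G"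
    by (rule solution_degiorgi_class[OF assms u_sq G_sq u_loc Euler_Lagrange])
  show "degiorgi_class c r ((8 * Lam + 2 * lam) / lam * C\<^sup>2) (\<lambda>x. - u x) (\<lambda>x. - G x)"
  proof (rule solution_degiorgi_class[OF assms])
    show "square_integrable lborel (\<lambda>x. - u x)" "square_integrable lborel (\<lambda>x. - G x)"
      using u_sq G_sq by (auto simp: square_integrable_def)
    show "H1_pair (\<lambda>x. \<psi> x * - u x) (\<lambda>x. \<psi> x *\<^sub>R - G x + - u x *\<^sub>R grad \<psi> x)" if "test_function (ball c r) \<psi>" for \<psi>
      using H1_pair_cmult[OF u_loc[OF that], of "-1"] by (simp add: algebra_simps)
    show "(\<integral>x. - G x \<bullet> (A x *v g x) \<partial>lborel) = 0"
      if "H1_pair h g" "\<rho> < r" "AE y in lborel. y \<notin> ball c \<rho> \<longrightarrow> h y = 0 \<and> g y = 0" for h g \<rho>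
      using Euler_Lagrange[OF that] by simp
  qed
qed

text \<open>The competitor is \<open>u + h = (u - k \<eta>)\<^sup>+\<close>, where \<open>\<eta> = 1\<close> on the half ball.\<close>

lemma sublevel_measure_le:
  assumes cut: "cutoff_bound TYPE('n) C" and k: "0 < k"
  shows "m * measure lborel {y \<in> ball c (r / 2). u y \<le> k} \<le> 4 * k\<^sup>2 * Lam * (4 * C / r)\<^sup>2 * measure lborel (ball c r)"
proof -
  have [measurable]: "ball c q \<in> sets borel" for q by simp
  obtain \<eta> where \<eta>: "test_function (ball c (3 * r / 4)) \<eta>" "\<And>x. 0 \<le> \<eta> x" 
     "\<And>x. x \<in> ball c (r / 2) \<Longrightarrow> \<eta> x = 1" "\<And>x. norm (grad \<eta> x) \<le> C / (3 * r / 4 - r / 2)"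
  proof -
    have "r / 2 < 3 * r / 4" using r by simp
    then show ?thesis using cut that unfolding cutoff_bound_def by blast
  qed
  \<comment> \<open>Only products of \<open>u\<close> with test functions are known to be
    \<open>H1_pair\<close>s. This second cut-off is \<open>1\<close> wherever \<eta> is nonzero, so
    it does not change \<open>u\<close> where \<open>k \<eta>\<close> competes with it.\<close>
  obtain \<psi> where \<psi>: "test_function (ball c (7 * r / 8)) \<psi>" "\<And>x. 0 \<le> \<psi> x"
     "\<And>x. x \<in> ball c (3 * r / 4) \<Longrightarrow> \<psi> x = 1" "\<And>x. x \<in> ball c (3 * r / 4) \<Longrightarrow> grad \<psi> x = 0"
  proof -
    have "3 * r / 4 < 7 * r / 8" using r by simp
    then show ?thesis using cut that unfolding cutoff_bound_def by blast
  qed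
  have \<psi>r: "test_function (ball c r) \<psi>" using test_function_mono[OF \<psi>(1)] r by (simp add: subset_ball)
  note [measurable] = test_function_measurable[OF \<eta>(1)]
  have out: "\<eta> x = 0" "grad \<eta> x = 0" if "x \<notin> ball c (3 * r / 4)" for x
    using that test_function_outside[OF \<eta>(1)] test_function_grad_outside[OF \<eta>(1)] by auto
  define z where "z x = max 0 (k * \<eta> x - \<psi> x * u x)" for x
  define gz where "gz x = (if 0 < k * \<eta> x - \<psi> x * u x then k *\<^sub>R grad \<eta> x - (\<psi> x *\<^sub>R G x + u x *\<^sub>R grad \<psi> x) else 0)" for x
  have zg: "H1_pair z gz" unfolding z_def[abs_def] gz_def[abs_def]
    by (intro H1_pair_pos H1_pair_diff u_loc \<psi>r H1_pair_cmult H1_pair_test_function[OF \<eta>(1)])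
  have kg: "H1_pair (\<lambda>x. k * \<eta> x) (\<lambda>x. k *\<^sub>R grad \<eta> x)" by (intro H1_pair_cmult H1_pair_test_function[OF \<eta>(1)])
  \<comment> \<open>Outside the support of \<eta> the truncated function is
    \<open>- \<psi> u\<close>, which is nonpositive because \<open>u\<close> is nonnegative.\<close>
  have zout: "AE y in lborel. y \<notin> ball c (3 * r / 4) \<longrightarrow> z y = 0 \<and> gz y = 0"
    using u_nonneg
  proof eventually_elim
    case (elim y)
    show ?case
    proof
      assume y: "y \<notin> ball c (3 * r / 4)"
      have "0 \<le> \<psi> y * u y"
        using elim \<psi>(2)[of y] test_function_outside[OF \<psi>r, of y] by (cases "y \<in> ball c r") auto
      then show "z y = 0 \<and> gz y = 0" using out[OF y] by (simp add: z_def gz_def)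
    qed
  qed
  have r34: "3 * r / 4 < r" using r by simp
  define Q where "Q x = k\<^sup>2 * (grad \<eta> x \<bullet> (A x *v grad \<eta> x))" for x
  define Ez where "Ez x = gz x \<bullet> (A x *v gz x)" for x
  note sq\<eta> = H1_pairD(2)[OF H1_pair_test_function[OF \<eta>(1)]]
  have iQ: "integrable lborel Q" unfolding Q_def[abs_def] by (intro integrable_mult_right A_integrable sq\<eta>)
  have iE: "integrable lborel Ez" unfolding Ez_def[abs_def] by (intro A_integrable H1_pairD(2)[OF zg])
  have iL: "integrable lborel (\<lambda>x. G x \<bullet> (A x *v gz x))" by (intro A_integrable H1_pairD(2)[OF zg] G_sq)
  have L0: "(\<integral>x. G x \<bullet> (A x *v gz x) \<partial>lborel) = 0" by (rule Euler_Lagrange[OF zg r34 zout])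
  \<comment> \<open>Where \<open>gz\<close> is nonzero it equals \<open>k grad \<eta> - G\<close>;
    expanding one factor of \<open>Ez\<close> and applying Young's inequality gives the pointwise
    bound. The subtracted term has integral zero by the Euler-Lagrange equation.\<close>
  have "(\<integral>x. Ez x \<partial>lborel) \<le> (\<integral>x. Q x - 2 * (G x \<bullet> (A x *v gz x)) \<partial>lborel)"
  proof (rule integral_mono_AE[OF iE])
    show "AE x in lborel. Ez x \<le> Q x - 2 * (G x \<bullet> (A x *v gz x))"
      using zout
    proof eventually_elim
      case (elim x)
      have Qpos: "0 \<le> Q x" unfolding Q_def using A_nonneg by simp
      show ?case
      proof (cases "0 < k * \<eta> x - \<psi> x * u x")
        case True
        show ?thesis
        proof (cases "x \<in> ball c (3 * r / 4)")
          case inb: True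
          have gzx: "gz x = k *\<^sub>R grad \<eta> x - G x" using True \<psi>(3,4)[OF inb] by (simp add: gz_def)
          have "Ez x = (k *\<^sub>R grad \<eta> x) \<bullet> (A x *v gz x) - G x \<bullet> (A x *v gz x)"
            unfolding Ez_def by (subst (1) gzx) (simp add: inner_diff_left)
          moreover have "2 * \<bar>(k *\<^sub>R grad \<eta> x) \<bullet> (A x *v gz x)\<bar> \<le> (k *\<^sub>R grad \<eta> x) \<bullet> (A x *v (k *\<^sub>R grad \<eta> x)) / 1 + 1 * Ez x"
            unfolding Ez_def by (rule A_Young) simp
          moreover have "(k *\<^sub>R grad \<eta> x) \<bullet> (A x *v (k *\<^sub>R grad \<eta> x)) = Q x"
            by (simp add: Q_def matrix_vector_mult_scaleR power2_eq_square)
          ultimately show ?thesis by linarith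
        qed (use elim Qpos in \<open>simp add: Ez_def\<close>)
      qed (use Qpos in \<open>simp add: Ez_def gz_def\<close>)
    qed
  qed (use iQ iL in auto)
  also have "\<dots> = (\<integral>x. Q x \<partial>lborel)" using iQ iL L0 by simp
  finally have EzQ: "(\<integral>x. Ez x \<partial>lborel) \<le> (\<integral>x. Q x \<partial>lborel)" .
  \<comment> \<open>On the support of \<eta> this makes \<open>u + h = max 0 (u - k \<eta>)\<close>.
    In the half ball the new function is zero wherever \<open>u \<le> k\<close>, so the sublevel set
    is part of what \<open>minimal\<close> charges for.\<close>
  define h where "h x = z x - k * \<eta> x" for x
  define gh where "gh x = gz x - k *\<^sub>R grad \<eta> x" for x
  have hg: "H1_pair h gh" unfolding h_def[abs_def] gh_def[abs_def] by (rule H1_pair_diff[OF zg kg])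
  have hout: "AE y in lborel. y \<notin> ball c (3 * r / 4) \<longrightarrow> h y = 0 \<and> gh y = 0"
    using zout by eventually_elim (auto simp: h_def gh_def out)
  have "{y \<in> ball c (r / 2). u y \<le> k} \<subseteq> {y \<in> ball c r. u y + h y \<le> 0}"
  proof
    fix y assume y: "y \<in> {y \<in> ball c (r / 2). u y \<le> k}"
    then have "\<eta> y = 1" "\<psi> y = 1" using \<eta>(3)[of y] \<psi>(3)[of y] r by auto
    then show "y \<in> {y \<in> ball c r. u y + h y \<le> 0}" using y r by (simp add: h_def z_def)
  qed
  moreover have hm: "h \<in> borel_measurable borel" using H1_pairD(3)[OF hg] .
  ultimately have "measure lborel {y \<in> ball c (r / 2). u y \<le> k} \<le> measure lborel {y \<in> ball c r. u y + h y \<le> 0}"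
    by (intro measure_mono_fmeasurable fmeasurable_ball_subset[of _ c r]) (auto, measurable)
  then have "m * measure lborel {y \<in> ball c (r / 2). u y \<le> k} \<le> m * measure lborel {y \<in> ball c r. u y + h y \<le> 0}"
    using m by (intro mult_left_mono) auto
  also have "\<dots> \<le> 2 * (\<integral>x. G x \<bullet> (A x *v gh x) \<partial>lborel) + (\<integral>x. gh x \<bullet> (A x *v gh x) \<partial>lborel)"
    by (rule minimal[OF hg r34 hout])
  also have "(\<integral>x. G x \<bullet> (A x *v gh x) \<partial>lborel) = 0" by (rule Euler_Lagrange[OF hg r34 hout])
  \<comment> \<open>With the linear term gone, the cost is the energy of
    \<open>gz - k grad \<eta>\<close>, at most \<open>2 Ez + 2 Q\<close> and hence, after
    integration, at most four times the energy \<open>Q\<close> of the cut-off.\<close>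
  also have "(\<integral>x. gh x \<bullet> (A x *v gh x) \<partial>lborel) \<le> (\<integral>x. 2 * Ez x + 2 * Q x \<partial>lborel)"
  proof (rule integral_mono)
    show "integrable lborel (\<lambda>x. gh x \<bullet> (A x *v gh x))" by (intro A_integrable H1_pairD(2)[OF hg])
    show "gh x \<bullet> (A x *v gh x) \<le> 2 * Ez x + 2 * Q x" for x
    proof -
      have "gh x = gz x + (- k) *\<^sub>R grad \<eta> x" by (simp add: gh_def)
      then have "gh x \<bullet> (A x *v gh x) = Ez x - 2 * k * (gz x \<bullet> (A x *v grad \<eta> x)) + Q x"
        using quadratic_form_expand[OF A_sym[of x], of "gz x" "- k" "grad \<eta> x"] by (simp add: Ez_def Q_def)
      moreover have "2 * \<bar>gz x \<bullet> (A x *v (k *\<^sub>R grad \<eta> x))\<bar> \<le> gz x \<bullet> (A x *v gz x) / 1 + 1 * ((k *\<^sub>R grad \<eta> x) \<bullet> (A x *v (k *\<^sub>R grad \<eta> x)))"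
        by (rule A_Young) simp
      ultimately show ?thesis by (simp add: Ez_def Q_def matrix_vector_mult_scaleR power2_eq_square abs_le_iff mult.assoc)
    qed
  qed (use iQ iE in auto)
  also have "(\<integral>x. 2 * Ez x + 2 * Q x \<partial>lborel) = 2 * (\<integral>x. Ez x \<partial>lborel) + 2 * (\<integral>x. Q x \<partial>lborel)" using iE iQ by simp
  finally have main: "m * measure lborel {y \<in> ball c (r / 2). u y \<le> k} \<le> 4 * (\<integral>x. Q x \<partial>lborel)" using EzQ by linarith
  have "(\<integral>x. Q x \<partial>lborel) \<le> (\<integral>x. k\<^sup>2 * Lam * (4 * C / r)\<^sup>2 * indicator (ball c r) x \<partial>lborel)"
  proof (rule integral_mono[OF iQ])
    show "integrable lborel (\<lambda>x. k\<^sup>2 * Lam * (4 * C / r)\<^sup>2 * indicator (ball c r) x :: real)"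
      by (intro integrable_mult_right integrable_indicator_ball_subset[of _ c r]) auto
    show "Q x \<le> k\<^sup>2 * Lam * (4 * C / r)\<^sup>2 * indicator (ball c r) x" for x
    proof (cases "x \<in> ball c (3 * r / 4)")
      case True
      have "C / (3 * r / 4 - r / 2) = 4 * C / r" using r by (simp add: field_simps)
      then have "norm (grad \<eta> x) \<le> 4 * C / r" using \<eta>(4)[of x] by (simp only:)
      then have "(norm (grad \<eta> x))\<^sup>2 \<le> (4 * C / r)\<^sup>2" by (intro power_mono) auto
      then have "Lam * (norm (grad \<eta> x))\<^sup>2 \<le> Lam * (4 * C / r)\<^sup>2" using lam by (intro mult_left_mono) auto
      then have "grad \<eta> x \<bullet> (A x *v grad \<eta> x) \<le> Lam * (4 * C / r)\<^sup>2" using A_upper[of "grad \<eta> x" x] by linarith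
      then have "Q x \<le> k\<^sup>2 * (Lam * (4 * C / r)\<^sup>2)" unfolding Q_def by (rule mult_left_mono) simp
      moreover have "x \<in> ball c r" using True r by auto
      ultimately show ?thesis by (simp add: mult.assoc)
    next
      case False
      then show ?thesis using out(2)[OF False] lam by (simp add: Q_def)
    qed
  qed
  also have "\<dots> = k\<^sup>2 * Lam * (4 * C / r)\<^sup>2 * measure lborel (ball c r)" by simp
  finally show ?thesis using main by simp
qed

end

text \<open>Sublevel sets of \<open>u\<close> occupy a small fraction of the half ball at levels \<open>\<epsilon> r \<surd>m\<close>, so that the local
  maximum principle for \<open>- u\<close> applies.\<close>

lemma local_minimizer_nondegenerate:
  fixes lam Lam :: real
  assumes lam: "0 < lam" "lam \<le> Lam"
  shows "\<exists>\<epsilon>>0. \<forall>A (c::real^'n::finite) r m u G. local_minimizer lam Lam A c r m u G \<longrightarrow>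
    (\<exists>l. \<epsilon> * r * sqrt m \<le> l \<and> (\<forall>e>0. \<exists>\<delta>>0. AE y in lborel. y \<in> ball c \<delta> \<longrightarrow> \<bar>u y - l\<bar> \<le> e))"
proof -
  obtain C where C: "cutoff_bound TYPE('n) C" using cutoff_bound_exists by blast
  define K where "K = (8 * Lam + 2 * lam) / lam * C\<^sup>2"
  have C0: "0 < C" using C by (simp add: cutoff_bound_def)
  have K: "0 < K" unfolding K_def using lam C0 by (intro mult_pos_pos divide_pos_pos add_pos_pos) auto
  obtain \<nu> where \<nu>: "0 < \<nu>" "\<And>(c::real^'n) R w G \<rho> k h. degiorgi_class c R K w G \<Longrightarrow> 0 < \<rho> \<Longrightarrow> \<rho> < R \<Longrightarrow> 0 < h \<Longrightarrow>
    excess c w k \<rho> \<le> \<nu> * h\<^sup>2 * measure lborel (ball c \<rho>) \<Longrightarrow> (AE x in lborel. x \<in> ball c (\<rho> / 2) \<longrightarrow> w x \<le> k + h)"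
    using local_maximum_principle[OF K, where 'n='n] by blast
  \<comment> \<open>With \<open>k^2 = \<epsilon>^2 r^2 m\<close> the sublevel estimate bounds the
    fraction of the half ball by \<open>64 Lam C^2 2^d \<epsilon>^2 = D \<epsilon>^2 / 4\<close>;
    the factor \<open>2^d\<close> compares the ball with the half ball. The choice of \<epsilon>
    makes this \<open>\<nu> / 4\<close>.\<close>
  define D where "D = 256 * Lam * C\<^sup>2 * 2 ^ CARD('n)"
  have D: "0 < D" using lam C0 by (simp add: D_def)
  define \<epsilon> where "\<epsilon> = sqrt (\<nu> / D)"
  have \<epsilon>: "0 < \<epsilon>" "D * \<epsilon>\<^sup>2 = \<nu>" using \<nu> D by (auto simp: \<epsilon>_def)
  have Deps: "256 * (Lam * (C\<^sup>2 * (\<epsilon>\<^sup>2 * 2 ^ CARD('n)))) = \<nu>" using \<epsilon>(2) by (simp add: D_def mult_ac)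
  show ?thesis
  proof (rule exI[of _ "\<epsilon> / 2"], intro conjI allI impI)
    show "0 < \<epsilon> / 2" using \<epsilon> by simp
    fix A and c :: "real^'n" and r m u G
    assume "local_minimizer lam Lam A c r m u G"
    then interpret local_minimizer lam Lam A c r m u G .
    note dg = degiorgi[OF C, folded K_def]
    obtain l where l: "\<forall>e>0. \<exists>\<delta>>0. AE y in lborel. y \<in> ball c \<delta> \<longrightarrow> \<bar>u y - l\<bar> \<le> e"
      using degiorgi_continuous_at_center[OF dg K r] by blast
    define k where "k = \<epsilon> * r * sqrt m"
    have k: "0 < k" "k\<^sup>2 = \<epsilon>\<^sup>2 * r\<^sup>2 * m" using \<epsilon> r m by (auto simp: k_def power_mult_distrib)
    define y where "y = measure lborel {y \<in> ball c (r / 2). u y \<le> k}"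
    have "m * y \<le> 4 * k\<^sup>2 * Lam * (4 * C / r)\<^sup>2 * measure lborel (ball c r)"
      unfolding y_def by (rule sublevel_measure_le[OF C k(1)])
    also have "measure lborel (ball c r) = 2 ^ CARD('n) * measure lborel (ball c (r / 2))"
      using measure_ball_scale[of r c] measure_ball_scale[of "r / 2" c] r by (simp add: power_divide)
    also have "4 * k\<^sup>2 * Lam * (4 * C / r)\<^sup>2 * (2 ^ CARD('n) * measure lborel (ball c (r / 2))) =
        m * (64 * (Lam * (C\<^sup>2 * (\<epsilon>\<^sup>2 * 2 ^ CARD('n)))) * measure lborel (ball c (r / 2)))"
      unfolding k(2) using r by (simp add: power2_eq_square field_simps)
    also have "64 * (Lam * (C\<^sup>2 * (\<epsilon>\<^sup>2 * 2 ^ CARD('n)))) = \<nu> / 4" using Deps by simp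
    finally have y: "y \<le> \<nu> / 4 * measure lborel (ball c (r / 2))" using m by simp
    \<comment> \<open>The local maximum principle for \<open>- u\<close> at level \<open>- k\<close>
      with height \<open>k / 2\<close>. Since \<open>- u \<le> 0\<close>, the truncation is at most
      \<open>k\<close>, and the fraction \<open>\<nu> / 4\<close> becomes the threshold
      \<open>\<nu> (k / 2)^2\<close>.\<close>
    have "AE x in lborel. x \<in> ball c (r / 2 / 2) \<longrightarrow> - u x \<le> - k + k / 2"
    proof (rule \<nu>(2)[OF dg(2)])
      have "AE x in lborel. x \<in> ball c (r / 2) \<longrightarrow> - u x \<le> - k + k"
        using u_nonneg by eventually_elim (use r in auto)
      then have "excess c (\<lambda>x. - u x) (- k) (r / 2) \<le> k\<^sup>2 * measure lborel {x \<in> ball c (r / 2). - k < - u x}"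
        using k r by (intro square_integral_le_const[OF dg(2)]) auto
      also have "\<dots> \<le> k\<^sup>2 * y"
      proof -
        have "measure lborel {x \<in> ball c (r / 2). - k < - u x} \<le> y"
          unfolding y_def by (intro measure_mono_fmeasurable fmeasurable_ball_subset[of _ c "r / 2"]) (auto, measurable)
        then show ?thesis by (rule mult_left_mono) simp
      qed
      also have "\<dots> \<le> k\<^sup>2 * (\<nu> / 4 * measure lborel (ball c (r / 2)))" using y by (rule mult_left_mono) simp
      finally show "excess c (\<lambda>x. - u x) (- k) (r / 2) \<le> \<nu> * (k / 2)\<^sup>2 * measure lborel (ball c (r / 2))"
        by (simp add: power_divide mult_ac)
    qed (use r k in auto)
    then have low: "AE x in lborel. x \<in> ball c (r / 4) \<longrightarrow> k / 2 \<le> u x" by eventually_elim auto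
    \<comment> \<open>Two almost everywhere statements hold on a common ball of positive measure, so
      some point satisfies both.\<close>
    have "k / 2 \<le> l + e" if e: "0 < e" for e
    proof -
      obtain \<delta> where \<delta>: "0 < \<delta>" "AE y in lborel. y \<in> ball c \<delta> \<longrightarrow> \<bar>u y - l\<bar> \<le> e" using l e by blast
      define \<rho> where "\<rho> = min \<delta> (r / 4)"
      have \<rho>: "0 < \<rho>" using \<delta> r by (simp add: \<rho>_def)
      have "\<exists>y. y \<in> ball c \<rho> \<and> \<bar>u y - l\<bar> \<le> e \<and> k / 2 \<le> u y"
      proof (rule ccontr)
        assume neg: "\<not> ?thesis"
        have "AE y in lborel. y \<notin> ball c \<rho>"
          using \<delta>(2) low by eventually_elim (use neg in \<open>auto simp: \<rho>_def\<close>)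
        then have "emeasure lborel (ball c \<rho>) = 0"
          by (subst (asm) AE_iff_measurable[of "ball c \<rho>"]) auto
        then show False using \<rho> unit_ball_vol_pos[of "real CARD('n)"] by (simp add: emeasure_ball)
      qed
      then show ?thesis by (auto simp: abs_le_iff)
    qed
    then have "k / 2 \<le> l" by (rule field_le_epsilon)
    then show "\<exists>l. \<epsilon> / 2 * r * sqrt m \<le> l \<and> (\<forall>e>0. \<exists>\<delta>>0. AE y in lborel. y \<in> ball c \<delta> \<longrightarrow> \<bar>u y - l\<bar> \<le> e)"
      using l by (intro exI[of _ l]) (simp add: k_def)
  qed
qed

section \<open>Weak gradients on open sets\<close>

text \<open>Functions on \<open>\<Omega>\<close> are Lebesgue measurable; they are replaced by Borel functions on the whole space
  that vanish outside \<open>\<Omega>\<close>.\<close>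

lemma indicator_scaleR_eq:
  fixes f :: "'a \<Rightarrow> 'b::real_vector"
  assumes "\<And>x. x \<notin> S \<Longrightarrow> f x = 0"
  shows "(\<lambda>x. indicator S x *\<^sub>R f x) = f"
proof
  show "indicator S x *\<^sub>R f x = f x" for x using assms[of x] by (cases "x \<in> S") auto
qed

text \<open>Each coordinate of a Lebesgue measurable function agrees almost everywhere with a Borel
  function; the finitely many exceptional sets are merged.\<close>

lemma borel_version:
  fixes f :: "real^'n::finite \<Rightarrow> 'b::euclidean_space"
  assumes \<Omega>: "\<Omega> \<in> sets borel" and f: "f \<in> borel_measurable (lebesgue_on \<Omega>)"
  shows "\<exists>f0\<in>borel_measurable borel. (AE x in lborel. x \<in> \<Omega> \<longrightarrow> f x = f0 x) \<and> (\<forall>x. x \<notin> \<Omega> \<longrightarrow> f0 x = 0)"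
proof -
  have "(\<lambda>x. indicator \<Omega> x *\<^sub>R f x) \<in> borel_measurable lebesgue"
    using f \<Omega> by (subst (asm) borel_measurable_restrict_space_iff) auto
  then have "\<exists>g\<in>borel_measurable lborel. AE x in lborel. (indicator \<Omega> x *\<^sub>R f x) \<bullet> b = g x" for b
    by (intro completion_ex_borel_measurable_real borel_measurable_inner) auto
  then have "\<forall>b. \<exists>g. g \<in> borel_measurable lborel \<and> (AE x in lborel. (indicator \<Omega> x *\<^sub>R f x) \<bullet> b = g x)" by blast
  from choice[OF this] obtain g where g: "\<And>b. g b \<in> borel_measurable lborel" "\<And>b. AE x in lborel. (indicator \<Omega> x *\<^sub>R f x) \<bullet> b = g b x"
    by blast
  define f0 where "f0 x = indicator \<Omega> x *\<^sub>R (\<Sum>b\<in>Basis. g b x *\<^sub>R b)" for x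
  have "f0 \<in> borel_measurable borel"
    unfolding f0_def[abs_def] using g(1) \<Omega> by measurable
  moreover have "AE x in lborel. \<forall>b\<in>Basis. (indicator \<Omega> x *\<^sub>R f x) \<bullet> b = g b x"
    using g(2) by (intro AE_finite_allI) auto
  then have "AE x in lborel. x \<in> \<Omega> \<longrightarrow> f x = f0 x"
  proof eventually_elim
    case (elim x)
    show ?case
    proof
      assume "x \<in> \<Omega>"
      then have "f0 x = (\<Sum>b\<in>Basis. (f x \<bullet> b) *\<^sub>R b)" using elim by (simp add: f0_def)
      then show "f x = f0 x" by (simp add: euclidean_representation)
    qed
  qed
  ultimately show ?thesis by (intro bexI[of _ f0]) (auto simp: f0_def)
qed

text \<open>The bridge between integrals over \<Omega> with respect to the completed measure, used
  in the statement, and integrals of Borel functions over the whole space, used in the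
  estimates.\<close>

lemma lebesgue_on_borel_version:
  fixes f f0 :: "real^'n::finite \<Rightarrow> 'b::euclidean_space"
  assumes \<Omega>: "\<Omega> \<in> sets borel" and f: "f \<in> borel_measurable (lebesgue_on \<Omega>)" and f0: "f0 \<in> borel_measurable borel"
    and eq: "AE x in lborel. x \<in> \<Omega> \<longrightarrow> f x = f0 x"
  shows "integrable (lebesgue_on \<Omega>) f \<longleftrightarrow> integrable lborel (\<lambda>x. indicator \<Omega> x *\<^sub>R f0 x)"
    and "(\<integral>x. f x \<partial>lebesgue_on \<Omega>) = (\<integral>x. indicator \<Omega> x *\<^sub>R f0 x \<partial>lborel)"
proof -
  have \<Omega>': "\<Omega> \<inter> space lebesgue \<in> sets lebesgue" using \<Omega> by simp
  have m1: "(\<lambda>x. indicator \<Omega> x *\<^sub>R f x) \<in> borel_measurable lebesgue"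
    using f \<Omega>' by (subst (asm) borel_measurable_restrict_space_iff) auto
  have m2: "(\<lambda>x. indicator \<Omega> x *\<^sub>R f0 x) \<in> borel_measurable borel" using \<Omega> f0 by measurable
  then have m3: "(\<lambda>x. indicator \<Omega> x *\<^sub>R f0 x) \<in> borel_measurable lebesgue" by (intro measurable_completion) simp
  have ae: "AE x in lebesgue. indicator \<Omega> x *\<^sub>R f x = indicator \<Omega> x *\<^sub>R f0 x"
    by (rule AE_completion) (use eq in \<open>eventually_elim, auto simp: indicator_def\<close>)
  show "integrable (lebesgue_on \<Omega>) f \<longleftrightarrow> integrable lborel (\<lambda>x. indicator \<Omega> x *\<^sub>R f0 x)"
    unfolding integrable_restrict_space[OF \<Omega>'] integrable_cong_AE[OF m1 m3 ae]
    using m2 by (intro integrable_completion) simp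
  show "(\<integral>x. f x \<partial>lebesgue_on \<Omega>) = (\<integral>x. indicator \<Omega> x *\<^sub>R f0 x \<partial>lborel)"
    unfolding integral_restrict_space[OF \<Omega>'] integral_cong_AE[OF m1 m3 ae]
    using m2 by (intro integral_completion) simp
qed

lemma borel_measurable_lebesgue_on:
  fixes f :: "real^'n::finite \<Rightarrow> 'b::euclidean_space"
  shows "f \<in> borel_measurable borel \<Longrightarrow> f \<in> borel_measurable (lebesgue_on \<Omega>)"
  by (intro measurable_restrict_space1 measurable_completion) simp

lemma AE_lebesgue_on_iff:
  fixes \<Omega> :: "(real^'n::finite) set"
  assumes "\<Omega> \<in> sets borel"
  shows "(AE x in lebesgue_on \<Omega>. P x) \<longleftrightarrow> (AE x in lborel. x \<in> \<Omega> \<longrightarrow> P x)"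
  using assms by (simp add: AE_restrict_space_iff AE_completion_iff)

lemma square_integrable_lebesgue_on:
  fixes f :: "real^'n::finite \<Rightarrow> 'b::euclidean_space"
  assumes "\<Omega> \<in> sets borel" "square_integrable lborel f"
  shows "square_integrable (lebesgue_on \<Omega>) f"
proof -
  have m: "f \<in> borel_measurable borel" using assms by (simp add: square_integrable_def)
  then have m2: "(\<lambda>x. (norm (f x))\<^sup>2) \<in> borel_measurable borel" by measurable
  have "integrable lborel (\<lambda>x. indicator \<Omega> x *\<^sub>R (norm (f x))\<^sup>2)"
    using square_integrable_integrable[OF assms(2)] assms(1) by (intro integrable_mult_indicator) auto
  then have "integrable (lebesgue_on \<Omega>) (\<lambda>x. (norm (f x))\<^sup>2)"
    using lebesgue_on_borel_version(1)[OF assms(1) borel_measurable_lebesgue_on[OF m2] m2] by simp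
  then show ?thesis using borel_measurable_lebesgue_on[OF m] by (simp add: square_integrable_def)
qed

lemma square_integrable_borel_version:
  fixes f :: "real^'n::finite \<Rightarrow> 'b::euclidean_space"
  assumes \<Omega>: "\<Omega> \<in> sets borel" and f: "square_integrable (lebesgue_on \<Omega>) f"
  shows "\<exists>f0. square_integrable lborel f0 \<and> (AE x in lborel. x \<in> \<Omega> \<longrightarrow> f x = f0 x) \<and> (\<forall>x. x \<notin> \<Omega> \<longrightarrow> f0 x = 0)"
proof -
  have fm: "f \<in> borel_measurable (lebesgue_on \<Omega>)" using f by (simp add: square_integrable_def)
  obtain f0 where f0: "f0 \<in> borel_measurable borel" "AE x in lborel. x \<in> \<Omega> \<longrightarrow> f x = f0 x" "\<forall>x. x \<notin> \<Omega> \<longrightarrow> f0 x = 0"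
    using borel_version[OF \<Omega> fm] by blast
  have m: "(\<lambda>x. (norm (f x))\<^sup>2) \<in> borel_measurable (lebesgue_on \<Omega>)" "(\<lambda>x. (norm (f0 x))\<^sup>2) \<in> borel_measurable borel"
    using fm f0(1) by measurable
  have "integrable lborel (\<lambda>x. indicator \<Omega> x *\<^sub>R (norm (f0 x))\<^sup>2)"
    by (rule iffD1[OF lebesgue_on_borel_version(1)[OF \<Omega> m]])
       (use f0(2) f in \<open>auto simp: square_integrable_def\<close>)
  also have "(\<lambda>x. indicator \<Omega> x *\<^sub>R (norm (f0 x))\<^sup>2) = (\<lambda>x. (norm (f0 x))\<^sup>2)"
    by (rule indicator_scaleR_eq) (simp add: f0(3))
  finally have "square_integrable lborel f0" using f0(1) by (simp add: square_integrable_def)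
  with f0 show ?thesis by blast
qed

text \<open>On a ball whose double lies in \<Omega>, multiplication by a cut-off function reduces
  the claim to the whole space. Countably many such balls cover \<Omega>, so their null sets add up
  to a null set.\<close>

lemma fundamental_lemma_open:
  fixes f :: "real^'n::finite \<Rightarrow> real"
  assumes \<Omega>: "open \<Omega>" and f: "square_integrable lborel f"
    and 0: "\<And>\<eta>. test_function \<Omega> \<eta> \<Longrightarrow> (\<integral>x. f x * \<eta> x \<partial>lborel) = 0"
  shows "AE x in lborel. x \<in> \<Omega> \<longrightarrow> f x = 0"
proof -
  define F where "F = {ball x e |x e. ball x (2 * e) \<subseteq> \<Omega> \<and> 0 < (e::real)}"
  have ball0: "AE y in lborel. y \<in> S \<longrightarrow> f y = 0" if "S \<in> F" for S
  proof -
    from that obtain x e where xe: "S = ball x e" "ball x (2 * e) \<subseteq> \<Omega>" "0 < e" by (auto simp: F_def)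
    obtain C where "cutoff_bound TYPE('n) C" using cutoff_bound_exists by blast
    then obtain \<psi> where \<psi>: "test_function (ball x (2 * e)) \<psi>" "\<forall>y\<in>ball x e. \<psi> y = 1"
      using xe(3) unfolding cutoff_bound_def by (metis less_add_same_cancel1 mult_2)
    obtain B where B: "0 < B" "\<And>x. \<bar>\<psi> x\<bar> \<le> B" "\<And>x. norm (grad \<psi> x) \<le> B"
      using test_function_bounded[OF \<psi>(1)] by metis
    have "square_integrable lborel (\<lambda>x. \<psi> x *\<^sub>R f x)"
      using test_function_measurable(1)[OF \<psi>(1)] by (intro square_integrable_mult_bounded[OF f _ B(2)]) simp
    then have "AE y in lborel. \<psi> y * f y = 0"
    proof (intro fundamental_lemma)
      fix \<eta> :: "real^'n \<Rightarrow> real" assume "test_function UNIV \<eta>"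
      then have "test_function \<Omega> (\<lambda>x. \<psi> x * \<eta> x)"
        using test_function_mono[OF \<psi>(1) xe(2)] by (intro test_function_mult test_function_smooth)
      from 0[OF this] show "(\<integral>x. \<psi> x * f x * \<eta> x \<partial>lborel) = 0" by (simp add: mult_ac)
    qed simp
    then show ?thesis unfolding xe(1) by eventually_elim (use \<psi>(2) in auto)
  qed
  obtain F' where F': "F' \<subseteq> F" "countable F'" "\<Union>F' = \<Union>F"
    using Lindelof[of F] by (auto simp: F_def)
  have "\<Omega> \<subseteq> \<Union>F"
  proof
    fix x assume "x \<in> \<Omega>"
    then obtain e where "0 < e" "ball x e \<subseteq> \<Omega>" using \<Omega> open_contains_ball by blast
    then have "ball x (e / 2) \<in> F" unfolding F_def by (auto intro!: exI[of _ x] exI[of _ "e / 2"])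
    then show "x \<in> \<Union>F" using \<open>0 < e\<close> by (intro UnionI[of "ball x (e / 2)"]) auto
  qed
  moreover have "AE y in lborel. \<forall>S\<in>F'. y \<in> S \<longrightarrow> f y = 0"
    using ball0 F' by (subst AE_ball_countable) auto
  then have "AE y in lborel. y \<in> \<Union>F' \<longrightarrow> f y = 0" by eventually_elim blast
  then have "AE y in lborel. y \<in> \<Union>F \<longrightarrow> f y = 0" unfolding F'(3) .
  ultimately show ?thesis by (auto elim!: eventually_mono)
qed

section \<open>Uniqueness and calculus of weak gradients on \<Omega>\<close>

lemma has_weak_gradient_square_integrable: "has_weak_gradient \<Omega> w G \<Longrightarrow> square_integrable (lebesgue_on \<Omega>) G"
  by (simp add: has_weak_gradient_def)

lemma has_weak_gradient_borel:
  fixes w w0 :: "real^'n::finite \<Rightarrow> real"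
  assumes \<Omega>: "open \<Omega>" and wG: "has_weak_gradient \<Omega> w G" and w: "w \<in> borel_measurable (lebesgue_on \<Omega>)"
    and w0: "w0 \<in> borel_measurable borel" "AE x in lborel. x \<in> \<Omega> \<longrightarrow> w x = w0 x"
    and G0: "G0 \<in> borel_measurable borel" "AE x in lborel. x \<in> \<Omega> \<longrightarrow> G x = G0 x"
    and \<eta>: "test_function \<Omega> \<eta>"
  shows "(\<integral>x. w0 x * partial_deriv i \<eta> x \<partial>lborel) = - (\<integral>x. G0 x $ i * \<eta> x \<partial>lborel)"
proof -
  have \<Omega>b: "\<Omega> \<in> sets borel" using \<Omega> by simp
  note m\<eta> = test_function_measurable[OF \<eta>]
  have out: "\<eta> x = 0" "partial_deriv i \<eta> x = 0" if "x \<notin> \<Omega>" for x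
    using test_function_outside[OF \<eta> that] test_function_grad_outside[OF \<eta> that] grad_nth[of \<eta> x i] by auto
  have nth: "(\<lambda>x. q x $ i) \<in> borel_measurable M" if "q \<in> borel_measurable M" for q :: "real^'n \<Rightarrow> real^'n" and M
    using measurable_compose[OF that, of "\<lambda>z. z $ i" borel] by auto
  have Gm: "G \<in> borel_measurable (lebesgue_on \<Omega>)"
    using has_weak_gradient_square_integrable[OF wG] by (simp add: square_integrable_def)
  have "(\<integral>x. w x * partial_deriv i \<eta> x \<partial>lebesgue_on \<Omega>) = (\<integral>x. indicator \<Omega> x *\<^sub>R (w0 x * partial_deriv i \<eta> x) \<partial>lborel)"
    using borel_measurable_lebesgue_on[OF m\<eta>(3)] w w0 m\<eta>
    by (intro lebesgue_on_borel_version(2) \<Omega>b borel_measurable_times) auto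
  also have "(\<lambda>x. indicator \<Omega> x *\<^sub>R (w0 x * partial_deriv i \<eta> x)) = (\<lambda>x. w0 x * partial_deriv i \<eta> x)"
    by (rule indicator_scaleR_eq) (simp add: out)
  finally have 1: "(\<integral>x. w x * partial_deriv i \<eta> x \<partial>lebesgue_on \<Omega>) = (\<integral>x. w0 x * partial_deriv i \<eta> x \<partial>lborel)" .
  have "(\<integral>x. G x $ i * \<eta> x \<partial>lebesgue_on \<Omega>) = (\<integral>x. indicator \<Omega> x *\<^sub>R (G0 x $ i * \<eta> x) \<partial>lborel)"
    using borel_measurable_lebesgue_on[OF m\<eta>(1)] nth[OF Gm] nth[OF G0(1)] G0(2) m\<eta>
    by (intro lebesgue_on_borel_version(2) \<Omega>b borel_measurable_times) auto
  also have "(\<lambda>x. indicator \<Omega> x *\<^sub>R (G0 x $ i * \<eta> x)) = (\<lambda>x. G0 x $ i * \<eta> x)"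
    by (rule indicator_scaleR_eq) (simp add: out)
  finally have 2: "(\<integral>x. G x $ i * \<eta> x \<partial>lebesgue_on \<Omega>) = (\<integral>x. G0 x $ i * \<eta> x \<partial>lborel)" .
  have "(\<integral>x. w x * partial_deriv i \<eta> x \<partial>lebesgue_on \<Omega>) = - (\<integral>x. G x $ i * \<eta> x \<partial>lebesgue_on \<Omega>)"
    using wG \<eta> unfolding has_weak_gradient_def by blast
  then show ?thesis unfolding 1 2 .
qed

text \<open>This makes \<open>weak_gradient\<close>, an arbitrary choice, computable: it agrees
  almost everywhere with any gradient exhibited by hand, so energies and \<open>H1_norm\<close> may
  be evaluated with the latter.\<close>

lemma has_weak_gradient_unique:
  fixes w :: "real^'n::finite \<Rightarrow> real"
  assumes \<Omega>: "open \<Omega>" and w: "w \<in> borel_measurable (lebesgue_on \<Omega>)"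
    and G: "has_weak_gradient \<Omega> w G1" "has_weak_gradient \<Omega> w G2"
  shows "AE x in lebesgue_on \<Omega>. G1 x = G2 x"
proof -
  have \<Omega>b: "\<Omega> \<in> sets borel" using \<Omega> by simp
  obtain w0 where w0: "w0 \<in> borel_measurable borel" "AE x in lborel. x \<in> \<Omega> \<longrightarrow> w x = w0 x"
    using borel_version[OF \<Omega>b w] by blast
  obtain H1 where H1: "square_integrable lborel H1" "AE x in lborel. x \<in> \<Omega> \<longrightarrow> G1 x = H1 x"
    using square_integrable_borel_version[OF \<Omega>b has_weak_gradient_square_integrable[OF G(1)]] by blast
  obtain H2 where H2: "square_integrable lborel H2" "AE x in lborel. x \<in> \<Omega> \<longrightarrow> G2 x = H2 x"
    using square_integrable_borel_version[OF \<Omega>b has_weak_gradient_square_integrable[OF G(2)]] by blast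
  have Hm: "H1 \<in> borel_measurable borel" "H2 \<in> borel_measurable borel" using H1 H2 by (auto simp: square_integrable_def)
  have "AE x in lborel. x \<in> \<Omega> \<longrightarrow> H1 x $ i - H2 x $ i = 0" for i
  proof (rule fundamental_lemma_open[OF \<Omega>])
    show "square_integrable lborel (\<lambda>x. H1 x $ i - H2 x $ i)"
      by (intro square_integrable_diff square_integrable_nth H1 H2)
    fix \<eta> assume \<eta>: "test_function \<Omega> \<eta>"
    have "(\<integral>x. H1 x $ i * \<eta> x \<partial>lborel) = (\<integral>x. H2 x $ i * \<eta> x \<partial>lborel)"
      using has_weak_gradient_borel[OF \<Omega> G(1) w w0 Hm(1) H1(2) \<eta>, of i]
        has_weak_gradient_borel[OF \<Omega> G(2) w w0 Hm(2) H2(2) \<eta>, of i] by simp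
    moreover have "integrable lborel (\<lambda>x. H1 x $ i * \<eta> x)" "integrable lborel (\<lambda>x. H2 x $ i * \<eta> x)"
      by (intro integrable_mult square_integrable_nth H1 H2 test_function_square_integrable[OF \<eta>])+
    ultimately show "(\<integral>x. (H1 x $ i - H2 x $ i) * \<eta> x \<partial>lborel) = 0" by (simp add: left_diff_distrib)
  qed
  then have "AE x in lborel. \<forall>i\<in>UNIV. x \<in> \<Omega> \<longrightarrow> H1 x $ i - H2 x $ i = 0" by (intro AE_finite_allI) auto
  with H1(2) H2(2) have "AE x in lborel. x \<in> \<Omega> \<longrightarrow> G1 x = G2 x"
    by eventually_elim (auto simp: vec_eq_iff)
  then show ?thesis by (simp add: AE_lebesgue_on_iff[OF \<Omega>b])
qed

lemma has_weak_gradient_weak_gradient: "has_weak_gradient \<Omega> w G \<Longrightarrow> has_weak_gradient \<Omega> w (weak_gradient \<Omega> w)"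
  unfolding weak_gradient_def by (rule someI[of "has_weak_gradient \<Omega> w"])

lemma weak_gradient_AE:
  assumes "open \<Omega>" "w \<in> borel_measurable (lebesgue_on \<Omega>)" "has_weak_gradient \<Omega> w G"
  shows "AE x in lebesgue_on \<Omega>. weak_gradient \<Omega> w x = G x"
  by (rule has_weak_gradient_unique[OF assms(1,2) has_weak_gradient_weak_gradient[OF assms(3)] assms(3)])

lemma H1_norm_eq:
  fixes w :: "real^'n::finite \<Rightarrow> real"
  assumes "open \<Omega>" "w \<in> borel_measurable (lebesgue_on \<Omega>)" "has_weak_gradient \<Omega> w G"
  shows "H1_norm \<Omega> w = sqrt ((\<integral>x. (w x)\<^sup>2 \<partial>lebesgue_on \<Omega>) + (\<integral>x. (norm (G x))\<^sup>2 \<partial>lebesgue_on \<Omega>))"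
proof -
  have [measurable]: "G \<in> borel_measurable (lebesgue_on \<Omega>)" "weak_gradient \<Omega> w \<in> borel_measurable (lebesgue_on \<Omega>)"
    using has_weak_gradient_square_integrable[OF assms(3)]
      has_weak_gradient_square_integrable[OF has_weak_gradient_weak_gradient[OF assms(3)]] by (auto simp: square_integrable_def)
  have "(\<integral>x. (norm (weak_gradient \<Omega> w x))\<^sup>2 \<partial>lebesgue_on \<Omega>) = (\<integral>x. (norm (G x))\<^sup>2 \<partial>lebesgue_on \<Omega>)"
    by (rule integral_cong_AE) (use weak_gradient_AE[OF assms] in auto)
  then show ?thesis by (simp add: H1_norm_def)
qed

lemma has_weak_gradient_add:
  fixes w w' :: "real^'n::finite \<Rightarrow> real"
  assumes \<Omega>: "\<Omega> \<in> sets borel" and w: "square_integrable (lebesgue_on \<Omega>) w" "square_integrable (lebesgue_on \<Omega>) w'"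
    and G: "has_weak_gradient \<Omega> w G" "has_weak_gradient \<Omega> w' G'"
  shows "has_weak_gradient \<Omega> (\<lambda>x. w x + w' x) (\<lambda>x. G x + G' x)"
  unfolding has_weak_gradient_def
proof (intro conjI allI impI)
  note sq = has_weak_gradient_square_integrable[OF G(1)] has_weak_gradient_square_integrable[OF G(2)]
  show "square_integrable (lebesgue_on \<Omega>) (\<lambda>x. G x + G' x)" by (intro square_integrable_add sq)
  fix \<eta> :: "real^'n \<Rightarrow> real" and i assume \<eta>: "test_function \<Omega> \<eta>"
  note s\<eta> = test_function_square_integrable[OF \<eta>, THEN square_integrable_lebesgue_on[OF \<Omega>]]
  have i: "integrable (lebesgue_on \<Omega>) (\<lambda>x. w x * partial_deriv i \<eta> x)" "integrable (lebesgue_on \<Omega>) (\<lambda>x. w' x * partial_deriv i \<eta> x)"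
    "integrable (lebesgue_on \<Omega>) (\<lambda>x. G x $ i * \<eta> x)" "integrable (lebesgue_on \<Omega>) (\<lambda>x. G' x $ i * \<eta> x)"
    by (intro integrable_mult square_integrable_nth w sq s\<eta>)+
  then show "(\<integral>x. (w x + w' x) * partial_deriv i \<eta> x \<partial>lebesgue_on \<Omega>) = - (\<integral>x. (G x + G' x) $ i * \<eta> x \<partial>lebesgue_on \<Omega>)"
    using G \<eta> by (simp add: distrib_right has_weak_gradient_def)
qed

lemma has_weak_gradient_minus:
  assumes "has_weak_gradient \<Omega> w G"
  shows "has_weak_gradient \<Omega> (\<lambda>x. - w x) (\<lambda>x. - G x)"
  using assms by (auto simp: has_weak_gradient_def square_integrable_def)

lemma has_weak_gradient_lborel:
  fixes w :: "real^'n::finite \<Rightarrow> real"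
  assumes \<Omega>: "\<Omega> \<in> sets borel" and w: "w \<in> borel_measurable borel" and G: "G \<in> borel_measurable borel"
    and sq: "square_integrable (lebesgue_on \<Omega>) G"
    and weak: "\<And>\<eta> i. test_function \<Omega> \<eta> \<Longrightarrow> (\<integral>x. w x * partial_deriv i \<eta> x \<partial>lborel) = - (\<integral>x. G x $ i * \<eta> x \<partial>lborel)"
  shows "has_weak_gradient \<Omega> w G"
  unfolding has_weak_gradient_def
proof (intro conjI allI impI sq)
  fix \<eta> :: "real^'n \<Rightarrow> real" and i assume \<eta>: "test_function \<Omega> \<eta>"
  note [measurable] = test_function_measurable[OF \<eta>] w G
  have [measurable]: "(\<lambda>x. G x $ i) \<in> borel_measurable borel"
    using measurable_compose[OF G, of "\<lambda>z. z $ i" borel] by auto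
  have out: "\<eta> x = 0" "partial_deriv i \<eta> x = 0" if "x \<notin> \<Omega>" for x
    using test_function_outside[OF \<eta> that] test_function_grad_outside[OF \<eta> that] grad_nth[of \<eta> x i] by auto
  have e: "(\<integral>x. q x \<partial>lebesgue_on \<Omega>) = (\<integral>x. q x \<partial>lborel)" if [measurable]: "q \<in> borel_measurable borel" and "\<And>x. x \<notin> \<Omega> \<Longrightarrow> q x = 0" for q :: "real^'n \<Rightarrow> real"
  proof -
    have "(\<integral>x. q x \<partial>lebesgue_on \<Omega>) = (\<integral>x. indicator \<Omega> x *\<^sub>R q x \<partial>lborel)"
      by (rule lebesgue_on_borel_version(2)[OF \<Omega> borel_measurable_lebesgue_on[OF that(1)] that(1)]) simp
    also have "(\<lambda>x. indicator \<Omega> x *\<^sub>R q x) = q" by (rule indicator_scaleR_eq[OF that(2)])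
    finally show ?thesis .
  qed
  show "(\<integral>x. w x * partial_deriv i \<eta> x \<partial>lebesgue_on \<Omega>) = - (\<integral>x. G x $ i * \<eta> x \<partial>lebesgue_on \<Omega>)"
  proof -
    have "(\<integral>x. w x * partial_deriv i \<eta> x \<partial>lebesgue_on \<Omega>) = (\<integral>x. w x * partial_deriv i \<eta> x \<partial>lborel)"
      by (rule e) (use test_function_measurable[OF \<eta>] w out in \<open>auto intro!: borel_measurable_times\<close>)
    moreover have "(\<integral>x. G x $ i * \<eta> x \<partial>lebesgue_on \<Omega>) = (\<integral>x. G x $ i * \<eta> x \<partial>lborel)"
      by (rule e) (use test_function_measurable[OF \<eta>] \<open>(\<lambda>x. G x $ i) \<in> borel_measurable borel\<close> out in \<open>auto intro!: borel_measurable_times\<close>)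
    ultimately show ?thesis using weak[OF \<eta>, of i] by simp
  qed
qed

lemma H1_pair_has_weak_gradient:
  assumes "\<Omega> \<in> sets borel" "H1_pair h g"
  shows "has_weak_gradient \<Omega> h g"
  using assms H1_pairD[OF assms(2)] test_function_mono[of \<Omega> _ UNIV]
  by (intro has_weak_gradient_lborel square_integrable_lebesgue_on) auto

lemma smooth_square_integrable_bounded:
  fixes v :: "real^'n::finite \<Rightarrow> 'b::euclidean_space"
  assumes \<Omega>: "\<Omega> \<in> sets borel" "bounded \<Omega>" and v: "continuous_on UNIV v"
  shows "square_integrable (lebesgue_on \<Omega>) v"
proof -
  have vm [measurable]: "v \<in> borel_measurable borel" using v by (rule borel_measurable_continuous_onI)
  have "bounded (v ` closure \<Omega>)"
    using \<Omega>(2) by (intro compact_imp_bounded compact_continuous_image continuous_on_subset[OF v]) auto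
  then obtain B where "\<forall>y\<in>v ` closure \<Omega>. norm y \<le> B" unfolding bounded_iff by blast
  then have B: "\<And>x. x \<in> \<Omega> \<Longrightarrow> norm (v x) \<le> B" using closure_subset by blast
  have "square_integrable lborel (\<lambda>x. indicator \<Omega> x *\<^sub>R v x)"
  proof (rule square_integrable_bound[OF square_integrable_indicator[OF \<Omega>], of _ B])
    show "(\<lambda>x. indicator \<Omega> x *\<^sub>R v x) \<in> borel_measurable lborel" using \<Omega>(1) by measurable
    show "AE x in lborel. norm (indicator \<Omega> x *\<^sub>R v x) \<le> B * norm (indicator \<Omega> x :: real)"
      using B by (auto simp: indicator_def)
  qed
  then have "square_integrable (lebesgue_on \<Omega>) (\<lambda>x. indicator \<Omega> x *\<^sub>R v x)" by (rule square_integrable_lebesgue_on[OF \<Omega>(1)])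
  then show ?thesis
  proof (rule square_integrable_bound[of _ _ _ 1])
    show "v \<in> borel_measurable (lebesgue_on \<Omega>)" by (rule borel_measurable_lebesgue_on[OF vm])
    show "AE x in lebesgue_on \<Omega>. norm (v x) \<le> 1 * norm (indicator \<Omega> x *\<^sub>R v x)"
      unfolding AE_lebesgue_on_iff[OF \<Omega>(1)] by auto
  qed
qed

lemma smooth_has_weak_gradient:
  fixes v :: "real^'n::finite \<Rightarrow> real"
  assumes "\<Omega> \<in> sets borel" "bounded \<Omega>" "smooth v"
  shows "has_weak_gradient \<Omega> v (grad v)"
  using assms integral_by_parts[OF assms(3) test_function_mono[of \<Omega> _ UNIV]]
  by (intro has_weak_gradient_lborel smooth_square_integrable_bounded smooth_continuous_grad)
     (auto intro!: borel_measurable_continuous_onI smooth_continuous smooth_continuous_grad)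

section \<open>Compactly supported perturbations keep the trace\<close>

text \<open>To the smooth functions \<open>v k\<close> approximating \<open>u\<close> one adds
  mollifications of \<open>h\<close>. These converge to \<open>h\<close> in \<open>H^1\<close> and,
  from some index on, vanish on the boundary, so the boundary integrals stay exactly the
  same.\<close>

lemma has_trace_perturb:
  fixes u h :: "real^'n::finite \<Rightarrow> real"
  assumes \<Omega>: "open \<Omega>" "bounded \<Omega>" and tr: "has_trace \<Omega> u g"
    and h: "H1_pair h gh" and out: "AE y in lborel. y \<notin> ball c \<rho> \<longrightarrow> h y = 0" and \<rho>: "\<rho> < r" "ball c r \<subseteq> \<Omega>"
  shows "has_trace \<Omega> (\<lambda>x. u x + h x) g"
proof -
  let ?M = "lebesgue_on \<Omega>"
  have \<Omega>b: "\<Omega> \<in> sets borel" using \<Omega> by simp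
  obtain v :: "nat \<Rightarrow> real^'n \<Rightarrow> real" where v: "\<And>k. smooth (v k)" "(\<lambda>k. H1_norm \<Omega> (\<lambda>x. v k x - u x)) \<longlonglongrightarrow> 0"
    "(\<lambda>k. \<integral>\<^sup>+x. ennreal ((v k x - g x)\<^sup>2) \<partial>surface_measure \<Omega>) \<longlonglongrightarrow> 0"
    and u: "square_integrable ?M u" and g: "square_integrable (surface_measure \<Omega>) g" and "\<exists>G. has_weak_gradient \<Omega> u G"
    using tr unfolding has_trace_def H1_def by blast
  then obtain G where G: "has_weak_gradient \<Omega> u G" by blast
  obtain q :: "nat \<Rightarrow> real^'n \<Rightarrow> real" where q: "\<And>k. smooth (q k)" "\<And>k. square_integrable lborel (q k)" "\<And>k. square_integrable lborel (grad (q k))"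
    "(\<lambda>k. \<integral>x. (q k x - h x)\<^sup>2 \<partial>lborel) \<longlonglongrightarrow> 0" "(\<lambda>k. \<integral>x. (norm (grad (q k) x - gh x))\<^sup>2 \<partial>lborel) \<longlonglongrightarrow> 0"
    "\<And>k x K. (AE y in lborel. y \<notin> K \<longrightarrow> h y = 0) \<Longrightarrow> (\<forall>y\<in>K. inverse (real (Suc k)) \<le> dist x y) \<Longrightarrow> q k x = 0"
    using H1_pair_smooth_approximation[OF h] by blast
  have "0 < r - \<rho>" using \<rho> by simp
  then obtain N where N: "inverse (real (Suc N)) < r - \<rho>" using reals_Archimedean by blast
  \<comment> \<open>Boundary points lie outside \<open>ball c r\<close>, hence at distance at least
    \<open>r - \<rho>\<close> from the ball that carries \<open>h\<close>; from index
    \<open>N\<close> on, the mollification radius is smaller than this.\<close>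
  have q0: "q (k + N) x = 0" if x: "x \<in> frontier \<Omega>" for x k
  proof (rule q(6)[OF out], intro ballI)
    fix y assume y: "y \<in> ball c \<rho>"
    have "x \<notin> \<Omega>" using x \<Omega>(1) by (simp add: frontier_def interior_open)
    then have "r \<le> dist c x" using \<rho>(2) by (meson mem_ball not_less subsetD)
    moreover have "dist c x \<le> dist c y + dist x y" using dist_triangle[of c x y] by (simp add: dist_commute)
    moreover have "dist c y < \<rho>" using y by simp
    moreover have "inverse (real (Suc (k + N))) \<le> inverse (real (Suc N))" by (intro le_imp_inverse_le) auto
    ultimately show "inverse (real (Suc (k + N))) \<le> dist x y" using N by linarith
  qed
  have sh: "square_integrable ?M h" by (rule square_integrable_lebesgue_on[OF \<Omega>b H1_pairD(1)[OF h]])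
  have wh: "has_weak_gradient \<Omega> h gh" by (rule H1_pair_has_weak_gradient[OF \<Omega>b h])
  have su: "square_integrable ?M (\<lambda>x. u x + h x)" by (rule square_integrable_add[OF u sh])
  have wu: "has_weak_gradient \<Omega> (\<lambda>x. u x + h x) (\<lambda>x. G x + gh x)" by (rule has_weak_gradient_add[OF \<Omega>b u sh G wh])
  define a where "a k x = v k x - u x" for k x
  define ga where "ga k x = grad (v k) x - G x" for k x
  define b where "b k x = q (k + N) x - h x" for k x
  define gb where "gb k x = grad (q (k + N)) x - gh x" for k x
  have sneg: "square_integrable ?M (\<lambda>x. - w x)" if "square_integrable ?M w" for w :: "real^'n \<Rightarrow> real"
    using that by (auto simp: square_integrable_def)
  have diff: "square_integrable ?M (\<lambda>x. w x - w' x)" "has_weak_gradient \<Omega> (\<lambda>x. w x - w' x) (\<lambda>x. W x - W' x)"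
    if "square_integrable ?M w" "square_integrable ?M w'" "has_weak_gradient \<Omega> w W" "has_weak_gradient \<Omega> w' W'" for w w' W W'
    using has_weak_gradient_add[OF \<Omega>b that(1) sneg[OF that(2)] that(3) has_weak_gradient_minus[OF that(4)]]
      square_integrable_diff[OF that(1,2)] by auto
  have sv: "square_integrable ?M (v k)" "has_weak_gradient \<Omega> (v k) (grad (v k))" for k
    by (intro smooth_square_integrable_bounded smooth_has_weak_gradient smooth_continuous v \<Omega>b \<Omega>(2))+
  have sq: "square_integrable ?M (q k)" "has_weak_gradient \<Omega> (q k) (grad (q k))" for k
    by (intro smooth_square_integrable_bounded smooth_has_weak_gradient smooth_continuous q \<Omega>b \<Omega>(2))+
  have A: "square_integrable ?M (a k)" "has_weak_gradient \<Omega> (a k) (ga k)" for k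
    unfolding a_def[abs_def] ga_def[abs_def] by (rule diff[OF sv(1) u sv(2) G])+
  have B: "square_integrable ?M (b k)" "has_weak_gradient \<Omega> (b k) (gb k)" for k
    unfolding b_def[abs_def] gb_def[abs_def] by (rule diff[OF sq(1) sh sq(2) wh])+
  note sga = has_weak_gradient_square_integrable[OF A(2)] and sgb = has_weak_gradient_square_integrable[OF B(2)]
  have meas: "w \<in> borel_measurable ?M" if "square_integrable ?M w" for w :: "real^'n \<Rightarrow> real" using that by (simp add: square_integrable_def)
  have nA: "(H1_norm \<Omega> (a k))\<^sup>2 = (\<integral>x. (norm (a k x))\<^sup>2 \<partial>?M) + (\<integral>x. (norm (ga k x))\<^sup>2 \<partial>?M)" for k
    unfolding H1_norm_eq[OF \<Omega>(1) meas[OF A(1)] A(2)] by simp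
  define e where "e k = (\<integral>x. (q (k + N) x - h x)\<^sup>2 \<partial>lborel) + (\<integral>x. (norm (grad (q (k + N)) x - gh x))\<^sup>2 \<partial>lborel)" for k
  have elim: "e \<longlonglongrightarrow> 0 + 0" unfolding e_def[abs_def]
    by (intro tendsto_add LIMSEQ_ignore_initial_segment q)
  have le_lborel: "(\<integral>x. (norm (z x))\<^sup>2 \<partial>?M) \<le> (\<integral>x. (norm (z x))\<^sup>2 \<partial>lborel)"
    if z: "square_integrable lborel z" for z :: "real^'n \<Rightarrow> 'c::euclidean_space"
  proof -
    have m: "(\<lambda>x. (norm (z x))\<^sup>2) \<in> borel_measurable borel" using z by (auto simp: square_integrable_def)
    have "(\<integral>x. (norm (z x))\<^sup>2 \<partial>?M) = (\<integral>x. indicator \<Omega> x *\<^sub>R (norm (z x))\<^sup>2 \<partial>lborel)"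
      by (rule lebesgue_on_borel_version(2)[OF \<Omega>b borel_measurable_lebesgue_on[OF m] m]) simp
    also have "\<dots> \<le> (\<integral>x. (norm (z x))\<^sup>2 \<partial>lborel)"
      using square_integrable_integrable[OF z] \<Omega>b
      by (intro integral_mono integrable_mult_indicator) (auto simp: indicator_def)
    finally show ?thesis .
  qed
  have nB: "(\<integral>x. (norm (b k x))\<^sup>2 \<partial>?M) + (\<integral>x. (norm (gb k x))\<^sup>2 \<partial>?M) \<le> e k" for k
    using le_lborel[OF square_integrable_diff[OF q(2)[of "k + N"] H1_pairD(1)[OF h]]]
      le_lborel[OF square_integrable_diff[OF q(3)[of "k + N"] H1_pairD(2)[OF h]]]
    by (simp add: e_def b_def gb_def)
  have sum2: "(\<integral>x. (norm (z x + z' x))\<^sup>2 \<partial>?M) \<le> 2 * (\<integral>x. (norm (z x))\<^sup>2 \<partial>?M) + 2 * (\<integral>x. (norm (z' x))\<^sup>2 \<partial>?M)"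
    if "square_integrable ?M z" "square_integrable ?M z'" for z z' :: "real^'n \<Rightarrow> 'c::euclidean_space"
  proof -
    have "(\<integral>x. (norm (z x + z' x))\<^sup>2 \<partial>?M) \<le> (\<integral>x. 2 * (norm (z x))\<^sup>2 + 2 * (norm (z' x))\<^sup>2 \<partial>?M)"
      using square_integrable_integrable[OF square_integrable_add[OF that]] square_integrable_integrable[OF that(1)]
        square_integrable_integrable[OF that(2)] power2_norm_add_le by (intro integral_mono) auto
    also have "\<dots> = 2 * (\<integral>x. (norm (z x))\<^sup>2 \<partial>?M) + 2 * (\<integral>x. (norm (z' x))\<^sup>2 \<partial>?M)"
      using square_integrable_integrable[OF that(1)] square_integrable_integrable[OF that(2)] by simp
    finally show ?thesis .
  qed
  have bound: "norm (H1_norm \<Omega> (\<lambda>x. v k x + q (k + N) x - (u x + h x))) \<le> sqrt (2 * (H1_norm \<Omega> (a k))\<^sup>2 + 2 * e k)" for k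
  proof -
    have eq: "(\<lambda>x. v k x + q (k + N) x - (u x + h x)) = (\<lambda>x. a k x + b k x)" by (auto simp: a_def b_def)
    have "H1_norm \<Omega> (\<lambda>x. a k x + b k x) = sqrt ((\<integral>x. (a k x + b k x)\<^sup>2 \<partial>?M) + (\<integral>x. (norm (ga k x + gb k x))\<^sup>2 \<partial>?M))"
      by (rule H1_norm_eq[OF \<Omega>(1) meas[OF square_integrable_add[OF A(1) B(1)]] has_weak_gradient_add[OF \<Omega>b A(1) B(1) A(2) B(2)]])
    also have "\<dots> \<le> sqrt (2 * (H1_norm \<Omega> (a k))\<^sup>2 + 2 * e k)"
      using sum2[OF A(1)[of k] B(1)[of k]] sum2[OF sga[of k] sgb[of k]] nB[of k] unfolding nA
      by (intro real_sqrt_le_mono) simp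
    finally show ?thesis unfolding eq by (simp add: H1_norm_def)
  qed
  have "(\<lambda>k. H1_norm \<Omega> (a k)) \<longlonglongrightarrow> 0" using v(2) by (simp add: a_def[abs_def])
  then have "(\<lambda>k. sqrt (2 * (H1_norm \<Omega> (a k))\<^sup>2 + 2 * e k)) \<longlonglongrightarrow> sqrt (2 * 0\<^sup>2 + 2 * (0 + 0))"
    by (intro tendsto_intros elim)
  then have lim: "(\<lambda>k. sqrt (2 * (H1_norm \<Omega> (a k))\<^sup>2 + 2 * e k)) \<longlonglongrightarrow> 0" by simp
  have "(\<integral>\<^sup>+x. ennreal ((v k x + q (k + N) x - g x)\<^sup>2) \<partial>surface_measure \<Omega>) = (\<integral>\<^sup>+x. ennreal ((v k x - g x)\<^sup>2) \<partial>surface_measure \<Omega>)" for k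
    by (intro nn_integral_cong) (simp add: surface_measure_def space_restrict_space q0)
  then have "(\<lambda>k. \<integral>\<^sup>+x. ennreal ((v k x + q (k + N) x - g x)\<^sup>2) \<partial>surface_measure \<Omega>) \<longlonglongrightarrow> 0" using v(3) by simp
  moreover have "(\<lambda>k. H1_norm \<Omega> (\<lambda>x. v k x + q (k + N) x - (u x + h x))) \<longlonglongrightarrow> 0"
    by (rule null_sequence_comparison[OF bound lim])
  moreover have "smooth (\<lambda>x. v k x + q (k + N) x)" for k by (intro smooth_add v q)
  moreover have "(\<lambda>x. u x + h x) \<in> H1 \<Omega>" unfolding H1_def using su wu by blast
  ultimately show ?thesis unfolding has_trace_def using g
    by (intro conjI exI[of _ "\<lambda>k x. v k x + q (k + N) x"]) auto
qed

section \<open>The free boundary problem\<close>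

text \<open>Extracts from global minimality what the local theory needs. The competitor
  \<open>u + h\<close> keeps the trace since \<open>h\<close> is compactly supported in \<Omega>;
  the energies differ by the expanded quadratic form, and the potential term drops by at least
  \<open>m\<close> on the part of the ball where \<open>u + h \<le> 0\<close>.\<close>

lemma J_minimizer_local_minimizer:
  fixes u :: "real^'n::finite \<Rightarrow> real"
  assumes lam: "0 < lam" "lam \<le> Lam" and dom: "bounded_lipschitz_domain \<Omega>" and ell: "A \<in> elliptic_matrices lam Lam \<Omega>"
    and \<phi>: "\<phi> \<in> borel_measurable (lebesgue_on \<Omega>)" and J: "J_minimizer \<Omega> A \<phi> g u"
    and r: "0 < r" "ball c r \<subseteq> positivity_set \<Omega> u"
    and m: "0 < m" "AE y in lborel. y \<in> ball c r \<longrightarrow> m \<le> \<phi> y"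
  shows "\<exists>A1 u0 G0. local_minimizer lam Lam A1 c r m u0 G0 \<and> (AE y in lborel. y \<in> \<Omega> \<longrightarrow> u y = u0 y)"
proof -
  let ?M = "lebesgue_on \<Omega>"
  have \<Omega>: "open \<Omega>" "bounded \<Omega>" using dom by (auto simp: bounded_lipschitz_domain_def)
  then have \<Omega>b: "\<Omega> \<in> sets borel" by simp
  note ae = AE_lebesgue_on_iff[OF \<Omega>b]
  have sub: "ball c r \<subseteq> \<Omega>" and upos: "\<And>y. y \<in> ball c r \<Longrightarrow> 0 < u y" using r(2) by (auto simp: positivity_set_def)
  have tr: "has_trace \<Omega> u g" and Jfin: "J_functional \<Omega> A \<phi> u < \<infinity>"
    and Jmin: "\<And>w. w \<in> H1_trace \<Omega> g \<Longrightarrow> J_functional \<Omega> A \<phi> u \<le> J_functional \<Omega> A \<phi> w"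
    using J by (auto simp: J_minimizer_def H1_trace_def)
  have uM: "square_integrable ?M u" and "\<exists>G. has_weak_gradient \<Omega> u G"
    using tr by (auto simp: has_trace_def H1_def)
  then have Gu: "has_weak_gradient \<Omega> u (weak_gradient \<Omega> u)" using has_weak_gradient_weak_gradient by blast
  define G where "G = weak_gradient \<Omega> u"
  have wG: "has_weak_gradient \<Omega> u G" unfolding G_def by (rule Gu)
  have GM: "square_integrable ?M G" by (rule has_weak_gradient_square_integrable[OF wG])
  have Am [measurable]: "A \<in> borel_measurable ?M" and Asym: "\<And>x. x \<in> \<Omega> \<Longrightarrow> transpose (A x) = A x"
    and Alow: "\<And>x e. x \<in> \<Omega> \<Longrightarrow> lam * (norm e)\<^sup>2 \<le> e \<bullet> (A x *v e)"
    and Aupp: "\<And>x e. x \<in> \<Omega> \<Longrightarrow> e \<bullet> (A x *v e) \<le> Lam * (norm e)\<^sup>2"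
    using ell by (auto simp: elliptic_matrices_def)
  obtain u0 where u0: "square_integrable lborel u0" "AE x in lborel. x \<in> \<Omega> \<longrightarrow> u x = u0 x" "\<forall>x. x \<notin> \<Omega> \<longrightarrow> u0 x = 0"
    using square_integrable_borel_version[OF \<Omega>b uM] by blast
  obtain G0 where G0: "square_integrable lborel G0" "AE x in lborel. x \<in> \<Omega> \<longrightarrow> G x = G0 x" "\<forall>x. x \<notin> \<Omega> \<longrightarrow> G0 x = 0"
    using square_integrable_borel_version[OF \<Omega>b GM] by blast
  obtain A0 where A0: "A0 \<in> borel_measurable borel" "AE x in lborel. x \<in> \<Omega> \<longrightarrow> A x = A0 x"
    using borel_version[OF \<Omega>b Am] by blast
  obtain N where N: "N \<in> null_sets lborel" "{x \<in> space lborel. \<not> (x \<in> \<Omega> \<longrightarrow> A x = A0 x)} \<subseteq> N"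
    using A0(2) by (auto elim: AE_E simp: null_sets_def)
  \<comment> \<open>Off \<Omega> and on the null set where the Borel version may fail to be
    elliptic, a multiple of the identity restores the bounds at every point.\<close>
  define A1 where "A1 x = (if x \<in> \<Omega> - N then A0 x else lam *\<^sub>R mat 1)" for x
  have A1A: "A1 x = A x" if "x \<in> \<Omega> - N" for x using that N(2) by (auto simp: A1_def)
  have Nb: "N \<in> sets borel" using N(1) by auto
  have Nae: "AE x in lborel. x \<notin> N" using N(1) by (rule AE_not_in)
  interpret E: elliptic_field lam Lam A1
  proof
    show "A1 \<in> borel_measurable borel" unfolding A1_def[abs_def] using A0(1) Nb \<Omega>b by measurable
    show "transpose (A1 x) = A1 x" for x
    proof (cases "x \<in> \<Omega> - N")
      case True
      then show ?thesis using A1A[OF True] Asym[of x] by simp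
    next
      case False
      then have "A1 x = lam *\<^sub>R mat 1" by (simp only: A1_def if_False)
      then show ?thesis by (simp add: vec_eq_iff transpose_def mat_def)
    qed
    have out: "e \<bullet> (A1 x *v e) = lam * (norm e)\<^sup>2" if "x \<notin> \<Omega> - N" for x e
    proof -
      have "A1 x = lam *\<^sub>R mat 1" using that by (simp only: A1_def if_False)
      then have "A1 x *v e = lam *\<^sub>R e" by (simp add: scaleR_matrix_vector_assoc[symmetric])
      then show ?thesis by (simp add: power2_norm_eq_inner)
    qed
    show "lam * (norm e)\<^sup>2 \<le> e \<bullet> (A1 x *v e)" for x e
      using out[of x e] A1A[of x] Alow[of x e] by (cases "x \<in> \<Omega> - N") auto
    show "e \<bullet> (A1 x *v e) \<le> Lam * (norm e)\<^sup>2" for x e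
      using out[of x e] A1A[of x] Aupp[of x e] lam by (cases "x \<in> \<Omega> - N") (auto intro: mult_right_mono)
  qed (use lam in auto)
  have u0m: "u0 \<in> borel_measurable borel" and G0m: "G0 \<in> borel_measurable borel"
    using u0(1) G0(1) by (auto simp: square_integrable_def)
  have um: "u \<in> borel_measurable ?M" and Gm [measurable]: "G \<in> borel_measurable ?M" using uM GM by (auto simp: square_integrable_def)
  have form: "integrable ?M (\<lambda>x. p x \<bullet> (A x *v q x))" "(\<integral>x. p x \<bullet> (A x *v q x) \<partial>?M) = (\<integral>x. p0 x \<bullet> (A1 x *v q0 x) \<partial>lborel)"
    if p: "p \<in> borel_measurable ?M" "square_integrable lborel p0" "AE x in lborel. x \<in> \<Omega> \<longrightarrow> p x = p0 x"
      and q: "q \<in> borel_measurable ?M" "square_integrable lborel q0" "AE x in lborel. x \<in> \<Omega> \<longrightarrow> q x = q0 x"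
      and out: "AE x in lborel. x \<notin> \<Omega> \<longrightarrow> q0 x = 0" for p p0 q q0
  proof -
    have m0 [measurable]: "p0 \<in> borel_measurable borel" "q0 \<in> borel_measurable borel"
      using p q by (auto simp: square_integrable_def)
    note [measurable] = p(1) q(1)
    have mf: "(\<lambda>x. p x \<bullet> (A x *v q x)) \<in> borel_measurable ?M" by measurable
    have mf0: "(\<lambda>x. p0 x \<bullet> (A1 x *v q0 x)) \<in> borel_measurable borel" by measurable
    have eq: "AE x in lborel. x \<in> \<Omega> \<longrightarrow> p x \<bullet> (A x *v q x) = p0 x \<bullet> (A1 x *v q0 x)"
      using p(3) q(3) Nae by eventually_elim (use A1A in auto)
    have mi: "(\<lambda>x. indicator \<Omega> x *\<^sub>R (p0 x \<bullet> (A1 x *v q0 x))) \<in> borel_measurable borel" using \<Omega>b by measurable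
    have eq2: "AE x in lborel. indicator \<Omega> x *\<^sub>R (p0 x \<bullet> (A1 x *v q0 x)) = p0 x \<bullet> (A1 x *v q0 x)"
      using out by eventually_elim (auto simp: indicator_def)
    have "integrable lborel (\<lambda>x. indicator \<Omega> x *\<^sub>R (p0 x \<bullet> (A1 x *v q0 x)))"
      by (rule iffD2[OF integrable_cong_AE[OF _ _ eq2] E.A_integrable[OF p(2) q(2)]]) (use mi mf0 in simp_all)
    then show "integrable ?M (\<lambda>x. p x \<bullet> (A x *v q x))"
      using lebesgue_on_borel_version(1)[OF \<Omega>b mf mf0 eq] by simp
    show "(\<integral>x. p x \<bullet> (A x *v q x) \<partial>?M) = (\<integral>x. p0 x \<bullet> (A1 x *v q0 x) \<partial>lborel)"
      unfolding lebesgue_on_borel_version(2)[OF \<Omega>b mf mf0 eq]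
      by (rule integral_cong_AE) (use mi mf0 eq2 in auto)
  qed
  have Gout: "AE x in lborel. x \<notin> \<Omega> \<longrightarrow> G0 x = 0" using G0(3) by auto
  note iGG = form[OF Gm G0(1,2) Gm G0(1,2) Gout]
  define Tu where "Tu x = \<phi> x * indicator (positivity_set \<Omega> u) x" for x
  have Iu: "J_integrand \<Omega> A \<phi> u = (\<lambda>x. G x \<bullet> (A x *v G x) + Tu x)"
    by (auto simp: J_integrand_def G_def Tu_def)
  \<comment> \<open>A nonintegrable integrand would give \<open>J_functional\<close> the value
    \<open>\<infinity>\<close>.\<close>
  have iIu: "integrable ?M (\<lambda>x. G x \<bullet> (A x *v G x) + Tu x)"
    using Jfin unfolding J_functional_def Iu by (auto split: if_splits)
  have iTu: "integrable ?M Tu"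
    using Bochner_Integration.integrable_diff[OF iIu iGG(1)] by simp
  have min: "m * measure lborel {y \<in> ball c r. u0 y + h y \<le> 0} \<le>
        2 * (\<integral>x. G0 x \<bullet> (A1 x *v gh x) \<partial>lborel) + (\<integral>x. gh x \<bullet> (A1 x *v gh x) \<partial>lborel)"
    if h: "H1_pair h gh" and \<rho>: "\<rho> < r" and out: "AE y in lborel. y \<notin> ball c \<rho> \<longrightarrow> h y = 0 \<and> gh y = 0" for h gh \<rho>
  proof -
    define w where "w x = u x + h x" for x
    have "AE y in lborel. y \<notin> ball c \<rho> \<longrightarrow> h y = 0" using out by eventually_elim auto
    then have trw: "has_trace \<Omega> w g" unfolding w_def[abs_def] by (rule has_trace_perturb[OF \<Omega> tr h _ \<rho> sub])
    then have wH: "w \<in> H1_trace \<Omega> g" by (auto simp: H1_trace_def has_trace_def)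
    have hM: "square_integrable ?M h" by (rule square_integrable_lebesgue_on[OF \<Omega>b H1_pairD(1)[OF h]])
    have wgw: "has_weak_gradient \<Omega> w (\<lambda>x. G x + gh x)"
      unfolding w_def[abs_def] by (rule has_weak_gradient_add[OF \<Omega>b uM hM wG H1_pair_has_weak_gradient[OF \<Omega>b h]])
    have wM: "square_integrable ?M w" unfolding w_def[abs_def] by (rule square_integrable_add[OF uM hM])
    then have wm [measurable]: "w \<in> borel_measurable ?M" by (simp add: square_integrable_def)
    have gwm [measurable]: "weak_gradient \<Omega> w \<in> borel_measurable ?M"
      using has_weak_gradient_square_integrable[OF has_weak_gradient_weak_gradient[OF wgw]] by (simp add: square_integrable_def)
    have gw: "AE x in ?M. weak_gradient \<Omega> w x = G x + gh x" by (rule weak_gradient_AE[OF \<Omega>(1) wm wgw])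
    have hm [measurable]: "h \<in> borel_measurable borel" "gh \<in> borel_measurable borel" using H1_pairD(3,4)[OF h] .
    note ghM [measurable] = borel_measurable_lebesgue_on[OF hm(2)]
    have ghout: "AE x in lborel. x \<notin> \<Omega> \<longrightarrow> gh x = 0"
    proof -
      have "ball c \<rho> \<subseteq> \<Omega>" using sub \<rho> subset_ball[of \<rho> r c] by auto
      with out show ?thesis by (auto elim!: eventually_mono)
    qed
    have ghae: "AE x in lborel. x \<in> \<Omega> \<longrightarrow> gh x = gh x" by simp
    note iGg = form[OF Gm G0(1,2) ghM H1_pairD(2)[OF h] ghae ghout]
    note igg = form[OF ghM H1_pairD(2)[OF h] ghae ghM H1_pairD(2)[OF h] ghae ghout]
    define S where "S = {y \<in> ball c r. u0 y + h y \<le> 0}"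
    have Sb: "S \<in> sets borel" unfolding S_def using u0m by measurable
    define Tw where "Tw x = \<phi> x * indicator (positivity_set \<Omega> w) x" for x
    have ps: "indicator (positivity_set \<Omega> w) x = (if 0 < w x then 1 else 0 :: real)" "indicator (positivity_set \<Omega> u) x = (if 0 < u x then 1 else 0 :: real)"
      if "x \<in> \<Omega>" for x using that by (auto simp: positivity_set_def)
    have Twm: "Tw \<in> borel_measurable ?M"
    proof -
      have "(\<lambda>x. \<phi> x * (if 0 < w x then 1 else 0)) \<in> borel_measurable ?M" using \<phi> by measurable
      then show ?thesis by (rule measurable_cong[THEN iffD1, rotated]) (simp add: Tw_def ps)
    qed
    \<comment> \<open>In the ball \<open>u\<close> is positive and
      \<open>\<phi> \<ge> m > 0\<close>, so positivity can only be lost, at a saving of at least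
      \<open>m\<close>; elsewhere \<open>w = u\<close>. The second part makes the competitor's
      potential term integrable, so its functional is finite and comparison is meaningful.\<close>
    have pw: "AE x in ?M. Tw x + m * indicator S x \<le> Tu x \<and> norm (Tw x) \<le> norm (Tu x)"
      unfolding ae using m(2) out u0(2)
    proof eventually_elim
      case (elim x)
      show ?case
      proof (intro impI)
        assume x: "x \<in> \<Omega>"
        show "Tw x + m * indicator S x \<le> Tu x \<and> norm (Tw x) \<le> norm (Tu x)"
        proof (cases "x \<in> ball c r")
          case True
          then have "m \<le> \<phi> x" "0 < u x" using elim upos by auto
          then show ?thesis using True x elim(3) m(1) by (auto simp: Tw_def Tu_def ps S_def w_def)
        next
          case False
          then have "x \<notin> ball c \<rho>" using \<rho> by auto
          then have "w x = u x" using elim by (simp add: w_def)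
          then show ?thesis using False x by (simp add: Tw_def Tu_def ps S_def)
        qed
      qed
    qed
    have iTw: "integrable ?M Tw"
      by (rule Bochner_Integration.integrable_bound[OF iTu Twm]) (use pw in auto)
    define Fw where "Fw x = (G x \<bullet> (A x *v G x) + 2 * (G x \<bullet> (A x *v gh x)) + gh x \<bullet> (A x *v gh x)) + Tw x" for x
    have iFw: "integrable ?M Fw"
      unfolding Fw_def[abs_def] using iGG(1) iGg(1) igg(1) iTw by simp
    have Fwm: "Fw \<in> borel_measurable ?M" using iFw by (rule borel_measurable_integrable)
    have Jm: "J_integrand \<Omega> A \<phi> w \<in> borel_measurable ?M"
      using Twm unfolding J_integrand_def[abs_def] Tw_def[abs_def] by measurable
    have Jeq: "AE x in ?M. J_integrand \<Omega> A \<phi> w x = Fw x"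
      using gw AE_space
    proof eventually_elim
      case (elim x)
      then have "x \<in> \<Omega>" by simp
      then show ?case using elim(1) quadratic_form_expand[OF Asym, of x "G x" 1 "gh x"]
        by (simp add: J_integrand_def Fw_def Tw_def)
    qed
    have "integrable ?M (J_integrand \<Omega> A \<phi> w)" using integrable_cong_AE[OF Jm Fwm Jeq] iFw by simp
    moreover have "(\<integral>x. J_integrand \<Omega> A \<phi> w x \<partial>?M) = (\<integral>x. Fw x \<partial>?M)" by (rule integral_cong_AE[OF Jm Fwm Jeq])
    ultimately have "J_functional \<Omega> A \<phi> w = ereal (\<integral>x. Fw x \<partial>?M)" by (simp add: J_functional_def)
    moreover have "J_functional \<Omega> A \<phi> u = ereal (\<integral>x. G x \<bullet> (A x *v G x) + Tu x \<partial>?M)"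
      unfolding J_functional_def Iu using iIu by simp
    ultimately have "(\<integral>x. G x \<bullet> (A x *v G x) + Tu x \<partial>?M) \<le> (\<integral>x. Fw x \<partial>?M)" using Jmin[OF wH] by simp
    then have le: "(\<integral>x. Tu x \<partial>?M) - (\<integral>x. Tw x \<partial>?M) \<le> 2 * (\<integral>x. G x \<bullet> (A x *v gh x) \<partial>?M) + (\<integral>x. gh x \<bullet> (A x *v gh x) \<partial>?M)"
      unfolding Fw_def using iGG(1) iGg(1) igg(1) iTw iTu by simp
    have SM: "integrable ?M (\<lambda>x. m * indicator S x)" "(\<integral>x. m * indicator S x \<partial>?M) = m * measure lborel S"
    proof -
      have ms: "(\<lambda>x. m * indicator S x :: real) \<in> borel_measurable borel" using Sb by measurable
      have e: "(\<lambda>x. indicator \<Omega> x *\<^sub>R (m * indicator S x) :: real) = (\<lambda>x. m * indicator S x)"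
        by (rule indicator_scaleR_eq) (use sub in \<open>auto simp: S_def indicator_def\<close>)
      have i: "integrable lborel (\<lambda>x. m * indicator S x :: real)"
        using Sb by (intro integrable_mult_right integrable_indicator_ball_subset[of _ c r]) (auto simp: S_def)
      show "integrable ?M (\<lambda>x. m * indicator S x)" "(\<integral>x. m * indicator S x \<partial>?M) = m * measure lborel S"
        using lebesgue_on_borel_version[OF \<Omega>b borel_measurable_lebesgue_on[OF ms] ms] i Sb unfolding e by auto
    qed
    have "m * measure lborel S \<le> (\<integral>x. Tu x - Tw x \<partial>?M)"
      unfolding SM(2)[symmetric]
      by (rule integral_mono_AE[OF SM(1)]) (use iTu iTw pw in \<open>auto elim!: eventually_mono\<close>)
    also have "\<dots> = (\<integral>x. Tu x \<partial>?M) - (\<integral>x. Tw x \<partial>?M)" using iTu iTw by simp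
    finally show ?thesis using le unfolding S_def iGg(2) igg(2) by linarith
  qed
  have "local_minimizer lam Lam A1 c r m u0 G0"
  proof
    show "AE y in lborel. y \<in> ball c r \<longrightarrow> 0 \<le> u0 y"
      using u0(2) by eventually_elim (use sub upos in \<open>force simp: less_imp_le\<close>)
    show "H1_pair (\<lambda>x. \<psi> x * u0 x) (\<lambda>x. \<psi> x *\<^sub>R G0 x + u0 x *\<^sub>R grad \<psi> x)" if "test_function (ball c r) \<psi>" for \<psi>
      by (rule H1_pair_localize[OF u0(1) G0(1) has_weak_gradient_borel[OF \<Omega>(1) wG um u0m u0(2) G0m G0(2)] test_function_mono[OF that sub]])
  qed (use r m u0 G0 min in auto)
  with u0(2) show ?thesis by blast
qed

text \<open>An almost everywhere bound on the deviation from \<open>l\<close> passes to averages, so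
  the essential limit is the value that \<open>precise_representative\<close> prescribes.\<close>

lemma average_tendsto:
  fixes u :: "real^'n::finite \<Rightarrow> real"
  assumes \<Omega>: "open \<Omega>" "x \<in> \<Omega>" and u: "u \<in> borel_measurable (lebesgue_on \<Omega>)"
    and l: "\<forall>e>0. \<exists>\<delta>>0. AE y in lborel. y \<in> ball x \<delta> \<longrightarrow> \<bar>u y - l\<bar> \<le> e"
  shows "((\<lambda>\<rho>. (\<integral>z. u z \<partial>lebesgue_on (ball x \<rho>)) / measure lebesgue (ball x \<rho>)) \<longlongrightarrow> l) (at_right 0)"
proof (rule tendstoI)
  fix e :: real assume e: "0 < e"
  then obtain \<delta> where \<delta>: "0 < \<delta>" "AE y in lborel. y \<in> ball x \<delta> \<longrightarrow> \<bar>u y - l\<bar> \<le> e / 2" using l[rule_format, of "e / 2"] by auto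
  obtain d where d: "0 < d" "ball x d \<subseteq> \<Omega>" using \<Omega> open_contains_ball by blast
  have \<Omega>b: "\<Omega> \<in> sets borel" using \<Omega> by simp
  obtain u0 where u0: "u0 \<in> borel_measurable borel" "AE x in lborel. x \<in> \<Omega> \<longrightarrow> u x = u0 x"
    using borel_version[OF \<Omega>b u] by blast
  have "dist ((\<integral>z. u z \<partial>lebesgue_on (ball x \<rho>)) / measure lebesgue (ball x \<rho>)) l < e" if \<rho>: "0 < \<rho>" "\<rho> < min \<delta> d" for \<rho>
  proof -
    let ?B = "ball x \<rho>"
    have B: "?B \<subseteq> \<Omega>" "?B \<subseteq> ball x \<delta>" using d \<rho> by auto
    define b where "b = measure lborel ?B"
    have b: "0 < b" using measure_ball_scale[of \<rho> x] \<rho> unit_ball_vol_pos[of "real CARD('n)"] by (simp add: b_def)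
    have mu: "u \<in> borel_measurable (lebesgue_on ?B)" by (rule measurable_restrict_mono[OF u B(1)])
    have val: "(\<integral>z. u z \<partial>lebesgue_on ?B) = (\<integral>z. indicator ?B z *\<^sub>R u0 z \<partial>lborel)"
      by (rule lebesgue_on_borel_version(2)[OF _ mu u0(1)]) (use u0(2) B in \<open>auto elim!: eventually_mono\<close>)
    have near: "AE z in lborel. z \<in> ?B \<longrightarrow> \<bar>u0 z - l\<bar> \<le> e / 2"
      using \<delta>(2) u0(2) by eventually_elim (use B in auto)
    have iB: "integrable lborel (\<lambda>z. q * indicator ?B z :: real)" for q
      by (intro integrable_mult_right integrable_indicator_ball_subset[OF order_refl]) simp
    have mB: "(\<lambda>z. indicator ?B z *\<^sub>R u0 z) \<in> borel_measurable lborel"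
    proof -
      have "?B \<in> sets borel" by simp
      then show ?thesis using u0(1) by measurable
    qed
    have i0: "integrable lborel (\<lambda>z. indicator ?B z *\<^sub>R u0 z)"
    proof (rule Bochner_Integration.integrable_bound[OF iB mB])
      show "AE z in lborel. norm (indicator ?B z *\<^sub>R u0 z) \<le> norm ((\<bar>l\<bar> + e / 2) * indicator ?B z)"
        using near
      proof eventually_elim
        case (elim z)
        have "\<bar>a\<bar> \<le> \<bar>\<bar>l\<bar> + e / 2\<bar>" if "\<bar>a - l\<bar> \<le> e / 2" for a using that e by linarith
        from this[of "u0 z"] show ?case using elim by (auto simp: indicator_def)
      qed
    qed
    have "\<bar>(\<integral>z. indicator ?B z *\<^sub>R u0 z \<partial>lborel) - l * b\<bar> = \<bar>\<integral>z. indicator ?B z *\<^sub>R u0 z - l * indicator ?B z \<partial>lborel\<bar>"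
      using i0 iB[of l] by (simp add: b_def)
    also have "\<dots> \<le> (\<integral>z. \<bar>indicator ?B z *\<^sub>R u0 z - l * indicator ?B z\<bar> \<partial>lborel)" by (rule integral_abs_bound)
    also have "\<dots> \<le> (\<integral>z. (e / 2) * indicator ?B z \<partial>lborel)"
    proof (rule integral_mono_AE)
      show "AE z in lborel. \<bar>indicator ?B z *\<^sub>R u0 z - l * indicator ?B z\<bar> \<le> (e / 2) * indicator ?B z"
        using near by eventually_elim (auto simp: indicator_def)
    qed (use i0 iB in auto)
    also have "\<dots> = e / 2 * b" by (simp add: b_def)
    finally have "\<bar>(\<integral>z. u z \<partial>lebesgue_on ?B) - l * b\<bar> \<le> e / 2 * b" unfolding val .
    moreover have "(\<integral>z. u z \<partial>lebesgue_on ?B) / b - l = ((\<integral>z. u z \<partial>lebesgue_on ?B) - l * b) / b" using b by (simp add: diff_divide_distrib)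
    ultimately have "\<bar>(\<integral>z. u z \<partial>lebesgue_on ?B) / b - l\<bar> \<le> e / 2" using b by (simp add: abs_divide pos_divide_le_eq)
    moreover have "measure lebesgue ?B = b" by (simp add: b_def)
    ultimately show ?thesis using e by (simp add: dist_real_def)
  qed
  then show "\<forall>\<^sub>F \<rho> in at_right 0. dist ((\<integral>z. u z \<partial>lebesgue_on (ball x \<rho>)) / measure lebesgue (ball x \<rho>)) l < e"
    unfolding eventually_at_right_field using \<delta>(1) d(1) by (intro exI[of _ "min \<delta> d"]) auto
qed

text \<open>For levels \<open>t\<close> at which \<open>c\<^sub>0 s\<^sup>\<sigma> t\<^sup>-\<^sup>p\<close> exceeds the volume of the ball of radius \<open>s\<close>, the density
  hypothesis says that \<open>\<phi> > t\<close> almost everywhere in that ball.\<close>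

lemma density_lower_bound:
  fixes \<phi> :: "real^'n::finite \<Rightarrow> real"
  assumes \<Omega>: "\<Omega> \<in> sets borel" and \<phi>: "\<phi> \<in> borel_measurable (lebesgue_on \<Omega>)"
    and p: "0 < p" and c0: "0 < c0" and \<sigma>: "\<sigma> < real CARD('n)" and R: "0 < R" "R \<le> r0"
    and dens: "\<forall>t>0. \<forall>r\<in>{0<..<r0}. measure lebesgue ({y \<in> \<Omega>. t < \<phi> y} \<inter> ball x0 r) \<ge>
         min (c0 * r powr \<sigma> * t powr (- p)) (measure lebesgue (ball x0 r))"
  defines "t \<equiv> (c0 / unit_ball_vol (real CARD('n))) powr (1 / p) * R powr (- ((real CARD('n) - \<sigma>) / p))"
  shows "AE y in lborel. y \<in> ball x0 R \<longrightarrow> t \<le> \<phi> y"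
proof -
  define d where "d = real CARD('n)"
  define \<omega> where "\<omega> = unit_ball_vol d"
  have \<omega>: "0 < \<omega>" unfolding \<omega>_def d_def by (intro unit_ball_vol_pos) simp
  have t_eq: "t = (c0 / \<omega>) powr (1 / p) * R powr (- ((d - \<sigma>) / p))" by (simp add: t_def \<omega>_def d_def)
  have t: "0 < t" unfolding t_eq using \<omega> c0 R by simp
  \<comment> \<open>So \<open>c0 s^\<sigma> t^(-p)\<close> equals
    \<open>\<omega> s^\<sigma> R^(d - \<sigma>)\<close>, which is at least the volume
    \<open>\<omega> s^d\<close> for every \<open>s < R\<close>: the minimum in the density
    hypothesis is the full ball.\<close>
  have tp: "t powr (- p) = \<omega> / c0 * R powr (d - \<sigma>)"
  proof -
    have "t powr (- p) = (c0 / \<omega>) powr (1 / p * - p) * R powr (- ((d - \<sigma>) / p) * - p)"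
      unfolding t_eq using \<omega> c0 R by (simp add: powr_mult powr_powr)
    also have "(c0 / \<omega>) powr (1 / p * - p) = \<omega> / c0" using p \<omega> c0 by (simp add: powr_minus_divide)
    also have "- ((d - \<sigma>) / p) * - p = d - \<sigma>" using p by simp
    finally show ?thesis .
  qed
  \<comment> \<open>Radii strictly below \<open>R\<close> are used because \<open>R = r0\<close> is
    allowed, while the density hypothesis concerns radii less than \<open>r0\<close>.\<close>
  have small: "AE y in lborel. y \<in> ball x0 s \<longrightarrow> t \<le> \<phi> y" if s: "0 < s" "s < R" for s
  proof -
    let ?S = "{y \<in> \<Omega>. t < \<phi> y} \<inter> ball x0 s"
    have "s powr d \<le> s powr \<sigma> * R powr (d - \<sigma>)"
    proof -
      have "s powr d = s powr \<sigma> * s powr (d - \<sigma>)" by (simp add: powr_add[symmetric])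
      also have "\<dots> \<le> s powr \<sigma> * R powr (d - \<sigma>)" using s \<sigma> by (intro mult_left_mono powr_mono2) (auto simp: d_def)
      finally show ?thesis .
    qed
    then have "\<omega> * s powr d \<le> \<omega> * (s powr \<sigma> * R powr (d - \<sigma>))" using \<omega> by (intro mult_left_mono) auto
    moreover have "measure lebesgue (ball x0 s) = \<omega> * s powr d"
      using measure_ball_scale[of s x0] s by (simp add: \<omega>_def d_def powr_realpow)
    ultimately have "measure lebesgue (ball x0 s) \<le> c0 * s powr \<sigma> * t powr (- p)"
      unfolding tp using c0 by (simp add: mult_ac)
    then have le: "measure lebesgue (ball x0 s) \<le> measure lebesgue ?S"
      using dens[rule_format, OF t, of s] s R by simp
    have Sm: "?S \<in> sets lebesgue"
    proof -
      have "{y \<in> space (lebesgue_on \<Omega>). t < \<phi> y} \<in> sets (lebesgue_on \<Omega>)" using \<phi> by measurable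
      then have "{y \<in> \<Omega>. t < \<phi> y} \<in> sets lebesgue"
        using \<Omega> by (auto simp: sets_restrict_space_iff)
      then show ?thesis by auto
    qed
    have Bm: "ball x0 s \<in> lmeasurable" by simp
    have Sl: "?S \<in> lmeasurable" by (rule fmeasurableI2[OF Bm _ Sm]) auto
    have "measure lebesgue (ball x0 s - ?S) = measure lebesgue (ball x0 s) - measure lebesgue ?S"
      by (rule measurable_measure_Diff[OF Bm]) (use Sl in \<open>auto simp: fmeasurableD\<close>)
    with le have "measure lebesgue (ball x0 s - ?S) = 0" using measure_nonneg[of lebesgue "ball x0 s - ?S"] by linarith
    moreover have "ball x0 s - ?S \<in> lmeasurable" using Bm Sl by (rule fmeasurable.Diff)
    ultimately have "ball x0 s - ?S \<in> null_sets lebesgue"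
      by (intro null_setsI) (simp_all only: emeasure_eq_measure2 ennreal_0 fmeasurableD)
    then have "AE y in lebesgue. y \<notin> ball x0 s - ?S" by (rule AE_not_in)
    then have "AE y in lebesgue. y \<in> ball x0 s \<longrightarrow> t \<le> \<phi> y" by eventually_elim auto
    then show ?thesis by (simp add: AE_completion_iff)
  qed
  \<comment> \<open>Radii increasing to \<open>R\<close>; the second \<open>Suc\<close> keeps
    \<open>s 0\<close> positive.\<close>
  define s where "s n = R * (1 - inverse (real (Suc (Suc n))))" for n
  have s: "0 < s n" "s n < R" for n
  proof -
    have "inverse (real (Suc (Suc n))) < 1" by (simp add: inverse_eq_divide)
    then show "0 < s n" "s n < R" using R by (auto simp: s_def)
  qed
  have "AE y in lborel. \<forall>n. y \<in> ball x0 (s n) \<longrightarrow> t \<le> \<phi> y"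
    using small s by (subst AE_all_countable) blast
  then show ?thesis
  proof eventually_elim
    case (elim y)
    show ?case
    proof
      assume y: "y \<in> ball x0 R"
      then have "0 < 1 - dist x0 y / R" using R by simp
      then obtain n where n: "inverse (real (Suc n)) < 1 - dist x0 y / R" using reals_Archimedean by blast
      have "inverse (real (Suc (Suc n))) \<le> inverse (real (Suc n))" by (intro le_imp_inverse_le) auto
      then have "dist x0 y / R < 1 - inverse (real (Suc (Suc n)))" using n by linarith
      then have "dist x0 y < s n" using R by (simp add: s_def pos_divide_less_eq mult.commute)
      then show "t \<le> \<phi> y" using elim by auto
    qed
  qed
qed

theorem lemma10:
  fixes lam Lam p c\<^sub>0 :: real
  assumes "CARD('n::finite) \<ge> 2" and "0 < lam" and "lam \<le> Lam" and "1 < p" and "0 < c\<^sub>0"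
  shows "\<exists>C>0. \<forall>(\<Omega> :: (real^'n) set) A \<phi> g u \<sigma> r\<^sub>0 x\<^sub>0.
    bounded_lipschitz_domain \<Omega> \<longrightarrow>
    A \<in> elliptic_matrices lam Lam \<Omega> \<longrightarrow>
    \<phi> \<in> borel_measurable (lebesgue_on \<Omega>) \<longrightarrow>
    g \<in> H_half_boundary \<Omega> \<longrightarrow> (AE y in surface_measure \<Omega>. 0 \<le> g y) \<longrightarrow>
    J_minimizer \<Omega> A \<phi> g u \<longrightarrow> precise_representative \<Omega> u \<longrightarrow>
    (AE y in lebesgue_on \<Omega>. 0 \<le> u y) \<longrightarrow>
    x\<^sub>0 \<in> frontier (positivity_set \<Omega> u) \<longrightarrow>
    0 \<le> \<sigma> \<longrightarrow> \<sigma> < real CARD('n) \<longrightarrow> 0 < r\<^sub>0 \<longrightarrow>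
    (\<forall>t>0. \<forall>r\<in>{0<..<r\<^sub>0}.
       measure lebesgue ({y \<in> \<Omega>. t < \<phi> y} \<inter> ball x\<^sub>0 r) \<ge>
         min (c\<^sub>0 * r powr \<sigma> * t powr (- p)) (measure lebesgue (ball x\<^sub>0 r))) \<longrightarrow>
    (\<forall>x\<in>\<Omega>. 0 < u x \<longrightarrow>
       norm (x - x\<^sub>0) = infdist x (frontier (positivity_set \<Omega> u)) \<longrightarrow>
       norm (x - x\<^sub>0) \<le> r\<^sub>0 / 2 \<longrightarrow>
       u x \<ge> C * norm (x - x\<^sub>0) powr (1 - (real CARD('n) - \<sigma>) / (2 * p)))"
proof -
  define d where "d = real CARD('n)"
  obtain \<epsilon> where \<epsilon>: "0 < \<epsilon>" "\<forall>A (c::real^'n) r m u G. local_minimizer lam Lam A c r m u G \<longrightarrow>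
    (\<exists>l. \<epsilon> * r * sqrt m \<le> l \<and> (\<forall>e>0. \<exists>\<delta>>0. AE y in lborel. y \<in> ball c \<delta> \<longrightarrow> \<bar>u y - l\<bar> \<le> e))"
    using local_minimizer_nondegenerate[OF assms(2,3), where 'n='n] by blast
  define Q where "Q = (c\<^sub>0 / unit_ball_vol d) powr (1 / p)"
  have "0 < unit_ball_vol d" by (intro unit_ball_vol_pos) (simp add: d_def)
  then have Q: "0 < Q" using assms(5) by (simp add: Q_def)
  \<comment> \<open>The last factor is the value at \<open>\<sigma> = 0\<close> of
    \<open>2 powr (- (d - \<sigma>) / (2 p))\<close>, the worst case, which frees the constant from
    \<sigma>.\<close>
  define C where "C = \<epsilon> * sqrt Q * 2 powr (- (d / (2 * p)))"
  show ?thesis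
  proof (rule exI[of _ C], intro conjI allI impI ballI)
    show "0 < C" using \<epsilon>(1) Q by (simp add: C_def)
    fix \<Omega> :: "(real^'n) set" and A \<phi> g u \<sigma> r\<^sub>0 x\<^sub>0 x
    assume dom: "bounded_lipschitz_domain \<Omega>" and ell: "A \<in> elliptic_matrices lam Lam \<Omega>"
      and \<phi>: "\<phi> \<in> borel_measurable (lebesgue_on \<Omega>)" and J: "J_minimizer \<Omega> A \<phi> g u"
      and prec: "precise_representative \<Omega> u"
      and \<sigma>: "0 \<le> \<sigma>" "\<sigma> < real CARD('n)"
      and dens: "\<forall>t>0. \<forall>r\<in>{0<..<r\<^sub>0}. measure lebesgue ({y \<in> \<Omega>. t < \<phi> y} \<inter> ball x\<^sub>0 r) \<ge>
         min (c\<^sub>0 * r powr \<sigma> * t powr (- p)) (measure lebesgue (ball x\<^sub>0 r))"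
      and x: "x \<in> \<Omega>" "0 < u x" and dist: "norm (x - x\<^sub>0) = infdist x (frontier (positivity_set \<Omega> u))"
      and le: "norm (x - x\<^sub>0) \<le> r\<^sub>0 / 2"
    define r where "r = norm (x - x\<^sub>0)"
    define a where "a = (d - \<sigma>) / (2 * p)"
    have \<Omega>: "open \<Omega>" using dom by (simp add: bounded_lipschitz_domain_def)
    show "C * norm (x - x\<^sub>0) powr (1 - (real CARD('n) - \<sigma>) / (2 * p)) \<le> u x"
    proof (cases "r = 0")
      \<comment> \<open>Here the right-hand side is zero, since \<open>0 powr\<close> any exponent
        is \<open>0\<close>, and \<open>0 < u x\<close> suffices.\<close>
      case True
      then show ?thesis using x by (simp add: r_def)
    next
      case False
      then have r: "0 < r" by (simp add: r_def)
      \<comment> \<open>The ball is connected, contains a point of the positivity set and misses its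
        frontier, so it lies inside the positivity set.\<close>
      have "ball x r \<inter> frontier (positivity_set \<Omega> u) = {}"
      proof (rule equals0I)
        fix y assume y: "y \<in> ball x r \<inter> frontier (positivity_set \<Omega> u)"
        then have "infdist x (frontier (positivity_set \<Omega> u)) \<le> dist x y" by (intro infdist_le) auto
        with y show False using dist by (simp add: r_def)
      qed
      moreover have "x \<in> ball x r \<inter> positivity_set \<Omega> u" using x r by (simp add: positivity_set_def)
      then have "ball x r \<inter> positivity_set \<Omega> u \<noteq> {}" by blast
      ultimately have sub: "ball x r \<subseteq> positivity_set \<Omega> u"
        using connected_Int_frontier[OF connected_ball, of x r "positivity_set \<Omega> u"] by blast
      define m where "m = Q * (2 * r) powr (- ((d - \<sigma>) / p))"
      have m: "0 < m" using Q r by (simp add: m_def)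
      \<comment> \<open>The bound \<open>r \<le> r\<^sub>0 / 2\<close> is what admits the radius
        \<open>2 r\<close> here.\<close>
      have "AE y in lborel. y \<in> ball x\<^sub>0 (2 * r) \<longrightarrow> m \<le> \<phi> y"
        unfolding m_def Q_def d_def
        by (rule density_lower_bound[OF _ \<phi> _ assms(5) \<sigma>(2) _ _ dens]) (use \<Omega> assms(4) r le in \<open>auto simp: r_def\<close>)
      then have mae: "AE y in lborel. y \<in> ball x r \<longrightarrow> m \<le> \<phi> y"
      proof eventually_elim
        case (elim y)
        have "dist x\<^sub>0 y \<le> dist x\<^sub>0 x + dist x y" by (rule dist_triangle)
        then show ?case using elim by (auto simp: r_def dist_norm norm_minus_commute)
      qed
      obtain A1 u0 G0 where lm: "local_minimizer lam Lam A1 x r m u0 G0" and u0: "AE y in lborel. y \<in> \<Omega> \<longrightarrow> u y = u0 y"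
        using J_minimizer_local_minimizer[OF assms(2,3) dom ell \<phi> J r sub m mae] by blast
      then obtain l where l: "\<epsilon> * r * sqrt m \<le> l" "\<forall>e>0. \<exists>\<delta>>0. AE y in lborel. y \<in> ball x \<delta> \<longrightarrow> \<bar>u0 y - l\<bar> \<le> e"
        using \<epsilon>(2) by blast
      \<comment> \<open>The Borel version agrees with \<open>u\<close> only in \<Omega>, so the ball
        is shrunk to radius at most \<open>r\<close>.\<close>
      have lu: "\<forall>e>0. \<exists>\<delta>>0. AE y in lborel. y \<in> ball x \<delta> \<longrightarrow> \<bar>u y - l\<bar> \<le> e"
      proof (intro allI impI)
        fix e :: real assume "0 < e"
        then obtain \<delta> where \<delta>: "0 < \<delta>" "AE y in lborel. y \<in> ball x \<delta> \<longrightarrow> \<bar>u0 y - l\<bar> \<le> e" using l(2) by blast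
        have "AE y in lborel. y \<in> ball x (min \<delta> r) \<longrightarrow> \<bar>u y - l\<bar> \<le> e"
          using \<delta>(2) u0 by eventually_elim (use sub in \<open>auto simp: positivity_set_def\<close>)
        then show "\<exists>\<delta>>0. AE y in lborel. y \<in> ball x \<delta> \<longrightarrow> \<bar>u y - l\<bar> \<le> e"
          using \<delta>(1) r by (intro exI[of _ "min \<delta> r"]) auto
      qed
      have um: "u \<in> borel_measurable (lebesgue_on \<Omega>)"
        using J by (auto simp: J_minimizer_def H1_trace_def H1_def square_integrable_def)
      have ul: "u x = l"
        using prec x(1) average_tendsto[OF \<Omega> x(1) um lu] unfolding precise_representative_def by blast
      have sm: "sqrt m = sqrt Q * (2 * r) powr (- a)"
      proof -
        have "sqrt ((2 * r) powr (- ((d - \<sigma>) / p))) = (2 * r) powr (- a)"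
        proof (rule real_sqrt_unique)
          show "((2 * r) powr (- a))\<^sup>2 = (2 * r) powr (- ((d - \<sigma>) / p))"
          proof -
            have "- a + - a = - ((d - \<sigma>) / p)" using assms(4) by (simp add: a_def field_simps)
            then show ?thesis by (simp only: power2_eq_square powr_add[symmetric])
          qed
        qed simp
        then show ?thesis by (simp add: m_def real_sqrt_mult)
      qed
      have "C * r powr (1 - a) \<le> \<epsilon> * r * sqrt m"
      proof -
        have "d / (2 * p) \<ge> a" using \<sigma> assms(4) by (simp add: a_def divide_right_mono)
        then have "2 powr (- (d / (2 * p))) \<le> 2 powr (- a)" by (intro powr_mono) auto
        then have "(\<epsilon> * sqrt Q * r powr (1 - a)) * 2 powr (- (d / (2 * p))) \<le> (\<epsilon> * sqrt Q * r powr (1 - a)) * 2 powr (- a)"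
          using \<epsilon> Q by (intro mult_left_mono) auto
        moreover have "r powr (1 - a) = r * r powr (- a)" using r by (simp add: powr_diff powr_minus divide_inverse)
        ultimately show ?thesis unfolding sm C_def using r by (simp add: powr_mult mult_ac)
      qed
      then show ?thesis using l(1) ul by (simp add: r_def a_def d_def)
    qed
  qed
qed

end
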